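(* Let $1\le p\le\infty$ and $s\in\mathbb{R}^n$, and let $\widetilde{k}=\widetilde{k}(p,s)\in\mathbb{Z}^n$ be the modified $\overline{\partial}$-weight of $(p,s)$. Then the sequence of sheaves on $\mathbb{C}^n$ $$0\rightarrow\mathcal{I}^{\widetilde{k}}\mathcal{O}\hookrightarrow|z|^s\mathcal{L}^p_{0,0}\xrightarrow{\ \overline{\partial}_{\widetilde{k}}\ }|z|^s\mathcal{L}^p_{0,1}\xrightarrow{\ \overline{\partial}_{\widetilde{k}}\ }\cdots\xrightarrow{\ \overline{\partial}_{\widetilde{k}}\ }|z|^s\mathcal{L}^p_{0,n}\rightarrow0$$ is an exact and fine resolution of $\mathcal{I}^{\widetilde{k}}\mathcal{O}$.
   Context: All $\overline{\partial}$ are in the sense of distributions. Multi-index notation: $|z|^{s}=|z_1|^{s_1}\cdots|z_n|^{s_n}$, $z^m=z_1^{m_1}\cdots z_n^{m_n}$ for $m\in\mathbb{Z}^n$. For open $U\subset\mathbb{C}^n$, $|z|^sL^p_{(0,q),loc}(U)$ is the space of measurable $(0,q)$-forms $f$ on $U$ with $|z|^{-s}f\in L^p_{(0,q),loc}(U)$. For $m\in\mathbb{Z}^n$ and a measurable $(0,q)$-form $f$ on $U$ with $z^{-m}f\in L^1_{(0,q),loc}(U)$ and $\overline{\partial}(z^{-m}f)\in L^1_{(0,q+1),loc}(U)$, set $\overline{\partial}_mf:=z^m\,\overline{\partial}(z^{-m}f)$. The modified $\overline{\partial}$-weight: for $\sigma\in\mathbb{R}$, $\widetilde{k}(p,\sigma):=\min\{m\in\mathbb{Z}:\mathcal{I}^m\mathcal{O}_{\mathbb{C}}\subset|z|^{\sigma}L^p_{loc}(\mathbb{C})\}$,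 which equals $\min\{m\in\mathbb{Z}:(\sigma-m)p<2\}$ if $p<\infty$ and $\min\{m\in\mathbb{Z}:\sigma-m\le0\}$ if $p=\infty$; for $s\in\mathbb{R}^n$, $\widetilde{k}(p,s):=(\widetilde{k}(p,s_1),\dots,\widetilde{k}(p,s_n))$. Here $|z|^s\mathcal{L}^p_{0,q}$ is the sheaf on $\mathbb{C}^n$ with sections over open $U$ $$|z|^s\mathcal{L}^p_{0,q}(U)=\{f\in|z|^sL^p_{(0,q),loc}(U):\ \overline{\partial}_{\widetilde{k}(p,s)}f\in|z|^sL^p_{(0,q+1),loc}(U)\},$$ where the condition includes that $\overline{\partial}_{\widetilde{k}(p,s)}f$ is defined. $\mathcal{I}_j=(z_j)$ is the sheaf of ideals of $\{z_j=0\}$ in $\mathbb{C}^n$, and for $m\in\mathbb{Z}^n$, $\mathcal{I}^m\mathcal{O}=\mathcal{I}_1^{m_1}\cdots\mathcal{I}_n^{m_n}\mathcal{O}$, a subsheaf of the sheaf of germs of meromorphic functions; i.e. its sections are the meromorphic functions $f$ such that $z^{-m}f$ is holomorphic. *)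

theory Defs
  imports "HOL-Analysis.Analysis" "HOL-Algebra.Algebra"
begin

section \<open>Sheaves of abelian groups on a topological space\<close>

text \<open>Groups of sections are HOL-Algebra groups, hence written multiplicatively; values of the
  fields at sets that are not open are irrelevant.\<close>

record ('x, 's) presheaf =
  secs :: "'x set \<Rightarrow> 's monoid"
  res :: "'x set \<Rightarrow> 'x set \<Rightarrow> 's \<Rightarrow> 's"

definition is_presheaf :: "('x::topological_space, 's) presheaf \<Rightarrow> bool" where
  "is_presheaf F \<longleftrightarrow>
     (\<forall>U. open U \<longrightarrow> comm_group (secs F U)) \<and>
     (\<forall>U V. open U \<longrightarrow> open V \<longrightarrow> V \<subseteq> U \<longrightarrow> res F U V \<in> hom (secs F U) (secs F V)) \<and>
     (\<forall>U. open U \<longrightarrow> (\<forall>s\<in>carrier (secs F U). res F U U s = s)) \<and>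
     (\<forall>U V W. open U \<longrightarrow> open V \<longrightarrow> open W \<longrightarrow> W \<subseteq> V \<longrightarrow> V \<subseteq> U \<longrightarrow>
        (\<forall>s\<in>carrier (secs F U). res F V W (res F U V s) = res F U W s))"

definition is_sheaf :: "('x::topological_space, 's) presheaf \<Rightarrow> bool" where
  "is_sheaf F \<longleftrightarrow> is_presheaf F \<and>
     (\<forall>\<V>. (\<forall>V\<in>\<V>. open V) \<longrightarrow>
        (\<forall>s\<in>carrier (secs F (\<Union>\<V>)). \<forall>t\<in>carrier (secs F (\<Union>\<V>)).
           (\<forall>V\<in>\<V>. res F (\<Union>\<V>) V s = res F (\<Union>\<V>) V t) \<longrightarrow> s = t) \<and>
        (\<forall>\<sigma>. (\<forall>V\<in>\<V>. \<sigma> V \<in> carrier (secs F V)) \<longrightarrow>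
             (\<forall>V\<in>\<V>. \<forall>W\<in>\<V>. res F V (V \<inter> W) (\<sigma> V) = res F W (V \<inter> W) (\<sigma> W)) \<longrightarrow>
           (\<exists>t\<in>carrier (secs F (\<Union>\<V>)). \<forall>V\<in>\<V>. res F (\<Union>\<V>) V t = \<sigma> V)))"

definition sheaf_hom ::
  "('x::topological_space, 's) presheaf \<Rightarrow> ('x, 't) presheaf \<Rightarrow> ('x set \<Rightarrow> 's \<Rightarrow> 't) \<Rightarrow> bool" where
  "sheaf_hom F G \<phi> \<longleftrightarrow>
     (\<forall>U. open U \<longrightarrow> \<phi> U \<in> hom (secs F U) (secs G U)) \<and>
     (\<forall>U V. open U \<longrightarrow> open V \<longrightarrow> V \<subseteq> U \<longrightarrow>
        (\<forall>s\<in>carrier (secs F U). \<phi> V (res F U V s) = res G U V (\<phi> U s)))"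

definition germ ::
  "('x::topological_space, 's) presheaf \<Rightarrow> 'x \<Rightarrow> 'x set \<Rightarrow> 's \<Rightarrow> ('x set \<times> 's) set" where
  "germ F x U s = {(V, t). open V \<and> x \<in> V \<and> t \<in> carrier (secs F V) \<and>
     (\<exists>W. open W \<and> x \<in> W \<and> W \<subseteq> U \<inter> V \<and> res F U W s = res F V W t)}"

definition stalk :: "('x::topological_space, 's) presheaf \<Rightarrow> 'x \<Rightarrow> ('x set \<times> 's) set set" where
  "stalk F x = {germ F x U s |U s. open U \<and> x \<in> U \<and> s \<in> carrier (secs F U)}"

definition zero_germ :: "('x::topological_space, 's) presheaf \<Rightarrow> 'x \<Rightarrow> ('x set \<times> 's) set" where
  "zero_germ F x = germ F x UNIV \<one>\<^bsub>secs F UNIV\<^esub>"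

text \<open>All the sets in the following union coincide when \<phi> is a sheaf homomorphism into G.\<close>

definition stalk_map ::
  "('x::topological_space, 't) presheaf \<Rightarrow> ('x set \<Rightarrow> 's \<Rightarrow> 't) \<Rightarrow> 'x
     \<Rightarrow> ('x set \<times> 's) set \<Rightarrow> ('x set \<times> 't) set" where
  "stalk_map G \<phi> x g = (\<Union>(U, s)\<in>g. germ G x U (\<phi> U s))"

definition exact_at ::
  "('x::topological_space, 'r) presheaf \<Rightarrow> ('x set \<Rightarrow> 'r \<Rightarrow> 's) \<Rightarrow> ('x, 's) presheaf
     \<Rightarrow> ('x set \<Rightarrow> 's \<Rightarrow> 't) \<Rightarrow> ('x, 't) presheaf \<Rightarrow> bool" where
  "exact_at F \<phi> G \<psi> H \<longleftrightarrow>
     (\<forall>x. stalk_map G \<phi> x ` stalk F x = {g \<in> stalk G x. stalk_map H \<psi> x g = zero_germ H x})"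

definition zero_sheaf :: "('x, 's) presheaf" where
  "zero_sheaf =
     \<lparr>secs = (\<lambda>U. \<lparr>carrier = {undefined}, mult = (\<lambda>_ _. undefined), one = undefined\<rparr>),
      res = (\<lambda>U V s. s)\<rparr>"

definition zero_hom :: "('x, 't) presheaf \<Rightarrow> 'x set \<Rightarrow> 's \<Rightarrow> 't" where
  "zero_hom G U s = \<one>\<^bsub>secs G U\<^esub>"

text \<open>A resolution \<open>0 \<rightarrow> A \<rightarrow> F\<^sub>0 \<rightarrow> \<dots> \<rightarrow> F\<^sub>N \<rightarrow> 0\<close>; the sequence is continued by zero beyond
  \<open>F\<^sub>N\<close>, so that exactness at \<open>F\<^sub>N\<close> needs no separate clause.\<close>

definition exact_resolution ::
  "nat \<Rightarrow> ('x::topological_space, 'r) presheaf \<Rightarrow> ('x set \<Rightarrow> 'r \<Rightarrow> 's)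
     \<Rightarrow> (nat \<Rightarrow> ('x, 's) presheaf) \<Rightarrow> (nat \<Rightarrow> 'x set \<Rightarrow> 's \<Rightarrow> 's) \<Rightarrow> bool" where
  "exact_resolution N A \<iota> F d \<longleftrightarrow>
     is_sheaf A \<and> (\<forall>q\<le>N. is_sheaf (F q)) \<and>
     sheaf_hom A (F 0) \<iota> \<and> (\<forall>q<N. sheaf_hom (F q) (F (Suc q)) (d q)) \<and>
     (let F' = (\<lambda>q. if q \<le> N then F q else zero_sheaf);
          d' = (\<lambda>q. if q < N then d q else zero_hom (F' (Suc q)))
      in exact_at (zero_sheaf :: ('x, unit) presheaf) (zero_hom A) A \<iota> (F' 0) \<and>
         exact_at A \<iota> (F' 0) (d' 0) (F' 1) \<and>
         (\<forall>q<N. exact_at (F' q) (d' q) (F' (q + 1)) (d' (q + 1)) (F' (q + 2))))"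

definition hom_support ::
  "('x::topological_space, 's) presheaf \<Rightarrow> ('x set \<Rightarrow> 's \<Rightarrow> 's) \<Rightarrow> 'x set" where
  "hom_support F \<eta> = closure {x. \<exists>g\<in>stalk F x. stalk_map F \<eta> x g \<noteq> zero_germ F x}"

text \<open>A sheaf is fine if every locally finite open cover has a subordinate partition of unity by
  endomorphisms of the sheaf. On an open set V that meets only finitely many members of the
  cover, the sum of the endomorphisms is a finite sum; such V form a basis of the topology.\<close>

definition fine_sheaf :: "('x::topological_space, 's) presheaf \<Rightarrow> bool" where
  "fine_sheaf F \<longleftrightarrow> is_sheaf F \<and>
     (\<forall>\<U>. (\<forall>U\<in>\<U>. open U) \<longrightarrow> \<Union>\<U> = UNIV \<longrightarrow> locally_finite_in euclidean \<U> \<longrightarrow>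
        (\<exists>\<eta>. (\<forall>U\<in>\<U>. sheaf_hom F F (\<eta> U) \<and> hom_support F (\<eta> U) \<subseteq> U) \<and>
             (\<forall>V. open V \<longrightarrow> finite {U\<in>\<U>. U \<inter> V \<noteq> {}} \<longrightarrow>
                (\<forall>s\<in>carrier (secs F V).
                   finprod (secs F V) (\<lambda>U. \<eta> U V s) {U\<in>\<U>. U \<inter> V \<noteq> {}} = s))))"


section \<open>Weights and holomorphic functions\<close>

text \<open>The weight \<open>|z|\<^sup>s\<close> and the monomial \<open>z\<^sup>m\<close>. On the null set \<open>z\<^sub>1\<cdots>z\<^sub>n = 0\<close> their values are
  the conventional ones of \<open>powr\<close> and \<open>powi\<close>; they are only used off this set or up to
  null sets.\<close>

definition abs_powr :: "complex^'n \<Rightarrow> real^'n::finite \<Rightarrow> real" where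
  "abs_powr z s = (\<Prod>j\<in>UNIV. norm (z $ j) powr (s $ j))"

definition monom_powi :: "complex^'n \<Rightarrow> int^'n::finite \<Rightarrow> complex" where
  "monom_powi z m = (\<Prod>j\<in>UNIV. (z $ j) powi (m $ j))"

definition Lp_loc ::
  "ennreal \<Rightarrow> (complex^'n::finite) set \<Rightarrow> (complex^'n \<Rightarrow> complex) \<Rightarrow> bool" where
  "Lp_loc p U f \<longleftrightarrow> f \<in> borel_measurable (lebesgue_on U) \<and>
     (\<forall>K. compact K \<longrightarrow> K \<subseteq> U \<longrightarrow>
        (if p = \<infinity> then \<exists>C. AE z in lebesgue_on K. norm (f z) \<le> C
         else (\<integral>\<^sup>+z. ennreal (norm (f z) powr enn2real p) \<partial>lebesgue_on K) < \<infinity>))"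

definition weighted_Lp_loc ::
  "ennreal \<Rightarrow> real^'n \<Rightarrow> (complex^'n::finite) set \<Rightarrow> (complex^'n \<Rightarrow> complex) \<Rightarrow> bool" where
  "weighted_Lp_loc p s U f \<longleftrightarrow> f \<in> borel_measurable (lebesgue_on U) \<and>
     Lp_loc p U (\<lambda>z. complex_of_real (abs_powr z (- s)) * f z)"

definition holomorphic_n :: "(complex^'n::finite) set \<Rightarrow> (complex^'n \<Rightarrow> complex) \<Rightarrow> bool" where
  "holomorphic_n U h \<longleftrightarrow>
     (\<forall>z\<in>U. \<exists>L. (h has_derivative L) (at z) \<and> (\<forall>c v. L (c *s v) = c * L v))"

text \<open>Sections over U of \<open>\<I>\<^sup>m\<O>\<close>: meromorphic f with \<open>z\<^sup>-\<^sup>mf\<close> holomorphic on U. Such an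
  f has its poles in \<open>{z\<^sub>1\<cdots>z\<^sub>n = 0}\<close> and is determined by its values on the dense complement of this
  set in U. It is represented by the function with these values there and 0 elsewhere. Conversely,
  \<open>f = z\<^sup>mh\<close> with h holomorphic is automatically meromorphic.\<close>

definition ideal_sections :: "int^'n \<Rightarrow> (complex^'n::finite) set \<Rightarrow> (complex^'n \<Rightarrow> complex) set" where
  "ideal_sections m U =
     {f. (\<forall>z. z \<notin> U \<or> (\<exists>j. z $ j = 0) \<longrightarrow> f z = 0) \<and>
         (\<exists>h. holomorphic_n U h \<and>
              (\<forall>z\<in>U. (\<forall>j. z $ j \<noteq> 0) \<longrightarrow> monom_powi z (- m) * f z = h z))}"

definition ideal_sheaf ::
  "int^'n \<Rightarrow> (complex^'n::finite, complex^'n \<Rightarrow> complex) presheaf" where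
  "ideal_sheaf m =
     \<lparr>secs = (\<lambda>U. \<lparr>carrier = ideal_sections m U, mult = (\<lambda>f g z. f z + g z), one = (\<lambda>z. 0)\<rparr>),
      res = (\<lambda>U V f z. if z \<in> V then f z else 0)\<rparr>"

text \<open>The modified weight \<open>min {m. \<I>\<^sup>m\<O>\<^sub>\<complex> \<subseteq> |z|\<^sup>\<sigma> L\<^sup>p\<^sub>l\<^sub>o\<^sub>c}\<close>, where \<open>\<complex>\<close> is \<^typ>\<open>complex^1\<close> and the
  inclusion of sheaves means inclusion of the sections over every open set.\<close>

definition dbar_weight1 :: "ennreal \<Rightarrow> real \<Rightarrow> int" where
  "dbar_weight1 p \<sigma> = (LEAST m. \<forall>U::(complex^1) set. open U \<longrightarrow>
     (\<forall>f\<in>ideal_sections (\<chi> j. m) U. weighted_Lp_loc p (\<chi> j. \<sigma>) U f))"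

definition dbar_weight :: "ennreal \<Rightarrow> real^'n::finite \<Rightarrow> int^'n" where
  "dbar_weight p s = (\<chi> j. dbar_weight1 p (s $ j))"


section \<open>(0,q)-forms and the distributional d-bar operator\<close>

text \<open>The coefficient of the wedge product of the \<open>dzbar\<^sub>j\<close> with j in J, taken in increasing order
  of j, is the value of the form at J. Values of the coefficients outside the open set under
  consideration are irrelevant. The linear order on the index type only serves to fix this basis
  of the forms.\<close>

type_synonym 'n form = "'n set \<Rightarrow> complex^'n \<Rightarrow> complex"

definition measurable_forms :: "nat \<Rightarrow> (complex^'n) set \<Rightarrow> 'n::finite form set" where
  "measurable_forms q U =
     {f. (\<forall>J. card J = q \<longrightarrow> f J \<in> borel_measurable (lebesgue_on U)) \<and>
         (\<forall>J. card J \<noteq> q \<longrightarrow> f J = (\<lambda>z. 0))}"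

definition weighted_Lp_forms ::
  "ennreal \<Rightarrow> real^'n \<Rightarrow> nat \<Rightarrow> (complex^'n) set \<Rightarrow> 'n::finite form set" where
  "weighted_Lp_forms p s q U =
     {f \<in> measurable_forms q U. \<forall>J. weighted_Lp_loc p s U (f J)}"

definition Lp_forms :: "ennreal \<Rightarrow> nat \<Rightarrow> (complex^'n) set \<Rightarrow> 'n::finite form set" where
  "Lp_forms p q U = {f \<in> measurable_forms q U. \<forall>J. Lp_loc p U (f J)}"

primrec C_k :: "nat \<Rightarrow> ('a::real_normed_vector \<Rightarrow> 'b::real_normed_vector) \<Rightarrow> bool" where
  "C_k 0 f \<longleftrightarrow> continuous_on UNIV f"
| "C_k (Suc k) f \<longleftrightarrow> (\<forall>x. f differentiable (at x)) \<and>
     (\<forall>v. C_k k (\<lambda>x. frechet_derivative f (at x) v))"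

definition test_function :: "(complex^'n::finite) set \<Rightarrow> (complex^'n \<Rightarrow> complex) \<Rightarrow> bool" where
  "test_function U \<phi> \<longleftrightarrow> (\<forall>k. C_k k \<phi>) \<and>
     compact (closure {z. \<phi> z \<noteq> 0}) \<and> closure {z. \<phi> z \<noteq> 0} \<subseteq> U"

definition wirtinger_bar ::
  "'n \<Rightarrow> (complex^'n::finite \<Rightarrow> complex) \<Rightarrow> complex^'n \<Rightarrow> complex" where
  "wirtinger_bar j \<phi> z =
     (frechet_derivative \<phi> (at z) (axis j 1) + \<i> * frechet_derivative \<phi> (at z) (axis j \<i>)) / 2"

text \<open>\<open>dbar f = g\<close> on U in the sense of distributions, with f and g locally integrable. The sign is
  the one that arises when \<open>dzbar\<^sub>j \<and> dzbar\<^bsub>K - {j}\<^esub>\<close> is put into increasing order.\<close>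

definition dist_dbar ::
  "(complex^'n::{finite,linorder}) set \<Rightarrow> nat \<Rightarrow> 'n form \<Rightarrow> 'n form \<Rightarrow> bool" where
  "dist_dbar U q f g \<longleftrightarrow> f \<in> Lp_forms 1 q U \<and> g \<in> Lp_forms 1 (Suc q) U \<and>
     (\<forall>K \<phi>. card K = Suc q \<longrightarrow> test_function U \<phi> \<longrightarrow>
        (LINT z|lebesgue_on U. g K z * \<phi> z) =
        - (LINT z|lebesgue_on U.
             (\<Sum>j\<in>K. (- 1) ^ card {i\<in>K. i < j} * f (K - {j}) z * wirtinger_bar j \<phi> z)))"

text \<open>\<open>dbar\<^sub>m f\<close> is defined on U and equal to h almost everywhere.\<close>

definition has_dbar_m ::
  "int^'n::{finite,linorder} \<Rightarrow> (complex^'n::{finite,linorder}) set \<Rightarrow> nat \<Rightarrow> 'n form \<Rightarrow> 'n form \<Rightarrow> bool" where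
  "has_dbar_m m U q f h \<longleftrightarrow> f \<in> measurable_forms q U \<and> h \<in> measurable_forms (Suc q) U \<and>
     (\<exists>g. dist_dbar U q (\<lambda>J z. monom_powi z (- m) * f J z) g \<and>
          (\<forall>K. AE z in lebesgue_on U. h K z = monom_powi z m * g K z))"


section \<open>The sheaves of weighted forms\<close>

definition dbar_Lp_forms ::
  "ennreal \<Rightarrow> real^'n::{finite,linorder} \<Rightarrow> nat \<Rightarrow> (complex^'n::{finite,linorder}) set \<Rightarrow> 'n form set" where
  "dbar_Lp_forms p s q U =
     {f \<in> weighted_Lp_forms p s q U.
        \<exists>h\<in>weighted_Lp_forms p s (Suc q) U. has_dbar_m (dbar_weight p s) U q f h}"

definition dbar_Lp_group ::
  "ennreal \<Rightarrow> real^'n::{finite,linorder} \<Rightarrow> nat \<Rightarrow> (complex^'n::{finite,linorder}) set \<Rightarrow> 'n form monoid" where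
  "dbar_Lp_group p s q U =
     \<lparr>carrier = dbar_Lp_forms p s q U, mult = (\<lambda>f g J z. f J z + g J z), one = (\<lambda>J z. 0)\<rparr>"

definition null_forms :: "nat \<Rightarrow> (complex^'n) set \<Rightarrow> 'n::finite form set" where
  "null_forms q U = {f \<in> measurable_forms q U. \<forall>J. AE z in lebesgue_on U. f J z = 0}"

text \<open>Sections are classes of forms modulo equality almost everywhere on U, that is, cosets of the
  null forms. A coset over U restricts to the unique coset over V that contains it.\<close>

definition Lp_sheaf ::
  "ennreal \<Rightarrow> real^'n::{finite,linorder} \<Rightarrow> nat \<Rightarrow> (complex^'n::{finite,linorder}, 'n form set) presheaf" where
  "Lp_sheaf p s q =
     \<lparr>secs = (\<lambda>U. dbar_Lp_group p s q U Mod null_forms q U),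
      res = (\<lambda>U V A. null_forms q V <#>\<^bsub>dbar_Lp_group p s q V\<^esub> A)\<rparr>"

definition ideal_incl ::
  "(complex^'n) set \<Rightarrow> (complex^'n \<Rightarrow> complex) \<Rightarrow> 'n::finite form set" where
  "ideal_incl U f =
     {h \<in> measurable_forms 0 U. AE z in lebesgue_on U. h {} z = f z}"

text \<open>The forms h with \<open>dbar\<^sub>m f = h\<close> make up one class modulo null forms, which depends only on
  the class of f.\<close>

definition dbar_map ::
  "int^'n::{finite,linorder} \<Rightarrow> nat \<Rightarrow> (complex^'n::{finite,linorder}) set \<Rightarrow> 'n form set \<Rightarrow> 'n form set" where
  "dbar_map m q U A = {h. \<exists>f\<in>A. has_dbar_m m U q f h}"

end

theory Submission
 imports Defs "HOL-Complex_Analysis.Cauchy_Integral_Formula"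
begin

section \<open>Smooth functions and partitions of unity\<close>

abbreviation nn_lborel :: "('a::euclidean_space => ennreal) => ennreal" (binder "NN " 10) where
 "NN x. f x == nn_integral lborel f"

abbreviation lmeas :: "'a::euclidean_space set => ('a => 'b::topological_space) set" where
 "lmeas U == borel_measurable (lebesgue_on U)"

definition smooth :: "('a::real_normed_vector => 'b::real_normed_vector) => bool" where
 "smooth f \<longleftrightarrow> (ALL k. C_k k f)"

abbreviation dir_deriv :: "('a::real_normed_vector => 'b::real_normed_vector) => 'a => 'a => 'b" where
 "dir_deriv f v \<equiv> (%x. frechet_derivative f (at x) v)"

lemma C_k_Suc_imp: "C_k (Suc k) f ==> C_k k f"
proof (induction k arbitrary: f)
 case 0
 thus ?case
  using differentiable_imp_continuous_within continuous_at_imp_continuous_on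
  by (metis C_k.simps(1) C_k.simps(2))
next
 case (Suc k)
 thus ?case by (metis C_k.simps(2))
qed

lemma C_k_has_derivative: "C_k (Suc k) f ==> (f has_derivative frechet_derivative f (at x)) (at x)"
 using frechet_derivative_works by auto

lemma C_k_SucI:
 assumes "!!x. (f has_derivative D x) (at x)" "!!v. C_k k (%x. D x v)"
 shows "C_k (Suc k) f"
proof -
 have "frechet_derivative f (at x) = D x" for x
  using assms(1) frechet_derivative_at by metis
 thus ?thesis using assms by (auto simp: differentiable_def)
qed

lemma C_k_const: "C_k k (%x. c)"
proof (induction k arbitrary: c)
 case (Suc k)
 show ?case by (rule C_k_SucI[where D = "%_ _. 0"]) (auto simp: Suc)
qed auto

lemma C_k_add: "C_k k f ==> C_k k g ==> C_k k (%x. f x + g x)"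
proof (induction k arbitrary: f g)
 case 0 thus ?case by (auto intro: continuous_intros)
next
 case (Suc k)
 show ?case
 proof (rule C_k_SucI)
  show "((%x. f x + g x) has_derivative
    (%v. frechet_derivative f (at x) v + frechet_derivative g (at x) v)) (at x)" for x
   by (intro has_derivative_add C_k_has_derivative[OF Suc.prems(1)] C_k_has_derivative[OF Suc.prems(2)])
 qed (use Suc in auto)
qed

lemma C_k_bounded_linear: "C_k k f ==> bounded_linear L ==> C_k k (%x. L (f x))"
proof (induction k arbitrary: f)
 case 0
 thus ?case
  using continuous_on_compose2[OF linear_continuous_on[OF 0(2), of UNIV]] by simp
next
 case (Suc k)
 show ?case
 proof (rule C_k_SucI)
  show "((%x. L (f x)) has_derivative (%v. L (frechet_derivative f (at x) v))) (at x)" for x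
   by (rule bounded_linear.has_derivative[OF Suc.prems(2) C_k_has_derivative[OF Suc.prems(1)]])
 qed (use Suc in auto)
qed

lemma C_k_comp_linear: "C_k k f ==> bounded_linear L ==> C_k k (%x. f (a + L x))"
proof (induction k arbitrary: f)
 case 0
 have "continuous_on UNIV (%x. a + L x)"
  by (intro continuous_intros linear_continuous_on 0)
 thus ?case using 0 by (auto intro: continuous_on_compose2[of UNIV f])
next
 case (Suc k)
 show ?case
 proof (rule C_k_SucI)
  show "((%x. f (a + L x)) has_derivative (%v. frechet_derivative f (at (a + L x)) (L v))) (at x)" for x
  proof -
   have "((%x. a + L x) has_derivative L) (at x)"
    using bounded_linear_imp_has_derivative[OF Suc.prems(2)] by (auto intro!: derivative_eq_intros)
   from has_derivative_compose[OF this C_k_has_derivative[OF Suc.prems(1)]]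
   show ?thesis .
  qed
  show "C_k k (%x. frechet_derivative f (at (a + L x)) (L v))" for v
   using Suc.IH[of "%x. frechet_derivative f (at x) (L v)"] Suc.prems by auto
 qed
qed

lemma C_k_linear: "bounded_linear L ==> C_k k L"
proof (cases k)
 case 0
 assume "bounded_linear L"
 thus ?thesis using 0 by (simp add: linear_continuous_on)
next
 case (Suc j) assume L: "bounded_linear L"
 show ?thesis unfolding Suc
  by (rule C_k_SucI[where D = "%_. L"]) (auto simp: bounded_linear_imp_has_derivative L C_k_const)
qed

lemma C_k_mult:
 fixes f g :: "'a::real_normed_vector => 'b::real_normed_algebra"
 shows "C_k k f ==> C_k k g ==> C_k k (%x. f x * g x)"
proof (induction k arbitrary: f g)
 case 0 thus ?case by (auto intro: continuous_intros)
next
 case (Suc k)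
 show ?case
 proof (rule C_k_SucI)
  show "((%x. f x * g x) has_derivative
    (%v. f x * frechet_derivative g (at x) v + frechet_derivative f (at x) v * g x)) (at x)" for x
   by (intro has_derivative_mult C_k_has_derivative[OF Suc.prems(1)] C_k_has_derivative[OF Suc.prems(2)])
  show "C_k k (%x. f x * frechet_derivative g (at x) v + frechet_derivative f (at x) v * g x)" for v
   using Suc C_k_Suc_imp[of k f] C_k_Suc_imp[of k g] by (intro C_k_add) auto
 qed
qed

lemma C_k_inverse:
 fixes f :: "'a::real_normed_vector => 'b::real_normed_field"
 assumes "C_k k f" "!!x. f x ~= 0" shows "C_k k (%x. inverse (f x))"
 using assms
proof (induction k)
 case 0 thus ?case by (auto intro: continuous_intros)
next
 case (Suc k)
 have IH: "C_k k (%x. inverse (f x))" using Suc C_k_Suc_imp by blast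
 show ?case
 proof (rule C_k_SucI)
  show "((%x. inverse (f x)) has_derivative
    (%v. - (inverse (f x) * frechet_derivative f (at x) v * inverse (f x)))) (at x)" for x
   by (rule Deriv.has_derivative_inverse[OF Suc.prems(2) C_k_has_derivative[OF Suc.prems(1)]])
  show "C_k k (%x. - (inverse (f x) * frechet_derivative f (at x) v * inverse (f x)))" for v
   using IH Suc.prems(1)
   by (intro C_k_bounded_linear[OF _ bounded_linear_minus[OF bounded_linear_ident]] C_k_mult) auto
 qed
qed

lemma C_k_local:
 assumes "!!x. EX N g. open N & x : N & C_k k g & (ALL y:N. f y = g y)"
 shows "C_k k f"
 using assms
proof (induction k arbitrary: f)
 case 0
 show ?case unfolding C_k.simps
 proof (rule continuous_at_imp_continuous_on, rule ballI)
  fix x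
  obtain N g where N: "open N" "x : N" "C_k 0 g" "ALL y:N. f y = g y" using "0.prems" by blast
  have "continuous (at x) g" using N(3) by (simp add: continuous_on_eq_continuous_at)
  thus "continuous (at x) f"
   using N by (metis (no_types, lifting) continuous_on_cong continuous_on_eq_continuous_at C_k.simps(1) continuous_on_subset subset_UNIV)
 qed
next
 case (Suc k)
 show ?case unfolding C_k.simps
 proof (intro conjI allI)
  fix x
  obtain N g where N: "open N" "x : N" "C_k (Suc k) g" "ALL y:N. f y = g y" using Suc.prems by blast
  have "(f has_derivative frechet_derivative g (at x)) (at x)"
   by (rule has_derivative_transform_within_open[OF C_k_has_derivative[OF N(3)] N(1,2)]) (use N in auto)
  thus "f differentiable (at x)" by (auto simp: differentiable_def)
 next
  fix v
  show "C_k k (%x. frechet_derivative f (at x) v)"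
  proof (rule Suc.IH)
   fix x
   obtain N g where N: "open N" "x : N" "C_k (Suc k) g" "ALL y:N. f y = g y" using Suc.prems by blast
   have "frechet_derivative f (at y) = frechet_derivative g (at y)" if "y : N" for y
   proof -
    have "(f has_derivative frechet_derivative g (at y)) (at y)"
     by (rule has_derivative_transform_within_open[OF C_k_has_derivative[OF N(3)] N(1) that]) (use N in auto)
    thus ?thesis using frechet_derivative_at by metis
   qed
   thus "EX N g. open N & x : N & C_k k g & (ALL y:N. frechet_derivative f (at y) v = g y)"
    using N by (intro exI[of _ N] exI[of _ "%x. frechet_derivative g (at x) v"]) auto
  qed
 qed
qed

lemma smoothD: "smooth f ==> C_k k f" by (simp add: smooth_def)

lemma smooth_has_derivative: "smooth f ==> (f has_derivative frechet_derivative f (at x)) (at x)"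
 using C_k_has_derivative smoothD by blast

lemma smooth_dir_deriv: "smooth f ==> smooth (dir_deriv f v)"
 using C_k.simps(2) smooth_def by blast

lemma smooth_continuous: "smooth f ==> continuous_on S f"
 using C_k.simps(1) continuous_on_subset smooth_def subset_UNIV by blast

lemma smooth_const: "smooth (%x. c)" by (simp add: smooth_def C_k_const)
lemma smooth_add: "smooth f ==> smooth g ==> smooth (%x. f x + g x)" by (simp add: smooth_def C_k_add)
lemma smooth_mult:
 fixes f g :: "'a::real_normed_vector => 'b::real_normed_algebra"
 shows "smooth f ==> smooth g ==> smooth (%x. f x * g x)" by (simp add: smooth_def C_k_mult)
lemma smooth_inverse:
 fixes f :: "'a::real_normed_vector => 'b::real_normed_field"
 shows "smooth f ==> (!!x. f x ~= 0) ==> smooth (%x. inverse (f x))" by (simp add: smooth_def C_k_inverse)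
lemma smooth_bounded_linear: "smooth f ==> bounded_linear L ==> smooth (%x. L (f x))"
 by (simp add: smooth_def C_k_bounded_linear)
lemma smooth_comp_linear: "smooth f ==> bounded_linear L ==> smooth (%x. f (a + L x))"
 by (simp add: smooth_def C_k_comp_linear)
lemma smooth_linear: "bounded_linear L ==> smooth L" by (simp add: smooth_def C_k_linear)
lemma smooth_of_real:
 fixes f :: "'a::real_normed_vector => real"
 shows "smooth f ==> smooth (%x. complex_of_real (f x))"
 by (rule smooth_bounded_linear[OF _ bounded_linear_of_real])

lemma smooth_local:
 assumes "!!x. EX N g. open N & x : N & smooth g & (ALL y:N. f y = g y)"
 shows "smooth f"
 unfolding smooth_def
proof (intro allI C_k_local)
 fix k x show "EX N g. open N & x : N & C_k k g & (ALL y:N. f y = g y)"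
  using assms[of x] by (auto simp: smooth_def)
qed

lemma smooth_sum: "(!!i. i : A ==> smooth (f i)) ==> smooth (%x. \<Sum>i\<in>A. f i x)"
 by (induction A rule: infinite_finite_induct) (auto intro: smooth_const smooth_add)

lemma smooth_prod:
 fixes f :: "'i => 'a::real_normed_vector => 'b::{real_normed_algebra, comm_ring_1}"
 shows "(!!i. i : A ==> smooth (f i)) ==> smooth (%x. \<Prod>i\<in>A. f i x)"
 by (induction A rule: infinite_finite_induct) (auto intro: smooth_const smooth_mult)

lemma smooth_power:
 fixes f :: "'a::real_normed_vector => 'b::real_normed_algebra_1"
 shows "smooth f ==> smooth (%x. f x ^ n)"
 by (induction n) (auto intro: smooth_const smooth_mult)

lemma frechet_derivative_eq: "(f has_derivative D) (at x) ==> frechet_derivative f (at x) = D"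
 using frechet_derivative_at by metis

lemma smooth_norm_squared: "smooth (%x::'a::real_inner. (x - a) \<bullet> (x - a))"
 unfolding smooth_def
proof
 fix k
 have *: "C_k (Suc k) (%x::'a. (x - a) \<bullet> (x - a))" for k
 proof (rule C_k_SucI)
  show "((%x. (x - a) \<bullet> (x - a)) has_derivative (%v. (x - a) \<bullet> v + v \<bullet> (x - a))) (at x)" for x
   by (auto intro!: derivative_eq_intros)
  have "C_k k (%x. ((-a) \<bullet> v + x \<bullet> v) + (v \<bullet> (-a) + v \<bullet> x))" for v
   by (intro C_k_add C_k_const C_k_linear bounded_linear_intros)
  moreover have "(x - a) \<bullet> v + v \<bullet> (x - a) = ((-a) \<bullet> v + x \<bullet> v) + (v \<bullet> (-a) + v \<bullet> x)" for x v
   by (simp add: inner_simps)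
  ultimately show "C_k k (%x. (x - a) \<bullet> v + v \<bullet> (x - a))" for v
   by (simp only:)
 qed
 show "C_k k (%x::'a. (x - a) \<bullet> (x - a))" using C_k_Suc_imp[OF *] .
qed

text \<open>The family \<open>x\<^sup>-\<^sup>n exp (-1/x)\<close>, extended by 0, is closed under differentiation up to
  linear combinations; this makes every member smooth at 0.\<close>

definition flat_exp :: "nat => real => real" where
 "flat_exp n x = (if x > 0 then inverse x ^ n * exp (- inverse x) else 0)"

lemma flat_exp_tendsto_0: "(flat_exp n \<longlongrightarrow> 0) (at 0)"
proof -
 have "((%x. x ^ n / exp x) \<longlongrightarrow> (0::real)) at_top" by (rule tendsto_power_div_exp_0)
 hence "((%x. inverse x ^ n / exp (inverse x)) \<longlongrightarrow> (0::real)) (at_right 0)"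
  by (rule filterlim_compose[OF _ filterlim_inverse_at_top_right])
 hence "(flat_exp n \<longlongrightarrow> 0) (at_right 0)"
  by (rule Lim_transform_eventually)
    (auto simp: flat_exp_def exp_minus field_simps eventually_at_right_field intro!: exI[of _ 1])
 moreover have "(flat_exp n \<longlongrightarrow> 0) (at_left 0)"
  by (rule Lim_transform_eventually[OF tendsto_const])
    (auto simp: flat_exp_def eventually_at_left_field intro!: exI[of _ "-1"])
 ultimately show ?thesis by (rule filterlim_split_at_real[rotated] | rule filterlim_split_at)
qed

lemma flat_exp_deriv: "DERIV (flat_exp n) x :> - real n * flat_exp (Suc n) x + flat_exp (Suc (Suc n)) x"
proof -
 consider "x > 0" | "x < 0" | "x = 0" by linarith
 thus ?thesis
 proof cases
  case 1
  have "DERIV (%x. inverse x ^ n * exp (- inverse x)) x :>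
    - real n * flat_exp (Suc n) x + flat_exp (Suc (Suc n)) x"
  proof (cases n)
   case 0 thus ?thesis using 1
    by (auto intro!: derivative_eq_intros simp: flat_exp_def field_simps power2_eq_square)
  next
   case (Suc k)
   have "DERIV inverse x :> - (inverse x * inverse x)"
    using 1 DERIV_inverse[of x] by (simp add: numeral_2_eq_2)
   note D = DERIV_power[OF this, of "Suc k"] DERIV_fun_exp[OF DERIV_minus[OF this]]
   have "DERIV (%x. inverse x ^ Suc k * exp (- inverse x)) x :>
     real (Suc k) * inverse x ^ k * (- (inverse x * inverse x)) * exp (- inverse x)
     + inverse x ^ Suc k * (exp (- inverse x) * (inverse x * inverse x))"
    using DERIV_mult[OF D] by (simp add: algebra_simps)
   thus ?thesis using 1 Suc by (simp add: flat_exp_def algebra_simps)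
  qed
  thus ?thesis
   by (rule has_field_derivative_transform_within_open[where S = "{0<..}"])
     (use 1 in "auto simp: flat_exp_def")
 next
  case 2
  have "DERIV (%x. 0) x :> (0::real)" by simp
  hence "DERIV (flat_exp n) x :> 0"
   by (rule has_field_derivative_transform_within_open[where S = "{..<0}"])
     (use 2 in "auto simp: flat_exp_def")
  thus ?thesis using 2 by (simp add: flat_exp_def)
 next
  case 3
  have "((%h. (flat_exp n (0 + h) - flat_exp n 0) / h) \<longlongrightarrow> 0) (at 0)"
   by (rule Lim_transform_eventually[OF flat_exp_tendsto_0[of "Suc n"]])
     (auto simp: flat_exp_def field_simps)
  thus ?thesis using 3 by (simp add: DERIV_def flat_exp_def)
 qed
qed

lemma smooth_flat_exp:
 fixes g :: "'a::real_normed_vector => real"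
 assumes "smooth g" shows "smooth (%x. flat_exp n (g x))"
proof -
 have "C_k k g ==> C_k k (%x. flat_exp n (g x))" for k n
 proof (induction k arbitrary: n)
  case 0
  have "continuous_on UNIV (flat_exp n)"
   using flat_exp_deriv by (meson DERIV_isCont continuous_at_imp_continuous_on)
  thus ?case using 0 by (auto intro: continuous_on_compose2)
 next
  case (Suc k)
  show ?case
  proof (rule C_k_SucI)
   show "((%x. flat_exp n (g x)) has_derivative (%v. frechet_derivative g (at x) v *
     ((- real n) * flat_exp (Suc n) (g x) + flat_exp (Suc (Suc n)) (g x)))) (at x)" for x
    using has_derivative_compose[OF C_k_has_derivative[OF Suc.prems]
      flat_exp_deriv[unfolded has_field_derivative_def]]
    by (simp add: mult.commute)
   have "C_k k g" using Suc.prems C_k_Suc_imp by blast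
   thus "C_k k (%x. frechet_derivative g (at x) v *
     ((- real n) * flat_exp (Suc n) (g x) + flat_exp (Suc (Suc n)) (g x)))" for v
    using Suc by (intro C_k_mult C_k_add C_k_const) auto
  qed
 qed
 thus ?thesis using assms by (simp add: smooth_def)
qed

definition bump :: "'a::real_inner => real => 'a => real" where
 "bump a r x = flat_exp 0 (r\<^sup>2 - (x - a) \<bullet> (x - a))"

lemma smooth_bump: "smooth (bump a r)"
proof -
 have "smooth (%x. flat_exp 0 (r\<^sup>2 + (-1) * ((x - a) \<bullet> (x - a))))"
  by (intro smooth_flat_exp smooth_add smooth_mult smooth_const smooth_norm_squared)
 thus ?thesis by (simp add: bump_def[abs_def])
qed

lemma bump_nonneg: "bump a r x >= 0" by (simp add: bump_def flat_exp_def)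

lemma bump_pos_iff: "r > 0 ==> bump a r x ~= 0 \<longleftrightarrow> x : ball a r"
proof -
 assume r: "r > 0"
 have "(x - a) \<bullet> (x - a) < r\<^sup>2 \<longleftrightarrow> norm (x - a) < r"
  using r power_mono_iff[of r "norm (x - a)" 2] by (simp add: power2_norm_eq_inner flip: not_le)
 thus ?thesis by (simp add: bump_def flat_exp_def dist_norm norm_minus_commute)
qed

text \<open>Balls around finitely many points in each of the compact shells \<open>n \<le> |x| \<le> n + 1\<close> form a
  locally finite cover, whatever the given cover is.\<close>

lemma locally_finite_ball_refinement:
 fixes \<U> :: "'a::euclidean_space set set"
 assumes op: "ALL U:\<U>. open U" and cov: "\<Union>\<U> = UNIV"
 shows "EX (I :: 'a set) r u. (ALL a. 0 < r a & u a : \<U> & cball a (r a) <= u a) &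
  (\<Union>a\<in>I. ball a (r a)) = UNIV & (ALL R. finite {a:I. cball a (r a) Int cball 0 R ~= {}})"
proof -
 have "EX r U. 0 < r & r <= 1 & U : \<U> & cball a r <= U" for a
 proof -
  obtain U where U: "U : \<U>" "a : U" using cov by auto
  then obtain e where "e > 0" "cball a e <= U" using op open_contains_cball by blast
  thus ?thesis using U by (intro exI[of _ "min e 1"] exI[of _ U]) auto
 qed
 then obtain r u where ru: "!!a. 0 < r a" "!!a. r a <= 1" "!!a. u a : \<U>" "!!a. cball a (r a) <= u a"
  by metis
 define K where "K n = {x::'a. real n <= norm x & norm x <= real n + 1}" for n :: nat
 have comp: "compact (K n)" for n
 proof -
  have "K n = cball 0 (real n + 1) - ball 0 (real n)" by (auto simp: K_def)
  thus ?thesis by (simp add: compact_diff)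
 qed
 have "EX A. finite A & A <= K n & K n <= (\<Union>a\<in>A. ball a (r a))" for n
 proof -
  have "K n <= (\<Union>a\<in>K n. ball a (r a))" using ru(1) by auto
  from compactE_image[OF comp _ this] show ?thesis by (metis open_ball)
 qed
 then obtain A where A: "!!n. finite (A n)" "!!n. A n <= K n" "!!n. K n <= (\<Union>a\<in>A n. ball a (r a))"
  by metis
 show ?thesis
 proof (intro exI[of _ "\<Union>n. A n"] exI[of _ r] exI[of _ u] conjI allI)
  show "(\<Union>a\<in>(\<Union>n. A n). ball a (r a)) = UNIV"
  proof -
   have "x : K (nat \<lfloor>norm x\<rfloor>)" for x by (auto simp: K_def)
   thus ?thesis using A(3) by fastforce
  qed
  show "finite {a : (\<Union>n. A n). cball a (r a) Int cball 0 R ~= {}}" for R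
  proof (rule finite_subset)
   show "{a : (\<Union>n. A n). cball a (r a) Int cball 0 R ~= {}} <= (\<Union>n\<in>{..nat \<lceil>R + 1\<rceil>}. A n)"
   proof
    fix a assume "a : {a : (\<Union>n. A n). cball a (r a) Int cball 0 R ~= {}}"
    then obtain n where a: "a : A n" "cball a (r a) Int cball 0 R ~= {}" by blast
    then obtain y where y: "dist a y <= r a" "norm y <= R" by auto
    have "norm a <= norm y + dist a y" by (metis dist_norm norm_triangle_sub)
    hence "norm a <= R + 1" using y ru(2)[of a] by linarith
    moreover have "real n <= norm a" using a A(2) by (auto simp: K_def)
    ultimately have "n <= nat \<lceil>R + 1\<rceil>" by linarith
    thus "a : (\<Union>n\<in>{..nat \<lceil>R + 1\<rceil>}. A n)" using a by auto
   qed
  qed (use A in auto)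
 qed (use ru in auto)
qed

theorem smooth_partition_of_unity:
 fixes \<U> :: "'a::euclidean_space set set"
 assumes op: "ALL U:\<U>. open U" and cov: "\<Union>\<U> = UNIV"
 obtains \<theta> :: "'a set => 'a => real" where
  "!!U. U : \<U> ==> smooth (\<theta> U)" "!!U x. 0 <= \<theta> U x" "!!U x. \<theta> U x <= 1"
  "!!U. U : \<U> ==> closure {x. \<theta> U x ~= 0} <= U"
  "!!R. finite {U:\<U>. EX x:cball 0 R. \<theta> U x ~= 0}"
  "!!F x. finite F ==> F <= \<U> ==> (!!U. U : \<U> ==> \<theta> U x ~= 0 ==> U : F) ==> (\<Sum>U\<in>F. \<theta> U x) = 1"
proof -
 obtain I r u where ru: "ALL a. 0 < r a & u a : \<U> & cball a (r a) <= u a"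
  and I4: "(\<Union>a\<in>I. ball a (r a)) = UNIV"
  and I5: "ALL R. finite {a:I. cball a (r a) Int cball 0 R ~= {}}"
  using locally_finite_ball_refinement[OF assms] by (elim exE conjE)
 have I: "0 < r a" "u a : \<U>" "cball a (r a) <= u a" for a using ru by auto
 define J where "J R = {a:I. cball a (r a) Int cball 0 R ~= {}}" for R
 define S where "S A x = (\<Sum>a\<in>{a:A. bump a (r a) x ~= 0}. bump a (r a) x)" for A x
 have nz: "bump a (r a) x ~= 0 \<longleftrightarrow> x : ball a (r a)" for a x using bump_pos_iff[OF I(1)] .
 have finJ: "finite (J R)" for R using I5 by (simp add: J_def)
 have sub: "{a:A. bump a (r a) x ~= 0} <= A Int J R" if "A <= I" "x : cball 0 R" for A x R
 proof
  fix a assume "a : {a:A. bump a (r a) x ~= 0}"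
  hence "a : A" "x : cball a (r a)" by (auto simp: nz)
  thus "a : A Int J R" using that unfolding J_def by blast
 qed
 have S_eq: "S A x = (\<Sum>a\<in>A Int J R. bump a (r a) x)" if "A <= I" "x : cball 0 R" for A x R
  unfolding S_def by (rule sum.mono_neutral_left) (use sub[OF that] finJ that in auto)
 have fin: "finite {a:A. bump a (r a) x ~= 0}" if "A <= I" for A x
  using sub[OF that, of x "norm x"] finJ by (meson finite_Int finite_subset mem_cball_0 order_refl)
 have S_nn: "0 <= S A x" for A x unfolding S_def by (intro sum_nonneg) (auto simp: bump_nonneg)
 have S_smooth: "smooth (S A)" if A: "A <= I" for A
 proof (rule smooth_local)
  fix x :: 'a
  show "EX N g. open N & x : N & smooth g & (ALL y:N. S A y = g y)"
   using S_eq[OF A, of _ "norm x + 1"]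
   by (intro exI[of _ "ball 0 (norm x + 1)"] exI[of _ "%y. \<Sum>a\<in>A Int J (norm x + 1). bump a (r a) y"])
     (auto intro!: smooth_sum smooth_bump)
 qed
 have S_pos: "0 < S I x" for x
 proof -
  obtain a where a: "a : I" "x : ball a (r a)" using I4 by blast
  hence "0 < bump a (r a) x" using nz bump_nonneg by (metis order_less_le)
  moreover have "bump a (r a) x <= S I x" unfolding S_def
   by (rule member_le_sum) (use a nz fin[of I] in "auto simp: bump_nonneg")
  ultimately show ?thesis by linarith
 qed
 define A where "A U = {a:I. u a = U}" for U
 have AI: "A U <= I" for U by (auto simp: A_def)
 define \<theta> where "\<theta> U x = S (A U) x * inverse (S I x)" for U x
 have S_mono: "S (A U) x <= S I x" for U x unfolding S_def
  by (rule sum_mono2) (use fin[of I] AI in "auto simp: bump_nonneg")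
 have chi_nz: "EX a:A U. x : ball a (r a)" if "\<theta> U x ~= 0" for U x
 proof (rule ccontr)
  assume "~ ?thesis"
  hence "{a:A U. bump a (r a) x ~= 0} = {}" using nz by auto
  hence "S (A U) x = 0" unfolding S_def by simp
  thus False using that by (simp add: \<theta>_def)
 qed
 show thesis
 proof (rule that[of \<theta>])
  show "smooth (\<theta> U)" for U unfolding \<theta>_def[abs_def]
   by (intro smooth_mult smooth_inverse S_smooth AI order_refl) (use S_pos in "auto simp: less_le")
  show "0 <= \<theta> U x" for U x unfolding \<theta>_def using S_nn S_pos[of x] by simp
  show "\<theta> U x <= 1" for U x unfolding \<theta>_def using S_mono[of U x] S_pos[of x] by (simp add: field_simps)
  show "closure {x. \<theta> U x ~= 0} <= U" if "U : \<U>" for U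
  proof
   fix x assume x: "x : closure {x. \<theta> U x ~= 0}"
   let ?R = "norm x + 1"
   let ?C = "\<Union>a\<in>A U Int J ?R. cball a (r a)"
   have "closed ?C" using finJ by (intro closed_UN) auto
   have "x : closure ({x. \<theta> U x ~= 0} Int ball 0 ?R)"
    using open_Int_closure_subset[of "ball 0 ?R" "{x. \<theta> U x ~= 0}"] x by (auto simp: Int_commute)
   moreover have "{x. \<theta> U x ~= 0} Int ball 0 ?R <= ?C"
   proof
    fix y assume "y : {x. \<theta> U x ~= 0} Int ball 0 ?R"
    then obtain a where a: "a : A U" "y : ball a (r a)" "y : cball 0 ?R" using chi_nz[of U y] by auto
    hence "y : cball a (r a) Int cball 0 ?R" by auto
    hence "a : J ?R" unfolding J_def using a AI[of U] by blast
    thus "y : ?C" using a \<open>y : cball a (r a) Int cball 0 ?R\<close> by blast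
   qed
   ultimately have "x : ?C" using \<open>closed ?C\<close> closure_minimal by blast
   thus "x : U" using I(3) unfolding A_def by blast
  qed
  show "finite {U:\<U>. EX x:cball 0 R. \<theta> U x ~= 0}" for R
  proof (rule finite_subset)
   show "{U:\<U>. EX x:cball 0 R. \<theta> U x ~= 0} <= u ` J R"
   proof clarify
    fix U x assume x: "x : cball 0 R" "\<theta> U x ~= 0"
    then obtain a where a: "a : A U" "x : ball a (r a)" using chi_nz by blast
    hence "x : cball a (r a) Int cball 0 R" using x by auto
    hence "a : J R" unfolding J_def using a AI[of U] by blast
    thus "U : u ` J R" using a by (auto simp: A_def)
   qed
  qed (use finJ in auto)
  show "(\<Sum>U\<in>F. \<theta> U x) = 1"
   if F: "finite F" "F <= \<U>" and sup: "!!U. U : \<U> ==> \<theta> U x ~= 0 ==> U : F" for F x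
  proof -
   let ?B = "%U. {a:A U. bump a (r a) x ~= 0}"
   have "(\<Sum>U\<in>F. S (A U) x) = (\<Sum>a\<in>(\<Union>U\<in>F. ?B U). bump a (r a) x)"
    unfolding S_def by (rule sum.UNION_disjoint[symmetric]) (use F fin[OF AI] in "auto simp: A_def")
   also have "(\<Union>U\<in>F. ?B U) = {a:I. bump a (r a) x ~= 0}"
   proof
    show "{a:I. bump a (r a) x ~= 0} <= (\<Union>U\<in>F. ?B U)"
    proof
     fix a assume a: "a : {a:I. bump a (r a) x ~= 0}"
     hence "a : ?B (u a)" by (auto simp: A_def)
     hence "bump a (r a) x <= S (A (u a)) x" unfolding S_def
      by (intro member_le_sum) (use fin[OF AI] in "auto simp: bump_nonneg")
     moreover have "0 < bump a (r a) x" using a bump_nonneg by (metis (mono_tags) mem_Collect_eq order_less_le)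
     ultimately have "\<theta> (u a) x ~= 0" using S_pos[of x] by (simp add: \<theta>_def)
     thus "a : (\<Union>U\<in>F. ?B U)" using sup I(2) \<open>a : ?B (u a)\<close> by blast
    qed
   qed (use AI in blast)
   finally have "(\<Sum>U\<in>F. S (A U) x) = S I x" by (simp add: S_def)
   thus ?thesis using S_pos[of x] by (simp add: \<theta>_def flip: sum_distrib_right)
  qed
 qed
qed

lemma smooth_cutoff:
 fixes K U :: "'a::euclidean_space set"
 assumes K: "compact K" and U: "open U" "K <= U"
 obtains \<theta> :: "'a => real" and C where "smooth \<theta>" "!!x. 0 <= \<theta> x" "!!x. \<theta> x <= 1"
  "compact C" "C <= U" "!!x. x ~: C ==> \<theta> x = 0" "!!x. x : K ==> \<theta> x = 1"
proof -
 obtain B where B: "B > 0" "K <= ball 0 B"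
  using compact_imp_bounded[OF K] bounded_subset_ballD by blast
 let ?V = "U Int ball 0 B"
 obtain \<theta> where \<theta>: "!!W. W : {?V, -K} ==> smooth (\<theta> W)" "!!W x. 0 <= \<theta> W x" "!!W x. \<theta> W x <= 1"
  "!!W. W : {?V, -K} ==> closure {x. \<theta> W x ~= 0} <= W"
  "!!F x. finite F ==> F <= {?V, -K} ==> (!!U. U : {?V, -K} ==> \<theta> U x ~= 0 ==> U : F) ==> (\<Sum>U\<in>F. \<theta> U x) = (1::real)"
  by (rule smooth_partition_of_unity[of "{?V, -K}"]) (use B U K in "auto simp: open_Compl compact_imp_closed")
 let ?C = "closure {x. \<theta> ?V x ~= 0}"
 have CV: "?C <= ?V" using \<theta>(4)[of ?V] by blast
 have out: "\<theta> (-K) x = 0" if "x : K" for x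
  using \<theta>(4)[of "-K"] closure_subset[of "{x. \<theta> (-K) x ~= 0}"] that by auto
 show thesis
 proof (rule that[of "\<theta> ?V" ?C])
  have "bounded ?C" using CV by (meson bounded_ball bounded_subset inf.boundedE)
  thus "compact ?C" by (simp add: compact_eq_bounded_closed)
  show "\<theta> ?V x = 0" if "x ~: ?C" for x
   using that subsetD[OF closure_subset, of x "{x. \<theta> ?V x ~= 0}"] by blast
  show "\<theta> ?V x = 1" if "x : K" for x
   using \<theta>(5)[of "{?V}" x] out[OF that] by auto
 qed (use \<theta> CV in auto)
qed

text \<open>Symmetry of second derivatives, by applying the mean value theorem to both iterated
  differences.\<close>

lemma second_difference_mean_value:
 fixes f :: "'a::real_normed_vector => real"
 assumes f: "C_k 2 f" and h: "h > 0"
 obtains \<xi> \<eta> where "0 <= \<xi>" "\<xi> <= h" "0 <= \<eta>" "\<eta> <= h"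
  "f (x + h *\<^sub>R a + h *\<^sub>R b) - f (x + h *\<^sub>R a) - f (x + h *\<^sub>R b) + f x
    = h * h * dir_deriv (dir_deriv f a) b (x + \<xi> *\<^sub>R a + \<eta> *\<^sub>R b)"
proof -
 have f': "C_k (Suc (Suc 0)) f" using f by (simp add: numeral_2_eq_2)
 have line: "((%t. g (y + t *\<^sub>R v)) has_derivative (%s. s * dir_deriv g v (y + t *\<^sub>R v))) (at t within T)"
  if "C_k (Suc k) g" for g :: "'a => real" and y v t T k
 proof -
  have 1: "((%t. y + t *\<^sub>R v) has_derivative (%s. s *\<^sub>R v)) (at t)"
   by (auto intro!: derivative_eq_intros)
  have lin: "frechet_derivative g (at z) (s *\<^sub>R v) = s * frechet_derivative g (at z) v" for z s
   using C_k_has_derivative[OF that, of z] by (simp add: has_derivative_bounded_linear bounded_linear.linear linear_cmul)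
  show ?thesis
   using has_derivative_compose[OF 1 C_k_has_derivative[OF that]] by (simp add: lin has_derivative_at_withinI)
 qed
 let ?g = "%t. f (x + t *\<^sub>R a + h *\<^sub>R b) - f (x + t *\<^sub>R a)"
 have "EX \<xi>. \<xi> : {0<..<h} & ?g h - ?g 0 = (h - 0) * (dir_deriv f a (x + \<xi> *\<^sub>R a + h *\<^sub>R b) - dir_deriv f a (x + \<xi> *\<^sub>R a))"
 proof -
  have D: "(?g has_derivative (%s. s * dir_deriv f a (x + h *\<^sub>R b + t *\<^sub>R a) - s * dir_deriv f a (x + t *\<^sub>R a))) (at t within {0..h})" for t
   using has_derivative_diff[OF line[OF f', of "x + h *\<^sub>R b" a t "{0..h}"] line[OF f', of x a t "{0..h}"]]
   by (simp add: algebra_simps)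
  obtain \<xi> where "\<xi> : {0<..<h}" "?g h - ?g 0 = (h - 0) * dir_deriv f a (x + h *\<^sub>R b + \<xi> *\<^sub>R a) - (h - 0) * dir_deriv f a (x + \<xi> *\<^sub>R a)"
   using mvt_simple[of 0 h ?g, OF h D] by blast
  thus ?thesis by (intro exI[of _ \<xi>]) (simp add: right_diff_distrib add.commute add.left_commute)
 qed
 then obtain \<xi> where \<xi>: "\<xi> : {0<..<h}" "?g h - ?g 0 = h * (dir_deriv f a (x + \<xi> *\<^sub>R a + h *\<^sub>R b) - dir_deriv f a (x + \<xi> *\<^sub>R a))"
  by auto
 have fa: "C_k (Suc 0) (dir_deriv f a)" using f' by simp
 obtain \<eta> where \<eta>: "\<eta> : {0<..<h}" "dir_deriv f a (x + \<xi> *\<^sub>R a + h *\<^sub>R b) - dir_deriv f a (x + \<xi> *\<^sub>R a)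
   = h * dir_deriv (dir_deriv f a) b (x + \<xi> *\<^sub>R a + \<eta> *\<^sub>R b)"
  using mvt_simple[of 0 h "%t. dir_deriv f a (x + \<xi> *\<^sub>R a + t *\<^sub>R b)", OF h
    line[OF fa, of "x + \<xi> *\<^sub>R a" b _ "{0..h}"]] by auto
 show thesis by (rule that[of \<xi> \<eta>]) (use \<xi> \<eta> in "auto simp: algebra_simps")
qed

lemma dir_deriv_symmetric_real:
 fixes f :: "'a::real_normed_vector => real"
 assumes f: "C_k 2 f"
 shows "dir_deriv (dir_deriv f a) b x = dir_deriv (dir_deriv f b) a x"
proof -
 have f': "C_k (Suc (Suc 0)) f" using f by (simp add: numeral_2_eq_2)
 define h where "h n = inverse (real (Suc n))" for n
 have h: "h n > 0" for n by (simp add: h_def)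
 let ?D = "%a b h. (f (x + h *\<^sub>R a + h *\<^sub>R b) - f (x + h *\<^sub>R a) - f (x + h *\<^sub>R b) + f x) / (h * h)"
 have lim: "(%n. ?D a b (h n)) \<longlonglongrightarrow> dir_deriv (dir_deriv f a) b x" for a b
 proof -
  have "EX \<xi> \<eta>. (0 <= \<xi> & \<xi> <= h n) & (0 <= \<eta> & \<eta> <= h n) & ?D a b (h n) = dir_deriv (dir_deriv f a) b (x + \<xi> *\<^sub>R a + \<eta> *\<^sub>R b)" for n
   by (rule second_difference_mean_value[OF f h[of n], of x a b]) (use h[of n] in auto)
  then obtain A Y where AY: "!!n. 0 <= A n & A n <= h n" "!!n. 0 <= Y n & Y n <= h n"
   "!!n. ?D a b (h n) = dir_deriv (dir_deriv f a) b (x + A n *\<^sub>R a + Y n *\<^sub>R b)" by metis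
  have z: "B \<longlonglongrightarrow> 0" if "!!n. 0 <= B n & B n <= h n" for B
   by (rule tendsto_sandwich[OF _ _ tendsto_const LIMSEQ_inverse_real_of_nat]) (use that in "auto simp: h_def")
  have "(%n. x + A n *\<^sub>R a + Y n *\<^sub>R b) \<longlonglongrightarrow> x + 0 *\<^sub>R a + 0 *\<^sub>R b"
   by (intro tendsto_intros z AY)
  moreover have "continuous_on UNIV (dir_deriv (dir_deriv f a) b)" using f' by auto
  ultimately show ?thesis unfolding AY(3) using continuous_on_tendsto_compose by fastforce
 qed
 have eq: "(%n. ?D b a (h n)) = (%n. ?D a b (h n))" by (simp add: algebra_simps)
 show ?thesis by (rule LIMSEQ_unique[OF lim]) (subst eq[symmetric], rule lim)
qed

lemma dir_deriv_bounded_linear: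
 assumes "C_k (Suc k) f" "bounded_linear L"
 shows "dir_deriv (%x. L (f x)) v x = L (dir_deriv f v x)"
 using frechet_derivative_eq[OF bounded_linear.has_derivative[OF assms(2) C_k_has_derivative[OF assms(1)]]]
 by auto

lemma dir_deriv_symmetric:
 fixes f :: "'a::real_normed_vector => complex"
 assumes f: "smooth f"
 shows "dir_deriv (dir_deriv f a) b x = dir_deriv (dir_deriv f b) a x"
proof -
 have "L (dir_deriv (dir_deriv f a) b x) = L (dir_deriv (dir_deriv f b) a x)"
  if L: "bounded_linear L" for L :: "complex => real"
 proof -
  have "C_k 2 (%x. L (f x))" using smoothD[OF f] C_k_bounded_linear L by blast
  moreover have "dir_deriv (dir_deriv (%x. L (f x)) v) w x = L (dir_deriv (dir_deriv f v) w x)" for v w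
   unfolding dir_deriv_bounded_linear[OF smoothD[OF f] L]
    dir_deriv_bounded_linear[OF smoothD[OF smooth_dir_deriv[OF f]] L] ..
  ultimately show ?thesis
   using dir_deriv_symmetric_real[where f = "%x. L (f x)" and a=a and b=b and x=x] by simp
 qed
 from this[OF bounded_linear_Re] this[OF bounded_linear_Im] show ?thesis
  by (simp add: complex_eq_iff)
qed

section \<open>Integration over Euclidean space\<close>

lemma cball_borel [measurable]: "cball a r : sets borel"
 by auto

lemma norm_LINT_le:
 fixes f :: "'w => 'b::{banach, second_countable_topology}"
 assumes "integrable M f" "integrable M g" "!!w. w : space M ==> norm (f w) <= g w"
 shows "norm (LINT w|M. f w) <= (LINT w|M. g w)"
proof -
 have "norm (LINT w|M. f w) <= (LINT w|M. norm (f w))" by (rule integral_norm_bound)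
 also have "... <= (LINT w|M. g w)" using assms by (intro integral_mono) auto
 finally show ?thesis .
qed

lemma nn_integral_lborel_translate:
 fixes f :: "'a::euclidean_space => ennreal"
 assumes "f : borel_measurable borel"
 shows "(NN x. f (x + a)) = (NN x. f x)"
proof -
 have "(NN x. f x) = (\<integral>\<^sup>+x. f x \<partial>distr lborel borel ((+) a))"
  by (simp add: lborel_distr_plus)
 also have "... = (NN x. f (a + x))"
  using assms by (intro nn_integral_distr) auto
 finally show ?thesis by (simp add: add.commute)
qed

lemma integral_lborel_translate:
 fixes f :: "'a::euclidean_space => 'b::{banach, second_countable_topology}"
 assumes "f : borel_measurable borel"
 shows "(LINT x|lborel. f (x + a)) = (LINT x|lborel. f x)"
proof -
 have "(LINT x|lborel. f x) = (LINT x|distr lborel borel ((+) a). f x)"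
  by (simp add: lborel_distr_plus)
 also have "... = (LINT x|lborel. f (a + x))"
  using assms by (intro integral_distr) auto
 finally show ?thesis by (simp add: add.commute)
qed

lemma integrable_lborel_translate:
 fixes f :: "'a::euclidean_space => 'b::{banach, second_countable_topology}"
 assumes "integrable lborel f"
 shows "integrable lborel (%x. f (x + a))"
proof -
 have "integrable (distr lborel borel ((+) a)) f" using assms by (simp add: lborel_distr_plus)
 hence "integrable lborel (%x. f (a + x))" by (subst (asm) integrable_distr_eq) (use assms in auto)
 thus ?thesis by (simp add: add.commute)
qed

lemma lborel_distr_uminus_euclidean: "distr lborel borel uminus = (lborel :: 'a::euclidean_space measure)"
 using lborel_affine[of "-1" "0::'a"] by (simp add: density_1)

lemma integral_lborel_uminus:
 fixes f :: "'a::euclidean_space => 'b::{banach, second_countable_topology}"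
 assumes "f : borel_measurable borel"
 shows "(LINT x|lborel. f (- x)) = (LINT x|lborel. f x)"
proof -
 have "(LINT x|lborel. f x) = (LINT x|distr lborel borel uminus. f x)"
  by (simp add: lborel_distr_uminus_euclidean)
 also have "... = (LINT x|lborel. f (- x))"
  using assms by (intro integral_distr) auto
 finally show ?thesis by simp
qed

lemma nn_integral_lborel_uminus:
 fixes f :: "'a::euclidean_space => ennreal"
 assumes "f : borel_measurable borel"
 shows "(NN x. f (- x)) = (NN x. f x)"
proof -
 have "(NN x. f x) = (\<integral>\<^sup>+x. f x \<partial>distr lborel borel uminus)"
  by (simp add: lborel_distr_uminus_euclidean)
 also have "... = (NN x. f (- x))"
  using assms by (intro nn_integral_distr) auto
 finally show ?thesis by simp
qed

lemma integral_lborel_scale: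
 fixes f :: "'a::euclidean_space => complex"
 assumes "f : borel_measurable borel" "e > 0"
 shows "(LINT x|lborel. f x) = e ^ DIM('a) *\<^sub>R (LINT x|lborel. f (e *\<^sub>R x))"
proof -
 have "(LINT x|lborel. f x) = (LINT x|density (distr lborel borel (%x. 0 + e *\<^sub>R x)) (%_. ennreal (\<bar>e\<bar> ^ DIM('a))). f x)"
  using lborel_affine[of e "0::'a"] assms by simp
 also have "... = e ^ DIM('a) *\<^sub>R (LINT x|lborel. f (e *\<^sub>R x))"
  using assms by (subst integral_density) (auto simp: integral_distr)
 finally show ?thesis .
qed

lemma integrable_continuous_support:
 fixes f :: "'a::euclidean_space => 'b::{banach, second_countable_topology}"
 assumes "continuous_on UNIV f" "!!x. norm x > R ==> f x = 0"
 shows "integrable lborel f"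
proof -
 have "integrable lborel (%x. indicator (cball 0 R) x *\<^sub>R f x)"
  by (intro borel_integrable_compact) (use assms(1) continuous_on_subset in auto)
 moreover have "(%x. indicator (cball 0 R) x *\<^sub>R f x) = f"
  using assms(2) by (auto simp: indicator_def)
 ultimately show ?thesis by simp
qed

lemma bounded_continuous_support:
 fixes f :: "'a::euclidean_space => 'b::real_normed_vector"
 assumes "continuous_on UNIV f" "!!x. norm x > R ==> f x = 0"
 obtains B where "B > 0" "!!x. norm (f x) <= B"
proof -
 have "bounded (f ` cball 0 R)"
  using assms(1) by (intro compact_imp_bounded compact_continuous_image) (auto intro: continuous_on_subset)
 then obtain B where B: "B > 0" "!!x. x : cball 0 R ==> norm (f x) <= B"
  by (auto simp: bounded_pos)
 show thesis
 proof (rule that[OF B(1)])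
  show "norm (f x) <= B" for x using B assms(2)[of x] by (cases "norm x > R") auto
 qed
qed

lemma has_derivative_line:
 assumes "(F has_derivative D) (at (x + t *\<^sub>R v))"
 shows "((%t. F (x + t *\<^sub>R v)) has_derivative (%s. s *\<^sub>R D v)) (at t within T)"
proof -
 have 1: "((%t. x + t *\<^sub>R v) has_derivative (%s. s *\<^sub>R v)) (at t)"
  by (auto intro!: derivative_eq_intros)
 have lin: "D (s *\<^sub>R v) = s *\<^sub>R D v" for s
  using has_derivative_bounded_linear[OF assms] by (simp add: bounded_linear.linear linear_cmul)
 show ?thesis
  using has_derivative_compose[OF 1 assms] by (simp add: lin has_derivative_at_withinI)
qed

text \<open>The integral is the limit of those of the difference quotients, which vanish by translation
  invariance. The derivative need not be continuous.\<close>

lemma integral_directional_derivative_eq_0: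
 fixes F :: "'a::euclidean_space => complex"
 assumes D: "!!x. (F has_derivative D x) (at x)"
  and supp: "!!x. norm x > R ==> F x = 0"
  and B: "!!x. norm (D x v) <= B"
 shows "integrable lborel (%x. D x v)" "(LINT x|lborel. D x v) = 0"
proof -
 have B0: "B >= 0" using B[of 0] norm_ge_zero order_trans by blast
 have contF: "continuous_on UNIV F"
  using D by (meson continuous_at_imp_continuous_on has_derivative_continuous)
 have intF: "integrable lborel F" by (rule integrable_continuous_support[OF contF supp])
 define h where "h n = inverse (real (Suc n))" for n
 have h: "0 < h n" "h n <= 1" for n by (auto simp: h_def field_simps)
 define s where "s n x = inverse (h n) *\<^sub>R (F (x + h n *\<^sub>R v) - F x)" for n x
 have lim: "(%n. s n x) \<longlonglongrightarrow> D x v" for x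
 proof -
  have "((%t. F (x + t *\<^sub>R v)) has_derivative (%s. s *\<^sub>R D x v)) (at 0 within UNIV)"
   using has_derivative_line[of F "D x" x 0 v UNIV] D by simp
  hence "((%t. norm (F (x + t *\<^sub>R v) - F x - t *\<^sub>R D x v) / norm t) \<longlongrightarrow> 0) (at 0)"
   by (simp add: has_derivative_iff_norm)
  moreover have "eventually (%t. norm (F (x + t *\<^sub>R v) - F x - t *\<^sub>R D x v) / norm t =
    norm (inverse t *\<^sub>R (F (x + t *\<^sub>R v) - F x) - D x v)) (at 0)"
  proof (rule eventually_at_filter[THEN iffD2, OF always_eventually], intro allI impI)
   fix t :: real assume t: "t ~= 0"
   have "inverse t *\<^sub>R (F (x + t *\<^sub>R v) - F x) - D x v = inverse t *\<^sub>R (F (x + t *\<^sub>R v) - F x - t *\<^sub>R D x v)"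
    using t by (simp add: scaleR_diff_right)
   thus "norm (F (x + t *\<^sub>R v) - F x - t *\<^sub>R D x v) / norm t =
    norm (inverse t *\<^sub>R (F (x + t *\<^sub>R v) - F x) - D x v)"
    by (simp add: divide_inverse mult.commute)
  qed
  ultimately have "((%t. norm (inverse t *\<^sub>R (F (x + t *\<^sub>R v) - F x) - D x v)) \<longlongrightarrow> 0) (at 0)"
   by (rule Lim_transform_eventually)
  hence "((%t. inverse t *\<^sub>R (F (x + t *\<^sub>R v) - F x)) \<longlongrightarrow> D x v) (at 0)"
   by (simp add: tendsto_norm_zero_iff LIM_zero_iff)
  moreover have "filterlim h (at 0) sequentially"
   unfolding filterlim_at using LIMSEQ_inverse_real_of_nat h by (auto simp: h_def[abs_def])
  ultimately show ?thesis unfolding s_def by (rule filterlim_compose)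
 qed
 have bd: "norm (F (x + t *\<^sub>R v) - F x) <= B * t" if "t > 0" for x t
 proof -
  have "norm (F (x + t *\<^sub>R v) - F (x + 0 *\<^sub>R v)) <= B * norm (t - 0)"
  proof (rule differentiable_bound[of "{0..t}"])
   show "((%t. F (x + t *\<^sub>R v)) has_derivative (%s. s *\<^sub>R D (x + r *\<^sub>R v) v)) (at r within {0..t})" for r
    by (rule has_derivative_line[OF D])
   show "onorm (%s. s *\<^sub>R D (x + r *\<^sub>R v) v) <= B" for r
    by (rule onorm_le) (use B in "auto simp: mult.commute[of B] intro!: mult_left_mono")
  qed (use that in auto)
  thus ?thesis using that by simp
 qed
 let ?w = "%x. B * indicator (cball 0 (R + norm v)) x"
 have dom: "norm (s n x) <= ?w x" for n x
 proof (cases "norm x <= R + norm v")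
  case True
  have "norm (s n x) <= inverse (h n) * (B * h n)"
   unfolding s_def using bd[OF h(1)] h(1)[of n] by (simp add: mult_left_mono)
  also have "... = B" using h(1)[of n] by simp
  finally show ?thesis using True by simp
 next
  case False
  have "norm (h n *\<^sub>R v) <= norm v" using h[of n] by (simp add: mult_left_le_one_le)
  hence "norm (x + h n *\<^sub>R v) > R" "norm x > R"
   using False norm_triangle_ineq4[of "x + h n *\<^sub>R v" "h n *\<^sub>R v"] norm_ge_zero[of v] by (auto simp del: norm_ge_zero norm_scaleR)
  thus ?thesis using supp False by (simp add: s_def)
 qed
 have mF [measurable]: "F : borel_measurable borel" using contF by (rule borel_measurable_continuous_onI)
 have ms [measurable]: "s n : borel_measurable borel" for n unfolding s_def by measurable
 have w: "integrable lborel ?w"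
  by (intro integrable_mult_right integrable_real_indicator) (auto simp: emeasure_lborel_cball_finite[unfolded infinity_ennreal_def])
 have mD: "(%x. D x v) : borel_measurable borel"
  by (rule borel_measurable_LIMSEQ_metric[OF ms]) (use lim in auto)
 have "(LINT x|lborel. s n x) = 0" for n
  unfolding s_def using integral_lborel_translate[OF mF, of "h n *\<^sub>R v"]
  by (simp add: intF integrable_lborel_translate)
 moreover have "(%n. LINT x|lborel. s n x) \<longlonglongrightarrow> (LINT x|lborel. D x v)"
  by (rule integral_dominated_convergence[OF _ _ w]) (use mD lim dom in auto)
 ultimately show "(LINT x|lborel. D x v) = 0" by (simp add: LIMSEQ_const_iff)
 show "integrable lborel (%x. D x v)"
  by (rule integrable_dominated_convergence[OF _ _ w, where s = s]) (use mD lim dom in auto)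
qed

lemma dir_deriv_outside_support:
 assumes "!!x. x ~: K ==> f x = 0" "closed K" "x ~: K"
 shows "frechet_derivative f (at x) = (%v. 0)"
proof -
 have "((%_. 0) has_derivative (%v. 0)) (at x)" by simp
 hence "(f has_derivative (%v. 0)) (at x)"
  by (rule has_derivative_transform_within_open[where s = "- K"]) (use assms in auto)
 thus ?thesis by (rule frechet_derivative_eq)
qed

lemma dir_deriv_expand:
 fixes f :: "'a::euclidean_space => complex"
 assumes "C_k (Suc 0) f"
 shows "dir_deriv f v x = (\<Sum>b\<in>Basis. (v \<bullet> b) *\<^sub>R dir_deriv f b x)"
proof -
 have lin: "linear (frechet_derivative f (at x))"
  using C_k_has_derivative[OF assms] has_derivative_linear by blast
 have "dir_deriv f v x = frechet_derivative f (at x) (\<Sum>b\<in>Basis. (v \<bullet> b) *\<^sub>R b)"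
  by (simp add: euclidean_representation)
 also have "... = (\<Sum>b\<in>Basis. (v \<bullet> b) *\<^sub>R dir_deriv f b x)"
  by (simp add: linear_sum[OF lin] linear_scale[OF lin])
 finally show ?thesis .
qed

lemma C_1_dir_deriv_bounded:
 fixes f :: "'a::euclidean_space => complex"
 assumes f: "C_k 1 f" "!!x. norm x > R ==> f x = 0"
 shows "EX B>0. ALL x v. norm (dir_deriv f v x) <= B * norm v"
proof -
 have f1: "C_k (Suc 0) f" using f by simp
 have out: "dir_deriv f v x = 0" if "norm x > R" for v x
  using dir_deriv_outside_support[of "cball 0 R" f x] f(2) that by auto
 have "EX B>0. ALL x. norm (dir_deriv f b x) <= B" for b
  using bounded_continuous_support[of "dir_deriv f b" R] out f1 by (metis C_k.simps)
 then obtain B where B: "!!b. B b > 0" "!!b x. norm (dir_deriv f b x) <= B b" by metis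
 have "norm (dir_deriv f v x) <= (\<Sum>b\<in>Basis. B b) * norm v" for v x
 proof -
  have lin: "linear (frechet_derivative f (at x))"
   using C_k_has_derivative[OF f1] has_derivative_linear by blast
  have "dir_deriv f v x = (\<Sum>b\<in>Basis. (v \<bullet> b) *\<^sub>R dir_deriv f b x)"
   by (rule dir_deriv_expand[OF f1])
  also have "norm ... <= (\<Sum>b\<in>Basis. norm v * B b)"
   by (rule sum_norm_le) (use B(2) Basis_le_norm in "auto intro!: mult_mono simp: less_imp_le")
  finally show ?thesis by (simp add: sum_distrib_left mult.commute)
 qed
 moreover have "(\<Sum>b\<in>(Basis::'a set). B b) > 0" using B(1) by (intro sum_pos) auto
 ultimately show ?thesis by blast
qed

text \<open>The remainder is bounded uniformly, which permits differentiation under any integral over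
  translates.\<close>

lemma smooth_second_order_bound:
 fixes f :: "'a::euclidean_space => complex"
 assumes f: "smooth f" "!!x. norm x > R ==> f x = 0"
 shows "EX K>=0. ALL x h. norm (f (x + h) - f x - dir_deriv f h x) <= K * norm h * norm h"
proof -
 have out: "dir_deriv f v x = 0" if "norm x > R" for v x
  using dir_deriv_outside_support[of "cball 0 R" f x] f(2) that by auto
 have "EX B>0. ALL x v. norm (dir_deriv (dir_deriv f b) v x) <= B * norm v" for b
  by (rule C_1_dir_deriv_bounded[OF smoothD[OF smooth_dir_deriv[OF f(1)]] out])
 then obtain B where B: "!!b. B b > 0" "!!b x v. norm (dir_deriv (dir_deriv f b) v x) <= B b * norm v" by metis
 define K where "K = (\<Sum>b\<in>(Basis::'a set). B b)"
 have f1: "C_k (Suc 0) f" by (rule smoothD[OF f(1)])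
 have K: "K >= 0" unfolding K_def using B(1) by (intro sum_nonneg) (simp add: less_imp_le)
 have key: "norm (dir_deriv f v y - dir_deriv f v x) <= K * norm v * norm (y - x)" for v x y
 proof -
  have b: "norm (dir_deriv f b y - dir_deriv f b x) <= B b * norm (y - x)" for b
   by (rule differentiable_bound[of UNIV]) (use B(2) in "auto intro!: onorm_le smooth_has_derivative smooth_dir_deriv f(1)")
  have "dir_deriv f v y - dir_deriv f v x = (\<Sum>b\<in>Basis. (v \<bullet> b) *\<^sub>R (dir_deriv f b y - dir_deriv f b x))"
   by (subst (1 2) dir_deriv_expand[OF f1]) (simp add: sum_subtractf scaleR_diff_right)
  also have "norm ... <= (\<Sum>b\<in>Basis. norm v * (B b * norm (y - x)))"
   by (rule sum_norm_le) (use b Basis_le_norm in "auto intro!: mult_mono")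
  finally show ?thesis by (simp add: K_def sum_distrib_left sum_distrib_right mult_ac)
 qed
 have "norm (f (x + h) - f x - dir_deriv f h x) <= K * norm h * norm h" for x h
 proof -
  have "norm ((%t. f (x + t *\<^sub>R h)) 1 - (%t. f (x + t *\<^sub>R h)) 0 -
    (%t s. s *\<^sub>R dir_deriv f h (x + t *\<^sub>R h)) 0 (1 - 0 :: real)) <= norm (1 - 0 :: real) * (K * norm h * norm h)"
  proof (rule differentiable_bound_linearization[where S = "{0..1}"])
   show "((%t. f (x + t *\<^sub>R h)) has_derivative (%s. s *\<^sub>R dir_deriv f h (x + t *\<^sub>R h))) (at t within {0..1})" for t
    by (rule has_derivative_line[OF C_k_has_derivative[OF f1]])
   fix t :: real assume t: "t : {0..1}"
   have "K * norm h * norm ((x + t *\<^sub>R h) - x) <= K * norm h * norm h"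
    using t K by (intro mult_left_mono) (auto intro: mult_left_le_one_le)
   from order_trans[OF key this]
   show "onorm ((%s. s *\<^sub>R dir_deriv f h (x + t *\<^sub>R h)) - (%s. s *\<^sub>R dir_deriv f h (x + 0 *\<^sub>R h))) <= K * norm h * norm h"
    by (intro onorm_le) (simp add: fun_diff_def mult.commute[of _ "\<bar>_\<bar>"] mult_left_mono flip: scaleR_diff_right)
  qed auto
  thus ?thesis by simp
 qed
 thus ?thesis using K by blast
qed

lemma integrable_mult_bounded:
 fixes \<kappa> g :: "'w => complex"
 assumes \<kappa>: "integrable M \<kappa>" and g: "g : borel_measurable M" "!!w. norm (g w) <= B"
 shows "integrable M (%w. \<kappa> w * g w)"
proof (rule Bochner_Integration.integrable_bound)
 show "integrable M (%w. \<bar>B\<bar> * norm (\<kappa> w))" using \<kappa> by simp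
 show "(%w. \<kappa> w * g w) : borel_measurable M" using borel_measurable_integrable[OF \<kappa>] g(1) by (rule borel_measurable_times)
 show "AE w in M. norm (\<kappa> w * g w) <= norm (\<bar>B\<bar> * norm (\<kappa> w))"
  by (intro AE_I2) (simp add: norm_mult mult.commute[of "\<bar>B\<bar>"] mult_left_mono order_trans[OF g(2) abs_ge_self])
qed

text \<open>Differentiation under the integral, for averages of translates in the directions \<open>a w\<close>; this
  covers convolutions as well as integral operators that act in one variable only.\<close>

lemma translate_average_has_derivative:
 fixes \<phi> :: "'a::euclidean_space => complex" and \<kappa> :: "'w => complex"
 assumes \<kappa>: "integrable M \<kappa>" and a: "a : borel_measurable M"
  and \<phi>: "smooth \<phi>" "!!x. norm x > R ==> \<phi> x = 0"
 shows "((%z. LINT w|M. \<kappa> w * \<phi> (z - a w)) has_derivative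
   (%v. LINT w|M. \<kappa> w * dir_deriv \<phi> v (z - a w))) (at z)"
proof -
 have \<phi>1: "C_k (Suc 0) \<phi>" by (rule smoothD[OF \<phi>(1)])
 have [measurable]: "\<kappa> : borel_measurable M" "a : borel_measurable M" using \<kappa> a by auto
 have int: "integrable M (%w. \<kappa> w * \<psi> (z - a w))"
  if "continuous_on UNIV \<psi>" "!!x. norm (\<psi> x) <= B" for \<psi> :: "'a => complex" and B z
  by (rule integrable_mult_bounded[OF \<kappa> _ that(2)])
    (use borel_measurable_continuous_onI[OF that(1)] in measurable)
 obtain B0 where B0: "!!x. norm (\<phi> x) <= B0"
  using bounded_continuous_support[of \<phi> R] \<phi>(2) C_k_Suc_imp[OF \<phi>1] by (metis C_k.simps(1))
 obtain B where B: "B > 0" "!!x v. norm (dir_deriv \<phi> v x) <= B * norm v"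
  using C_1_dir_deriv_bounded[OF smoothD[OF \<phi>(1)] \<phi>(2)] by blast
 have int0: "integrable M (%w. \<kappa> w * \<phi> (z - a w))" for z
  by (rule int[OF _ B0]) (use C_k_Suc_imp[OF \<phi>1] in auto)
 have int1: "integrable M (%w. \<kappa> w * dir_deriv \<phi> v (z - a w))" for z v
  by (rule int[OF _ B(2)]) (use \<phi>1 in auto)
 have lin: "linear (frechet_derivative \<phi> (at x))" for x
  using C_k_has_derivative[OF \<phi>1] has_derivative_linear by blast
 define N where "N = (LINT w|M. norm (\<kappa> w))"
 have N: "N >= 0" by (simp add: N_def)
 show ?thesis unfolding has_derivative_at_alt
 proof (intro conjI allI impI)
  show "bounded_linear (%v. LINT w|M. \<kappa> w * dir_deriv \<phi> v (z - a w))"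
  proof (rule bounded_linear_intro)
   fix v u show "(LINT w|M. \<kappa> w * dir_deriv \<phi> (v + u) (z - a w)) =
     (LINT w|M. \<kappa> w * dir_deriv \<phi> v (z - a w)) + (LINT w|M. \<kappa> w * dir_deriv \<phi> u (z - a w))"
    by (simp add: linear_add[OF lin] distrib_left int1)
  next
   fix r v show "(LINT w|M. \<kappa> w * dir_deriv \<phi> (r *\<^sub>R v) (z - a w)) =
     r *\<^sub>R (LINT w|M. \<kappa> w * dir_deriv \<phi> v (z - a w))"
    by (simp add: linear_scale[OF lin])
  next
   fix v
   have "norm (LINT w|M. \<kappa> w * dir_deriv \<phi> v (z - a w)) <= (LINT w|M. norm (\<kappa> w) * (B * norm v))"
    by (rule norm_LINT_le) (use int1 \<kappa> B in "auto simp: norm_mult intro!: mult_left_mono")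
   thus "norm (LINT w|M. \<kappa> w * dir_deriv \<phi> v (z - a w)) <= norm v * (B * N)"
    by (simp add: N_def mult_ac)
  qed
 next
  fix e :: real assume e: "e > 0"
  obtain K where K: "K >= 0" "!!x h. norm (\<phi> (x + h) - \<phi> x - dir_deriv \<phi> h x) <= K * norm h * norm h"
   using smooth_second_order_bound[OF \<phi>] by blast
  define d where "d = e / (N * K + 1)"
  have NK: "N * K >= 0" using N K by simp
  hence d: "d > 0" using e by (simp add: d_def)
  show "EX d>0. ALL y. norm (y - z) < d -->
    norm ((LINT w|M. \<kappa> w * \<phi> (y - a w)) - (LINT w|M. \<kappa> w * \<phi> (z - a w)) -
     (LINT w|M. \<kappa> w * dir_deriv \<phi> (y - z) (z - a w))) <= e * norm (y - z)"
  proof (intro exI[of _ d] conjI allI impI d)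
   fix y assume y: "norm (y - z) < d"
   let ?r = "%w. \<phi> (y - a w) - \<phi> (z - a w) - dir_deriv \<phi> (y - z) (z - a w)"
   have eq: "(LINT w|M. \<kappa> w * \<phi> (y - a w)) - (LINT w|M. \<kappa> w * \<phi> (z - a w)) -
     (LINT w|M. \<kappa> w * dir_deriv \<phi> (y - z) (z - a w)) = (LINT w|M. \<kappa> w * ?r w)"
    using int0 int1 by (simp add: right_diff_distrib)
   have "norm (LINT w|M. \<kappa> w * ?r w) <= (LINT w|M. norm (\<kappa> w) * (K * norm (y - z) * norm (y - z)))"
   proof (rule norm_LINT_le)
    show "integrable M (%w. \<kappa> w * ?r w)" using int0 int1 by (simp add: right_diff_distrib)
    show "norm (\<kappa> w * ?r w) <= norm (\<kappa> w) * (K * norm (y - z) * norm (y - z))" for w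
     using K(2)[of "z - a w" "y - z"] by (simp add: norm_mult mult_left_mono)
   qed (use \<kappa> in auto)
   also have "... = (N * K * norm (y - z)) * norm (y - z)" by (simp add: N_def mult_ac)
   also have "... <= e * norm (y - z)"
   proof (rule mult_right_mono)
    have "N * K * norm (y - z) <= N * K * d" using y NK by (intro mult_left_mono) auto
    also have "... <= e" using NK e by (simp add: d_def field_simps)
    finally show "N * K * norm (y - z) <= e" .
   qed simp
   finally show "norm ((LINT w|M. \<kappa> w * \<phi> (y - a w)) - (LINT w|M. \<kappa> w * \<phi> (z - a w)) -
     (LINT w|M. \<kappa> w * dir_deriv \<phi> (y - z) (z - a w))) <= e * norm (y - z)"
    unfolding eq by simp
  qed
 qed
qed

lemma smooth_translate_average:
 fixes \<phi> :: "'a::euclidean_space => complex" and \<kappa> :: "'w => complex"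
 assumes \<kappa>: "integrable M \<kappa>" and a: "a : borel_measurable M"
  and \<phi>: "smooth \<phi>" "!!x. norm x > R ==> \<phi> x = 0"
 shows "smooth (%z. LINT w|M. \<kappa> w * \<phi> (z - a w))"
proof -
 have "C_k k (%z. LINT w|M. \<kappa> w * \<phi> (z - a w))" for k
  using \<phi>
 proof (induction k arbitrary: \<phi>)
  case 0
  have "continuous (at z) (%z. LINT w|M. \<kappa> w * \<phi> (z - a w))" for z
   using translate_average_has_derivative[OF \<kappa> a 0] has_derivative_continuous by blast
  thus ?case by (simp add: continuous_at_imp_continuous_on)
 next
  case (Suc k)
  show ?case
  proof (rule C_k_SucI[OF translate_average_has_derivative[OF \<kappa> a Suc.prems]])
   fix v
   have "dir_deriv \<phi> v x = 0" if "norm x > R" for x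
    using dir_deriv_outside_support[of "cball 0 R" \<phi> x] Suc.prems(2) that by auto
   thus "C_k k (%z. LINT w|M. \<kappa> w * dir_deriv \<phi> v (z - a w))"
    by (intro Suc.IH smooth_dir_deriv Suc.prems(1)) auto
  qed
 qed
 thus ?thesis by (simp add: smooth_def)
qed

text \<open>Fubini's theorem together with the translation invariance of the integral.\<close>

lemma translate_average_swap:
 fixes u g :: "'a::euclidean_space => complex" and \<kappa> :: "'b::euclidean_space => complex"
 assumes \<kappa>: "integrable lborel \<kappa>" and a [measurable]: "a : borel_measurable borel" and u: "integrable lborel u"
  and g [measurable]: "g : borel_measurable borel" and B: "!!x. norm (g x) <= B"
 shows "(LINT z|lborel. (LINT w|lborel. \<kappa> w * u (z - a w)) * g z) = (LINT z|lborel. u z * (LINT w|lborel. \<kappa> w * g (z + a w)))"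
proof -
 have [measurable]: "\<kappa> : borel_measurable borel" "u : borel_measurable borel" using \<kappa> u by auto
 let ?F = "%z w. \<kappa> w * u (z - a w) * g z" and ?G = "%z w. u z * (\<kappa> w * g (z + a w))"
 have eq: "?F z w = ?G (z + - a w) w" for z w by simp
 have tr: "(NN z. ennreal (norm (?F z w))) = (NN z. ennreal (norm (?G z w)))"
  "(LINT z|lborel. ?F z w) = (LINT z|lborel. ?G z w)" for w
  unfolding eq by (rule nn_integral_lborel_translate[of "%z. ennreal (norm (?G z w))"] integral_lborel_translate[of "%z. ?G z w"], measurable)+
 have nn: "(\<integral>\<^sup>+x. ennreal (norm (case_prod H x)) \<partial>(lborel \<Otimes>\<^sub>M lborel)) = (NN w. \<integral>\<^sup>+z. ennreal (norm (H z w)) \<partial>lborel)"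
  if "case_prod H : borel_measurable (lborel \<Otimes>\<^sub>M lborel)" for H :: "'a => 'b => complex"
  using that by (subst lborel_pair.nn_integral_snd[symmetric]) (auto simp: case_prod_unfold)
 have "(NN w. \<integral>\<^sup>+z. ennreal (norm (?G z w)) \<partial>lborel)
  <= (NN w. \<integral>\<^sup>+z. ennreal (norm (\<kappa> w)) * (ennreal \<bar>B\<bar> * ennreal (norm (u z))) \<partial>lborel)"
 proof (intro nn_integral_mono)
  fix w z
  have "norm (?G z w) <= norm (\<kappa> w) * (\<bar>B\<bar> * norm (u z))"
   using order_trans[OF B[of "z + a w"] abs_ge_self] by (simp add: norm_mult mult.left_commute[of "norm (u z)"] mult.commute[of "\<bar>B\<bar>"] mult_left_mono)
  thus "ennreal (norm (?G z w)) <= ennreal (norm (\<kappa> w)) * (ennreal \<bar>B\<bar> * ennreal (norm (u z)))"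
   by (simp add: ennreal_leI flip: ennreal_mult)
 qed
 also have "... = (NN w. ennreal (norm (\<kappa> w))) * (ennreal \<bar>B\<bar> * (NN z. ennreal (norm (u z))))"
  by (simp add: nn_integral_cmult nn_integral_multc)
 also have "... < \<infinity>" using \<kappa> u by (simp add: integrable_iff_bounded ennreal_mult_less_top)
 finally have fin: "(NN w. \<integral>\<^sup>+z. ennreal (norm (?G z w)) \<partial>lborel) < \<infinity>" .
 have int: "integrable (lborel \<Otimes>\<^sub>M lborel) (case_prod ?F)" "integrable (lborel \<Otimes>\<^sub>M lborel) (case_prod ?G)"
  by (rule integrableI_bounded; (subst nn)?; use fin in "(simp only: tr)?, measurable?")+
 have "(LINT z|lborel. (LINT w|lborel. \<kappa> w * u (z - a w)) * g z) = (LINT z|lborel. LINT w|lborel. ?F z w)" by simp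
 also have "... = (LINT w|lborel. LINT z|lborel. ?F z w)" by (rule lborel_pair.Fubini_integral[OF int(1), symmetric])
 also have "... = (LINT z|lborel. LINT w|lborel. ?G z w)" unfolding tr by (rule lborel_pair.Fubini_integral[OF int(2)])
 finally show ?thesis by simp
qed

subsection \<open>Powers of the norm\<close>

lemma nn_integral_finite_dyadic:
 fixes f :: "'a::euclidean_space => real"
 assumes f: "!!x. f x ~= 0 ==> EX k. norm x <= r k & f x <= B k"
  and nonneg: "!!k::nat. 0 <= r k" "!!k. 0 <= B k"
  and sum: "summable (%k. B k * r k ^ DIM('a))"
 shows "(NN x. ennreal (f x)) < \<infinity>"
proof -
 let ?V = "unit_ball_vol (real DIM('a))"
 have "(NN x. ennreal (f x)) <= (NN (x::'a). suminf (%k. ennreal (B k) * indicator (cball 0 (r k)) x))"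
 proof (rule nn_integral_mono)
  fix x
  show "ennreal (f x) <= suminf (%k. ennreal (B k) * indicator (cball 0 (r k)) x)"
  proof (cases "f x = 0")
   case False
   then obtain k where k: "norm x <= r k" "f x <= B k" using f by blast
   let ?g = "%k. ennreal (B k) * indicator (cball 0 (r k)) x"
   have "ennreal (f x) <= sum ?g {k}" using k by (simp add: ennreal_leI)
   also have "... <= suminf (%k. ennreal (B k) * indicator (cball 0 (r k)) x)"
    by (rule sum_le_suminf) auto
   finally show ?thesis .
  qed auto
 qed
 also have "... = suminf (%k. ennreal (B k) * emeasure lborel (cball (0::'a) (r k)))"
  by (subst nn_integral_suminf) (simp_all add: nn_integral_cmult_indicator)
 also have "... = suminf (%k. ennreal (?V * (B k * r k ^ DIM('a))))"
  using nonneg by (simp add: emeasure_cball ennreal_mult'[symmetric] mult_ac)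
 also have "... < \<infinity>"
  using summable_mult[OF sum, of ?V] nonneg
  by (subst suminf_ennreal2) auto
 finally show ?thesis .
qed

text \<open>Scaling by 1/2 compares the integral over a ball with that over the ball of half the radius.
  Applied to the truncations \<open>min N (|x|\<^sup>-\<^sup>c)\<close> this gives a bound that does not depend on \<open>N\<close>.\<close>

lemma nn_integral_norm_powr_finite:
 fixes c R :: real
 assumes c: "c < DIM('a)"
 shows "(NN (x::'a::euclidean_space). ennreal (norm x powr (- c)) * indicator (cball 0 R) x) < \<infinity>"
proof (cases "c >= 0 & R > 0")
 case True
 define r where "r k = R / 2 ^ k" for k :: nat
 define B where "B k = r (Suc k) powr (- c)" for k
 have rpos: "r k > 0" for k using True by (simp add: r_def)
 have eq: "ennreal (norm x powr (- c)) * indicator (cball 0 R) x = ennreal (norm x powr (- c) * indicator (cball 0 R) x)" for x :: 'a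
  by (simp add: indicator_def)
 show ?thesis
 proof (subst eq, rule nn_integral_finite_dyadic[where r = r and B = B])
  fix x :: 'a assume "norm x powr (- c) * indicator (cball 0 R) x ~= 0"
  hence x: "x ~= 0" "norm x <= R" by (auto simp: indicator_def split: if_splits)
  have "(%k. R / 2 ^ k) \<longlonglongrightarrow> 0" by real_asymp
  hence "eventually (%k. R / 2 ^ k < norm x) sequentially"
   using x(1) by (intro order_tendstoD(2)) auto
  hence ex: "EX k. r (Suc k) < norm x" unfolding eventually_sequentially r_def by (meson le_SucI order_refl)
  define k where "k = (LEAST k. r (Suc k) < norm x)"
  have 1: "r (Suc k) < norm x" unfolding k_def using ex by (rule LeastI_ex)
  have 2: "norm x <= r k"
  proof (cases k)
   case 0 thus ?thesis using x by (simp add: r_def)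
  next
   case (Suc j)
   hence "~ r (Suc j) < norm x" using not_less_Least[of j "%k. r (Suc k) < norm x"] by (simp add: k_def)
   thus ?thesis using Suc by simp
  qed
  have "norm x powr (- c) <= B k" unfolding B_def
   using 1 True rpos[of "Suc k"] by (intro powr_mono2') auto
  thus "EX k. norm x <= r k & norm x powr (- c) * indicator (cball 0 R) x <= B k"
   using 2 x by (intro exI[of _ k]) auto
 next
  have "B k * r k ^ DIM('a) = (2 powr c * R powr (DIM('a) - c)) * (2 powr (c - DIM('a))) ^ k" for k
  proof -
   have "r k ^ DIM('a) = r k powr (real DIM('a))" using rpos by (simp add: powr_realpow)
   have Bk: "B k = (r k / 2) powr (- c)" by (simp add: B_def r_def mult.commute)
   have "(r k / 2) powr (- c) = 2 powr c * r k powr (- c)"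
    using rpos[of k] by (simp add: powr_divide powr_minus field_simps)
   with \<open>r k ^ DIM('a) = r k powr (real DIM('a))\<close> have "B k * r k ^ DIM('a) = 2 powr c * r k powr (DIM('a) - c)"
    using powr_add[of "r k" "- c" "real DIM('a)"] by (simp add: Bk mult.assoc)
   moreover have "r k = R * 2 powr (- real k)" by (simp add: r_def powr_minus powr_realpow divide_inverse)
   moreover have "(R * 2 powr (- real k)) powr (DIM('a) - c) = R powr (DIM('a) - c) * (2 powr (c - DIM('a))) powr (real k)"
    using True by (simp add: powr_mult powr_powr algebra_simps)
   moreover have "((2::real) powr (c - DIM('a))) powr (real k) = (2 powr (c - DIM('a))) ^ k"
    by (rule powr_realpow) simp
   ultimately show ?thesis by (metis mult.assoc)
  qed
  moreover have "norm ((2::real) powr (c - DIM('a))) < 1"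
   using powr_less_mono[of "c - DIM('a)" 0 2] c by simp
  ultimately show "summable (%k. B k * r k ^ DIM('a))"
   by (simp add: summable_mult summable_geometric)
 qed (use rpos in "auto simp: B_def less_imp_le")
next
 case False
 then consider "R <= 0" | "c < 0" "R > 0" by linarith
 thus ?thesis
 proof cases
  case 1
  have "ennreal (norm x powr (- c)) * indicator (cball 0 R) x = 0" for x :: 'a
  proof (cases "x = 0")
   case False
   hence "x ~: cball 0 R" using 1 by (metis dual_order.trans mem_cball_0 norm_le_zero_iff)
   thus ?thesis by simp
  qed simp
  thus ?thesis by (simp only: nn_integral_0_iff_AE) simp
 next
  case 2
  have "(NN (x::'a). ennreal (norm x powr (- c)) * indicator (cball 0 R) x)
   <= (NN (x::'a). ennreal (R powr (-c)) * indicator (cball 0 R) x)"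
  proof (rule nn_integral_mono)
   fix x :: 'a
   show "ennreal (norm x powr (- c)) * indicator (cball 0 R) x <= ennreal (R powr (- c)) * indicator (cball 0 R) x"
    using 2 by (cases "x : cball 0 R") (auto intro!: ennreal_leI powr_mono2)
  qed
  also have "... = ennreal (R powr (-c)) * emeasure lborel (cball (0::'a) R)" by (simp add: nn_integral_cmult_indicator)
  also have "... < \<infinity>" by (simp add: ennreal_mult_less_top emeasure_lborel_cball_finite[unfolded infinity_ennreal_def])
  finally show ?thesis .
 qed
qed

lemma nn_integral_norm_powr_infinite:
 fixes c R :: real
 assumes c: "c >= DIM('a)" and R: "R > 0"
 shows "(NN (x::'a::euclidean_space). ennreal (norm x powr (- c)) * indicator (cball 0 R) x) = \<infinity>"
proof (rule ccontr)
 let ?f = "%x::'a. ennreal (norm x powr (- c)) * indicator (cball 0 R) x"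
 assume "~ ?thesis"
 hence fin: "(NN x. ?f x) < \<infinity>" by (simp add: less_top)
 have mf [measurable]: "?f : borel_measurable lborel" by measurable
 let ?M = "density lborel ?f"
 define A where "A n = cball (0::'a) (min R 1 / real (Suc n))" for n
 let ?V = "unit_ball_vol (real DIM('a))"
 have r: "0 < min R 1 / real (Suc n)" "min R 1 / real (Suc n) <= R" "min R 1 / real (Suc n) <= 1" for n
 proof -
  have "min R 1 / real (Suc n) <= min R 1 / 1" using R by (intro divide_left_mono) auto
  thus "0 < min R 1 / real (Suc n)" "min R 1 / real (Suc n) <= R" "min R 1 / real (Suc n) <= 1" using R by auto
 qed
 have "(%n. emeasure ?M (A n)) \<longlonglongrightarrow> emeasure ?M (\<Inter>n. A n)"
 proof (rule Lim_emeasure_decseq)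
  show "decseq A" unfolding A_def decseq_def using R by (auto intro!: subset_cball divide_left_mono)
  show "emeasure ?M (A n) ~= \<infinity>" for n
  proof -
   have "emeasure ?M (A n) <= emeasure ?M (space ?M)" by (rule emeasure_space)
   also have "... = (NN x. ?f x)" by (subst emeasure_density[OF mf]) auto
   finally show ?thesis using fin by auto
  qed
 qed (auto simp: A_def)
 moreover have "(\<Inter>n. A n) = {0}"
 proof -
  have "x = 0" if "x : (\<Inter>n. A n)" for x
  proof -
   have le: "norm x <= min R 1 / real (Suc n)" for n using that by (auto simp: A_def)
   have "(%n. min R 1 / real (Suc n)) \<longlonglongrightarrow> 0"
    using tendsto_mult_right_zero[OF LIMSEQ_inverse_real_of_nat, of "min R 1"] by (simp add: divide_inverse)
   hence "norm x <= 0" by (rule LIMSEQ_le_const) (use le in auto)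
   thus ?thesis by simp
  qed
  thus ?thesis using r(1) by (auto simp: A_def less_imp_le)
 qed
 moreover have "emeasure ?M {0} = 0"
  by (subst emeasure_density[OF mf]) (auto intro!: nn_integral_null_set simp: null_sets_def)
 moreover have "ennreal ?V <= emeasure ?M (A n)" for n
 proof -
  let ?r = "min R 1 / real (Suc n)"
  have "ennreal ?V <= ennreal (?r powr (- c)) * emeasure lborel (A n)"
  proof -
   have "1 <= ?r powr (DIM('a) - c)" using powr_mono'[of "DIM('a) - c" 0 ?r] r[of n] c by (simp split: if_splits)
   also have "... = ?r powr (- c) * ?r ^ DIM('a)" using r(1)[of n] by (simp add: powr_diff powr_minus field_simps powr_realpow)
   finally have "?V <= ?r powr (- c) * (?V * ?r ^ DIM('a))"
    using mult_left_mono[of 1 "?r powr (- c) * ?r ^ DIM('a)" ?V] by (simp add: mult_ac)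
   thus ?thesis using r(1)[of n] unfolding A_def
    by (subst emeasure_cball) (auto simp: ennreal_mult'[symmetric] ennreal_leI)
  qed
  also have "... = (NN x. ennreal (?r powr (- c)) * indicator (A n - {0}) x)"
   using emeasure_Diff_null_set[of "{0::'a}" lborel "A n"]
   by (subst nn_integral_cmult_indicator) (auto simp: A_def null_sets_def)
  also have "... <= (NN x. ?f x * indicator (A n) x)"
  proof (rule nn_integral_mono)
   fix x :: 'a
   show "ennreal (?r powr (- c)) * indicator (A n - {0}) x <= ?f x * indicator (A n) x"
    using r(2)[of n] c by (auto simp: indicator_def A_def intro!: ennreal_leI powr_mono2')
  qed
  also have "... = emeasure ?M (A n)" by (subst emeasure_density[OF mf]) (auto simp: A_def)
  finally show ?thesis .
 qed
 ultimately have lim0: "(%n. emeasure ?M (A n)) \<longlonglongrightarrow> 0" and le: "!!n. ennreal ?V <= emeasure ?M (A n)" by simp_all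
 have "ennreal ?V <= 0" by (rule LIMSEQ_le_const[OF lim0]) (use le in auto)
 moreover have "?V > 0" by simp
 ultimately show False by (simp add: ennreal_eq_0_iff)
qed

section \<open>The Cauchy transform in one variable\<close>

lemma wirtinger_bar_eq:
 "(f has_derivative D) (at z) ==> wirtinger_bar j f z = (D (axis j 1) + \<i> * D (axis j \<i>)) / 2"
 by (simp add: wirtinger_bar_def frechet_derivative_eq)

lemma wirtinger_bar_mult:
 assumes "(f has_derivative Df) (at z)" "(g has_derivative Dg) (at z)"
 shows "wirtinger_bar j (%z. f z * g z) z = wirtinger_bar j f z * g z + f z * wirtinger_bar j g z"
 unfolding wirtinger_bar_eq[OF has_derivative_mult[OF assms]] wirtinger_bar_eq[OF assms(1)] wirtinger_bar_eq[OF assms(2)]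
 by (simp add: field_simps)

lemma smooth_wirtinger_bar:
 fixes \<phi> :: "complex^'n::finite => complex"
 assumes "smooth \<phi>" shows "smooth (wirtinger_bar j \<phi>)"
proof -
 have "smooth (%z. (1/2) * (dir_deriv \<phi> (axis j 1) z + \<i> * dir_deriv \<phi> (axis j \<i>) z))"
  by (intro smooth_mult smooth_add smooth_const smooth_dir_deriv assms)
 thus ?thesis by (simp add: wirtinger_bar_def[abs_def])
qed

lemma wirtinger_bar_outside_support:
 assumes "!!x. x ~: K ==> f x = 0" "closed K" "x ~: K"
 shows "wirtinger_bar j f x = 0"
 by (simp add: wirtinger_bar_def dir_deriv_outside_support[OF assms])

lemma wirtinger_bar_cong_open:
 assumes "open N" "z : N" "!!y. y : N ==> f y = g y" "(g has_derivative D) (at z)"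
 shows "wirtinger_bar j f z = wirtinger_bar j g z"
proof -
 have "(f has_derivative D) (at z)"
  by (rule has_derivative_transform_within_open[OF assms(4,1,2)]) (use assms(3) in auto)
 thus ?thesis using assms(4) by (simp add: wirtinger_bar_eq)
qed

lemma integral_wirtinger_bar_eq_0:
 fixes F :: "complex^'n::finite => complex"
 assumes F: "smooth F" "!!x. norm x > R ==> F x = 0"
 shows "integrable lborel (wirtinger_bar j F)" "(LINT z|lborel. wirtinger_bar j F z) = 0"
proof -
 obtain B where B: "!!x v. norm (dir_deriv F v x) <= B * norm v"
  using C_1_dir_deriv_bounded[OF smoothD[OF F(1)] F(2)] by blast
 have 1: "integrable lborel (dir_deriv F v)" "(LINT x|lborel. dir_deriv F v x) = 0" for v
  using integral_directional_derivative_eq_0[of F "%x. frechet_derivative F (at x)" R v "B * norm v",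
    OF smooth_has_derivative[OF F(1)] F(2) B] by auto
 show "integrable lborel (wirtinger_bar j F)" "(LINT z|lborel. wirtinger_bar j F z) = 0"
  unfolding wirtinger_bar_def[abs_def] using 1 by auto
qed

text \<open>The Bochner-Martinelli kernel, up to a constant factor. In dimension one it is \<open>1 / w\<close>.\<close>

definition bm_kernel :: "complex^'m::finite => 'm => complex" where
 "bm_kernel w j = cnj (w $ j) / complex_of_real (norm w ^ (2 * CARD('m)))"

definition bm_const :: "'m::finite itself => real" where
 "bm_const _ = (LINT v|(lborel :: (complex^'m) measure). real CARD('m) * inverse (1 + v \<bullet> v) ^ Suc CARD('m))"

lemma norm_bm_kernel_le: "norm (bm_kernel w j) <= norm w powr (- (2 * real CARD('m) - 1))"
 for w :: "complex^'m::finite"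
proof (cases "w = 0")
 case False
 have "norm (bm_kernel w j) <= norm w / norm w ^ (2 * CARD('m))"
  unfolding bm_kernel_def norm_divide using Finite_Cartesian_Product.norm_nth_le[of w j]
  by (auto intro!: divide_right_mono simp: norm_power)
 also have "... = norm w powr (- (2 * real CARD('m) - 1))"
  using False by (simp add: powr_minus powr_diff powr_realpow[symmetric] divide_inverse)
 finally show ?thesis .
qed (simp add: bm_kernel_def)

lemma bm_kernel_measurable [measurable]: "(%w. bm_kernel w j) : borel_measurable borel"
proof -
 have [measurable]: "(%w::complex^'a. w $ j) : borel_measurable borel"
  by (intro borel_measurable_continuous_onI continuous_intros)
 have [measurable]: "cnj : borel_measurable borel"
  by (intro borel_measurable_continuous_onI continuous_intros)
 show ?thesis unfolding bm_kernel_def by measurable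
qed

lemma bm_kernel_uminus: "bm_kernel (- w) j = - bm_kernel w j"
 by (simp add: bm_kernel_def)

lemma bm_kernel_integrable: "integrable lborel (%w. indicator (cball 0 R) w * bm_kernel w j)"
 for j :: "'m::finite"
proof (rule integrableI_bounded)
 have "(NN (w::complex^'m). ennreal (norm (indicator (cball 0 R) w * bm_kernel w j)))
   <= (NN (w::complex^'m). ennreal (norm w powr (- (2 * real CARD('m) - 1))) * indicator (cball 0 R) w)"
  by (intro nn_integral_mono) (use norm_bm_kernel_le in "auto simp: indicator_def intro!: ennreal_leI")
 also have "... < \<infinity>" by (rule nn_integral_norm_powr_finite) simp
 finally show "(NN (w::complex^'m). ennreal (norm (indicator (cball 0 R) w * bm_kernel w j))) < \<infinity>" .
qed measurable

lemma bm_weight_integrable: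
 "integrable lborel (%v::complex^'m::finite. real CARD('m) * inverse (1 + v \<bullet> v) ^ Suc CARD('m) :: real)"
proof (rule integrable_mult_right, rule integrableI_bounded)
 let ?n = "CARD('m)"
 let ?f = "%v::complex^'m. inverse (1 + v \<bullet> v) ^ Suc ?n"
 have pos: "0 < 1 + v \<bullet> v" for v :: "complex^'m" by (simp add: add_pos_nonneg)
 define B :: "nat => real" where "B k = 4 ^ Suc ?n * (1/4) ^ (k * Suc ?n)" for k
 have "(NN v. ennreal (?f v)) < \<infinity>"
 proof (rule nn_integral_finite_dyadic[where r = "%k. 2 ^ k" and B = B])
  fix v :: "complex^'m"
  have ex: "EX k. norm v <= 2 ^ k" using real_arch_pow[of 2 "norm v"] less_imp_le by auto
  define k where "k = (LEAST k. norm v <= 2 ^ k)"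
  have 1: "norm v <= 2 ^ k" unfolding k_def using ex by (rule LeastI_ex)
  have q: "1/4 * 4 ^ k <= 1 + v \<bullet> v"
  proof (cases k)
   case (Suc i)
   hence "~ norm v <= 2 ^ i" using not_less_Least[of i "%k. norm v <= 2 ^ k"] by (simp add: k_def)
   hence "(2 ^ i)\<^sup>2 <= (norm v)\<^sup>2" by (intro power_mono) auto
   thus ?thesis using Suc by (simp add: power2_norm_eq_inner flip: power_mult power_mult_distrib)
     (simp add: power_mult mult.commute[of i 2])
  qed simp
  hence "inverse (1 + v \<bullet> v) <= inverse (1/4 * 4 ^ k)" by (intro le_imp_inverse_le) auto
  hence "?f v <= inverse (1/4 * 4 ^ k) ^ Suc ?n" using pos[of v] by (intro power_mono) auto
  also have "... = B k" by (simp add: B_def power_mult_distrib power_mult inverse_eq_divide power_one_over flip: power_Suc)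
    (simp add: power_divide power_mult[symmetric] mult.commute flip: power_Suc)
  finally show "EX k. norm v <= 2 ^ k & ?f v <= B k" using 1 by blast
 next
  have "B k * (2 ^ k) ^ DIM(complex^'m) = 4 ^ Suc ?n * (1/4) ^ k" for k
  proof -
   have "((2::real) ^ k) ^ DIM(complex^'m) = 4 ^ (k * ?n)"
   proof -
    have "((2::real) ^ k) ^ DIM(complex^'m) = (2\<^sup>2) ^ (k * ?n)"
     unfolding power_mult[symmetric] by (simp add: mult_ac)
    thus ?thesis by simp
   qed
   moreover have "((1/4)::real) ^ (k * Suc ?n) * 4 ^ (k * ?n) = (1/4) ^ k"
    by (simp add: power_add power_one_over)
   ultimately show ?thesis by (simp add: B_def mult.assoc)
  qed
  thus "summable (%k. B k * (2 ^ k) ^ DIM(complex^'m))"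
   by (simp add: summable_mult summable_geometric)
 qed (auto simp: B_def)
 thus "(NN v. ennreal (norm (?f v))) < \<infinity>"
  using pos by (simp add: norm_power less_imp_le abs_of_pos)
 have "continuous_on UNIV ?f" using pos by (intro continuous_intros) (auto simp: less_le)
 thus "?f : borel_measurable lborel" by (simp add: borel_measurable_continuous_onI)
qed

lemma bm_const_pos: "bm_const TYPE('m::finite) > 0"
proof -
 let ?f = "%v::complex^'m. real CARD('m) * inverse (1 + v \<bullet> v) ^ Suc CARD('m) :: real"
 have pos: "?f v > 0" for v
  by (intro mult_pos_pos zero_less_power) (auto simp: add_pos_nonneg)
 have "bm_const TYPE('m) >= 0" unfolding bm_const_def using pos by (intro Bochner_Integration.integral_nonneg) (simp add: less_imp_le)
 moreover have "bm_const TYPE('m) ~= 0"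
 proof
  assume "bm_const TYPE('m) = 0"
  hence "AE v in lborel. ?f v = 0"
   unfolding bm_const_def using integral_nonneg_eq_0_iff_AE[OF bm_weight_integrable[where 'm = 'm]] pos
   by (simp add: less_imp_le del: mult_eq_0_iff power_Suc)
  moreover have "?f v = 0 \<longleftrightarrow> False" for v by (metis pos less_irrefl)
  ultimately have "AE v in (lborel :: (complex^'m) measure). False" by simp
  thus False by (simp add: eventually_False ae_filter_eq_bot_iff)
 qed
 ultimately show ?thesis by simp
qed

text \<open>The kernels \<open>cnj (w j) / (|w|\<^sup>2 + e\<^sup>2)\<^sup>n\<close> are smooth, and the sum of their derivatives with
  respect to the conjugate variables is \<open>n e\<^sup>2 / (|w|\<^sup>2 + e\<^sup>2)\<^sup>n\<^sup>+\<^sup>1\<close>, an approximate identity. Letting e tend to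
  0 gives the formula without any boundary integral.\<close>

theorem Bochner_Martinelli:
 fixes \<phi> :: "complex^'m::finite => complex"
 assumes \<phi>: "smooth \<phi>" "!!x. norm x > R ==> \<phi> x = 0"
 shows "(LINT w|lborel. (\<Sum>j\<in>UNIV. wirtinger_bar j \<phi> w * bm_kernel w j)) = - of_real (bm_const TYPE('m)) * \<phi> 0"
proof -
 let ?n = "CARD('m)"
 define q where "q e w = complex_of_real (w \<bullet> w + e\<^sup>2)" for e and w :: "complex^'m"
 define G where "G e w = inverse (q e w) ^ ?n" for e w
 define k where "k e j w = cnj (w $ j) * G e w" for e j w
 have qnz: "q e w ~= 0" if "e > 0" for e w
 proof -
  have "w \<bullet> w + e\<^sup>2 > 0" using that by (simp add: add_nonneg_pos)
  thus ?thesis unfolding q_def by (metis less_irrefl of_real_eq_0_iff)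
 qed
 have qD: "(q e has_derivative (%v. of_real (2 * (w \<bullet> v)))) (at w)" for e w
  unfolding q_def by (auto intro!: derivative_eq_intros simp: inner_commute)
 have cD: "((%w. cnj (w $ j)) has_derivative (%v. cnj (v $ j))) (at w)" for j and w :: "complex^'m"
  by (rule bounded_linear_imp_has_derivative) (intro bounded_linear_compose[OF bounded_linear_cnj] bounded_linear_vec_nth)
 have q_smooth: "smooth (q e)" for e
 proof -
  have "smooth (%w::complex^'m. complex_of_real ((w - 0) \<bullet> (w - 0) + e\<^sup>2))"
   by (intro smooth_of_real smooth_add smooth_norm_squared smooth_const)
  thus ?thesis by (simp add: q_def[abs_def])
 qed
 have G_smooth: "smooth (G e)" if "e > 0" for e
  unfolding G_def[abs_def] by (intro smooth_power smooth_inverse q_smooth qnz that)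
 have c_smooth: "smooth (%w::complex^'m. cnj (w $ j))" for j
  by (intro smooth_linear bounded_linear_compose[OF bounded_linear_cnj] bounded_linear_vec_nth)
 have k_smooth: "smooth (k e j)" if "e > 0" for e j
  unfolding k_def[abs_def] by (intro smooth_mult c_smooth G_smooth that)
 have wG: "wirtinger_bar j (G e) w = - of_nat ?n * inverse (q e w) ^ Suc ?n * w $ j" if e: "e > 0" for e j w
 proof -
  obtain m where m: "?n = Suc m" by (metis card_gt_0_iff finite UNIV_not_empty gr0_implies_Suc)
  have "(G e has_derivative (%v. of_nat ?n * (- (inverse (q e w) * of_real (2 * (w \<bullet> v)) * inverse (q e w))) * inverse (q e w) ^ (?n - 1))) (at w)"
   unfolding G_def[abs_def]
   by (rule has_derivative_power[OF Deriv.has_derivative_inverse[OF qnz[OF e] qD]])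
  note D = this
  define A where "A = - of_nat ?n * inverse (q e w) * inverse (q e w) * inverse (q e w) ^ (?n - 1)"
  have "wirtinger_bar j (G e) w = A * (complex_of_real (w \<bullet> axis j 1) + \<i> * complex_of_real (w \<bullet> axis j \<i>))"
  proof -
   have "(%v. of_nat ?n * (- (inverse (q e w) * of_real (2 * (w \<bullet> v)) * inverse (q e w))) * inverse (q e w) ^ (?n - 1))
     = (%v. 2 * (A * of_real (w \<bullet> v)))"
    by (auto simp: A_def mult_ac)
   from wirtinger_bar_eq[OF D[unfolded this], of j] show ?thesis
    by (simp add: add_divide_distrib distrib_left mult.left_commute[of \<i>])
  qed
  also have "complex_of_real (w \<bullet> axis j 1) + \<i> * complex_of_real (w \<bullet> axis j \<i>) = w $ j"
   by (simp add: inner_axis inner_complex_def complex_eq_iff)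
  finally show ?thesis by (simp add: A_def m mult_ac)
 qed
 have wc: "wirtinger_bar j (%w. cnj (w $ j)) w = 1" for j and w :: "complex^'m"
  by (subst wirtinger_bar_eq[OF cD]) (simp add: axis_def)
 have wk: "wirtinger_bar j (k e j) w = G e w - of_nat ?n * inverse (q e w) ^ Suc ?n * (cnj (w $ j) * w $ j)"
  if e: "e > 0" for e j w
  unfolding k_def using wirtinger_bar_mult[OF cD smooth_has_derivative[OF G_smooth[OF e]], where j = j]
  by (simp add: wc wG[OF e] algebra_simps)
 have wk_sum: "(\<Sum>j\<in>UNIV. wirtinger_bar j (k e j) w) = of_nat ?n * of_real (e\<^sup>2) * inverse (q e w) ^ Suc ?n"
  if e: "e > 0" for e w
 proof -
  have "(\<Sum>j\<in>UNIV. cnj (w $ j) * w $ j) = of_real (w \<bullet> w)"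
   by (simp add: inner_vec_def complex_norm_square[symmetric] power2_norm_eq_inner[symmetric] mult.commute)
  hence "(\<Sum>j\<in>UNIV. wirtinger_bar j (k e j) w) = of_nat ?n * G e w - of_nat ?n * inverse (q e w) ^ Suc ?n * of_real (w \<bullet> w)"
   by (simp add: wk[OF e] sum_subtractf flip: sum_distrib_left)
  also have "G e w = inverse (q e w) ^ Suc ?n * q e w" using qnz[OF e, of w] by (simp add: G_def)
  also have "of_nat ?n * (inverse (q e w) ^ Suc ?n * q e w) - of_nat ?n * inverse (q e w) ^ Suc ?n * of_real (w \<bullet> w)
    = of_nat ?n * of_real (e\<^sup>2) * inverse (q e w) ^ Suc ?n"
   by (subst (2) q_def) (simp add: algebra_simps)
  finally show ?thesis .
 qed
 obtain B where B: "B > 0" "!!x. norm (\<phi> x) <= B"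
  using bounded_continuous_support[OF smooth_continuous[OF \<phi>(1)] \<phi>(2)] by blast
 have out: "wirtinger_bar j \<phi> x = 0" if "norm x > R" for j x
  by (rule wirtinger_bar_outside_support[of "cball 0 R"]) (use \<phi>(2) that in auto)
 have "EX B>0. ALL x. norm (wirtinger_bar j \<phi> x) <= B" for j
  using bounded_continuous_support[OF smooth_continuous[OF smooth_wirtinger_bar[OF \<phi>(1)]] out] by metis
 then obtain B' where B': "!!j. B' j > 0" "!!j x. norm (wirtinger_bar j \<phi> x) <= B' j" by metis
 have id: "(LINT w|lborel. (\<Sum>j\<in>UNIV. wirtinger_bar j \<phi> w * k e j w))
   = - (LINT w|lborel. \<phi> w * (of_nat ?n * of_real (e\<^sup>2) * inverse (q e w) ^ Suc ?n))" if e: "e > 0" for e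
 proof -
  have sm: "smooth (%w. \<phi> w * k e j w)" for j by (intro smooth_mult \<phi>(1) k_smooth e)
  have 0: "integrable lborel (wirtinger_bar j (%w. \<phi> w * k e j w))"
    "(LINT w|lborel. wirtinger_bar j (%w. \<phi> w * k e j w) w) = 0" for j
   using integral_wirtinger_bar_eq_0[OF sm, of R j] \<phi>(2) by auto
  have i1: "integrable lborel (%w. wirtinger_bar j \<phi> w * k e j w)" for j
   by (rule integrable_continuous_support[where R = R])
     (use out in \<open>auto intro!: smooth_continuous smooth_mult smooth_wirtinger_bar \<phi>(1) k_smooth[OF e]\<close>)
  have "continuous_on UNIV (%w. \<phi> w * (of_nat ?n * of_real (e\<^sup>2) * inverse (q e w) ^ Suc ?n))"
   using qnz[OF e] by (intro continuous_intros smooth_continuous[OF \<phi>(1)] smooth_continuous[OF q_smooth]) auto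
  hence i2: "integrable lborel (%w. \<phi> w * (of_nat ?n * of_real (e\<^sup>2) * inverse (q e w) ^ Suc ?n))"
   by (rule integrable_continuous_support[where R = R]) (use \<phi>(2) in auto)
  have "0 = (LINT w|lborel. (\<Sum>j\<in>UNIV. wirtinger_bar j (%w. \<phi> w * k e j w) w))" using 0 by simp
  also have "... = (LINT w|lborel. (\<Sum>j\<in>UNIV. wirtinger_bar j \<phi> w * k e j w) + \<phi> w * (\<Sum>j\<in>UNIV. wirtinger_bar j (k e j) w))"
   by (simp add: wirtinger_bar_mult[OF smooth_has_derivative[OF \<phi>(1)] smooth_has_derivative[OF k_smooth[OF e]]]
     sum.distrib sum_distrib_left)
  also have "... = (LINT w|lborel. (\<Sum>j\<in>UNIV. wirtinger_bar j \<phi> w * k e j w))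
    + (LINT w|lborel. \<phi> w * (of_nat ?n * of_real (e\<^sup>2) * inverse (q e w) ^ Suc ?n))"
   unfolding wk_sum[OF e] using i1 i2 by (intro Bochner_Integration.integral_add) auto
  finally show ?thesis by (simp add: eq_neg_iff_add_eq_0)
 qed
 define h where "h i = inverse (real (Suc i))" for i
 have h: "h i > 0" for i by (simp add: h_def)
 have h0: "h \<longlonglongrightarrow> 0" unfolding h_def by (rule LIMSEQ_inverse_real_of_nat)
 have k_le: "norm (k e j w) <= norm (bm_kernel w j)" for e j w
 proof (cases "w = 0")
  case False
  have "norm (G e w) = inverse (w \<bullet> w + e\<^sup>2) ^ ?n" by (simp add: G_def q_def norm_power norm_inverse abs_of_nonneg add_nonneg_nonneg del: of_real_add of_real_power)
  also have "... <= inverse (w \<bullet> w) ^ ?n" using False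
   by (intro power_mono le_imp_inverse_le) auto
  also have "... = inverse (norm w ^ (2 * ?n))" by (simp add: power_mult power2_norm_eq_inner power_inverse)
  finally show ?thesis
   by (simp add: k_def bm_kernel_def norm_mult norm_divide norm_power norm_inverse divide_inverse mult_left_mono)
 qed (simp add: k_def)
 have lim1: "(%i. LINT w|lborel. (\<Sum>j\<in>UNIV. wirtinger_bar j \<phi> w * k (h i) j w)) \<longlonglongrightarrow>
   (LINT w|lborel. (\<Sum>j\<in>UNIV. wirtinger_bar j \<phi> w * bm_kernel w j))"
 proof (rule integral_dominated_convergence[where w = "%w. \<Sum>j\<in>UNIV. B' j * norm (indicator (cball 0 R) w * bm_kernel w j)"])
  have [measurable]: "wirtinger_bar j \<phi> : borel_measurable borel" for j
   by (intro borel_measurable_continuous_onI smooth_continuous smooth_wirtinger_bar \<phi>(1))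
  have [measurable]: "k (h i) j : borel_measurable borel" for i j
   by (intro borel_measurable_continuous_onI smooth_continuous k_smooth h)
  show "(%w. \<Sum>j\<in>UNIV. wirtinger_bar j \<phi> w * bm_kernel w j) : borel_measurable lborel" by measurable
  show "(%w. \<Sum>j\<in>UNIV. wirtinger_bar j \<phi> w * k (h i) j w) : borel_measurable lborel" for i by measurable
  show "integrable lborel (%w. \<Sum>j\<in>UNIV. B' j * norm (indicator (cball 0 R) w * bm_kernel w j))"
   by (intro Bochner_Integration.integrable_sum integrable_mult_right integrable_norm bm_kernel_integrable)
  show "AE w in lborel. (%i. \<Sum>j\<in>UNIV. wirtinger_bar j \<phi> w * k (h i) j w) \<longlonglongrightarrow> (\<Sum>j\<in>UNIV. wirtinger_bar j \<phi> w * bm_kernel w j)"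
  proof (intro AE_I2 tendsto_sum tendsto_mult tendsto_const)
   fix w :: "complex^'m" and j
   show "(%i. k (h i) j w) \<longlonglongrightarrow> bm_kernel w j"
   proof (cases "w = 0")
    case False
    have "(%i. cnj (w $ j) * inverse (complex_of_real (w \<bullet> w + (h i)\<^sup>2)) ^ ?n) \<longlonglongrightarrow>
      cnj (w $ j) * inverse (complex_of_real (w \<bullet> w + 0\<^sup>2)) ^ ?n"
     using False by (intro tendsto_intros h0) auto
    also have "cnj (w $ j) * inverse (complex_of_real (w \<bullet> w + 0\<^sup>2)) ^ ?n = bm_kernel w j"
     by (simp add: bm_kernel_def power_mult power2_norm_eq_inner divide_inverse power_inverse)
    finally show ?thesis by (simp add: k_def G_def q_def)
   qed (simp add: k_def bm_kernel_def)
  qed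
  show "AE w in lborel. norm (\<Sum>j\<in>UNIV. wirtinger_bar j \<phi> w * k (h i) j w) <=
    (\<Sum>j\<in>UNIV. B' j * norm (indicator (cball 0 R) w * bm_kernel w j))" for i
  proof (intro AE_I2 sum_norm_le)
   fix w :: "complex^'m" and j
   show "norm (wirtinger_bar j \<phi> w * k (h i) j w) <= B' j * norm (indicator (cball 0 R) w * bm_kernel w j)"
    using out[of w j] B'[of j] k_le[of "h i" j w]
    by (cases "norm w > R") (auto simp: norm_mult intro!: mult_mono less_imp_le[OF B'(1)])
  qed
 qed
 let ?P = "%v::complex^'m. real ?n * inverse (1 + v \<bullet> v) ^ Suc ?n"
 have scale: "(LINT w|lborel. \<phi> w * (of_nat ?n * of_real (e\<^sup>2) * inverse (q e w) ^ Suc ?n))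
   = (LINT v|lborel. \<phi> (e *\<^sub>R v) * of_real (?P v))" if e: "e > 0" for e
 proof -
  have "continuous_on UNIV (%w. \<phi> w * (of_nat ?n * of_real (e\<^sup>2) * inverse (q e w) ^ Suc ?n))"
   using qnz[OF e] by (intro continuous_intros smooth_continuous[OF \<phi>(1)] smooth_continuous[OF q_smooth]) auto
  hence m: "(%w. \<phi> w * (of_nat ?n * of_real (e\<^sup>2) * inverse (q e w) ^ Suc ?n)) : borel_measurable borel"
   by (rule borel_measurable_continuous_onI)
  have "e ^ DIM(complex^'m) *\<^sub>R (\<phi> (e *\<^sub>R v) * (of_nat ?n * of_real (e\<^sup>2) * inverse (q e (e *\<^sub>R v)) ^ Suc ?n))
    = \<phi> (e *\<^sub>R v) * of_real (?P v)" for v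
  proof -
   have "q e (e *\<^sub>R v) = of_real (e\<^sup>2) * of_real (1 + v \<bullet> v)"
    by (simp add: q_def power2_eq_square algebra_simps)
   hence "inverse (q e (e *\<^sub>R v)) ^ Suc ?n = inverse (of_real (e\<^sup>2)) ^ Suc ?n * of_real (inverse (1 + v \<bullet> v) ^ Suc ?n)"
    by (simp only: inverse_mult_distrib power_mult_distrib of_real_inverse of_real_power)
   moreover have "complex_of_real (e ^ DIM(complex^'m)) * of_real (e\<^sup>2) * inverse (of_real (e\<^sup>2)) ^ Suc ?n = 1"
   proof -
    have "complex_of_real (e ^ DIM(complex^'m)) * of_real (e\<^sup>2) = of_real (e\<^sup>2) ^ Suc ?n"
     by (simp add: power_mult[symmetric] mult.commute flip: of_real_power of_real_mult power_add)
    thus ?thesis using e by (simp add: power_inverse del: power_Suc)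
   qed
   ultimately show ?thesis
    by (simp add: scaleR_conv_of_real mult_ac del: power_Suc of_real_power)
  qed
  thus ?thesis unfolding integral_lborel_scale[OF m e] by (simp flip: integral_scaleR_right)
 qed
 have [measurable]: "\<phi> : borel_measurable borel"
  by (intro borel_measurable_continuous_onI smooth_continuous \<phi>(1))
 have Pint: "integrable lborel ?P" by (rule bm_weight_integrable)
 have Pnn: "?P v >= 0" for v by (simp add: add_nonneg_nonneg)
 have lim2: "(%i. LINT v|lborel. \<phi> (h i *\<^sub>R v) * of_real (?P v)) \<longlonglongrightarrow> (LINT v|lborel. \<phi> 0 * of_real (?P v))"
 proof (rule integral_dominated_convergence[where w = "%v. B * ?P v"])
  have [measurable]: "?P : borel_measurable borel" using Pint by simp
  show "(%v. \<phi> 0 * of_real (?P v)) : borel_measurable lborel" by measurable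
  show "(%v. \<phi> (h i *\<^sub>R v) * of_real (?P v)) : borel_measurable lborel" for i by measurable
  show "integrable lborel (%v. B * ?P v)" using Pint by (rule integrable_mult_right)
  show "AE v in lborel. (%i. \<phi> (h i *\<^sub>R v) * of_real (?P v)) \<longlonglongrightarrow> \<phi> 0 * of_real (?P v)"
  proof (intro AE_I2 tendsto_mult tendsto_const)
   fix v :: "complex^'m"
   have "(%i. h i *\<^sub>R v) \<longlonglongrightarrow> 0 *\<^sub>R v" by (intro tendsto_intros h0)
   thus "(%i. \<phi> (h i *\<^sub>R v)) \<longlonglongrightarrow> \<phi> 0"
    using continuous_on_tendsto_compose[OF smooth_continuous[OF \<phi>(1), of UNIV]] by auto
  qed
  show "AE v in lborel. norm (\<phi> (h i *\<^sub>R v) * of_real (?P v)) <= B * ?P v" for i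
   using B(2) Pnn by (intro AE_I2) (simp only: norm_mult norm_of_real abs_of_nonneg mult_right_mono)
 qed
 have "(%i. - (LINT v|lborel. \<phi> (h i *\<^sub>R v) * of_real (?P v))) \<longlonglongrightarrow>
   (LINT w|lborel. (\<Sum>j\<in>UNIV. wirtinger_bar j \<phi> w * bm_kernel w j))"
  using lim1 unfolding id[OF h] scale[OF h] .
 from LIMSEQ_unique[OF this tendsto_minus[OF lim2]]
 show ?thesis using Pint by (simp add: bm_const_def mult.commute flip: of_real_mult)
qed

text \<open>The Cauchy kernel \<open>1 / (\<pi> w)\<close>. The value \<open>\<pi>\<close> of the constant is not needed.\<close>

definition cauchy_kernel :: "complex^1 => complex" where
 "cauchy_kernel w = bm_kernel w 1 / of_real (bm_const TYPE(1))"

definition cauchy_transform :: "'n => (complex^'n::finite => complex) => complex^'n => complex" where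
 "cauchy_transform k f z = (LINT w|lborel. cauchy_kernel w * f (z - axis k (w $ 1)))"

lemma cauchy_kernel_measurable [measurable]: "cauchy_kernel : borel_measurable borel"
 unfolding cauchy_kernel_def[abs_def] by measurable

lemma norm_axis_complex: "norm (axis k a :: complex^'n::finite) = norm a"
proof -
 have "norm (axis k a :: complex^'n) = L2_set (%i. norm ((axis k a :: complex^'n) $ i)) UNIV" by (simp add: norm_vec_def)
 also have "... = sqrt (\<Sum>i\<in>UNIV. if i = k then (norm a)\<^sup>2 else 0)"
  unfolding L2_set_def by (intro arg_cong[of _ _ sqrt] sum.cong) (auto simp: axis_def)
 finally show ?thesis by simp
qed

lemma bounded_linear_axis_nth: "bounded_linear (%w::complex^1. axis k (w $ 1) :: complex^'n::finite)"
proof (rule bounded_linear_intro[where K = 1])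
 show "norm (axis k (w $ 1) :: complex^'n) <= norm w * 1" for w :: "complex^1"
  by (simp add: norm_axis_complex norm_vector_1)
qed (auto simp: axis_def vec_eq_iff)

lemma axis_nth_measurable [measurable]: "(%w::complex^1. axis k (w $ 1) :: complex^'n::finite) : borel_measurable borel"
 by (intro borel_measurable_continuous_onI linear_continuous_on bounded_linear_axis_nth)

lemma vec_nth_measurable [measurable]: "(%w::complex^'n::finite. w $ j) : borel_measurable borel"
 by (intro borel_measurable_continuous_onI continuous_intros)

lemma cauchy_kernel_uminus: "cauchy_kernel (- w) = - cauchy_kernel w"
 by (simp add: cauchy_kernel_def bm_kernel_uminus)

definition cauchy_bound :: real where "cauchy_bound = inverse (bm_const TYPE(1))"

lemma cauchy_bound_pos: "cauchy_bound > 0"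
 by (simp add: cauchy_bound_def bm_const_pos)

lemma norm_cauchy_kernel_le: "norm (cauchy_kernel w) <= cauchy_bound * norm w powr (- 1)"
proof -
 have "norm (cauchy_kernel w) = cauchy_bound * norm (bm_kernel w 1)"
  using bm_const_pos[where 'm = 1] by (simp add: cauchy_kernel_def cauchy_bound_def norm_divide field_simps)
 also have "... <= cauchy_bound * norm w powr (- 1)"
  using norm_bm_kernel_le[of w 1] cauchy_bound_pos by (intro mult_left_mono) auto
 finally show ?thesis .
qed

lemma cauchy_kernel_integrable: "integrable lborel (%w. indicator (cball 0 R) w * cauchy_kernel w)"
proof -
 have "integrable lborel (%w. indicator (cball 0 R) w * bm_kernel w (1::1) / of_real (bm_const TYPE(1)))"
  by (intro integrable_divide bm_kernel_integrable)
 thus ?thesis by (simp add: cauchy_kernel_def)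
qed

lemma norm_minus_axis: "norm z <= M ==> norm w > M + R ==> norm (z - axis k (w $ 1) :: complex^'n::finite) > R"
 for w :: "complex^1"
 using norm_triangle_ineq2[of "axis k (w $ 1)" z] by (simp add: norm_axis_complex norm_vector_1 norm_minus_commute)

lemma cauchy_transform_truncate:
 assumes "!!x. norm x > R ==> f x = 0" "norm z <= M"
 shows "cauchy_transform k f z = (LINT w|lborel. (indicator (cball 0 (M + R)) w * cauchy_kernel w) * f (z - axis k (w $ 1)))"
 unfolding cauchy_transform_def
proof (rule Bochner_Integration.integral_cong[OF refl])
 fix w :: "complex^1"
 show "cauchy_kernel w * f (z - axis k (w $ 1)) = indicator (cball 0 (M + R)) w * cauchy_kernel w * f (z - axis k (w $ 1))"
  using assms(1)[OF norm_minus_axis[OF assms(2), of R w k]] by (cases "norm w > M + R") auto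
qed

lemma cauchy_transform_has_derivative:
 assumes \<phi>: "smooth \<phi>" "!!x. norm x > R ==> \<phi> x = 0"
 shows "(cauchy_transform k \<phi> has_derivative (%v. cauchy_transform k (dir_deriv \<phi> v) z)) (at z)"
  and "smooth (cauchy_transform k \<phi>)"
proof -
 let ?T = "%M f z. LINT w|lborel. (indicator (cball 0 (M + R)) w * cauchy_kernel w) * f (z - axis k (w $ 1))"
 have am: "(%w::complex^1. axis k (w $ 1) :: complex^'a) : borel_measurable lborel" by simp
 have eq: "cauchy_transform k f y = ?T M f y" if "norm y < M" "!!x. norm x > R ==> f x = 0" for y M f
  by (rule cauchy_transform_truncate) (use that in auto)
 have out: "dir_deriv \<phi> v x = 0" if "norm x > R" for v x
  using dir_deriv_outside_support[of "cball 0 R" \<phi> x] \<phi>(2) that by auto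
 have "(cauchy_transform k \<phi> has_derivative (%v. ?T (norm z + 1) (dir_deriv \<phi> v) z)) (at z)"
  by (rule has_derivative_transform_within_open[OF translate_average_has_derivative[OF cauchy_kernel_integrable am \<phi>],
     where s = "ball 0 (norm z + 1)"]) (use eq[OF _ \<phi>(2)] in auto)
 thus "(cauchy_transform k \<phi> has_derivative (%v. cauchy_transform k (dir_deriv \<phi> v) z)) (at z)"
  by (simp add: eq[OF _ out, of z "norm z + 1"])
 show "smooth (cauchy_transform k \<phi>)"
 proof (rule smooth_local)
  fix x
  show "EX N g. open N & x : N & smooth g & (ALL y:N. cauchy_transform k \<phi> y = g y)"
   by (rule exI[of _ "ball 0 (norm x + 1)"], rule exI[of _ "?T (norm x + 1) \<phi>"])
     (use eq[OF _ \<phi>(2), of _ "norm x + 1"] smooth_translate_average[OF cauchy_kernel_integrable am \<phi>] in auto)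
 qed
qed

lemma integrable_cauchy_kernel_mult:
 fixes z :: "complex^'n::finite"
 assumes "continuous_on UNIV f" "!!x. norm x > R ==> f x = 0"
 shows "integrable lborel (%w. cauchy_kernel w * f (z - axis k (w $ 1)))"
proof -
 obtain B where B: "B > 0" "!!x. norm (f x) <= B" using bounded_continuous_support[OF assms] by blast
 have [measurable]: "f : borel_measurable borel" using assms(1) by (rule borel_measurable_continuous_onI)
 show ?thesis
 proof (rule Bochner_Integration.integrable_bound)
  show "integrable lborel (%w. B * norm (indicator (cball 0 (norm z + R)) w * cauchy_kernel w))"
   by (intro integrable_mult_right integrable_norm cauchy_kernel_integrable)
  show "(%w. cauchy_kernel w * f (z - axis k (w $ 1))) : borel_measurable lborel" by measurable
  show "AE w in lborel. norm (cauchy_kernel w * f (z - axis k (w $ 1))) <= norm (B * norm (indicator (cball 0 (norm z + R)) w * cauchy_kernel w))"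
  proof (rule AE_I2)
   fix w :: "complex^1"
   show "norm (cauchy_kernel w * f (z - axis k (w $ 1))) <= norm (B * norm (indicator (cball 0 (norm z + R)) w * cauchy_kernel w))"
   proof (cases "norm w > norm z + R")
    case True
    thus ?thesis using assms(2)[OF norm_minus_axis[OF order_refl True, of k]] by simp
   next
    case False
    thus ?thesis using B by (simp add: norm_mult mult.commute[of B] mult_left_mono)
   qed
  qed
 qed
qed

lemma wirtinger_bar_cauchy_transform:
 assumes \<phi>: "smooth \<phi>" "!!x. norm x > R ==> \<phi> x = 0"
 shows "wirtinger_bar j (cauchy_transform k \<phi>) = cauchy_transform k (wirtinger_bar j \<phi>)"
proof
 fix z
 have out: "dir_deriv \<phi> v x = 0" if "norm x > R" for v x
  using dir_deriv_outside_support[of "cball 0 R" \<phi> x] \<phi>(2) that by auto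
 have i: "integrable lborel (%w. cauchy_kernel w * dir_deriv \<phi> v (z - axis k (w $ 1)))" for v
  by (rule integrable_cauchy_kernel_mult[OF smooth_continuous[OF smooth_dir_deriv[OF \<phi>(1)]] out])
 have "wirtinger_bar j (cauchy_transform k \<phi>) z =
  (cauchy_transform k (dir_deriv \<phi> (axis j 1)) z + \<i> * cauchy_transform k (dir_deriv \<phi> (axis j \<i>)) z) / 2"
  by (rule wirtinger_bar_eq[OF cauchy_transform_has_derivative(1)[OF \<phi>]])
 also have "... = (LINT w|lborel. (cauchy_kernel w * dir_deriv \<phi> (axis j 1) (z - axis k (w $ 1)) +
    \<i> * (cauchy_kernel w * dir_deriv \<phi> (axis j \<i>) (z - axis k (w $ 1)))) / 2)"
  unfolding cauchy_transform_def using i by simp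
 also have "... = cauchy_transform k (wirtinger_bar j \<phi>) z"
  unfolding cauchy_transform_def wirtinger_bar_def by (intro Bochner_Integration.integral_cong refl) (simp add: field_simps)
 finally show "wirtinger_bar j (cauchy_transform k \<phi>) z = cauchy_transform k (wirtinger_bar j \<phi>) z" .
qed

lemma cauchy_transform_wirtinger_bar:
 fixes \<phi> :: "complex^'n::finite => complex"
 assumes \<phi>: "smooth \<phi>" "!!x. norm x > R ==> \<phi> x = 0"
 shows "cauchy_transform k (wirtinger_bar k \<phi>) = \<phi>"
proof
 fix z :: "complex^'n"
 let ?L = "%w::complex^1. - axis k (w $ 1) :: complex^'n"
 define \<psi> where "\<psi> w = \<phi> (z + ?L w)" for w
 have L: "bounded_linear ?L"
  by (rule bounded_linear_minus[OF bounded_linear_axis_nth])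
 have s: "smooth \<psi>" unfolding \<psi>_def by (rule smooth_comp_linear[OF \<phi>(1) L])
 have out: "\<psi> w = 0" if "norm w > norm z + R" for w
  unfolding \<psi>_def using \<phi>(2)[OF norm_minus_axis[OF order_refl that, of k]] by simp
 have wb: "wirtinger_bar 1 \<psi> w = - wirtinger_bar k \<phi> (z - axis k (w $ 1))" for w
 proof -
  have "((%w. z + ?L w) has_derivative ?L) (at w)"
   using has_derivative_add[OF has_derivative_const bounded_linear_imp_has_derivative[OF L]] by simp
  from has_derivative_compose[OF this smooth_has_derivative[OF \<phi>(1)]]
  have D: "(\<psi> has_derivative (%v. dir_deriv \<phi> (?L v) (z + ?L w))) (at w)" by (simp add: \<psi>_def[abs_def])
  have lin: "linear (frechet_derivative \<phi> (at (z + ?L w)))"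
   using smooth_has_derivative[OF \<phi>(1)] has_derivative_linear by blast
  have L1: "axis k ((axis 1 a :: complex^1) $ 1) = (axis k a :: complex^'n)" for a by (simp add: axis_def)
  show ?thesis unfolding wirtinger_bar_eq[OF D] L1 linear_neg[OF lin] by (simp add: wirtinger_bar_def field_simps)
 qed
 have "(LINT w|lborel. wirtinger_bar 1 \<psi> w * bm_kernel w 1) = - of_real (bm_const TYPE(1)) * \<phi> z"
  proof -
  have "axis k (0::complex) = (0 :: complex^'n)" by (simp add: axis_def vec_eq_iff)
  hence "\<psi> 0 = \<phi> (z + - 0)" unfolding \<psi>_def by (simp only: zero_index)
  thus ?thesis using Bochner_Martinelli[OF s out] by simp
 qed
 moreover have "cauchy_transform k (wirtinger_bar k \<phi>) z = (LINT w|lborel. - (wirtinger_bar 1 \<psi> w * bm_kernel w 1) / of_real (bm_const TYPE(1)))"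
  unfolding cauchy_transform_def by (intro Bochner_Integration.integral_cong refl) (simp add: wb cauchy_kernel_def)
 ultimately show "cauchy_transform k (wirtinger_bar k \<phi>) z = \<phi> z"
  using bm_const_pos[where 'm = 1] by simp
qed

subsection \<open>The Cauchy transform of integrable functions\<close>

lemma cauchy_integrand_measurable [measurable]:
 fixes u :: "complex^'n::finite => 'b::topological_space"
 assumes [measurable]: "u : borel_measurable borel"
 shows "(%(z, w::complex^1). u (z - axis k (w $ 1))) : borel_measurable (borel \<Otimes>\<^sub>M borel)"
  "(%(z, w::complex^1). u (z + axis k (w $ 1))) : borel_measurable (borel \<Otimes>\<^sub>M borel)"
 by measurable

lemma cauchy_transform_measurable [measurable]:
 fixes u :: "complex^'n::finite => complex"
 assumes [measurable]: "u : borel_measurable borel"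
 shows "cauchy_transform k u : borel_measurable borel"
proof -
 have "(%z. LINT w|lborel. cauchy_kernel w * u (z - axis k (w $ 1))) : borel_measurable lborel"
  by (rule lborel.borel_measurable_lebesgue_integral) measurable
 thus ?thesis by (simp add: cauchy_transform_def[abs_def])
qed

text \<open>The kernel is odd, so the Cauchy transform is antisymmetric.\<close>

lemma cauchy_transform_antisymmetric:
 fixes u \<phi> :: "complex^'n::finite => complex"
 assumes u: "integrable lborel u" "!!x. norm x > R ==> u x = 0"
  and \<phi>: "\<phi> : borel_measurable borel" "!!x. norm (\<phi> x) <= B" "!!x. norm x > R' ==> \<phi> x = 0"
 shows "(LINT z|lborel. cauchy_transform k u z * \<phi> z) = - (LINT z|lborel. u z * cauchy_transform k \<phi> z)"
proof -
 have [measurable]: "u : borel_measurable borel" "\<phi> : borel_measurable borel" using u \<phi> by auto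
 let ?\<kappa> = "%w. indicator (cball 0 (R' + R)) w * cauchy_kernel w" and ?a = "%w::complex^1. axis k (w $ 1) :: complex^'n"
 have 1: "cauchy_transform k u z * \<phi> z = (LINT w|lborel. ?\<kappa> w * u (z - ?a w)) * \<phi> z" for z
  using cauchy_transform_truncate[of R u z R' k] u(2) \<phi>(3)[of z] by (cases "norm z > R'") auto
 have 2: "u z * (LINT w|lborel. ?\<kappa> w * \<phi> (z + ?a w)) = - (u z * cauchy_transform k \<phi> z)" for z
 proof (cases "norm z > R")
  case False
  have "axis k (- a) = (- axis k a :: complex^'n)" for a by (simp add: axis_def vec_eq_iff)
  hence "?\<kappa> (- w) * \<phi> (z + ?a (- w)) = - ((indicator (cball 0 (R + R')) w * cauchy_kernel w) * \<phi> (z - ?a w))" for w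
   by (simp add: cauchy_kernel_uminus indicator_def add.commute)
  hence "(LINT w|lborel. ?\<kappa> w * \<phi> (z + ?a w)) = - cauchy_transform k \<phi> z"
   using integral_lborel_uminus[of "%w. ?\<kappa> w * \<phi> (z + ?a w)"] cauchy_transform_truncate[of R' \<phi> z R k] \<phi>(3) False by simp
  thus ?thesis by simp
 qed (simp add: u(2))
 have "(LINT z|lborel. (LINT w|lborel. ?\<kappa> w * u (z - ?a w)) * \<phi> z) = (LINT z|lborel. u z * (LINT w|lborel. ?\<kappa> w * \<phi> (z + ?a w)))"
  by (rule translate_average_swap[OF cauchy_kernel_integrable _ u(1) \<phi>(1,2)]) measurable
 thus ?thesis by (simp only: 1 2 integral_minus)
qed

section \<open>Weighted estimates for the Cauchy transform\<close>

lemma AE_coords_nonzero: "AE z in (lborel :: (complex^'n::finite) measure). ALL j. z $ j ~= 0"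
proof -
 have "AE z in (lborel :: (complex^'n) measure). z $ j ~= 0" for j
 proof -
  have "negligible {z::complex^'n. z $ j = 0}"
  proof (rule negligible_subset)
   show "negligible {z::complex^'n. axis j 1 \<bullet> z = 0}" by (rule negligible_hyperplane) (simp add: axis_eq_0_iff)
  qed (auto simp: inner_commute[of "axis j 1"] inner_axis)
  hence "{z::complex^'n. z $ j = 0} : null_sets lebesgue" by (simp add: negligible_iff_null_sets)
  moreover have "{z::complex^'n. z $ j = 0} : sets lborel" by measurable
  ultimately have "{z::complex^'n. z $ j = 0} : null_sets lborel" by (simp add: null_sets_def)
  from AE_not_in[OF this] show ?thesis by simp
 qed
 thus ?thesis by (simp add: AE_all_countable)
qed

lemma young_tangent:
 fixes p g s :: real
 assumes "p >= 1" "g >= 0" "s > 0"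
 shows "p * s powr (p - 1) * g <= g powr p + (p - 1) * s powr p"
proof (cases "g = 0")
 case True
 thus ?thesis using assms by simp
next
 case False
 have "(g powr p) powr (1/p) * (s powr p) powr ((p-1)/p) <= (1/p) * g powr p + ((p-1)/p) * s powr p"
  by (rule Youngs_inequality_0) (use assms False in "auto simp: field_simps")
 hence "g * s powr (p - 1) <= (1/p) * g powr p + ((p-1)/p) * s powr p"
  using assms by (simp add: powr_powr)
 hence "p * (g * s powr (p - 1)) <= p * ((1/p) * g powr p + ((p-1)/p) * s powr p)"
  using assms by (intro mult_left_mono) auto
 also have "... = g powr p + (p - 1) * s powr p" using assms by (simp add: distrib_left)
 finally show ?thesis by (simp add: mult_ac)
qed

lemma ennreal_weighted_sum:
 assumes "B >= 0" "u >= 0" "q >= 0" "v >= 0" "t >= 0"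
 shows "ennreal B * (ennreal u + (ennreal q * ennreal v + ennreal t)) = ennreal (B * (u + (q * v + t)))"
 using assms by (simp add: ennreal_mult)

text \<open>Jensen's inequality for the power function and a weight of total mass at most A.\<close>

lemma weighted_power_mean:
 fixes \<kappa> g :: "'w => real"
 assumes [measurable]: "\<kappa> : borel_measurable M" "g : borel_measurable M"
  and nn: "!!w. \<kappa> w >= 0" "!!w. g w >= 0" and p: "p >= 1"
  and A: "A > 0" "(\<integral>\<^sup>+w. ennreal (\<kappa> w) \<partial>M) <= ennreal A"
  and I: "(\<integral>\<^sup>+w. ennreal (\<kappa> w * g w powr p) \<partial>M) = ennreal y" "y >= 0"
 shows "integrable M (%w. \<kappa> w * g w)" "(LINT w|M. \<kappa> w * g w) powr p <= A powr (p - 1) * y"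
proof -
 have i1: "integrable M \<kappa>" using A nn by (intro integrableI_nonneg) (auto intro: le_less_trans)
 have i2: "integrable M (%w. \<kappa> w * g w powr p)" using I nn by (intro integrableI_nonneg) auto
 show i3: "integrable M (%w. \<kappa> w * g w)"
 proof (rule Bochner_Integration.integrable_bound)
  show "integrable M (%w. \<kappa> w + \<kappa> w * g w powr p)" using i1 i2 by simp
  show "AE w in M. norm (\<kappa> w * g w) <= norm (\<kappa> w + \<kappa> w * g w powr p)"
  proof (rule AE_I2)
   fix w
   have "g w <= 1 + g w powr p"
   proof (cases "g w <= 1")
    case False
    hence "g w powr 1 <= g w powr p" using p by (intro powr_mono) auto
    thus ?thesis using False by simp
   qed (simp add: add_increasing2)
   hence "\<kappa> w * g w <= \<kappa> w * (1 + g w powr p)" using nn by (intro mult_left_mono) auto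
   thus "norm (\<kappa> w * g w) <= norm (\<kappa> w + \<kappa> w * g w powr p)"
    using nn by (simp add: distrib_left)
  qed
 qed measurable
 let ?x = "LINT w|M. \<kappa> w * g w"
 have yint: "(LINT w|M. \<kappa> w * g w powr p) = y"
  using I nn by (intro integral_eq_nn_integral[THEN trans]) auto
 have m: "(LINT w|M. \<kappa> w) <= A"
 proof -
  have "ennreal (LINT w|M. \<kappa> w) = (\<integral>\<^sup>+w. ennreal (\<kappa> w) \<partial>M)" using nn_integral_eq_integral[OF i1] nn by auto
  hence "ennreal (LINT w|M. \<kappa> w) <= ennreal A" using A by simp
  thus ?thesis using A by (simp add: ennreal_le_iff)
 qed
 have x0: "?x >= 0" using nn by (intro Bochner_Integration.integral_nonneg) simp
 show "?x powr p <= A powr (p - 1) * y"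
 proof (cases "?x = 0")
  case True thus ?thesis using I A by simp
 next
  case False
  define s where "s = ?x / A"
  have s: "s > 0" using False x0 A by (simp add: s_def)
  have "(LINT w|M. \<kappa> w * (p * s powr (p - 1) * g w)) <= (LINT w|M. \<kappa> w * (g w powr p + (p - 1) * s powr p))"
  proof (rule integral_mono)
   show "integrable M (%w. \<kappa> w * (p * s powr (p - 1) * g w))" using integrable_mult_right[OF i3, of "p * s powr (p - 1)"] by (simp add: mult_ac)
   show "integrable M (%w. \<kappa> w * (g w powr p + (p - 1) * s powr p))" using i1 i2 by (simp add: distrib_left)
  qed (use young_tangent[OF p nn(2) s] nn(1) in "auto intro!: mult_left_mono")
  moreover have "(LINT w|M. \<kappa> w * (p * s powr (p - 1) * g w)) = p * s powr (p - 1) * ?x"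
   using integral_mult_right_zero[of M "p * s powr (p - 1)" "%w. \<kappa> w * g w"] by (simp add: mult_ac)
  moreover have "(LINT w|M. \<kappa> w * (g w powr p + (p - 1) * s powr p)) = y + (LINT w|M. \<kappa> w) * ((p - 1) * s powr p)"
   using i1 i2 yint by (simp add: distrib_left)
  moreover have "(LINT w|M. \<kappa> w) * ((p - 1) * s powr p) <= A * ((p - 1) * s powr p)"
   using m p by (intro mult_right_mono) auto
  moreover have "p * s powr (p - 1) * ?x = p * (A * s powr p)"
  proof -
   have "?x = A * s" using A by (simp add: s_def)
   moreover have "s powr (p - 1) * (A * s) = A * s powr p" using s by (simp add: powr_diff)
   ultimately show ?thesis by (metis mult.assoc)
  qed
  moreover have "A * ((p - 1) * s powr p) = p * (A * s powr p) - A * s powr p" by (simp add: algebra_simps)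
  ultimately have "A * s powr p <= y" by linarith
  hence "A powr (p - 1) * (A * s powr p) <= A powr (p - 1) * y" by (intro mult_left_mono) auto
  moreover have "A powr (p - 1) * (A * s powr p) = ?x powr p"
  proof -
   have "A powr (p - 1) * A = A powr p" using A by (simp add: powr_diff)
   moreover have "A powr p * s powr p = ?x powr p" using A s x0 by (simp add: s_def powr_divide)
   ultimately show ?thesis by (metis mult.assoc)
  qed
  ultimately show ?thesis by simp
 qed
qed

lemma nn_integral_translated_norm_powr:
 fixes a :: "complex^1" and c Q :: real
 assumes c: "c < 2"
 shows "EX A>0. ALL a::complex^1. norm a <= Q -->
   (NN w. ennreal (norm (a + w) powr (- c)) * indicator (cball 0 Q') w) <= ennreal A"
proof -
 let ?I = "\<integral>\<^sup>+(w::complex^1). ennreal (norm w powr (- c)) * indicator (cball 0 (Q + Q')) w \<partial>lborel"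
 have "?I < \<infinity>" using c by (intro nn_integral_norm_powr_finite) simp
 then obtain A where A: "?I = ennreal A" "A >= 0" by (cases ?I) auto
 have "(NN w. ennreal (norm (a + w) powr (- c)) * indicator (cball 0 Q') w) <= ennreal (A + 1)"
  if a: "norm a <= Q" for a :: "complex^1"
 proof -
  have "(NN w. ennreal (norm (a + w) powr (- c)) * indicator (cball 0 Q') w)
   <= (NN w. ennreal (norm (w + a) powr (- c)) * indicator (cball 0 (Q + Q')) (w + a))"
  proof (rule nn_integral_mono)
   fix w
   have "norm w <= Q' ==> norm (w + a) <= Q + Q'" using a norm_triangle_ineq[of w a] by linarith
   thus "ennreal (norm (a + w) powr (- c)) * indicator (cball 0 Q') w
     <= ennreal (norm (w + a) powr (- c)) * indicator (cball 0 (Q + Q')) (w + a)"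
    by (auto simp: indicator_def add.commute)
  qed
  also have "... = ?I"
   by (rule nn_integral_lborel_translate[of "%w. ennreal (norm w powr (- c)) * indicator (cball 0 (Q + Q')) w"]) measurable
  also have "... <= ennreal (A + 1)" unfolding A(1) by (rule ennreal_leI) simp
  finally show ?thesis .
 qed
 thus ?thesis using A(2) by (intro exI[of _ "A + 1"]) auto
qed

text \<open>The power weights \<open>|w|\<^sup>-\<^sup>b\<close> with \<open>0 \<le> b < 2\<close> are, up to a constant, preserved by the absolute
  value of the Cauchy kernel on bounded sets: multiply by \<open>|a|\<^sup>b\<close> and use that one of \<open>|w|\<close>,
  \<open>|a - w|\<close> is at least \<open>|a| / 2\<close>.\<close>

lemma cauchy_power_weight:
 fixes b Q :: real
 assumes b: "0 <= b" "b < 2" and Q: "Q > 0"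
 shows "EX A>0. ALL a::complex^1. a ~= 0 --> norm a <= Q -->
  (NN w. ennreal (norm w powr (- 1) * norm (a + w) powr (- b)) * indicator (cball 0 Q) w)
   <= ennreal (A * norm a powr (- b))"
proof -
 define t where "t c a = (NN w. ennreal (norm (a + w) powr (- c)) * indicator (cball 0 Q) w)" for c and a :: "complex^1"
 obtain A1 where A1: "A1 > 0" "!!a. norm a <= Q ==> t 1 a <= ennreal A1"
  using nn_integral_translated_norm_powr[of 1 Q Q] unfolding t_def by auto
 obtain A2 where A2: "A2 > 0" "!!a. norm a <= Q ==> t b a <= ennreal A2"
  using nn_integral_translated_norm_powr[OF b(2), of Q Q] unfolding t_def by auto
 define q where "q = Q powr (b - 1)"
 have q: "q > 0" using Q by (simp add: q_def)
 have pw: "norm a powr b * (norm w powr (- 1) * norm (a + w) powr (- b))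
   <= 2 powr b * (norm (0 + w) powr (- 1) + (q * norm (a + w) powr (- b) + norm (a + w) powr (- 1)))"
  if w: "norm w <= Q" "w ~= 0" "a + w ~= 0" for a w :: "complex^1"
 proof -
  let ?x = "norm w" and ?y = "norm (a + w)"
  have xy: "?x > 0" "?y > 0" using w by auto
  have tri: "norm a <= ?x + ?y" using norm_triangle_ineq4[of "a + w" w] by simp
  consider (y) "norm a <= 2 * ?y" | (x) "norm a <= 2 * ?x" using tri by linarith
  hence "norm a powr b * (?x powr (- 1) * ?y powr (- b)) <= 2 powr b * (?x powr (- 1) + (q * ?y powr (- b) + ?y powr (- 1)))"
  proof cases
   case y
   have "norm a powr b <= (2 * ?y) powr b" using y b by (intro powr_mono2) auto
   hence "norm a powr b * (?x powr (- 1) * ?y powr (- b)) <= (2 * ?y) powr b * (?x powr (- 1) * ?y powr (- b))"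
    by (intro mult_right_mono) auto
   also have "... = 2 powr b * ?x powr (- 1)" using xy by (simp add: powr_mult powr_minus field_simps)
   also have "... <= 2 powr b * (?x powr (- 1) + (q * ?y powr (- b) + ?y powr (- 1)))"
    using q by (intro mult_left_mono) auto
   finally show ?thesis .
  next
   case x
   have "norm a powr b <= (2 * ?x) powr b" using x b by (intro powr_mono2) auto
   hence "norm a powr b * (?x powr (- 1) * ?y powr (- b)) <= (2 * ?x) powr b * (?x powr (- 1) * ?y powr (- b))"
    by (intro mult_right_mono) auto
   also have "... = 2 powr b * (?x powr (b - 1) * ?y powr (- b))" using xy by (simp add: powr_mult powr_minus powr_diff field_simps)
   also have "?x powr (b - 1) * ?y powr (- b) <= ?x powr (- 1) + (q * ?y powr (- b) + ?y powr (- 1))"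
   proof (cases "b >= 1")
    case True
    hence "?x powr (b - 1) <= q" unfolding q_def using w by (intro powr_mono2) auto
    hence "?x powr (b - 1) * ?y powr (- b) <= q * ?y powr (- b)" by (intro mult_right_mono) auto
    thus ?thesis by (simp add: add_increasing add_increasing2)
   next
    case False
    let ?m = "min ?x ?y"
    have m: "?m > 0" using xy by simp
    have "?x powr (b - 1) * ?y powr (- b) <= ?m powr (b - 1) * ?m powr (- b)"
     using False b m by (intro mult_mono powr_mono2') auto
    also have "... = ?m powr (- 1)" by (simp flip: powr_add)
    also have "... <= ?x powr (- 1) + ?y powr (- 1)" by (auto simp: min_def)
    finally have "?x powr (b - 1) * ?y powr (- b) <= ?x powr (- 1) + ?y powr (- 1)" .
    moreover have "q * ?y powr (- b) >= 0" using q by simp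
    ultimately show ?thesis by linarith
   qed
   hence "2 powr b * (?x powr (b - 1) * ?y powr (- b)) <= 2 powr b * (?x powr (- 1) + (q * ?y powr (- b) + ?y powr (- 1)))"
    by (intro mult_left_mono) auto
   finally show ?thesis .
  qed
  thus ?thesis by simp
 qed
 define A where "A = 2 powr b * (A1 + (q * A2 + A1))"
 have Apos: "A > 0" unfolding A_def using A1 A2 q by (intro mult_pos_pos add_pos_pos) auto
 have "(NN w. ennreal (norm w powr (- 1) * norm (a + w) powr (- b)) * indicator (cball 0 Q) w)
   <= ennreal (A * norm a powr (- b))" if a: "a ~= 0" "norm a <= Q" for a :: "complex^1"
 proof -
  let ?L = "\<integral>\<^sup>+w. ennreal (norm w powr (- 1) * norm (a + w) powr (- b)) * indicator (cball 0 Q) w \<partial>lborel"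
  have "ennreal (norm a powr b) * ?L = (NN w. ennreal (norm a powr b) * (ennreal (norm w powr (- 1) * norm (a + w) powr (- b)) * indicator (cball 0 Q) w))"
   by (rule nn_integral_cmult[symmetric]) measurable
  also have "... <= (NN w. ennreal (2 powr b) * (ennreal (norm (0 + w) powr (- 1)) * indicator (cball 0 Q) w
    + (ennreal q * (ennreal (norm (a + w) powr (- b)) * indicator (cball 0 Q) w) + ennreal (norm (a + w) powr (- 1)) * indicator (cball 0 Q) w)))"
  proof (rule nn_integral_mono_AE)
   have "AE w in (lborel :: (complex^1) measure). w ~= 0 & w ~= - a"
    by (intro AE_conjI AE_lborel_singleton)
   thus "AE w in lborel. ennreal (norm a powr b) * (ennreal (norm w powr (- 1) * norm (a + w) powr (- b)) * indicator (cball 0 Q) w)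
     <= ennreal (2 powr b) * (ennreal (norm (0 + w) powr (- 1)) * indicator (cball 0 Q) w
    + (ennreal q * (ennreal (norm (a + w) powr (- b)) * indicator (cball 0 Q) w) + ennreal (norm (a + w) powr (- 1)) * indicator (cball 0 Q) w))"
   proof eventually_elim
    case (elim w)
    hence "a + w ~= 0" by (simp add: add_eq_0_iff)
    thus ?case
    proof (cases "norm w <= Q")
     case True
     have "ennreal (norm a powr b) * ennreal (norm w powr (- 1) * norm (a + w) powr (- b))
      = ennreal (norm a powr b * (norm w powr (- 1) * norm (a + w) powr (- b)))"
      by (rule ennreal_mult[symmetric]) auto
     also have "... <= ennreal (2 powr b * (norm (0 + w) powr (- 1) + (q * norm (a + w) powr (- b) + norm (a + w) powr (- 1))))"
      using pw[OF True _ \<open>a + w ~= 0\<close>] elim by (intro ennreal_leI) auto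
     also have "... = ennreal (2 powr b) * (ennreal (norm (0 + w) powr (- 1)) + (ennreal q * ennreal (norm (a + w) powr (- b)) + ennreal (norm (a + w) powr (- 1))))"
      using q by (intro ennreal_weighted_sum[symmetric]) auto
     finally show ?thesis using True by (simp only: indicator_simps mem_cball_0 mult_1_right)
    qed simp
   qed
  qed
  also have "... = ennreal (2 powr b) * (t 1 0 + (ennreal q * t b a + t 1 a))"
   unfolding t_def by (simp add: nn_integral_cmult nn_integral_add)
  also have "... <= ennreal (2 powr b) * (ennreal A1 + (ennreal q * ennreal A2 + ennreal A1))"
   using A1(2)[of 0] A1(2)[of a] A2(2)[of a] a Q by (intro mult_left_mono add_mono) auto
  also have "... = ennreal A" unfolding A_def using A1 A2 q by (intro ennreal_weighted_sum) auto
  finally have le: "ennreal (norm a powr b) * ?L <= ennreal A" .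
  have "?L = ennreal (norm a powr (- b)) * (ennreal (norm a powr b) * ?L)"
   using a by (simp add: mult.assoc[symmetric] ennreal_mult[symmetric] powr_minus)
  also have "... <= ennreal (norm a powr (- b)) * ennreal A" using le by (rule mult_left_mono) simp
  also have "... = ennreal (A * norm a powr (- b))" using Apos by (simp add: ennreal_mult mult.commute)
  finally show ?thesis .
 qed
 thus ?thesis using Apos by blast
qed

lemma cauchy_power_weight':
 fixes b Q :: real
 assumes b: "0 <= b" "b < 2" and Q: "Q > 0"
 shows "EX A>0. ALL a::complex. a ~= 0 --> norm a <= Q -->
  (NN (w::complex^1). ennreal (norm w powr (- 1) * norm (a + w $ 1) powr (- b)) * indicator (cball 0 Q) w)
   <= ennreal (A * norm a powr (- b)) &
  (NN (w::complex^1). ennreal (norm w powr (- 1) * norm (a - w $ 1) powr (- b)) * indicator (cball 0 Q) w)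
   <= ennreal (A * norm a powr (- b))"
proof -
 obtain A where A: "A > 0" "!!a::complex^1. a ~= 0 ==> norm a <= Q ==>
  (NN (w::complex^1). ennreal (norm w powr (- 1) * norm (a + w) powr (- b)) * indicator (cball 0 Q) w)
   <= ennreal (A * norm a powr (- b))"
  using cauchy_power_weight[OF assms] by blast
 have 1: "(NN (w::complex^1). ennreal (norm w powr (- 1) * norm (a + w $ 1) powr (- b)) * indicator (cball 0 Q) w)
   <= ennreal (A * norm a powr (- b))" if a: "a ~= 0" "norm a <= Q" for a :: complex
  using A(2)[of "vec a"] a by (simp add: norm_vector_1 vec_eq_iff)
 have 2: "(NN (w::complex^1). ennreal (norm w powr (- 1) * norm (a - w $ 1) powr (- b)) * indicator (cball 0 Q) w)
   = (NN (w::complex^1). ennreal (norm w powr (- 1) * norm (a + w $ 1) powr (- b)) * indicator (cball 0 Q) w)" for a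
  using nn_integral_lborel_uminus[of "%w. ennreal (norm w powr (- 1) * norm (a + w $ 1) powr (- b)) * indicator (cball 0 Q) (w::complex^1)"]
  by (simp add: indicator_def)
 show ?thesis using A(1) 1 2 by (intro exI[of _ A]) simp
qed

lemma ennreal_weight_swap:
 assumes "a >= 0" "b >= 0" "x >= 0" "e >= 0" "f >= 0"
 shows "ennreal (a * b) * (ennreal (x * e * f) * i) = ennreal (a * e * f) * (ennreal (x * b) * i)"
 using assms by (simp add: ennreal_mult mult_ac)

text \<open>The estimate is Schur's test. The exponents b and c are those for which both
  \<open>|z\<^sub>k|\<^sup>-\<^sup>b\<close> and \<open>|z\<^sub>k|\<^sup>-\<^sup>c\<close> are admissible in the preceding lemma.\<close>

theorem cauchy_transform_weighted_Lp:
 fixes F :: "complex^'n::finite => complex" and W :: "complex^'n => real"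
 assumes F [measurable]: "F : borel_measurable borel" and supp: "!!z. norm z > R ==> F z = 0"
  and W [measurable]: "W : borel_measurable borel" and Wnn: "!!z. W z >= 0"
  and Wk: "!!z a. W (z + axis k a) = W z"
  and p: "p >= 1" and bc: "0 <= b" "b < 2" "0 <= c" "c < 2" "c = tp + b * (p - 1)"
  and fin: "(NN z. ennreal (W z * norm (z $ k) powr (- tp) * norm (F z) powr p)) < \<infinity>"
  and RM: "R >= 0" "M > 0"
 shows "(NN z. ennreal (W z * norm (z $ k) powr (- tp) * norm (cauchy_transform k F z) powr p) * indicator (cball 0 M) z) < \<infinity>"
proof -
 define Q where "Q = M + R"
 have Q: "Q > 0" using RM by (simp add: Q_def)
 obtain A where A: "A > 0" "!!a. a ~= 0 ==> norm a <= Q ==>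
  (NN (w::complex^1). ennreal (norm w powr (- 1) * norm (a - w $ 1) powr (- b)) * indicator (cball 0 Q) w)
   <= ennreal (A * norm a powr (- b))"
  using cauchy_power_weight'[OF bc(1,2) Q] by blast
 obtain A' where A': "A' > 0" "!!a. a ~= 0 ==> norm a <= Q ==>
  (NN (w::complex^1). ennreal (norm w powr (- 1) * norm (a + w $ 1) powr (- c)) * indicator (cball 0 Q) w)
   <= ennreal (A' * norm a powr (- c))"
  using cauchy_power_weight'[OF bc(3,4) Q] by blast
 define C where "C = cauchy_bound powr p * A powr (p - 1)"
 have C: "C > 0" using A cauchy_bound_pos by (simp add: C_def)
 let ?e = "b * (p - 1)"
 define J where "J z = (NN (w::complex^1). ennreal (norm w powr (- 1) * norm ((z - axis k (w $ 1)) $ k) powr ?e * norm (F (z - axis k (w $ 1))) powr p) * indicator (cball 0 Q) w)" for z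
 have pointwise: "ennreal (norm (cauchy_transform k F z) powr p) <= ennreal (C * norm (z $ k) powr (- ?e)) * J z"
  if z: "norm z <= M" "z $ k ~= 0" for z
 proof (cases "J z = \<infinity>")
  case True
  thus ?thesis using C z by (simp add: ennreal_mult_top)
 next
  case False
  then obtain y where y: "J z = ennreal y" "y >= 0" by (cases "J z") auto
  have zk: "norm (z $ k) <= Q" using z Finite_Cartesian_Product.norm_nth_le[of z k] RM by (simp add: Q_def)
  define \<kappa> where "\<kappa> w = norm w powr (- 1) * norm (z $ k - w $ 1) powr (- b) * indicator (cball 0 Q) w" for w :: "complex^1"
  define g where "g w = norm (z $ k - w $ 1) powr b * norm (F (z - axis k (w $ 1)))" for w :: "complex^1"
  have [measurable]: "\<kappa> : borel_measurable lborel" "g : borel_measurable lborel"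
   unfolding \<kappa>_def g_def by measurable
  have nn: "\<kappa> w >= 0" "g w >= 0" for w by (auto simp: \<kappa>_def g_def)
  have Az: "A * norm (z $ k) powr (- b) > 0" using A z by simp
  have mass: "(NN (w::complex^1). ennreal (\<kappa> w)) <= ennreal (A * norm (z $ k) powr (- b))"
  proof -
   have "ennreal (\<kappa> w) = ennreal (norm w powr (- 1) * norm (z $ k - w $ 1) powr (- b)) * indicator (cball 0 Q) w" for w
    by (simp add: \<kappa>_def indicator_def)
   thus ?thesis using A(2)[OF z(2) zk] by simp
  qed
  have ne: "AE w in (lborel :: (complex^1) measure). w $ 1 ~= z $ k"
  proof -
   have "AE w in (lborel :: (complex^1) measure). w ~= vec (z $ k)" by (rule AE_lborel_singleton)
   thus ?thesis by eventually_elim (auto simp: vec_eq_iff)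
  qed
  have I: "(NN (w::complex^1). ennreal (\<kappa> w * g w powr p)) = ennreal y"
  proof -
   have "(NN (w::complex^1). ennreal (\<kappa> w * g w powr p)) = J z" unfolding J_def
   proof (rule nn_integral_cong_AE, use ne in eventually_elim)
    case (elim w)
    let ?r = "norm (z $ k - w $ 1)"
    have r: "?r > 0" using elim by auto
    have "?r powr (- b) * (?r powr b) powr p = ?r powr ?e"
     using r by (simp add: powr_powr algebra_simps flip: powr_add)
    hence "\<kappa> w * g w powr p = norm w powr (- 1) * ?r powr ?e * norm (F (z - axis k (w $ 1))) powr p * indicator (cball 0 Q) w"
     unfolding \<kappa>_def g_def by (simp add: powr_mult)
    thus ?case by (simp add: axis_def indicator_def)
   qed
   thus ?thesis using y by simp
  qed
  note mean = weighted_power_mean[OF _ _ nn p Az mass I y(2)]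
  have le: "norm (cauchy_transform k F z) <= cauchy_bound * (LINT w|lborel. \<kappa> w * g w)"
  proof (cases "integrable lborel (%w. cauchy_kernel w * F (z - axis k (w $ 1)))")
   case True
   have "norm (cauchy_transform k F z) <= (LINT w|lborel. norm (cauchy_kernel w * F (z - axis k (w $ 1))))"
    unfolding cauchy_transform_def by (rule integral_norm_bound)
   also have "... <= (LINT w|lborel. cauchy_bound * (\<kappa> w * g w))"
   proof (rule integral_mono_AE)
    show "integrable lborel (%w. norm (cauchy_kernel w * F (z - axis k (w $ 1))))" using True by simp
    show "integrable lborel (%w. cauchy_bound * (\<kappa> w * g w))" using mean(1) by simp
    show "AE w in lborel. norm (cauchy_kernel w * F (z - axis k (w $ 1))) <= cauchy_bound * (\<kappa> w * g w)"
     using ne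
    proof eventually_elim
     case (elim w)
     let ?r = "norm (z $ k - w $ 1)"
     have r: "?r > 0" using elim by auto
     show ?case
     proof (cases "norm w <= Q")
      case True
      have "?r powr (- b) * ?r powr b = 1" using r by (simp flip: powr_add)
      hence "\<kappa> w * g w = norm w powr (- 1) * norm (F (z - axis k (w $ 1)))"
       unfolding \<kappa>_def g_def using True by simp
      moreover have "norm (cauchy_kernel w) * norm (F (z - axis k (w $ 1))) <= (cauchy_bound * norm w powr (- 1)) * norm (F (z - axis k (w $ 1)))"
       by (intro mult_right_mono norm_cauchy_kernel_le) simp
      ultimately show ?thesis by (simp only: norm_mult mult.assoc)
     next
      case False
      hence "F (z - axis k (w $ 1)) = 0"
       using supp[OF norm_minus_axis[OF z(1), of R w k]] by (simp add: Q_def)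
      thus ?thesis using nn cauchy_bound_pos by (simp add: mult_nonneg_nonneg less_imp_le)
     qed
    qed
   qed
   finally show ?thesis by simp
  next
   case False
   hence "cauchy_transform k F z = 0" unfolding cauchy_transform_def by (rule not_integrable_integral_eq)
   moreover have "(LINT w|lborel. \<kappa> w * g w) >= 0" using nn by (intro Bochner_Integration.integral_nonneg) simp
   ultimately show ?thesis using cauchy_bound_pos by simp
  qed
  have "norm (cauchy_transform k F z) powr p <= (cauchy_bound * (LINT w|lborel. \<kappa> w * g w)) powr p"
   using le p by (intro powr_mono2) auto
  also have "... = cauchy_bound powr p * (LINT w|lborel. \<kappa> w * g w) powr p"
   using cauchy_bound_pos nn by (intro powr_mult)
  also have "... <= cauchy_bound powr p * ((A * norm (z $ k) powr (- b)) powr (p - 1) * y)"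
   using mean(2) by (intro mult_left_mono) auto
  also have "... = C * norm (z $ k) powr (- ?e) * y"
   using A by (simp add: C_def powr_mult powr_powr)
  finally have "ennreal (norm (cauchy_transform k F z) powr p) <= ennreal (C * norm (z $ k) powr (- ?e) * y)"
   by (rule ennreal_leI)
  thus ?thesis using y C by (simp add: ennreal_mult)
 qed
 have zk0: "AE z in (lborel :: (complex^'n) measure). z $ k ~= 0"
  using AE_coords_nonzero by eventually_elim simp
 let ?h = "%z w. ennreal (W z * norm (z $ k) powr (- c)) * (ennreal (norm w powr (- 1) * norm ((z - axis k (w $ 1)) $ k) powr ?e * norm (F (z - axis k (w $ 1))) powr p) * indicator (cball 0 Q) w)"
 let ?h' = "%z w. ennreal (W z * norm ((z + axis k (w $ 1)) $ k) powr (- c)) * (ennreal (norm w powr (- 1) * norm (z $ k) powr ?e * norm (F z) powr p) * indicator (cball 0 Q) w)"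
 have "(NN z. ennreal (W z * norm (z $ k) powr (- tp) * norm (cauchy_transform k F z) powr p) * indicator (cball 0 M) z)
   <= (NN z. ennreal C * (ennreal (W z * norm (z $ k) powr (- c)) * J z))"
 proof (rule nn_integral_mono_AE, use zk0 in eventually_elim)
  case (elim z)
  show ?case
  proof (cases "norm z <= M")
   case True
   have "ennreal (W z * norm (z $ k) powr (- tp) * norm (cauchy_transform k F z) powr p)
     = ennreal (W z * norm (z $ k) powr (- tp)) * ennreal (norm (cauchy_transform k F z) powr p)"
    using Wnn by (simp add: ennreal_mult)
   also have "... <= ennreal (W z * norm (z $ k) powr (- tp)) * (ennreal (C * norm (z $ k) powr (- ?e)) * J z)"
    by (rule mult_left_mono[OF pointwise[OF True elim]]) simp
   also have "... = ennreal C * (ennreal (W z * (norm (z $ k) powr (- tp) * norm (z $ k) powr (- ?e))) * J z)"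
    using Wnn C by (simp add: ennreal_mult mult_ac)
   also have "norm (z $ k) powr (- tp) * norm (z $ k) powr (- ?e) = norm (z $ k) powr (- c)"
    using bc(5) by (simp flip: powr_add)
   finally show ?thesis using True by simp
  qed simp
 qed
 also have "... = ennreal C * (NN z. (NN (w::complex^1). ?h z w))"
 proof -
  have "ennreal (W z * norm (z $ k) powr (- c)) * J z = (NN (w::complex^1). ?h z w)" for z
   unfolding J_def by (rule nn_integral_cmult[symmetric]) measurable
  hence "(NN z. ennreal C * (ennreal (W z * norm (z $ k) powr (- c)) * J z))
    = (NN z. ennreal C * (NN (w::complex^1). ?h z w))" by (simp only:)
  also have "... = ennreal C * (NN z. (NN (w::complex^1). ?h z w))"
   by (rule nn_integral_cmult) measurable
  finally show ?thesis .
 qed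
 also have "(NN z. (NN (w::complex^1). ?h z w)) = (NN (w::complex^1). (NN z. ?h z w))"
  by (rule lborel_pair.Fubini'[symmetric]) measurable
 also have "... = (NN (w::complex^1). (NN z. ?h' z w))"
 proof (rule nn_integral_cong)
  fix w :: "complex^1"
  have "(NN z. ?h (z + axis k (w $ 1)) w) = (NN z. ?h z w)"
   by (rule nn_integral_lborel_translate[of "%z. ?h z w"]) measurable
  thus "(NN z. ?h z w) = (NN z. ?h' z w)" by (simp add: Wk)
 qed
 also have "... = (NN z. (NN (w::complex^1). ?h' z w))"
  by (rule lborel_pair.Fubini') measurable
 also have "... <= (NN z. ennreal A' * ennreal (W z * norm (z $ k) powr (- tp) * norm (F z) powr p))"
 proof (rule nn_integral_mono_AE, use zk0 in eventually_elim)
  case (elim z)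
  show ?case
  proof (cases "norm z <= R")
   case True
   have zk: "norm (z $ k) <= Q" using True Finite_Cartesian_Product.norm_nth_le[of z k] RM by (simp add: Q_def)
   let ?v = "ennreal (W z * norm (z $ k) powr ?e * norm (F z) powr p)"
   let ?g = "%w::complex^1. ennreal (norm w powr (- 1) * norm (z $ k + w $ 1) powr (- c)) * indicator (cball 0 Q) w"
   have nk: "(z + axis k (w $ 1)) $ k = z $ k + w $ 1" for w :: "complex^1" by (simp add: axis_def)
   have "?h' z w = ?v * ?g w" for w
    unfolding nk using Wnn by (intro ennreal_weight_swap) auto
   hence "(NN (w::complex^1). ?h' z w) = (NN (w::complex^1). ?v * ?g w)" by (simp only:)
   also have "... = ?v * (NN (w::complex^1). ?g w)" by (rule nn_integral_cmult) measurable
   also have "... <= ?v * ennreal (A' * norm (z $ k) powr (- c))"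
    by (rule mult_left_mono[OF A'(2)[OF elim zk]]) simp
   also have "... = ennreal (A' * (W z * (norm (z $ k) powr ?e * norm (z $ k) powr (- c)) * norm (F z) powr p))"
    using A' Wnn by (simp add: mult_ac flip: ennreal_mult)
   also have "norm (z $ k) powr ?e * norm (z $ k) powr (- c) = norm (z $ k) powr (- tp)"
    using bc(5) by (simp flip: powr_add)
   finally show ?thesis using A' Wnn by (simp add: ennreal_mult)
  next
   case False
   thus ?thesis using supp[of z] by simp
  qed
 qed
 also have "... = ennreal A' * (NN z. ennreal (W z * norm (z $ k) powr (- tp) * norm (F z) powr p))"
  by (rule nn_integral_cmult) measurable
 finally have "(NN z. ennreal (W z * norm (z $ k) powr (- tp) * norm (cauchy_transform k F z) powr p) * indicator (cball 0 M) z)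
   <= ennreal C * (ennreal A' * (NN z. ennreal (W z * norm (z $ k) powr (- tp) * norm (F z) powr p)))"
  by (simp add: mult_left_mono)
 also have "... < \<infinity>" using fin by (simp add: ennreal_mult_less_top)
 finally show ?thesis .
qed

theorem cauchy_transform_weighted_bounded:
 fixes F :: "complex^'n::finite => complex" and W :: "complex^'n => real"
 assumes F [measurable]: "F : borel_measurable borel" and supp: "!!z. norm z > R ==> F z = 0"
  and Wk: "!!z a. W (z + axis k a) = W z" and Wnn: "!!z. W z >= 0"
  and b: "0 <= b" "b < 2"
  and bd: "!!z. norm (F z) <= W z * norm (z $ k) powr (- b)"
  and RM: "R >= 0" "M > 0"
 shows "EX C. ALL z. norm z <= M --> z $ k ~= 0 --> norm (cauchy_transform k F z) <= C * W z * norm (z $ k) powr (- b)"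
proof -
 define Q where "Q = M + R"
 have Q: "Q > 0" using RM by (simp add: Q_def)
 obtain A where A: "A > 0" "!!a. a ~= 0 ==> norm a <= Q ==>
  (NN (w::complex^1). ennreal (norm w powr (- 1) * norm (a - w $ 1) powr (- b)) * indicator (cball 0 Q) w)
   <= ennreal (A * norm a powr (- b))"
  using cauchy_power_weight'[OF b Q] by blast
 have "norm (cauchy_transform k F z) <= cauchy_bound * A * W z * norm (z $ k) powr (- b)" if z: "norm z <= M" "z $ k ~= 0" for z
 proof (cases "integrable lborel (%w. cauchy_kernel w * F (z - axis k (w $ 1)))")
  case True
  have zk: "norm (z $ k) <= Q" using z Finite_Cartesian_Product.norm_nth_le[of z k] RM by (simp add: Q_def)
  have W': "W (z - axis k a) = W z" for a using Wk[of "z - axis k a" a] by simp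
  have "ennreal (norm (cauchy_transform k F z)) <= (NN (w::complex^1). ennreal (norm (cauchy_kernel w * F (z - axis k (w $ 1)))))"
   unfolding cauchy_transform_def by (rule integral_norm_bound_ennreal[OF True])
  also have "... <= (NN (w::complex^1). ennreal (cauchy_bound * W z) * (ennreal (norm w powr (- 1) * norm (z $ k - w $ 1) powr (- b)) * indicator (cball 0 Q) w))"
  proof (rule nn_integral_mono)
   fix w :: "complex^1"
   show "ennreal (norm (cauchy_kernel w * F (z - axis k (w $ 1)))) <= ennreal (cauchy_bound * W z) * (ennreal (norm w powr (- 1) * norm (z $ k - w $ 1) powr (- b)) * indicator (cball 0 Q) w)"
   proof (cases "norm w <= Q")
    case True
    have nk: "(z - axis k (w $ 1)) $ k = z $ k - w $ 1" by (simp add: axis_def)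
    have "norm (cauchy_kernel w * F (z - axis k (w $ 1))) <= (cauchy_bound * norm w powr (- 1)) * (W z * norm (z $ k - w $ 1) powr (- b))"
     unfolding norm_mult using bd[of "z - axis k (w $ 1)"] norm_cauchy_kernel_le[of w] cauchy_bound_pos
     by (intro mult_mono) (auto simp: W' nk simp del: vector_minus_component)
    hence "ennreal (norm (cauchy_kernel w * F (z - axis k (w $ 1)))) <= ennreal ((cauchy_bound * W z) * (norm w powr (- 1) * norm (z $ k - w $ 1) powr (- b)))"
     by (intro ennreal_leI) (simp add: mult_ac)
    also have "... = ennreal (cauchy_bound * W z) * ennreal (norm w powr (- 1) * norm (z $ k - w $ 1) powr (- b))"
     using Wnn cauchy_bound_pos by (intro ennreal_mult) (auto intro!: mult_nonneg_nonneg less_imp_le)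
    finally show ?thesis using True by simp
   next
    case False
    hence "F (z - axis k (w $ 1)) = 0"
     using supp[OF norm_minus_axis[OF z(1), of R w k]] by (simp add: Q_def)
    thus ?thesis by simp
   qed
  qed
  also have "... = ennreal (cauchy_bound * W z) * (NN (w::complex^1). ennreal (norm w powr (- 1) * norm (z $ k - w $ 1) powr (- b)) * indicator (cball 0 Q) w)"
   by (rule nn_integral_cmult) measurable
  also have "... <= ennreal (cauchy_bound * W z) * ennreal (A * norm (z $ k) powr (- b))"
   by (rule mult_left_mono[OF A(2)[OF z(2) zk]]) simp
  also have "... = ennreal (cauchy_bound * A * W z * norm (z $ k) powr (- b))"
   using A Wnn cauchy_bound_pos by (simp add: mult_ac flip: ennreal_mult)
  finally show ?thesis
   using A Wnn cauchy_bound_pos by (subst (asm) ennreal_le_iff) (auto intro!: mult_nonneg_nonneg less_imp_le)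
 next
  case False
  hence "cauchy_transform k F z = 0" unfolding cauchy_transform_def by (rule not_integrable_integral_eq)
  thus ?thesis using A Wnn cauchy_bound_pos by (auto intro!: mult_nonneg_nonneg less_imp_le)
 qed
 thus ?thesis by blast
qed

section \<open>Locally integrable functions on open sets\<close>

lemma open_in_lebesgue: "open U ==> U : sets lebesgue" for U :: "'a::euclidean_space set"
 by auto

lemma compact_in_lebesgue: "compact K ==> K : sets lebesgue" for K :: "'a::euclidean_space set"
 by (simp add: borel_compact)

lemma AE_on_iff:
 fixes U :: "'a::euclidean_space set"
 assumes "U : sets lebesgue"
 shows "(AE z in lebesgue_on U. P z) \<longleftrightarrow> (AE z in lborel. z : U --> P z)"
 using assms by (simp add: AE_restrict_space_iff AE_completion_iff)

lemma AE_on_subset: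
 fixes U V :: "'a::euclidean_space set"
 assumes "AE z in lebesgue_on U. P z" "V <= U" "U : sets lebesgue" "V : sets lebesgue"
 shows "AE z in lebesgue_on V. P z"
 using assms(1) unfolding AE_on_iff[OF assms(3)] AE_on_iff[OF assms(4)] by eventually_elim (use assms(2) in auto)

lemma AE_on_cover:
 fixes U :: "'a::euclidean_space set"
 assumes U: "open U" and loc: "!!x. x : U ==> EX V. open V & x : V & (AE z in lebesgue_on V. P z)"
 shows "AE z in lebesgue_on U. P z"
proof -
 obtain V where V: "!!x. x : U ==> open (V x) & x : V x & (AE z in lebesgue_on (V x). P z)" using loc by metis
 have "!!S. S : V ` U ==> open S" using V by auto
 then obtain \<C> where C: "\<C> <= V ` U" "countable \<C>" "\<Union>\<C> = \<Union>(V ` U)" using Lindelof by metis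
 have "AE z in lborel. ALL S:\<C>. z : S --> P z"
 proof (rule AE_ball_countable'[OF _ C(2)])
  fix S assume "S : \<C>"
  then obtain x where "x : U" "S = V x" using C by auto
  thus "AE z in lborel. z : S --> P z" using V AE_on_iff[OF open_in_lebesgue] by metis
 qed
 hence "AE z in lborel. z : U --> P z"
  by eventually_elim (use V C(3) in blast)
 thus ?thesis by (simp add: AE_on_iff open_in_lebesgue U)
qed

lemma LINT_on:
 fixes f :: "'a::euclidean_space => complex"
 assumes "U : sets lebesgue"
 shows "(LINT z|lebesgue_on U. f z) = (LINT z|lebesgue. indicator U z *\<^sub>R f z)"
 using assms by (simp add: integral_restrict_space)

lemma LINT_on_subset:
 fixes f :: "'a::euclidean_space => complex"
 assumes "U : sets lebesgue" "V : sets lebesgue" "V <= U" "!!z. z : U ==> z ~: V ==> f z = 0"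
 shows "(LINT z|lebesgue_on U. f z) = (LINT z|lebesgue_on V. f z)"
 unfolding LINT_on[OF assms(1)] LINT_on[OF assms(2)]
 by (rule Bochner_Integration.integral_cong[OF refl]) (use assms(3,4) in "auto simp: indicator_def")

lemma nn_integral_on:
 assumes "K : sets lebesgue"
 shows "(\<integral>\<^sup>+z. h z \<partial>lebesgue_on K) = (NN z. h z * indicator K z)"
 using assms by (simp add: nn_integral_restrict_space nn_integral_completion)

lemma measurable_on_iff:
 fixes f :: "'a::euclidean_space => complex"
 assumes "U : sets lebesgue"
 shows "f : lmeas U \<longleftrightarrow> (%z. indicator U z *\<^sub>R f z) : borel_measurable lebesgue"
 using assms by (simp add: borel_measurable_restrict_space_iff)

lemma measurable_on_subset:
 fixes f :: "'a::euclidean_space => complex"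
 assumes "f : lmeas U" "V <= U"
 shows "f : lmeas V"
 using assms measurable_restrict_mono by blast

lemma borel_imp_measurable_on: "f : borel_measurable borel ==> f : lmeas U"
 for f :: "'a::euclidean_space => 'b::topological_space"
 by (intro measurable_restrict_space1 measurable_completion) simp

lemma measurable_on_cong_AE:
 fixes f g :: "'a::euclidean_space => complex"
 assumes "U : sets lebesgue" "f : lmeas U" "AE z in lebesgue_on U. g z = f z"
 shows "g : lmeas U"
proof -
 have "(%z. indicator U z *\<^sub>R f z) : borel_measurable lebesgue" using assms measurable_on_iff by blast
 moreover have "AE z in lebesgue. indicator U z *\<^sub>R f z = indicator U z *\<^sub>R g z"
  using assms(3) unfolding AE_on_iff[OF assms(1)] by (auto simp: AE_completion_iff indicator_def elim!: eventually_mono)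
 ultimately have "(%z. indicator U z *\<^sub>R g z) : borel_measurable lebesgue"
  by (rule borel_measurable_AE)
 thus ?thesis using assms measurable_on_iff by blast
qed

lemma borel_representative:
 fixes f :: "'a::euclidean_space => complex"
 assumes U: "U : sets lebesgue" and f: "f : lmeas U"
 obtains g where "g : borel_measurable borel" "AE z in lebesgue_on U. g z = f z"
proof -
 let ?f = "%z. indicator U z *\<^sub>R f z"
 have m: "?f : borel_measurable lebesgue" using assms measurable_on_iff by blast
 have "(%z. Re (?f z)) : borel_measurable (completion lborel)" "(%z. Im (?f z)) : borel_measurable (completion lborel)"
  using m by measurable
 note this[THEN completion_ex_borel_measurable_real]
 then obtain a b where a: "a : borel_measurable lborel" "AE z in lborel. Re (?f z) = a z"
  and b: "b : borel_measurable lborel" "AE z in lborel. Im (?f z) = b z"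
  by blast
 have [measurable]: "a : borel_measurable borel" "b : borel_measurable borel" using a b by auto
 show thesis
 proof (rule that)
  show "(%z. Complex (a z) (b z)) : borel_measurable borel" 
   by (subst Complex_eq) measurable
  show "AE z in lebesgue_on U. Complex (a z) (b z) = f z"
   unfolding AE_on_iff[OF U] using a(2) b(2)
   by eventually_elim (auto simp: complex_eq_iff)
 qed
qed

lemma compact_cover_split:
 fixes K :: "'a::euclidean_space set"
 assumes K: "compact K" and loc: "!!x. x : K ==> EX V. open V & x : V & P V"
 shows "EX \<K>. finite \<K> & K = \<Union>\<K> & (ALL C:\<K>. compact C & (EX V. open V & C <= V & P V))"
proof -
 have "EX r V. 0 < r & open V & cball x r <= V & P V" if "x : K" for x
  using loc[OF that] open_contains_cball by metis
 then obtain r V where rV: "!!x. x : K ==> 0 < r x & open (V x) & cball x (r x) <= V x & P (V x)" by metis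
 have "K <= (\<Union>x\<in>K. ball x (r x))" using rV by force
 then obtain D where D: "D <= K" "finite D" "K <= (\<Union>x\<in>D. ball x (r x))"
  using compactE_image[OF K, of K "%x. ball x (r x)"] by (metis open_ball)
 show ?thesis
 proof (intro exI[of _ "(%x. K Int cball x (r x)) ` D"] conjI ballI)
  show "finite ((%x. K Int cball x (r x)) ` D)" using D by simp
  show "K = \<Union>((%x. K Int cball x (r x)) ` D)" using D(3) by (force simp: less_imp_le)
  fix C assume C: "C : (%x. K Int cball x (r x)) ` D"
  obtain x where x: "x : D" "C = K Int cball x (r x)" using C by auto
  thus "compact C" "EX V. open V & C <= V & P V" using rV[of x] D K by (auto intro!: compact_Int exI[of _ "V x"])
 qed
qed

lemma Lp_locD:
 assumes "Lp_loc p U f" "compact K" "K <= U"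
 shows "if p = \<infinity> then EX C. AE z in lborel. z : K --> norm (f z) <= C
     else (NN z. ennreal (norm (f z) powr enn2real p) * indicator K z) < \<infinity>"
proof -
 have K: "K : sets lebesgue" using assms(2) by (rule compact_in_lebesgue)
 have "if p = \<infinity> then EX C. AE z in lebesgue_on K. norm (f z) <= C
     else (\<integral>\<^sup>+z. ennreal (norm (f z) powr enn2real p) \<partial>lebesgue_on K) < \<infinity>"
  using assms unfolding Lp_loc_def by blast
 thus ?thesis unfolding AE_on_iff[OF K] nn_integral_on[OF K] .
qed

lemma Lp_locI:
 assumes "f : lmeas U"
  "!!K. compact K ==> K <= U ==> if p = \<infinity> then EX C. AE z in lborel. z : K --> norm (f z) <= C
     else (NN z. ennreal (norm (f z) powr enn2real p) * indicator K z) < \<infinity>"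
 shows "Lp_loc p U f"
 unfolding Lp_loc_def
proof (intro conjI allI impI assms(1))
 fix K :: "(complex^'a) set" assume K: "compact K" "K <= U"
 hence K': "K : sets lebesgue" by (simp add: compact_in_lebesgue)
 show "if p = \<infinity> then EX C. AE z in lebesgue_on K. norm (f z) <= C
     else (\<integral>\<^sup>+z. ennreal (norm (f z) powr enn2real p) \<partial>lebesgue_on K) < \<infinity>"
  using assms(2)[OF K] unfolding AE_on_iff[OF K'] nn_integral_on[OF K'] .
qed

lemma measurable_norm_powr_indicator:
 fixes k :: "'a::euclidean_space => complex"
 assumes "K : sets lebesgue" "k : lmeas K"
 shows "(%z. ennreal (norm (k z) powr q) * indicator K z) : borel_measurable lebesgue"
proof -
 have "(%z. ennreal (norm (k z) powr q)) : lmeas K" using assms(2) by measurable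
 moreover have "K Int space lebesgue : sets lebesgue" using assms(1) by simp
 ultimately show ?thesis by (simp only: borel_measurable_restrict_space_iff_ennreal)
qed

text \<open>All closure properties of the local spaces that are needed reduce to a pointwise bound of the
  norm, up to a constant on each compact set, by a sum of two norms.\<close>

lemma Lp_loc_bound:
 assumes p: "p >= 1" and U: "open U" and f: "f : lmeas U"
  and g: "Lp_loc p U g" and h: "Lp_loc p U h"
  and bd: "!!K. compact K ==> K <= U ==> EX C. AE z in lborel. z : K --> norm (f z) <= C * (norm (g z) + norm (h z))"
 shows "Lp_loc p U f"
proof (rule Lp_locI[OF f])
 fix K :: "(complex^'a) set" assume K: "compact K" "K <= U"
 have Km: "K : sets borel" using K by (simp add: borel_compact)
 obtain C0 where C0: "AE z in lborel. z : K --> norm (f z) <= C0 * (norm (g z) + norm (h z))" using bd[OF K] by blast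
 define C where "C = max C0 0"
 have C: "AE z in lborel. z : K --> norm (f z) <= C * (norm (g z) + norm (h z))" "C >= 0"
  using C0 by (auto simp: C_def elim!: eventually_mono intro: order_trans[OF _ mult_right_mono])
 note gK = Lp_locD[OF g K] and hK = Lp_locD[OF h K]
 show "if p = \<infinity> then EX C. AE z in lborel. z : K --> norm (f z) <= C
     else (NN z. ennreal (norm (f z) powr enn2real p) * indicator K z) < \<infinity>"
 proof (cases "p = \<infinity>")
  case True
  then obtain A B where AB: "AE z in lborel. z : K --> norm (g z) <= A" "AE z in lborel. z : K --> norm (h z) <= B"
   using gK hK by auto
  have "AE z in lborel. z : K --> norm (f z) <= C * (A + B)"
   using AB C(1)
  proof eventually_elim
   case (elim z)
   show ?case
   proof
    assume "z : K"
    hence "norm (f z) <= C * (norm (g z) + norm (h z))" "norm (g z) + norm (h z) <= A + B" using elim by auto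
    thus "norm (f z) <= C * (A + B)" using C(2) by (meson mult_left_mono order_trans)
   qed
  qed
  thus ?thesis using True by auto
 next
  case False
  define q where "q = enn2real p"
  have q: "q >= 1" using p False unfolding q_def by (cases p) auto
  have "ennreal (norm (f z) powr q) <= ennreal ((2 * C) powr q) * (ennreal (norm (g z) powr q) + ennreal (norm (h z) powr q))"
   if "norm (f z) <= C * (norm (g z) + norm (h z))" for z
  proof -
   let ?m = "max (norm (g z)) (norm (h z))"
   have "C * (norm (g z) + norm (h z)) <= C * (2 * ?m)" using C(2) by (intro mult_left_mono) auto
   hence "norm (f z) powr q <= (2 * C * ?m) powr q" using that q by (intro powr_mono2) auto
   also have "... = (2 * C) powr q * ?m powr q" using C(2) by (intro powr_mult)
   also have "... <= (2 * C) powr q * (norm (g z) powr q + norm (h z) powr q)"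
    by (intro mult_left_mono) (auto simp: max_def)
   finally have "ennreal (norm (f z) powr q) <= ennreal ((2 * C) powr q * (norm (g z) powr q + norm (h z) powr q))"
    by (rule ennreal_leI)
   thus ?thesis by (simp add: ennreal_mult)
  qed
  hence "(NN z. ennreal (norm (f z) powr q) * indicator K z) <=
    (NN z. ennreal ((2 * C) powr q) * (ennreal (norm (g z) powr q) * indicator K z + ennreal (norm (h z) powr q) * indicator K z))"
   by (intro nn_integral_mono_AE, use C(1) in eventually_elim) (auto simp: indicator_def)
  also have "... = (\<integral>\<^sup>+z. ennreal ((2 * C) powr q) * (ennreal (norm (g z) powr q) * indicator K z + ennreal (norm (h z) powr q) * indicator K z) \<partial>lebesgue)"
   by (simp add: nn_integral_completion)
  also have "... = ennreal ((2 * C) powr q) * ((\<integral>\<^sup>+z. ennreal (norm (g z) powr q) * indicator K z \<partial>lebesgue) + (\<integral>\<^sup>+z. ennreal (norm (h z) powr q) * indicator K z \<partial>lebesgue))"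
  proof -
   have meas: "(%z. ennreal (norm (k z) powr q) * indicator K z) : borel_measurable lebesgue"
    if "k : lmeas U" for k :: "complex^'a => complex"
    using measurable_on_subset[OF that K(2)] K(1) by (intro measurable_norm_powr_indicator compact_in_lebesgue)
   have "g : lmeas U" "h : lmeas U" using g h by (auto simp: Lp_loc_def)
   note gh = this[THEN meas]
   have "(\<integral>\<^sup>+z. ennreal ((2 * C) powr q) * (ennreal (norm (g z) powr q) * indicator K z + ennreal (norm (h z) powr q) * indicator K z) \<partial>lebesgue)
    = ennreal ((2 * C) powr q) * (\<integral>\<^sup>+z. ennreal (norm (g z) powr q) * indicator K z + ennreal (norm (h z) powr q) * indicator K z \<partial>lebesgue)"
    by (rule nn_integral_cmult[OF borel_measurable_add[OF gh]])
   thus ?thesis unfolding nn_integral_add[OF gh] .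
  qed
  also have "... < \<infinity>" using gK hK False by (simp add: q_def nn_integral_completion ennreal_mult_less_top)
  finally show ?thesis using False by (simp add: q_def)
 qed
qed

lemma Lp_loc_zero: "Lp_loc p U (%z. 0)"
 by (rule Lp_locI) (auto intro!: exI[of _ 0])

lemma Lp_loc_cong_AE:
 assumes p: "p >= 1" and U: "open U" and f: "Lp_loc p U f" and eq: "AE z in lebesgue_on U. g z = f z"
 shows "Lp_loc p U g"
proof (rule Lp_loc_bound[OF p U _ f Lp_loc_zero])
 show "g : lmeas U"
  using measurable_on_cong_AE[OF open_in_lebesgue[OF U] _ eq] f by (simp add: Lp_loc_def)
 fix K :: "(complex^'a) set" assume K: "K <= U"
 have "AE z in lborel. z : U --> g z = f z" using eq U by (simp add: AE_on_iff open_in_lebesgue)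
 thus "EX C. AE z in lborel. z : K --> norm (g z) <= C * (norm (f z) + norm (0::complex))"
  by (intro exI[of _ 1]) (use K in "auto elim!: eventually_mono")
qed

lemma Lp_loc_add:
 assumes p: "p >= 1" and U: "open U" and f: "Lp_loc p U f" and g: "Lp_loc p U g"
 shows "Lp_loc p U (%z. f z + g z)"
 by (rule Lp_loc_bound[OF p U _ f g]) (use f g in "auto simp: Lp_loc_def norm_triangle_ineq intro!: exI[of _ 1]")

lemma Lp_loc_mult:
 assumes p: "p >= 1" and U: "open U" and f: "Lp_loc p U f" and g: "g : lmeas U"
  and bd: "!!K. compact K ==> K <= U ==> EX C. ALL z:K. norm (g z) <= C"
 shows "Lp_loc p U (%z. g z * f z)"
proof (rule Lp_loc_bound[OF p U _ f Lp_loc_zero])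
 show "(%z. g z * f z) : lmeas U" using f g by (auto simp: Lp_loc_def)
 fix K :: "(complex^'a) set" assume "compact K" "K <= U"
 then obtain C where "ALL z:K. norm (g z) <= C" using bd by blast
 thus "EX C. AE z in lborel. z : K --> norm (g z * f z) <= C * (norm (f z) + norm (0::complex))"
  by (intro exI[of _ C] AE_I2) (auto simp: norm_mult intro!: mult_right_mono)
qed

lemma Lp_loc_mult_continuous:
 assumes p: "p >= 1" and U: "open U" and f: "Lp_loc p U f" and g: "continuous_on UNIV g"
 shows "Lp_loc p U (%z. g z * f z)"
proof (rule Lp_loc_mult[OF p U f])
 show "g : lmeas U" using g by (intro borel_imp_measurable_on borel_measurable_continuous_onI)
 fix K :: "(complex^'a) set" assume "compact K"
 hence "bounded (g ` K)" using g by (intro compact_imp_bounded compact_continuous_image) (auto intro: continuous_on_subset)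
 thus "EX C. ALL z:K. norm (g z) <= C" by (auto simp: bounded_iff)
qed

lemma Lp_loc_subset:
 assumes "Lp_loc p U f" "V <= U" shows "Lp_loc p V f"
 using assms measurable_on_subset unfolding Lp_loc_def by (metis order_trans)

lemma measurable_on_local:
 fixes f :: "'a::euclidean_space => complex"
 assumes U: "open U" and loc: "!!x. x : U ==> EX V. open V & x : V & V <= U & f : lmeas V"
 shows "f : lmeas U"
proof -
 obtain V where V: "!!x. x : U ==> open (V x) & x : V x & V x <= U & f : borel_measurable (lebesgue_on (V x))" using loc by metis
 have "!!S. S : V ` U ==> open S" using V by auto
 then obtain \<C> where C: "\<C> <= V ` U" "countable \<C>" "\<Union>\<C> = \<Union>(V ` U)" using Lindelof by metis
 have UC: "\<Union>\<C> = U" using V C(3) by blast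
 show ?thesis
 proof (rule measurable_piecewise_restrict[OF C(2)])
  fix S assume "S : \<C>"
  hence S: "open S" "S <= U" "f : lmeas S" using C V by auto
  show "S Int space (lebesgue_on U) : sets (lebesgue_on U)"
   using S U by (auto simp: sets_restrict_space_iff open_in_lebesgue)
  have "restrict_space (lebesgue_on U) S = lebesgue_on S"
   using S by (simp add: restrict_restrict_space open_in_lebesgue U Int_absorb1)
  thus "f : borel_measurable (restrict_space (lebesgue_on U) S)" using S by simp
 qed (use UC in auto)
qed

lemma Lp_loc_local:
 assumes p: "p >= 1" and U: "open U" and loc: "!!x. x : U ==> EX V. open V & x : V & V <= U & Lp_loc p V f"
 shows "Lp_loc p U f"
proof (rule Lp_locI)
 show "f : lmeas U"
  using measurable_on_local[OF U] loc unfolding Lp_loc_def by meson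
 fix K :: "(complex^'a) set" assume K: "compact K" "K <= U"
 have "EX V. open V & x : V & Lp_loc p V f" if "x : K" for x using loc K(2) that by blast
 from compact_cover_split[OF K(1), of "%V. Lp_loc p V f", OF this]
 obtain \<K> where KK: "finite \<K>" "K = \<Union>\<K>" "!!C. C : \<K> ==> compact C & (EX V. open V & C <= V & Lp_loc p V f)"
  by blast
 have each: "if p = \<infinity> then EX C'. AE z in lborel. z : C --> norm (f z) <= C'
     else (NN z. ennreal (norm (f z) powr enn2real p) * indicator C z) < \<infinity>" if "C : \<K>" for C
  using KK(3)[OF that] Lp_locD by blast
 show "if p = \<infinity> then EX C. AE z in lborel. z : K --> norm (f z) <= C
     else (NN z. ennreal (norm (f z) powr enn2real p) * indicator K z) < \<infinity>"
 proof (cases "p = \<infinity>")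
  case True
  hence "ALL C:\<K>. EX C'. AE z in lborel. z : C --> norm (f z) <= C'" using each by auto
  then obtain B where B: "!!C. C : \<K> ==> AE z in lborel. z : C --> norm (f z) <= B C" by metis
  have "AE z in lborel. ALL C:\<K>. z : C --> norm (f z) <= B C" using KK(1) B by (simp add: AE_ball_countable' countable_finite)
  hence "AE z in lborel. z : K --> norm (f z) <= (\<Sum>C\<in>\<K>. \<bar>B C\<bar>)"
  proof eventually_elim
   case (elim z)
   show ?case
   proof
    assume "z : K"
    then obtain C where C: "C : \<K>" "z : C" using KK(2) by auto
    hence "norm (f z) <= \<bar>B C\<bar>" using elim by fastforce
    also have "... <= (\<Sum>C\<in>\<K>. \<bar>B C\<bar>)" using C KK(1) by (intro member_le_sum) auto
    finally show "norm (f z) <= (\<Sum>C\<in>\<K>. \<bar>B C\<bar>)" .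
   qed
  qed
  thus ?thesis using True by auto
 next
  case False
  let ?q = "enn2real p"
  have fm: "f : lmeas U" using measurable_on_local[OF U] loc unfolding Lp_loc_def by meson
  have meas: "(%z. ennreal (norm (f z) powr ?q) * indicator C z) : borel_measurable lebesgue" if "C : \<K>" for C
  proof (rule measurable_norm_powr_indicator)
   show "C : sets lebesgue" using KK(3)[OF that] compact_in_lebesgue by blast
   show "f : lmeas C" using fm measurable_on_subset KK(2) K(2) that by blast
  qed
  have "(\<integral>\<^sup>+z. ennreal (norm (f z) powr ?q) * indicator K z \<partial>lebesgue) <= (\<integral>\<^sup>+z. (\<Sum>C\<in>\<K>. ennreal (norm (f z) powr ?q) * indicator C z) \<partial>lebesgue)"
  proof (rule nn_integral_mono)
   fix z :: "complex^'a"
   show "ennreal (norm (f z) powr ?q) * indicator K z <= (\<Sum>C\<in>\<K>. ennreal (norm (f z) powr ?q) * indicator C z)"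
   proof (cases "z : K")
    case True
    then obtain C where C: "C : \<K>" "z : C" using KK(2) by auto
    have "ennreal (norm (f z) powr ?q) * indicator K z = ennreal (norm (f z) powr ?q) * indicator C z" using True C by simp
    also have "... <= (\<Sum>C\<in>\<K>. ennreal (norm (f z) powr ?q) * indicator C z)" using C KK(1) by (intro member_le_sum) auto
    finally show ?thesis .
   qed simp
  qed
  also have "... = (\<Sum>C\<in>\<K>. \<integral>\<^sup>+z. ennreal (norm (f z) powr ?q) * indicator C z \<partial>lebesgue)"
   by (rule nn_integral_sum[OF meas])
  also have "... < \<infinity>" using each False KK(1) by (simp add: nn_integral_completion)
  finally show ?thesis using False by (simp add: nn_integral_completion)
 qed
qed

lemma borel_measurable_abs_powr [measurable]: "(%z. abs_powr z s) : borel_measurable borel"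
 unfolding abs_powr_def by measurable

lemma borel_measurable_monom_powi [measurable]: "(%z. monom_powi z m) : borel_measurable borel"
 unfolding monom_powi_def power_int_def by measurable

section \<open>Test functions and pairings\<close>

lemma test_functionI:
 assumes "smooth \<phi>" "compact K" "K <= U" "!!z. z ~: K ==> \<phi> z = 0"
 shows "test_function U \<phi>"
proof -
 have "{z. \<phi> z ~= 0} <= K" using assms(4) by auto
 hence "closure {z. \<phi> z ~= 0} <= K" using compact_imp_closed[OF assms(2)] closure_minimal by blast
 moreover have "compact (closure {z. \<phi> z ~= 0})"
  using compact_Int_closed[OF assms(2), of "closure {z. \<phi> z ~= 0}"] \<open>closure _ <= K\<close> by (simp add: Int_absorb1)
 ultimately show ?thesis using assms by (auto simp: test_function_def smooth_def)
qed

lemma test_functionE: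
 assumes "test_function U \<phi>"
 shows "EX K. smooth \<phi> & compact K & K <= U & (ALL z. z ~: K --> \<phi> z = 0)"
proof (intro exI conjI allI impI)
 show "smooth \<phi>" "compact (closure {z. \<phi> z ~= 0})" "closure {z. \<phi> z ~= 0} <= U"
  using assms by (auto simp: test_function_def smooth_def)
 show "\<phi> z = 0" if "z ~: closure {z. \<phi> z ~= 0}" for z
  using that subsetD[OF closure_subset, of z "{z. \<phi> z ~= 0}"] by blast
qed

lemma test_function_smooth: "test_function U \<phi> ==> smooth \<phi>"
 by (simp add: test_function_def smooth_def)

lemma test_function_wirtinger_bar:
 assumes "test_function U \<phi>" shows "test_function U (wirtinger_bar j \<phi>)"
proof -
 obtain K where K: "smooth \<phi>" "compact K" "K <= U" "!!z. z ~: K ==> \<phi> z = 0" using test_functionE[OF assms] by blast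
 show ?thesis
  by (rule test_functionI[OF smooth_wirtinger_bar[OF K(1)] K(2,3)])
    (use wirtinger_bar_outside_support[of K \<phi>] K compact_imp_closed in blast)
qed

lemma test_function_mult:
 assumes "test_function U \<phi>" "smooth g" shows "test_function U (%z. g z * \<phi> z)"
proof -
 obtain K where K: "smooth \<phi>" "compact K" "K <= U" "!!z. z ~: K ==> \<phi> z = 0" using test_functionE[OF assms(1)] by blast
 show ?thesis by (rule test_functionI[OF smooth_mult[OF assms(2) K(1)] K(2,3)]) (use K(4) in auto)
qed

lemma test_function_mono: "test_function V \<phi> ==> V <= U ==> test_function U \<phi>"
 by (auto simp: test_function_def)

lemma test_function_bounded_support:
 assumes "test_function U \<phi>"
 obtains R B where "R > 0" "!!z. norm z > R ==> \<phi> z = 0" "!!z. norm (\<phi> z) <= B"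
proof -
 obtain K where K: "smooth \<phi>" "compact K" "K <= U" "!!z. z ~: K ==> \<phi> z = 0" using test_functionE[OF assms] by blast
 obtain R where R: "R > 0" "!!z. z : K ==> norm z <= R" using compact_imp_bounded[OF K(2)] by (auto simp: bounded_pos)
 have out: "\<phi> z = 0" if "norm z > R" for z using K(4) R(2) that by force
 obtain B where B: "!!z. norm (\<phi> z) <= B"
  using bounded_continuous_support[OF smooth_continuous[OF K(1)] out] by blast
 show thesis by (rule that[OF R(1) out B])
qed

definition pairing :: "(complex^'n::finite) set => (complex^'n => complex) => (complex^'n => complex) => complex" where
 "pairing U f \<phi> = (LINT z|lebesgue_on U. f z * \<phi> z)"

lemma pairing_integrable:
 assumes U: "open U" and f: "Lp_loc 1 U f" and \<phi>: "test_function U \<phi>"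
 shows "integrable (lebesgue_on U) (%z. f z * \<phi> z)"
proof (rule integrableI_bounded)
 obtain K where K: "smooth \<phi>" "compact K" "K <= U" "!!z. z ~: K ==> \<phi> z = 0" using test_functionE[OF \<phi>] by blast
 obtain R B where B: "!!z. norm (\<phi> z) <= B" using test_function_bounded_support[OF \<phi>] by metis
 have B0: "B >= 0" using B[of 0] norm_ge_zero order_trans by blast
 have "\<phi> : lmeas U"
  by (intro borel_imp_measurable_on borel_measurable_continuous_onI smooth_continuous K)
 thus "(%z. f z * \<phi> z) : lmeas U" using f by (auto simp: Lp_loc_def)
 have "(\<integral>\<^sup>+z. ennreal (norm (f z * \<phi> z)) \<partial>lebesgue_on U) = (NN z. ennreal (norm (f z * \<phi> z)) * indicator U z)"
  by (rule nn_integral_on[OF open_in_lebesgue[OF U]])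
 also have "... <= (NN z. ennreal B * (ennreal (norm (f z) powr 1) * indicator K z))"
 proof (rule nn_integral_mono)
  fix z
  show "ennreal (norm (f z * \<phi> z)) * indicator U z <= ennreal B * (ennreal (norm (f z) powr 1) * indicator K z)"
  proof (cases "z : K")
   case True
   have "norm (f z * \<phi> z) <= B * (norm (f z) powr 1)" using B[of z] by (simp add: norm_mult mult.commute[of "norm (f z)"] mult_right_mono)
   hence "ennreal (norm (f z * \<phi> z)) <= ennreal B * ennreal (norm (f z) powr 1)"
    using B0 by (simp add: ennreal_leI flip: ennreal_mult)
   thus ?thesis using True K by (auto simp: indicator_def)
  qed (use K(4) in simp)
 qed
 also have "... = (\<integral>\<^sup>+z. ennreal B * (ennreal (norm (f z) powr 1)) \<partial>lebesgue_on K)"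
  using K(2) by (subst nn_integral_on) (auto simp: mult.assoc compact_in_lebesgue)
 also have "... = ennreal B * (\<integral>\<^sup>+z. ennreal (norm (f z) powr 1) \<partial>lebesgue_on K)"
 proof (rule nn_integral_cmult)
  have "f : lmeas K" using f K measurable_on_subset unfolding Lp_loc_def by blast
  thus "(%z. ennreal (norm (f z) powr 1)) : lmeas K" by measurable
 qed
 also have "... < \<infinity>"
 proof -
  have "(\<integral>\<^sup>+z. ennreal (norm (f z) powr enn2real 1) \<partial>lebesgue_on K) < \<infinity>"
   using f K unfolding Lp_loc_def by (metis ennreal_one_neq_top infinity_ennreal_def)
  thus ?thesis by (simp add: ennreal_mult_less_top)
 qed
 finally show "(\<integral>\<^sup>+z. ennreal (norm (f z * \<phi> z)) \<partial>lebesgue_on U) < \<infinity>" .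
qed

lemma pairing_add:
 assumes "open U" "Lp_loc 1 U f" "Lp_loc 1 U g" "test_function U \<phi>"
 shows "pairing U (%z. f z + g z) \<phi> = pairing U f \<phi> + pairing U g \<phi>"
 unfolding pairing_def using pairing_integrable[OF assms(1,2,4)] pairing_integrable[OF assms(1,3,4)]
 by (simp add: distrib_right)

lemma pairing_add_right:
 assumes "open U" "Lp_loc 1 U f" "test_function U \<phi>" "test_function U \<psi>"
 shows "pairing U f (%z. \<phi> z + \<psi> z) = pairing U f \<phi> + pairing U f \<psi>"
 unfolding pairing_def using pairing_integrable[OF assms(1,2,3)] pairing_integrable[OF assms(1,2,4)]
 by (simp add: distrib_left)

lemma pairing_cmult: "pairing U (%z. c * f z) \<phi> = c * pairing U f \<phi>"
 by (simp add: pairing_def mult.assoc)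

lemma pairing_zero [simp]: "pairing U (%z. 0) \<phi> = 0" by (simp add: pairing_def)

lemma pairing_zero_right [simp]: "pairing U f (%z. 0) = 0" by (simp add: pairing_def)

lemma pairing_cong_AE:
 assumes U: "open U" and m: "f : lmeas U" and eq: "AE z in lebesgue_on U. g z = f z" and \<phi>: "test_function U \<phi>"
 shows "pairing U g \<phi> = pairing U f \<phi>"
 unfolding pairing_def
proof (rule integral_cong_AE)
 have "\<phi> : lmeas U"
  using test_function_smooth[OF \<phi>] by (intro borel_imp_measurable_on borel_measurable_continuous_onI smooth_continuous)
 thus "(%z. g z * \<phi> z) : lmeas U" "(%z. f z * \<phi> z) : lmeas U"
  using m measurable_on_cong_AE[OF open_in_lebesgue[OF U] m eq] by auto
 show "AE z in lebesgue_on U. g z * \<phi> z = f z * \<phi> z" using eq by eventually_elim simp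
qed

lemma pairing_subset:
 assumes "open U" "open V" "V <= U" "test_function V \<phi>"
 shows "pairing U f \<phi> = pairing V f \<phi>"
proof -
 obtain K where K: "K <= V" "!!z. z ~: K ==> \<phi> z = 0" using test_functionE[OF assms(4)] by blast
 show ?thesis unfolding pairing_def
  by (rule LINT_on_subset) (use assms K in "auto simp: open_in_lebesgue")
qed

lemma pairing_sum_right:
 assumes "open U" "Lp_loc 1 U f" "!!i. i : A ==> test_function U (\<phi> i)"
 shows "pairing U f (%z. \<Sum>i\<in>A. \<phi> i z) = (\<Sum>i\<in>A. pairing U f (\<phi> i))"
 unfolding pairing_def using pairing_integrable[OF assms(1,2)] assms(3)
 by (simp add: sum_distrib_left)

lemma pairing_lborel:
 assumes "f : borel_measurable borel" "smooth \<phi>"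
 shows "pairing UNIV f \<phi> = (LINT z|lborel. f z * \<phi> z)"
proof -
 have [measurable]: "\<phi> : borel_measurable borel" "f : borel_measurable borel"
  using assms by (auto intro!: borel_measurable_continuous_onI smooth_continuous)
 have "pairing UNIV f \<phi> = (LINT z|lebesgue. f z * \<phi> z)" by (simp add: pairing_def LINT_on)
 also have "... = (LINT z|lborel. f z * \<phi> z)" by (rule integral_completion) measurable
 finally show ?thesis .
qed

text \<open>The fundamental lemma of the calculus of variations. A set on which the function has positive
  real part is, up to a null set, a countable union of compact sets, and the indicator function of a
  compact set is a bounded limit of test functions.\<close>

lemma pairing_compact_eq_0:
 assumes U: "open U" and f: "Lp_loc 1 U f" and 0: "!!\<phi>. test_function U \<phi> ==> pairing U f \<phi> = 0"
  and K: "compact K" "K <= U"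
 shows "(LINT z|lebesgue_on U. indicator K z * f z) = 0"
proof -
 define N where "N n = U Int {z. infdist z K < inverse (real (Suc n))}" for n
 show ?thesis
 proof (cases "K = {}")
  case False
  have opN: "open (N n)" for n unfolding N_def
   by (intro open_Int U open_Collect_less continuous_intros)
  have KN: "K <= N n" for n using K(2) by (auto simp: N_def)
  obtain \<theta>0 C0 where \<theta>0: "smooth \<theta>0" "!!x. 0 <= \<theta>0 x" "!!x. \<theta>0 x <= (1::real)" "compact C0" "C0 <= U"
    "!!x. x ~: C0 ==> \<theta>0 x = 0" "!!x. x : K ==> \<theta>0 x = 1" using smooth_cutoff[OF K(1) U K(2)] by metis
  have "EX \<theta> C. smooth \<theta> & (ALL x. 0 <= \<theta> x) & (ALL x. \<theta> x <= (1::real)) & C <= N n & (ALL x. x ~: C --> \<theta> x = 0) & (ALL x:K. \<theta> x = 1)" for n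
   using smooth_cutoff[OF K(1) opN KN, of n] by metis
  then obtain \<theta> C where \<theta>: "!!n. smooth (\<theta> n)" "!!n x. 0 <= \<theta> n x" "!!n x. \<theta> n x <= (1::real)" "!!n. C n <= N n"
    "!!n x. x ~: C n ==> \<theta> n x = 0" "!!n x. x : K ==> \<theta> n x = 1" by metis
  define \<phi> where "\<phi> n z = complex_of_real (\<theta> n z) * complex_of_real (\<theta>0 z)" for n z
  have t0: "test_function U (%z. complex_of_real (\<theta>0 z))"
   by (rule test_functionI[OF smooth_of_real[OF \<theta>0(1)] \<theta>0(4,5)]) (use \<theta>0 in auto)
  have t: "test_function U (\<phi> n)" for n
   unfolding \<phi>_def[abs_def] by (intro test_function_mult t0 smooth_of_real \<theta>)
  have fm: "f : lmeas U" using f by (simp add: Lp_loc_def)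
  have "(%n. LINT z|lebesgue_on U. f z * \<phi> n z) \<longlonglongrightarrow> (LINT z|lebesgue_on U. indicator K z * f z)"
  proof (rule integral_dominated_convergence[where w = "%z. norm (f z * complex_of_real (\<theta>0 z))"])
   show "integrable (lebesgue_on U) (%z. norm (f z * complex_of_real (\<theta>0 z)))"
    by (intro integrable_norm pairing_integrable U f t0)
   show "(%z. f z * \<phi> n z) : lmeas U" for n
    using pairing_integrable[OF U f t] by auto
   have [measurable]: "K : sets borel" using K(1) by (rule borel_compact)
   have "(%z. indicator K z :: complex) : lmeas U"
    by (intro borel_imp_measurable_on) measurable
   thus "(%z. indicator K z * f z) : lmeas U" using fm by measurable
   show "AE z in lebesgue_on U. norm (f z * \<phi> n z) <= norm (f z * complex_of_real (\<theta>0 z))" for n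
    using \<theta>(2,3) \<theta>0(2) by (intro AE_I2) (auto simp: \<phi>_def norm_mult abs_of_nonneg mult_left_mono mult_left_le_one_le)
   show "AE z in lebesgue_on U. (%n. f z * \<phi> n z) \<longlonglongrightarrow> indicator K z * f z"
   proof (rule AE_I2)
    fix z
    show "(%n. f z * \<phi> n z) \<longlonglongrightarrow> indicator K z * f z"
    proof (cases "z : K")
     case True thus ?thesis using \<theta>(6) \<theta>0(7) by (simp add: \<phi>_def)
    next
     case False
     hence "infdist z K > 0" using in_closed_iff_infdist_zero[OF compact_imp_closed[OF K(1)] \<open>K ~= {}\<close>, of z]
      by (metis infdist_nonneg order_le_less)
     then obtain m where m: "inverse (real (Suc m)) < infdist z K" using reals_Archimedean by blast
     have "\<phi> n z = 0" if "n >= m" for n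
     proof -
      have "inverse (real (Suc n)) <= inverse (real (Suc m))" using that by (intro le_imp_inverse_le) auto
      hence "~ infdist z K < inverse (real (Suc n))" using m by linarith
      hence "z ~: N n" by (simp add: N_def)
      thus ?thesis using \<theta>(4,5) by (auto simp: \<phi>_def)
     qed
     hence "eventually (%n. 0 = f z * \<phi> n z) sequentially" by (auto simp: eventually_sequentially)
     thus ?thesis using False by (simp add: tendsto_eventually eventually_mono)
    qed
   qed
  qed
  thus ?thesis using 0[OF t] by (simp add: pairing_def LIMSEQ_const_iff)
 qed simp
qed

lemma pairing_eq_0_imp_AE_Re:
 assumes U: "open U" and f: "Lp_loc 1 U f" and 0: "!!\<phi>. test_function U \<phi> ==> pairing U f \<phi> = 0"
 shows "AE z in lebesgue_on U. ~ 0 < Re (f z)"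
proof -
 have UL: "U : sets lebesgue" using U by auto
 have fm: "f : lmeas U" using f by (simp add: Lp_loc_def)
 have "{z : space (lebesgue_on U). 0 < Re (f z)} : sets (lebesgue_on U)" using fm by measurable
 hence "{z:U. 0 < Re (f z)} : sets (lebesgue_on U)" by (simp only: space_restrict_space space_completion space_lborel space_borel Int_UNIV_right)
 moreover have "U Int space lebesgue : sets lebesgue" using UL by simp
 ultimately have SL: "{z:U. 0 < Re (f z)} : sets lebesgue" using sets_restrict_space_iff by blast
 obtain C T where CT: "fsigma C" "T : null_sets lebesgue" "C Un T = {z:U. 0 < Re (f z)}"
  by (rule lebesgue_set_almost_fsigma[OF SL])
 have comp: "K : null_sets lebesgue" if K: "compact K" "K <= {z:U. 0 < Re (f z)}" for K
 proof -
  have KU: "K <= U" using K by auto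
  obtain \<theta> C where \<theta>: "smooth \<theta>" "compact C" "C <= U" "!!x. x ~: C ==> \<theta> x = (0::real)" "!!x. x : K ==> \<theta> x = 1"
   using smooth_cutoff[OF K(1) U KU] by metis
  have t: "test_function U (%z. complex_of_real (\<theta> z))"
   by (rule test_functionI[OF smooth_of_real[OF \<theta>(1)] \<theta>(2,3)]) (use \<theta> in auto)
  have Km [measurable]: "K : sets borel" using K(1) by (rule borel_compact)
  have [measurable]: "(%z. indicator K z :: complex) : lmeas U"
   by (intro borel_imp_measurable_on) measurable
  have [measurable]: "f : lmeas U" by (rule fm)
  have int: "integrable (lebesgue_on U) (%z. indicator K z * f z)"
  proof (rule Bochner_Integration.integrable_bound[OF pairing_integrable[OF U f t]])
   show "AE z in lebesgue_on U. norm (indicator K z * f z) <= norm (f z * complex_of_real (\<theta> z))"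
    using \<theta>(5) by (intro AE_I2) (auto simp: indicator_def)
  qed measurable
  have "(LINT z|lebesgue_on U. Re (indicator K z * f z)) = 0"
   using pairing_compact_eq_0[OF U f 0 K(1) KU] integral_Re[OF int] by simp
  moreover have nn: "0 <= Re (indicator K z * f z)" for z using K(2) by (auto simp: indicator_def less_imp_le)
  ultimately have "AE z in lebesgue_on U. Re (indicator K z * f z) = 0"
   using integral_nonneg_eq_0_iff_AE[OF integrable_Re[OF int] AE_I2[OF nn]] by blast
  hence "AE z in lborel. z : U --> Re (indicator K z * f z) = 0" by (simp add: AE_on_iff UL)
  hence "AE z in lborel. z ~: K"
  proof eventually_elim
   case (elim z)
   thus ?case using K(2) by (auto simp: indicator_def)
  qed
  hence "K : null_sets lborel" using Km by (simp add: AE_iff_null_sets)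
  thus ?thesis by (simp add: null_sets_completionI)
 qed
 have "C : null_sets lebesgue"
 proof -
  obtain A where A: "!!n::nat. closed (A n)" "C = \<Union>(range A)" using CT(1) by (auto elim: fsigma.cases)
  have UN: "(\<Union>m::nat. cball (0::complex^'a) (real m)) = UNIV"
   using real_arch_simple by auto
  have "A n Int cball 0 (real m) : null_sets lebesgue" for n m
  proof (rule comp)
   show "compact (A n Int cball 0 (real m))" using A(1) by (simp add: closed_Int_compact)
   show "A n Int cball 0 (real m) <= {z:U. 0 < Re (f z)}" using A(2) CT(3) by blast
  qed
  hence "(\<Union>n. \<Union>m. A n Int cball 0 (real m)) : null_sets lebesgue" by (intro null_sets_UN)
  thus ?thesis using A(2) UN by simp
 qed
 hence "{z:U. 0 < Re (f z)} : null_sets lebesgue" using CT by (metis null_sets.Un)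
 from AE_not_in[OF this] have "AE z in lebesgue. z : U --> ~ 0 < Re (f z)" by eventually_elim auto
 thus ?thesis using UL by (simp add: AE_on_iff AE_completion_iff)
qed

theorem pairing_eq_0_imp_AE:
 assumes U: "open U" and f: "Lp_loc 1 U f" and 0: "!!\<phi>. test_function U \<phi> ==> pairing U f \<phi> = 0"
 shows "AE z in lebesgue_on U. f z = 0"
proof -
 have *: "AE z in lebesgue_on U. ~ 0 < Re (c * f z)" for c
 proof (rule pairing_eq_0_imp_AE_Re[OF U])
  show "Lp_loc 1 U (%z. c * f z)" using Lp_loc_mult_continuous[OF _ U f, of "%_. c"] by simp
  show "pairing U (%z. c * f z) \<phi> = 0" if "test_function U \<phi>" for \<phi> using 0[OF that] by (simp add: pairing_cmult)
 qed
 show ?thesis using *[of 1] *[of "-1"] *[of \<i>] *[of "-\<i>"]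
  by eventually_elim (auto simp: complex_eq_iff)
qed

section \<open>The distributional operator\<close>

definition form_sign :: "'n::{finite,linorder} => 'n set => complex" where
 "form_sign j K = (- 1) ^ card {i:K. i < j}"

lemma form_sign_square [simp]: "form_sign j K * form_sign j K = 1"
 by (simp add: form_sign_def flip: power_add)

lemma form_sign_swap:
 assumes "i : K" "j : K" "i ~= j"
 shows "form_sign j K * form_sign i (K - {j}) = - (form_sign i K * form_sign j (K - {i}))"
proof -
 have *: "form_sign j K * form_sign i (K - {j}) = - (form_sign i K * form_sign j (K - {i}))"
  if ij: "i < j" "i : K" "j : K" for i j
 proof -
  have "{l : K - {j}. l < i} = {l : K. l < i}" using ij by auto
  hence 1: "form_sign i (K - {j}) = form_sign i K" by (simp add: form_sign_def)
  have "{l : K. l < j} = insert i {l : K - {i}. l < j}" using ij by auto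
  hence "card {l : K. l < j} = Suc (card {l : K - {i}. l < j})" by simp
  hence 2: "form_sign j K = - form_sign j (K - {i})" by (simp add: form_sign_def)
  show ?thesis unfolding 1 2 by simp
 qed
 from assms(3) consider "i < j" | "j < i" by fastforce
 thus ?thesis
 proof cases
  case 1 thus ?thesis using * assms by blast
 next
  case 2 thus ?thesis using *[of j i] assms by (metis minus_minus)
 qed
qed

lemma Lp_forms_iff:
 "f : Lp_forms p q U \<longleftrightarrow> (ALL J. Lp_loc p U (f J)) & (ALL J. card J ~= q --> f J = (%z. 0))"
 by (auto simp: Lp_forms_def measurable_forms_def Lp_loc_def)

lemma dist_dbar_iff:
 assumes U: "open U"
 shows "dist_dbar U q f g \<longleftrightarrow> f : Lp_forms 1 q U & g : Lp_forms 1 (Suc q) U &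
  (ALL K \<phi>. card K = Suc q --> test_function U \<phi> -->
   pairing U (g K) \<phi> = - (\<Sum>j\<in>K. form_sign j K * pairing U (f (K - {j})) (wirtinger_bar j \<phi>)))"
proof -
 have "(LINT z|lebesgue_on U. (\<Sum>j\<in>K. (- 1) ^ card {i:K. i < j} * f (K - {j}) z * wirtinger_bar j \<phi> z))
   = (\<Sum>j\<in>K. form_sign j K * pairing U (f (K - {j})) (wirtinger_bar j \<phi>))"
  if f: "f : Lp_forms 1 q U" and \<phi>: "test_function U \<phi>" for K \<phi>
 proof -
  have "integrable (lebesgue_on U) (%z. f J z * wirtinger_bar j \<phi> z)" for J j
   by (rule pairing_integrable[OF U _ test_function_wirtinger_bar[OF \<phi>]]) (use f in "simp add: Lp_forms_iff")
  thus ?thesis by (simp add: pairing_def form_sign_def mult.assoc)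
 qed
 thus ?thesis unfolding dist_dbar_def by (auto simp: pairing_def)
qed

lemma dist_dbarI:
 assumes "open U" "f : Lp_forms 1 q U" "g : Lp_forms 1 (Suc q) U"
  "!!K \<phi>. card K = Suc q ==> test_function U \<phi> ==>
   pairing U (g K) \<phi> = - (\<Sum>j\<in>K. form_sign j K * pairing U (f (K - {j})) (wirtinger_bar j \<phi>))"
 shows "dist_dbar U q f g"
 using assms dist_dbar_iff by blast

lemma dist_dbarD:
 assumes "open U" "dist_dbar U q f g"
 shows "!!J. Lp_loc 1 U (f J)" "!!J. Lp_loc 1 U (g J)" "!!J. card J ~= q ==> f J = (%z. 0)"
  "!!J. card J ~= Suc q ==> g J = (%z. 0)"
  "!!K \<phi>. card K = Suc q ==> test_function U \<phi> ==>
   pairing U (g K) \<phi> = - (\<Sum>j\<in>K. form_sign j K * pairing U (f (K - {j})) (wirtinger_bar j \<phi>))"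
 using assms dist_dbar_iff unfolding Lp_forms_iff by blast+

lemma dist_dbar_subset:
 assumes "open U" "open V" "V <= U" "dist_dbar U q f g"
 shows "dist_dbar V q f g"
proof (rule dist_dbarI[OF assms(2)])
 note D = dist_dbarD[OF assms(1,4)]
 show "f : Lp_forms 1 q V" "g : Lp_forms 1 (Suc q) V"
  using D Lp_loc_subset[OF _ assms(3)] by (auto simp: Lp_forms_iff)
 show "pairing V (g K) \<phi> = - (\<Sum>j\<in>K. form_sign j K * pairing V (f (K - {j})) (wirtinger_bar j \<phi>))"
  if "card K = Suc q" "test_function V \<phi>" for K \<phi>
  using D(5)[OF that(1) test_function_mono[OF that(2) assms(3)]]
  by (simp add: pairing_subset[OF assms(1-3)] that test_function_wirtinger_bar)
qed

lemma dist_dbar_cong_AE: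
 assumes U: "open U" and D: "dist_dbar U q f g"
  and f': "!!J. AE z in lebesgue_on U. f' J z = f J z" "!!J. card J ~= q ==> f' J = (%z. 0)"
  and g': "!!J. AE z in lebesgue_on U. g' J z = g J z" "!!J. card J ~= Suc q ==> g' J = (%z. 0)"
 shows "dist_dbar U q f' g'"
proof (rule dist_dbarI[OF U])
 note D = dist_dbarD[OF U D]
 show "f' : Lp_forms 1 q U" "g' : Lp_forms 1 (Suc q) U"
  using Lp_loc_cong_AE[OF _ U D(1) f'(1)] Lp_loc_cong_AE[OF _ U D(2) g'(1)] f'(2) g'(2) by (auto simp: Lp_forms_iff)
 have m: "f J : lmeas U" "g J : lmeas U" for J
  using D(1,2) by (auto simp: Lp_loc_def)
 show "pairing U (g' K) \<phi> = - (\<Sum>j\<in>K. form_sign j K * pairing U (f' (K - {j})) (wirtinger_bar j \<phi>))"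
  if "card K = Suc q" "test_function U \<phi>" for K \<phi>
  using D(5)[OF that]
  by (simp add: pairing_cong_AE[OF U m(1) f'(1)] pairing_cong_AE[OF U m(2) g'(1)] that test_function_wirtinger_bar)
qed

lemma dist_dbar_add:
 assumes U: "open U" and D: "dist_dbar U q f g" and D': "dist_dbar U q f' g'"
 shows "dist_dbar U q (%J z. f J z + f' J z) (%J z. g J z + g' J z)"
proof (rule dist_dbarI[OF U])
 note D = dist_dbarD[OF U D] and D' = dist_dbarD[OF U D']
 show "(%J z. f J z + f' J z) : Lp_forms 1 q U" "(%J z. g J z + g' J z) : Lp_forms 1 (Suc q) U"
  using D D' Lp_loc_add[OF order_refl U] by (auto simp: Lp_forms_iff)
 show "pairing U (%z. g K z + g' K z) \<phi> = - (\<Sum>j\<in>K. form_sign j K * pairing U (%z. f (K - {j}) z + f' (K - {j}) z) (wirtinger_bar j \<phi>))"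
  if "card K = Suc q" "test_function U \<phi>" for K \<phi>
  using D(5)[OF that] D'(5)[OF that] D(1,2) D'(1,2)
  by (simp add: pairing_add[OF U] that test_function_wirtinger_bar distrib_left sum.distrib)
qed

lemma dist_dbar_cmult:
 assumes U: "open U" and D: "dist_dbar U q f g"
 shows "dist_dbar U q (%J z. c * f J z) (%J z. c * g J z)"
proof (rule dist_dbarI[OF U])
 note D = dist_dbarD[OF U D]
 show "(%J z. c * f J z) : Lp_forms 1 q U" "(%J z. c * g J z) : Lp_forms 1 (Suc q) U"
  using D Lp_loc_mult_continuous[OF order_refl U _ continuous_on_const[of UNIV c]] by (auto simp: Lp_forms_iff)
 show "pairing U (%z. c * g K z) \<phi> = - (\<Sum>j\<in>K. form_sign j K * pairing U (%z. c * f (K - {j}) z) (wirtinger_bar j \<phi>))"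
  if "card K = Suc q" "test_function U \<phi>" for K \<phi>
  using D(5)[OF that] by (simp add: pairing_cmult sum_distrib_left mult.left_commute)
qed

lemma dist_dbar_zero: "open U ==> dist_dbar U q (%J z. 0) (%J z. 0)"
 by (rule dist_dbarI) (auto simp: Lp_forms_iff Lp_loc_zero)

lemma dist_dbar_unique:
 assumes U: "open U" and D: "dist_dbar U q f g" and D': "dist_dbar U q f g'"
 shows "AE z in lebesgue_on U. g' K z = g K z"
proof (cases "card K = Suc q")
 case True
 note D = dist_dbarD[OF U D] and D' = dist_dbarD[OF U D']
 have n: "Lp_loc 1 U (%z. (-1) * g K z)"
  using Lp_loc_mult_continuous[OF order_refl U D(2) continuous_on_const[of UNIV "-1"]] .
 have "AE z in lebesgue_on U. g' K z + (-1) * g K z = 0"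
 proof (rule pairing_eq_0_imp_AE[OF U Lp_loc_add[OF order_refl U D'(2) n]])
  fix \<phi> assume t: "test_function U \<phi>"
  show "pairing U (%z. g' K z + (-1) * g K z) \<phi> = 0"
   unfolding pairing_add[OF U D'(2) n t] pairing_cmult D(5)[OF True t] D'(5)[OF True t] by simp
 qed
 thus ?thesis by eventually_elim simp
next
 case False
 thus ?thesis using dist_dbarD(4)[OF U D] dist_dbarD(4)[OF U D'] by simp
qed

text \<open>Leibniz rule for the product with a smooth function.\<close>

definition dbar_wedge :: "(complex^'n::{finite,linorder} => complex) => 'n form => 'n form" where
 "dbar_wedge \<theta> f K z = (\<Sum>j\<in>K. form_sign j K * wirtinger_bar j \<theta> z * f (K - {j}) z)"

lemma dist_dbar_mult:
 assumes U: "open U" and D: "dist_dbar U q f g" and \<theta>: "smooth \<theta>"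
 shows "dist_dbar U q (%J z. \<theta> z * f J z) (%J z. \<theta> z * g J z + dbar_wedge \<theta> f J z)"
proof (rule dist_dbarI[OF U])
 note D = dist_dbarD[OF U D]
 have L: "Lp_loc 1 U (%z. h z * f J z)" "Lp_loc 1 U (%z. h z * g J z)" if "smooth h" for h J
  using Lp_loc_mult_continuous[OF order_refl U _ smooth_continuous[OF that]] D(1,2) by auto
 have Lj: "Lp_loc 1 U (%z. form_sign j K * wirtinger_bar j \<theta> z * f J z)" for j J K
  by (rule L(1)) (intro smooth_mult smooth_const smooth_wirtinger_bar \<theta>)
 have Lsum: "Lp_loc 1 U (%z. \<Sum>j\<in>A. form_sign j K * wirtinger_bar j \<theta> z * f (K - {j}) z)" for A K
  by (induction A rule: infinite_finite_induct) (auto simp: Lp_loc_zero intro: Lp_loc_add[OF order_refl U Lj])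
 have Lw: "Lp_loc 1 U (dbar_wedge \<theta> f K)" for K
  using Lsum[of K K] by (simp add: dbar_wedge_def[abs_def])
 show "(%J z. \<theta> z * f J z) : Lp_forms 1 q U" using L(1)[OF \<theta>] D(3) by (simp add: Lp_forms_iff)
 have "dbar_wedge \<theta> f K z = 0" if "card K ~= Suc q" for K z
 proof -
  have "card (K - {j}) ~= q" if "j : K" for j using that \<open>card K ~= Suc q\<close> card_Suc_Diff1[of K j] by auto
  thus ?thesis unfolding dbar_wedge_def using D(3) by (intro sum.neutral) simp
 qed
 thus "(%J z. \<theta> z * g J z + dbar_wedge \<theta> f J z) : Lp_forms 1 (Suc q) U"
  using Lp_loc_add[OF order_refl U L(2)[OF \<theta>] Lw] D(4) by (simp add: Lp_forms_iff)
 fix K :: "'a set" and \<phi> assume K: "card K = Suc q" and t: "test_function U \<phi>"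
 have t': "test_function U (%z. \<theta> z * \<phi> z)" by (rule test_function_mult[OF t \<theta>])
 have wp: "pairing U (f J) (wirtinger_bar j (%z. \<theta> z * \<phi> z)) = pairing U (%z. \<theta> z * f J z) (wirtinger_bar j \<phi>)
   + pairing U (%z. wirtinger_bar j \<theta> z * f J z) \<phi>" for J j
 proof -
  have "wirtinger_bar j (%z. \<theta> z * \<phi> z) = (%z. wirtinger_bar j \<theta> z * \<phi> z + \<theta> z * wirtinger_bar j \<phi> z)"
   by (intro ext wirtinger_bar_mult[OF smooth_has_derivative[OF \<theta>] smooth_has_derivative[OF test_function_smooth[OF t]]])
  moreover have "test_function U (%z. wirtinger_bar j \<theta> z * \<phi> z)" "test_function U (%z. \<theta> z * wirtinger_bar j \<phi> z)"
   by (intro test_function_mult t smooth_wirtinger_bar \<theta> test_function_wirtinger_bar)+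
  ultimately show ?thesis using pairing_add_right[OF U D(1)] by (simp add: pairing_def mult_ac)
 qed
 have "pairing U (%z. \<theta> z * g K z + dbar_wedge \<theta> f K z) \<phi> = pairing U (%z. \<theta> z * g K z) \<phi> + pairing U (dbar_wedge \<theta> f K) \<phi>"
  by (rule pairing_add[OF U L(2)[OF \<theta>] Lw t])
 also have "pairing U (%z. \<theta> z * g K z) \<phi> = pairing U (g K) (%z. \<theta> z * \<phi> z)" by (simp add: pairing_def mult_ac)
 also have "... = - (\<Sum>j\<in>K. form_sign j K * pairing U (f (K - {j})) (wirtinger_bar j (%z. \<theta> z * \<phi> z)))"
  by (rule D(5)[OF K t'])
 also have "... = - (\<Sum>j\<in>K. form_sign j K * pairing U (%z. \<theta> z * f (K - {j}) z) (wirtinger_bar j \<phi>))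
   - (\<Sum>j\<in>K. form_sign j K * pairing U (%z. wirtinger_bar j \<theta> z * f (K - {j}) z) \<phi>)"
  by (simp add: wp distrib_left sum.distrib)
 also have "(\<Sum>j\<in>K. form_sign j K * pairing U (%z. wirtinger_bar j \<theta> z * f (K - {j}) z) \<phi>) = pairing U (dbar_wedge \<theta> f K) \<phi>"
 proof -
  have cm: "pairing U (%z. form_sign j K * wirtinger_bar j \<theta> z * f J z) \<phi> = form_sign j K * pairing U (%z. wirtinger_bar j \<theta> z * f J z) \<phi>" for j J
   by (simp add: pairing_def mult.assoc)
  have "pairing U (%z. \<Sum>j\<in>A. form_sign j K * wirtinger_bar j \<theta> z * f (K - {j}) z) \<phi>
   = (\<Sum>j\<in>A. form_sign j K * pairing U (%z. wirtinger_bar j \<theta> z * f (K - {j}) z) \<phi>)" for A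
  proof (induction A rule: infinite_finite_induct)
   case (insert j A)
   thus ?case by (simp add: pairing_add[OF U Lj Lsum t] cm)
  qed auto
  thus ?thesis by (simp add: dbar_wedge_def[abs_def])
 qed
 finally show "pairing U (%z. \<theta> z * g K z + dbar_wedge \<theta> f K z) \<phi>
   = - (\<Sum>j\<in>K. form_sign j K * pairing U (%z. \<theta> z * f (K - {j}) z) (wirtinger_bar j \<phi>))" by simp
qed

lemma wirtinger_bar_commute:
 assumes "smooth \<phi>"
 shows "wirtinger_bar i (wirtinger_bar j \<phi>) = wirtinger_bar j (wirtinger_bar i \<phi>)"
proof
 fix z
 have D: "dir_deriv (wirtinger_bar j \<phi>) v z = (dir_deriv (dir_deriv \<phi> (axis j 1)) v z + \<i> * dir_deriv (dir_deriv \<phi> (axis j \<i>)) v z) / 2" for j v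
 proof -
  have "((%z. (1/2) * (dir_deriv \<phi> (axis j 1) z + \<i> * dir_deriv \<phi> (axis j \<i>) z)) has_derivative
    (%v. (1/2) * (dir_deriv (dir_deriv \<phi> (axis j 1)) v z + \<i> * dir_deriv (dir_deriv \<phi> (axis j \<i>)) v z))) (at z)"
   by (intro has_derivative_mult_right has_derivative_add smooth_has_derivative smooth_dir_deriv assms)
  from frechet_derivative_eq[OF this] show ?thesis by (simp add: wirtinger_bar_def[abs_def])
 qed
 have sym: "dir_deriv (dir_deriv \<phi> (axis i a)) (axis j b) z = dir_deriv (dir_deriv \<phi> (axis j b)) (axis i a) z" for a b
  by (rule dir_deriv_symmetric[OF assms])
 show "wirtinger_bar i (wirtinger_bar j \<phi>) z = wirtinger_bar j (wirtinger_bar i \<phi>) z"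
  unfolding wirtinger_bar_def[of i "wirtinger_bar j \<phi>"] wirtinger_bar_def[of j "wirtinger_bar i \<phi>"] D
  by (simp add: sym field_simps)
qed

lemma dist_dbar_dbar:
 assumes U: "open U" and D: "dist_dbar U q f g"
 shows "dist_dbar U (Suc q) g (%J z. 0)"
proof (rule dist_dbarI[OF U])
 note D = dist_dbarD[OF U D]
 show "g : Lp_forms 1 (Suc q) U" "(%J z. 0) : Lp_forms 1 (Suc (Suc q)) U"
  using D by (auto simp: Lp_forms_iff Lp_loc_zero)
 fix K :: "'a set" and \<phi> assume K: "card K = Suc (Suc q)" and t: "test_function U \<phi>"
 have fK: "finite K" using K card_ge_0_finite by force
 define a where "a i j = (if i = j then 0 else form_sign j K * (form_sign i (K - {j}) * pairing U (f (K - {j} - {i})) (wirtinger_bar i (wirtinger_bar j \<phi>))))" for i j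
 have anti: "a i j = - a j i" if "i : K" "j : K" for i j
 proof (cases "i = j")
  case False
  have "K - {j} - {i} = K - {i} - {j}" by auto
  thus ?thesis using form_sign_swap[OF that False] False
   wirtinger_bar_commute[OF test_function_smooth[OF t], of i j]
   by (simp add: a_def flip: mult.assoc)
 qed (simp add: a_def)
 have "(\<Sum>j\<in>K. form_sign j K * pairing U (g (K - {j})) (wirtinger_bar j \<phi>)) = - (\<Sum>j\<in>K. \<Sum>i\<in>K. a i j)"
 proof -
  have "form_sign j K * pairing U (g (K - {j})) (wirtinger_bar j \<phi>) = - (\<Sum>i\<in>K. a i j)" if j: "j : K" for j
  proof -
   have "card (K - {j}) = Suc q" using K j by (simp add: card_Diff_singleton)
   from D(5)[OF this test_function_wirtinger_bar[OF t]]
   have "form_sign j K * pairing U (g (K - {j})) (wirtinger_bar j \<phi>) = - (\<Sum>i\<in>K - {j}. a i j)"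
    by (simp add: a_def sum_distrib_left)
   also have "(\<Sum>i\<in>K - {j}. a i j) = (\<Sum>i\<in>K. a i j)"
    by (rule sum.mono_neutral_left) (use fK in "auto simp: a_def")
   finally show ?thesis .
  qed
  thus ?thesis by (simp add: sum_negf)
 qed
 moreover have "(\<Sum>j\<in>K. \<Sum>i\<in>K. a i j) = 0"
 proof -
  have "(\<Sum>j\<in>K. \<Sum>i\<in>K. a i j) = (\<Sum>j\<in>K. \<Sum>i\<in>K. - a j i)" by (intro sum.cong refl anti)
  also have "... = - (\<Sum>i\<in>K. \<Sum>j\<in>K. a j i)" by (subst sum.swap) (simp add: sum_negf)
  finally show ?thesis by simp
 qed
 ultimately show "pairing U (%z. 0) \<phi> = - (\<Sum>j\<in>K. form_sign j K * pairing U (g (K - {j})) (wirtinger_bar j \<phi>))" by simp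
qed

text \<open>The condition is local: a test function is a finite sum of test functions with small
  supports.\<close>

lemma test_function_decompose:
 assumes U: "open U" and t: "test_function U \<phi>" and loc: "!!x. x : U ==> EX V. open V & x : V & V <= U & P V"
 obtains A \<psi> where "finite A" "!!V. V : A ==> open V & V <= U & P V & test_function V (\<psi> V)" "\<phi> = (%z. \<Sum>V\<in>A. \<psi> V z)"
proof -
 obtain K where K: "smooth \<phi>" "compact K" "K <= U" "!!z. z ~: K ==> \<phi> z = 0" using test_functionE[OF t] by blast
 obtain R where R: "!!z. z : K ==> norm z <= R" using compact_imp_bounded[OF K(2)] by (auto simp: bounded_iff)
 define \<V> where "\<V> = {V. open V & V <= U & P V}"
 have cov: "\<Union>(insert (- K) \<V>) = UNIV"
 proof -
  have "x : \<Union>(insert (- K) \<V>)" for x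
   using loc[of x] K(3) by (cases "x : K") (auto simp: \<V>_def)
  thus ?thesis by auto
 qed
 have op: "ALL V:insert (- K) \<V>. open V" using K(2) compact_imp_closed by (auto simp: \<V>_def open_Compl)
 obtain \<theta> where \<theta>: "!!V. V : insert (- K) \<V> ==> smooth (\<theta> V)"
  "!!V. V : insert (- K) \<V> ==> closure {x. \<theta> V x ~= 0} <= V"
  "!!R. finite {V:insert (- K) \<V>. EX x:cball 0 R. \<theta> V x ~= 0}"
  "!!F x. finite F ==> F <= insert (- K) \<V> ==> (!!V. V : insert (- K) \<V> ==> \<theta> V x ~= 0 ==> V : F) ==> (\<Sum>V\<in>F. \<theta> V x) = (1::real)"
  by (rule smooth_partition_of_unity[OF op cov]) blast
 define F where "F = {V:insert (- K) \<V>. EX x:cball 0 R. \<theta> V x ~= 0}"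
 define \<psi> where "\<psi> V z = complex_of_real (\<theta> V z) * \<phi> z" for V z
 show thesis
 proof (rule that[of "F Int \<V>" \<psi>])
  show "finite (F Int \<V>)" using \<theta>(3) by (simp add: F_def)
  show "open V & V <= U & P V & test_function V (\<psi> V)" if V: "V : F Int \<V>" for V
  proof -
   have V': "V : insert (- K) \<V>" using V by auto
   have "test_function V (\<psi> V)"
   proof (rule test_functionI)
    show "smooth (\<psi> V)" unfolding \<psi>_def[abs_def] by (intro smooth_mult smooth_of_real \<theta>(1) V' K(1))
    show "compact (K Int closure {x. \<theta> V x ~= 0})" by (intro compact_Int_closed K(2)) simp
    show "K Int closure {x. \<theta> V x ~= 0} <= V" using \<theta>(2)[OF V'] by blast
    show "\<psi> V z = 0" if "z ~: K Int closure {x. \<theta> V x ~= 0}" for z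
     using that K(4)[of z] subsetD[OF closure_subset, of z "{x. \<theta> V x ~= 0}"] by (auto simp: \<psi>_def)
   qed
   thus ?thesis using V by (auto simp: \<V>_def)
  qed
  show "\<phi> = (%z. \<Sum>V\<in>F Int \<V>. \<psi> V z)"
  proof
   fix z
   show "\<phi> z = (\<Sum>V\<in>F Int \<V>. \<psi> V z)"
   proof (cases "z : K")
    case True
    have out: "\<theta> (- K) z = 0"
     using \<theta>(2)[of "- K"] True subsetD[OF closure_subset, of z "{x. \<theta> (- K) x ~= 0}"] by auto
    have "(\<Sum>V\<in>F Int \<V>. \<theta> V z) = 1"
    proof (rule \<theta>(4))
     show "finite (F Int \<V>)" using \<theta>(3) by (simp add: F_def)
     show "V : F Int \<V>" if "V : insert (- K) \<V>" "\<theta> V z ~= 0" for V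
      using that out True R by (auto simp: F_def)
    qed auto
    hence "(\<Sum>V\<in>F Int \<V>. complex_of_real (\<theta> V z)) = 1" by (simp flip: of_real_sum)
    thus ?thesis unfolding \<psi>_def sum_distrib_right[symmetric] by simp
   qed (simp add: \<psi>_def K(4))
  qed
 qed
qed

lemma wirtinger_bar_sum:
 assumes "!!i. i : A ==> smooth (\<psi> i)"
 shows "wirtinger_bar j (%z. \<Sum>i\<in>A. \<psi> i z) = (%z. \<Sum>i\<in>A. wirtinger_bar j (\<psi> i) z)"
proof
 fix z
 have "((%z. \<Sum>i\<in>A. \<psi> i z) has_derivative (%v. \<Sum>i\<in>A. dir_deriv (\<psi> i) v z)) (at z)"
  by (intro has_derivative_sum smooth_has_derivative assms)
 from wirtinger_bar_eq[OF this, of j]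
 show "wirtinger_bar j (%z. \<Sum>i\<in>A. \<psi> i z) z = (\<Sum>i\<in>A. wirtinger_bar j (\<psi> i) z)"
  by (simp add: wirtinger_bar_def sum_distrib_left sum.distrib sum_divide_distrib add_divide_distrib)
qed

lemma dist_dbar_local:
 assumes U: "open U" and loc: "!!x. x : U ==> EX V. open V & x : V & V <= U & dist_dbar V q f g"
  and fg: "!!J. card J ~= q ==> f J = (%z. 0)" "!!J. card J ~= Suc q ==> g J = (%z. 0)"
 shows "dist_dbar U q f g"
proof (rule dist_dbarI[OF U])
 have "Lp_loc 1 U (f J)" "Lp_loc 1 U (g J)" for J
  using Lp_loc_local[OF order_refl U] loc dist_dbarD(1,2) by meson+
 hence L: "Lp_loc 1 U (f J)" "Lp_loc 1 U (g J)" for J by auto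
 show "f : Lp_forms 1 q U" "g : Lp_forms 1 (Suc q) U" using L fg by (auto simp: Lp_forms_iff)
 fix K :: "'a set" and \<phi> assume K: "card K = Suc q" and t: "test_function U \<phi>"
 obtain A \<psi> where A: "finite A" "!!V. V : A ==> open V & V <= U & dist_dbar V q f g & test_function V (\<psi> V)"
   and eq: "\<phi> = (%z. \<Sum>V\<in>A. \<psi> V z)"
  using test_function_decompose[OF U t, of "%V. dist_dbar V q f g"] loc by metis
 have tU: "test_function U (\<psi> V)" if "V : A" for V using A(2)[OF that] test_function_mono by blast
 have each: "pairing U (g K) (\<psi> V) = - (\<Sum>j\<in>K. form_sign j K * pairing U (f (K - {j})) (wirtinger_bar j (\<psi> V)))"
  if V: "V : A" for V
 proof -
  have V': "open V" "V <= U" "dist_dbar V q f g" "test_function V (\<psi> V)" using A(2)[OF V] by auto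
  show ?thesis using dist_dbarD(5)[OF V'(1,3) K V'(4)]
   by (simp add: pairing_subset[OF U V'(1,2)] V'(4) test_function_wirtinger_bar)
 qed
 have wb: "wirtinger_bar j \<phi> = (%z. \<Sum>V\<in>A. wirtinger_bar j (\<psi> V) z)" for j
  unfolding eq by (rule wirtinger_bar_sum) (use tU test_function_smooth in blast)
 have "pairing U (g K) \<phi> = (\<Sum>V\<in>A. pairing U (g K) (\<psi> V))" unfolding eq by (rule pairing_sum_right[OF U L(2) tU])
 also have "... = - (\<Sum>j\<in>K. form_sign j K * (\<Sum>V\<in>A. pairing U (f (K - {j})) (wirtinger_bar j (\<psi> V))))"
  by (simp add: each sum_negf sum_distrib_left) (rule sum.swap)
 also have "... = - (\<Sum>j\<in>K. form_sign j K * pairing U (f (K - {j})) (wirtinger_bar j \<phi>))"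
  unfolding wb by (subst pairing_sum_right[OF U L(1)]) (use tU test_function_wirtinger_bar in blast)+
 finally show "pairing U (g K) \<phi> = - (\<Sum>j\<in>K. form_sign j K * pairing U (f (K - {j})) (wirtinger_bar j \<phi>))" .
qed

section \<open>Holomorphic functions of several variables\<close>

lemma smult_axis: "c *s axis j a = axis j (c * a)" for c a :: complex
 by (simp add: axis_def vec_eq_iff)

lemma complex_linear_iff:
 fixes L :: "complex^'n::finite => complex"
 assumes L: "linear L"
 shows "(ALL c v. L (c *s v) = c * L v) \<longleftrightarrow> (ALL j. L (axis j \<i>) = \<i> * L (axis j 1))"
proof
 assume "ALL c v. L (c *s v) = c * L v"
 thus "ALL j. L (axis j \<i>) = \<i> * L (axis j 1)" by (metis smult_axis mult.right_neutral)
next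
 assume *: "ALL j. L (axis j \<i>) = \<i> * L (axis j 1)"
 have ax: "L (axis j a) = a * L (axis j 1)" for j a
 proof -
  have "axis j a = Re a *\<^sub>R axis j 1 + Im a *\<^sub>R (axis j \<i> :: complex^'n)"
   by (auto simp: axis_def vec_eq_iff complex_eq_iff)
  hence "L (axis j a) = Re a *\<^sub>R L (axis j 1) + Im a *\<^sub>R L (axis j \<i>)"
   by (simp add: linear_add[OF L] linear_scale[OF L])
  also have "... = a * L (axis j 1)" using * by (simp add: scaleR_conv_of_real algebra_simps complex_eq_iff)
  finally show ?thesis .
 qed
 have "v = (\<Sum>j\<in>UNIV. axis j (v $ j))" for v :: "complex^'n"
  by (simp add: vec_eq_iff axis_def)
 hence exp: "L v = (\<Sum>j\<in>UNIV. v $ j * L (axis j 1))" for v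
  by (metis (no_types, lifting) L ax linear_sum sum.cong)
 show "ALL c v. L (c *s v) = c * L v"
 proof (intro allI)
  fix c v show "L (c *s v) = c * L v"
   unfolding exp[of "c *s v"] exp[of v] by (simp add: sum_distrib_left mult.assoc)
 qed
qed

lemma holomorphic_n_wirtinger_bar:
 assumes "smooth h" "!!z j. z : U ==> wirtinger_bar j h z = 0"
 shows "holomorphic_n U h"
 unfolding holomorphic_n_def
proof (intro ballI exI conjI)
 fix z assume z: "z : U"
 show D: "(h has_derivative frechet_derivative h (at z)) (at z)" by (rule smooth_has_derivative[OF assms(1)])
 have "dir_deriv h (axis j \<i>) z = \<i> * dir_deriv h (axis j 1) z" for j
 proof -
  have "dir_deriv h (axis j 1) z + \<i> * dir_deriv h (axis j \<i>) z = 0"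
   using assms(2)[OF z, of j] by (simp add: wirtinger_bar_def)
  hence "\<i> * (dir_deriv h (axis j 1) z + \<i> * dir_deriv h (axis j \<i>) z) = 0" by simp
  thus ?thesis by (simp add: distrib_left flip: mult.assoc)
 qed
 thus "ALL c v. dir_deriv h (c *s v) z = c * dir_deriv h v z"
  using complex_linear_iff[OF has_derivative_linear[OF D]] by blast
qed

lemma holomorphic_n_continuous: "holomorphic_n U h ==> continuous_on U h"
 unfolding holomorphic_n_def
 by (meson continuous_at_imp_continuous_on has_derivative_continuous)

lemma holomorphic_n_subset: "holomorphic_n U h ==> V <= U ==> holomorphic_n V h"
 by (auto simp: holomorphic_n_def)

lemma compact_collar:
 fixes K U :: "'a::euclidean_space set"
 assumes "compact K" "open U" "K <= U"
 shows "EX e>0. compact {x + y |x y. x : K & y : cball 0 e} & {x + y |x y. x : K & y : cball 0 e} <= U"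
proof -
 obtain e where e: "e > 0" "(\<Union>x\<in>K. cball x e) <= U"
  using compact_subset_open_imp_cball_epsilon_subset[OF assms] by metis
 have "x + y : cball x e" if "y : cball 0 e" for x y :: 'a using that by (simp add: dist_norm)
 hence "{x + y |x y. x : K & y : cball 0 e} <= U" using e(2) by blast
 thus ?thesis using e(1) compact_sums[OF assms(1) compact_cball] by blast
qed

text \<open>Cauchy's inequality on discs in the coordinate directions bounds the first derivatives.\<close>

lemma holomorphic_n_derivative_bounded:
 fixes h :: "complex^'n::finite => complex"
 assumes h: "holomorphic_n U h" and U: "open U" and K: "compact K" "K <= U"
 shows "EX B. ALL z:K. ALL L. (h has_derivative L) (at z) --> norm (L (axis j 1)) <= B"
proof -
 obtain e where e: "e > 0" "compact {x + y |x y. x : K & y : cball 0 e}" "{x + y |x y. x : K & y : cball 0 e} <= U"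
  using compact_collar[OF K(1) U K(2)] by blast
 have "bounded (h ` {x + y |x y. x : K & y : cball 0 e})"
  using holomorphic_n_continuous[OF h] e by (intro compact_imp_bounded compact_continuous_image) (auto intro: continuous_on_subset)
 then obtain M where M: "!!x y. x : K ==> y : cball 0 e ==> norm (h (x + y)) <= M"
  by (auto simp: bounded_iff)
 have "norm (L (axis j 1)) <= M / e" if z: "z : K" and L: "(h has_derivative L) (at z)" for z L
 proof -
  define g where "g \<zeta> = h (z + axis j \<zeta>)" for \<zeta>
  have inU: "z + axis j \<zeta> : U" if "norm \<zeta> <= e" for \<zeta>
  proof -
   have "axis j \<zeta> : cball 0 e" using that by (simp add: norm_axis_complex)
   thus ?thesis using e(3) z by blast
  qed
  have bl: "bounded_linear (%\<zeta>::complex. axis j \<zeta> :: complex^'n)"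
  proof (rule bounded_linear_intro[where K = 1])
   show "norm (axis j \<zeta> :: complex^'n) <= norm \<zeta> * 1" for \<zeta> :: complex by (simp add: norm_axis_complex)
  qed (auto simp: axis_def vec_eq_iff)
  have gD: "(g has_field_derivative L' (axis j 1)) (at \<zeta>)"
   if L': "(h has_derivative L') (at (z + axis j \<zeta>))" "ALL c v. L' (c *s v) = c * L' v" for L' \<zeta>
  proof -
   have "((%\<zeta>. z + axis j \<zeta>) has_derivative (%\<zeta>. axis j \<zeta>)) (at \<zeta>)"
    using has_derivative_add[OF has_derivative_const bounded_linear_imp_has_derivative[OF bl]] by simp
   from has_derivative_compose[OF this L'(1)]
   have "(g has_derivative (%\<zeta>. L' (axis j \<zeta>))) (at \<zeta>)" by (simp add: g_def[abs_def])
   moreover have "(%\<zeta>. L' (axis j \<zeta>)) = (*) (L' (axis j 1))"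
      proof
        fix \<xi> show "L' (axis j \<xi>) = L' (axis j 1) * \<xi>"
          using L'(2) smult_axis[of \<xi> j 1] by (metis mult.commute mult.right_neutral)
      qed
      ultimately show ?thesis unfolding has_field_derivative_def by (simp only:)
    qed
    have gf: "\<exists>d. (g has_field_derivative d) (at \<zeta>)" if "norm \<zeta> \<le> e" for \<zeta>
      using h inU[OF that] gD unfolding holomorphic_n_def by meson
    have "norm ((deriv ^^ 1) g 0) \<le> fact 1 * M / e ^ 1"
    proof (rule Cauchy_inequality)
      show "g holomorphic_on ball 0 e"
        unfolding holomorphic_on_def field_differentiable_def
        using gf by (meson has_field_derivative_at_within less_imp_le mem_ball_0)
      show "continuous_on (cball 0 e) g"
        using gf by (meson DERIV_isCont continuous_at_imp_continuous_on mem_cball_0)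
      show "norm (g \<zeta>) \<le> M" if "norm (0 - \<zeta>) = e" for \<zeta>
        unfolding g_def using M[OF z, of "axis j \<zeta>"] that by (simp add: norm_axis_complex)
    qed (rule e(1))
    moreover have "deriv g 0 = L (axis j 1)"
    proof -
      obtain L' where L': "(h has_derivative L') (at z)" "\<forall>c v. L' (c *s v) = c * L' v"
        using h K(2) z unfolding holomorphic_n_def by blast
      hence "L' = L" using L has_derivative_unique by blast
      moreover have "z + axis j 0 = z" by (simp add: axis_def vec_eq_iff)
      ultimately have "(g has_field_derivative L (axis j 1)) (at 0)"
        by (intro gD) (use L L'(2) in \<open>simp_all only: simp_thms\<close>)
      thus ?thesis by (rule DERIV_imp_deriv)
    qed
    ultimately show ?thesis by simp
  qed
  thus ?thesis by blast
qed

lemma holomorphic_n_pairing: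
  fixes h :: "complex^'n::finite \<Rightarrow> complex"
  assumes h: "holomorphic_n U h" and U: "open U" and t: "test_function U \<phi>"
  shows "pairing U h (wirtinger_bar j \<phi>) = 0"
proof -
  obtain K where K: "smooth \<phi>" "compact K" "K \<subseteq> U" "\<And>z. z \<notin> K \<Longrightarrow> \<phi> z = 0" using test_functionE[OF t] by blast
  obtain R B where R: "\<And>z. norm z > R \<Longrightarrow> \<phi> z = 0" and B: "\<And>z. norm (\<phi> z) \<le> B"
    using test_function_bounded_support[OF t] by metis
  obtain B2 where B2: "\<And>z v. norm (dir_deriv \<phi> v z) \<le> B2 * norm v"
    using C_1_dir_deriv_bounded[OF smoothD[OF K(1)] R] by blast
  obtain B3 where B3: "\<And>z L. z \<in> K \<Longrightarrow> (h has_derivative L) (at z) \<Longrightarrow> norm (L (axis j 1)) \<le> B3"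
    using holomorphic_n_derivative_bounded[OF h U K(2,3)] by blast
  have "bounded (h ` K)"
    using holomorphic_n_continuous[OF h] K by (intro compact_imp_bounded compact_continuous_image) (auto intro: continuous_on_subset)
  then obtain B1 where B1: "\<And>z. z \<in> K \<Longrightarrow> norm (h z) \<le> B1" by (auto simp: bounded_iff)
  obtain L where L: "\<And>z. z \<in> U \<Longrightarrow> (h has_derivative L z) (at z)" "\<And>z c v. z \<in> U \<Longrightarrow> L z (c *s v) = c * L z v"
    using h unfolding holomorphic_n_def by metis
  define F where "F z = (if z \<in> U then h z * \<phi> z else 0)" for z
  define D where "D z v = (if z \<in> K then h z * dir_deriv \<phi> v z + L z v * \<phi> z else 0)" for z v
  have FD: "(F has_derivative D z) (at z)" for z
  proof (cases "z \<in> K")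
    case True
    hence zU: "z \<in> U" using K by auto
    have "((\<lambda>z. h z * \<phi> z) has_derivative (\<lambda>v. h z * dir_deriv \<phi> v z + L z v * \<phi> z)) (at z)"
      by (rule has_derivative_mult[OF L(1)[OF zU] smooth_has_derivative[OF K(1)]])
    hence "(F has_derivative (\<lambda>v. h z * dir_deriv \<phi> v z + L z v * \<phi> z)) (at z)"
      by (rule has_derivative_transform_within_open[OF _ U zU]) (simp add: F_def)
    thus ?thesis using True by (simp add: D_def[abs_def])
  next
    case False
    have "((\<lambda>_. 0) has_derivative (\<lambda>v. 0)) (at z)" by simp
    hence "(F has_derivative (\<lambda>v. 0)) (at z)"
      by (rule has_derivative_transform_within_open[where s = "- K"])
         (use K False compact_imp_closed in \<open>auto simp: F_def open_Compl\<close>)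
    thus ?thesis using False by (simp add: D_def[abs_def])
  qed
  have Fs: "F z = 0" if "norm z > R" for z using R[OF that] by (simp add: F_def)
  have Db: "norm (D z (axis j c)) \<le> \<bar>B1\<bar> * (\<bar>B2\<bar> * norm c) + (norm c * \<bar>B3\<bar>) * \<bar>B\<bar>" for z c
  proof (cases "z \<in> K")
    case True
    hence zU: "z \<in> U" using K by auto
    have "norm (dir_deriv \<phi> (axis j c) z) \<le> \<bar>B2\<bar> * norm c"
      using B2[of z "axis j c"] by (simp add: norm_axis_complex) (meson abs_ge_self mult_right_mono norm_ge_zero order_trans)
    moreover have "norm (L z (axis j c)) \<le> norm c * \<bar>B3\<bar>"
    proof -
      have "L z (axis j c) = c * L z (axis j 1)" using L(2)[OF zU, of c "axis j 1"] by (simp add: smult_axis)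
      moreover have "norm (L z (axis j 1)) \<le> \<bar>B3\<bar>" using B3[OF True L(1)[OF zU]] by linarith
      ultimately show ?thesis by (simp add: norm_mult mult_left_mono)
    qed
    moreover have "norm (h z) \<le> \<bar>B1\<bar>" "norm (\<phi> z) \<le> \<bar>B\<bar>" using B1[OF True] B[of z] by linarith+
    ultimately have "norm (h z * dir_deriv \<phi> (axis j c) z) + norm (L z (axis j c) * \<phi> z) \<le> \<bar>B1\<bar> * (\<bar>B2\<bar> * norm c) + (norm c * \<bar>B3\<bar>) * \<bar>B\<bar>"
      unfolding norm_mult by (intro add_mono mult_mono) auto
    thus ?thesis using True norm_triangle_ineq order_trans unfolding D_def by (smt (verit))
  qed (simp add: D_def)
  note I = integral_directional_derivative_eq_0[OF FD Fs Db]
  have "D z (axis j 1) + \<i> * D z (axis j \<i>) = 2 * (indicator U z *\<^sub>R (h z * wirtinger_bar j \<phi> z))" for z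
  proof (cases "z \<in> K")
    case True
    hence zU: "z \<in> U" using K by auto
    have "L z (axis j \<i>) = \<i> * L z (axis j 1)" using L(2)[OF zU, of \<i> "axis j 1"] by (simp add: smult_axis)
    thus ?thesis using True zU by (simp add: D_def wirtinger_bar_def algebra_simps)
  next
    case False
    thus ?thesis using wirtinger_bar_outside_support[OF K(4) compact_imp_closed[OF K(2)] False]
      by (simp add: D_def)
  qed
  hence eq: "(\<lambda>z. D z (axis j 1) + \<i> * D z (axis j \<i>)) = (\<lambda>z. 2 * (indicator U z *\<^sub>R (h z * wirtinger_bar j \<phi> z)))" by auto
  have "(LINT z|lborel. D z (axis j 1) + \<i> * D z (axis j \<i>)) = 0"
    using I by simp
  hence "2 * (LINT z|lborel. indicator U z *\<^sub>R (h z * wirtinger_bar j \<phi> z)) = 0"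
    unfolding eq by (subst (asm) integral_mult_right_zero)
  hence 0: "(LINT z|lborel. indicator U z *\<^sub>R (h z * wirtinger_bar j \<phi> z)) = 0"
    unfolding mult_eq_0_iff by (elim disjE) (simp only: zero_neq_numeral[symmetric])
  have "integrable lborel (\<lambda>z. D z (axis j 1) + \<i> * D z (axis j \<i>))" using I by simp
  hence "integrable lborel (\<lambda>z. (1/2) * (2 * (indicator U z *\<^sub>R (h z * wirtinger_bar j \<phi> z))))"
    unfolding eq by (rule integrable_mult_right)
  hence "(\<lambda>z. indicator U z *\<^sub>R (h z * wirtinger_bar j \<phi> z)) \<in> borel_measurable lborel" by (simp add: borel_measurable_integrable)
  from integral_completion[OF this] show ?thesis
    using 0 by (simp add: pairing_def LINT_on open_in_lebesgue U)
qed

text \<open>Weyl's lemma. Cutting off the Bochner-Martinelli kernel near the diagonal gives, for every test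
  function, a representation \<open>\<phi> = \<Sum>\<^sub>j dbar\<^sub>j (S\<^sub>j \<phi>) - \<phi> * \<omega>\<close> with a smooth compactly supported \<open>\<omega>\<close>. A
  function annihilated by all \<open>dbar\<^sub>j\<close> therefore equals its convolution with \<open>- \<omega>\<close>.\<close>

theorem dbar_closed_imp_holomorphic:
  fixes f :: "complex^'n::finite \<Rightarrow> complex"
  assumes U: "open U" "x \<in> U" and f: "Lp_loc 1 U f"
    and 0: "\<And>j \<phi>. test_function U \<phi> \<Longrightarrow> pairing U f (wirtinger_bar j \<phi>) = 0"
  shows "\<exists>W h. open W \<and> x \<in> W \<and> W \<subseteq> U \<and> holomorphic_n W h \<and> (AE z in lebesgue_on W. f z = h z)"
proof -
  let ?n = "CARD('n)"
  obtain e where e: "e > 0" "cball x (2 * e) \<subseteq> U"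
  proof -
    obtain d where "d > 0" "cball x d \<subseteq> U" using U open_contains_cball by blast
    thus thesis by (intro that[of "d / 2"]) auto
  qed
  have fm: "f \<in> lmeas U" using f by (simp add: Lp_loc_def)
  obtain f1 where f1: "f1 \<in> borel_measurable borel" "AE z in lebesgue_on U. f1 z = f z"
    using borel_representative[OF open_in_lebesgue[OF U(1)] fm] by metis
  define f2 where "f2 z = indicator (cball x (2 * e)) z * f1 z" for z
  have f2m [measurable]: "f2 \<in> borel_measurable borel" unfolding f2_def using f1(1) by measurable
  have Lf1: "Lp_loc 1 U f1" by (rule Lp_loc_cong_AE[OF order_refl U(1) f f1(2)])
  have f2i: "integrable lborel f2"
  proof (rule integrableI_bounded)
    have "(NN z. ennreal (norm (f1 z) powr enn2real 1) * indicator (cball x (2 * e)) z) < \<infinity>"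
      using Lp_locD[OF Lf1 compact_cball e(2)] by simp
    moreover have "ennreal (norm (f2 z)) = ennreal (norm (f1 z) powr enn2real 1) * indicator (cball x (2 * e)) z" for z
      by (simp add: f2_def indicator_def)
    ultimately show "(NN z. ennreal (norm (f2 z))) < \<infinity>" by simp
  qed measurable
  define W where "W = ball x e"
  have W: "open W" "x \<in> W" "W \<subseteq> U" using e by (auto simp: W_def)
  have e2: "cball (0::complex^'n) (e/2) \<subseteq> ball 0 e" "{0::complex^'n} \<subseteq> ball 0 (e/2)" using e by auto
  obtain \<theta> C where \<theta>: "smooth \<theta>" "compact C" "C \<subseteq> ball (0::complex^'n) e" "\<And>w. w \<notin> C \<Longrightarrow> \<theta> w = (0::real)" "\<And>w. w \<in> cball 0 (e/2) \<Longrightarrow> \<theta> w = 1"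
      "\<And>w. 0 \<le> \<theta> w" "\<And>w. \<theta> w \<le> 1"
    by (rule smooth_cutoff[OF compact_cball open_ball e2(1)]) blast
  have cs: "compact {0::complex^'n}" by simp
  obtain \<theta>2 C2 where \<theta>2: "smooth \<theta>2" "compact C2" "C2 \<subseteq> ball (0::complex^'n) (e/2)" "\<And>w. w \<notin> C2 \<Longrightarrow> \<theta>2 w = (0::real)" "\<And>w. w \<in> {0} \<Longrightarrow> \<theta>2 w = 1"
      "\<And>w. 0 \<le> \<theta>2 w"
    by (rule smooth_cutoff[OF cs open_ball e2(2)]) blast
  define \<Theta> where "\<Theta> w = complex_of_real (\<theta> w)" for w
  have T_smooth: "smooth \<Theta>" unfolding \<Theta>_def[abs_def] by (rule smooth_of_real[OF \<theta>(1)])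
  have T_out: "\<Theta> w = 0" if "w \<notin> C" for w using \<theta>(4)[OF that] by (simp add: \<Theta>_def)
  define c where "c = bm_const TYPE('n)"
  have c: "c > 0" unfolding c_def by (rule bm_const_pos)
  define Dn where "Dn w = complex_of_real ((w \<bullet> w) ^ ?n + \<theta>2 w)" for w
  have Dn0: "Dn w \<noteq> 0" for w
  proof -
    have "(w \<bullet> w) ^ ?n + \<theta>2 w > 0"
    proof (cases "w = 0")
      case True thus ?thesis using \<theta>2(5)[of 0] by (simp add: add_nonneg_pos)
    next
      case False
      hence "(w \<bullet> w) ^ ?n > 0" by simp
      thus ?thesis using \<theta>2(6)[of w] by linarith
    qed
    thus ?thesis unfolding Dn_def by (metis less_irrefl of_real_eq_0_iff)
  qed
  have "smooth (\<lambda>w::complex^'n. complex_of_real (((w - 0) \<bullet> (w - 0)) ^ ?n + \<theta>2 w))"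
    by (intro smooth_of_real smooth_add smooth_power smooth_norm_squared \<theta>2(1))
  hence Dn_smooth: "smooth Dn" by (simp add: Dn_def[abs_def])
  define \<omega> where "\<omega> w = (\<Sum>j\<in>UNIV. wirtinger_bar j \<Theta> w * (cnj (w $ j) * inverse (Dn w))) * of_real (inverse c)" for w
  have cn: "smooth (\<lambda>w::complex^'n. cnj (w $ j))" for j
    by (intro smooth_linear bounded_linear_compose[OF bounded_linear_cnj] bounded_linear_vec_nth)
  have om_smooth: "smooth \<omega>" unfolding \<omega>_def[abs_def]
    by (intro smooth_mult smooth_sum smooth_wirtinger_bar T_smooth cn smooth_inverse Dn_smooth Dn0 smooth_const)
  have wT_out: "wirtinger_bar j \<Theta> w = 0" if "w \<notin> C" for j w
    by (rule wirtinger_bar_outside_support[OF T_out compact_imp_closed[OF \<theta>(2)] that])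
  have om_out: "\<omega> w = 0" if "w \<notin> C" for w using wT_out[OF that] by (simp add: \<omega>_def)
  have wT_in: "wirtinger_bar j \<Theta> w = 0" if "norm w < e/2" for j w
  proof -
    have "((\<lambda>_. 1) has_derivative (\<lambda>_. 0)) (at w)" by simp
    hence "wirtinger_bar j \<Theta> w = wirtinger_bar j (\<lambda>_. 1) w"
      by (rule wirtinger_bar_cong_open[of "ball 0 (e/2)", rotated 3]) (use that \<theta>(5) in \<open>auto simp: \<Theta>_def\<close>)
    thus ?thesis by (simp add: wirtinger_bar_def)
  qed
  have om_eq: "\<omega> w = (\<Sum>j\<in>UNIV. wirtinger_bar j \<Theta> w * bm_kernel w j) * of_real (inverse c)" for w
  proof (cases "norm w < e/2")
    case True thus ?thesis by (simp add: \<omega>_def wT_in)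
  next
    case False
    hence "\<theta>2 w = 0" using \<theta>2(3,4) by (metis mem_ball_0 subsetD)
    hence "Dn w = complex_of_real (norm w ^ (2 * ?n))" by (simp add: Dn_def power_mult power2_norm_eq_inner)
    thus ?thesis by (simp add: \<omega>_def bm_kernel_def divide_inverse)
  qed
  define \<kappa> where "\<kappa> j w = \<Theta> w * bm_kernel w j * of_real (inverse c)" for j w
  have T_meas [measurable]: "\<Theta> \<in> borel_measurable borel"
    by (intro borel_measurable_continuous_onI smooth_continuous T_smooth)
  have \<kappa>i: "integrable lborel (\<kappa> j)" for j
  proof (rule Bochner_Integration.integrable_bound)
    show "integrable lborel (\<lambda>w. inverse c * norm (indicator (cball 0 e) w * bm_kernel w j))"
      by (intro integrable_mult_right integrable_norm bm_kernel_integrable)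
    show "\<kappa> j \<in> borel_measurable lborel" unfolding \<kappa>_def by measurable
    show "AE w in lborel. norm (\<kappa> j w) \<le> norm (inverse c * norm (indicator (cball 0 e) w * bm_kernel w j))"
    proof (rule AE_I2)
      fix w
      show "norm (\<kappa> j w) \<le> norm (inverse c * norm (indicator (cball 0 e) w * bm_kernel w j))"
      proof (cases "w \<in> C")
        case True
        hence "w \<in> cball 0 e" using \<theta>(3) by auto
        moreover have "norm (\<Theta> w) * norm (bm_kernel w j) \<le> 1 * norm (bm_kernel w j)"
          using \<theta>(6,7) by (intro mult_right_mono) (auto simp: \<Theta>_def abs_of_nonneg)
        ultimately show ?thesis using c by (simp add: \<kappa>_def norm_mult norm_inverse mult.commute[of _ "inverse c"])
      qed (simp add: \<kappa>_def T_out)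
    qed
  qed
  define h where "h \<zeta> = - (LINT z|lborel. f2 z * \<omega> (- (\<zeta> - z)))" for \<zeta>
  define \<omega>' where "\<omega>' y = \<omega> (0 + - y)" for y
  have neg: "bounded_linear (\<lambda>y::complex^'n. - y)" by (intro bounded_linear_minus bounded_linear_ident)
  have om'_smooth: "smooth \<omega>'" unfolding \<omega>'_def[abs_def] by (rule smooth_comp_linear[OF om_smooth neg])
  have om'_out: "\<omega>' y = 0" if "norm y > e" for y
    using om_out[of "- y"] \<theta>(3) that by (force simp: \<omega>'_def)
  have h_eq: "h \<zeta> = - (LINT z|lborel. f2 z * \<omega>' (\<zeta> - z))" for \<zeta> by (simp add: h_def \<omega>'_def)
  have idm: "(\<lambda>z::complex^'n. z) \<in> borel_measurable lborel" by simp
  have h_smooth: "smooth h"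
  proof -
    have "smooth (\<lambda>\<zeta>. (- 1) * (LINT z|lborel. f2 z * \<omega>' (\<zeta> - z)))"
      by (intro smooth_mult smooth_const smooth_translate_average[OF f2i idm om'_smooth om'_out])
    thus ?thesis by (simp add: h_eq[abs_def])
  qed
  have f2_pair: "pairing U f \<psi> = (LINT z|lborel. f2 z * \<psi> z)" if s: "smooth \<psi>" and K: "compact K" "K \<subseteq> cball x (2 * e)" "\<And>z. z \<notin> K \<Longrightarrow> \<psi> z = 0" for \<psi> K
  proof -
    have t: "test_function U \<psi>" by (rule test_functionI[OF s K(1) _ K(3)]) (use K(2) e in auto)
    have [measurable]: "\<psi> \<in> borel_measurable borel" by (intro borel_measurable_continuous_onI smooth_continuous s)
    have "pairing U f \<psi> = pairing U f1 \<psi>" by (rule pairing_cong_AE[OF U(1) fm f1(2) t, symmetric])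
    also have "\<dots> = (LINT z|lebesgue. f2 z * \<psi> z)"
      unfolding pairing_def LINT_on[OF open_in_lebesgue[OF U(1)]]
    proof (rule Bochner_Integration.integral_cong[OF refl])
      fix z show "indicator U z *\<^sub>R (f1 z * \<psi> z) = f2 z * \<psi> z"
        using K e by (cases "z \<in> K") (auto simp: f2_def indicator_def)
    qed
    also have "\<dots> = (LINT z|lborel. f2 z * \<psi> z)" by (rule integral_completion) measurable
    finally show ?thesis .
  qed
  have holo: "holomorphic_n W h"
  proof (rule holomorphic_n_wirtinger_bar[OF h_smooth])
    fix \<zeta> j assume z: "\<zeta> \<in> W"
    define \<tau> where "\<tau> z = \<omega> (- \<zeta> + z)" for z
    have t_smooth: "smooth \<tau>" unfolding \<tau>_def[abs_def] by (rule smooth_comp_linear[OF om_smooth bounded_linear_ident])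
    have t_out: "\<tau> z = 0" if "z \<notin> cball \<zeta> e" for z
    proof -
      have "- \<zeta> + z \<notin> C" using \<theta>(3) that by (force simp: dist_norm norm_minus_commute)
      thus ?thesis by (simp add: \<tau>_def om_out)
    qed
    have sub: "cball \<zeta> e \<subseteq> cball x (2 * e)" using z by (simp add: W_def cball_subset_cball_iff dist_commute)
    have wt_out: "wirtinger_bar j \<tau> z = 0" if "z \<notin> cball \<zeta> e" for z
      by (rule wirtinger_bar_outside_support[OF t_out closed_cball that])
    have lin: "linear (frechet_derivative \<omega> (at y))" for y
      using smooth_has_derivative[OF om_smooth] has_derivative_linear by blast
    have d': "dir_deriv \<omega>' v (\<zeta> - z) = - dir_deriv \<tau> v z" for v z
    proof -
      have "((\<lambda>y. 0 + - y) has_derivative (\<lambda>y. - y)) (at (\<zeta> - z))" by (auto intro!: derivative_eq_intros)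
      from has_derivative_compose[OF this smooth_has_derivative[OF om_smooth]]
      have 1: "dir_deriv \<omega>' v (\<zeta> - z) = dir_deriv \<omega> (- v) (0 + - (\<zeta> - z))"
        using frechet_derivative_eq by (fastforce simp: \<omega>'_def[abs_def])
      have "((\<lambda>y. - \<zeta> + y) has_derivative (\<lambda>y. y)) (at z)" by (auto intro!: derivative_eq_intros)
      from has_derivative_compose[OF this smooth_has_derivative[OF om_smooth]]
      have 2: "dir_deriv \<tau> v z = dir_deriv \<omega> v (- \<zeta> + z)"
        using frechet_derivative_eq by (fastforce simp: \<tau>_def[abs_def])
      show ?thesis unfolding 1 2 linear_neg[OF lin] by simp
    qed
    have D0: "((\<lambda>\<zeta>. LINT z|lborel. f2 z * \<omega>' (\<zeta> - z)) has_derivative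
        (\<lambda>v. LINT z|lborel. f2 z * dir_deriv \<omega>' v (\<zeta> - z))) (at \<zeta>)"
      by (rule translate_average_has_derivative[OF f2i idm om'_smooth om'_out])
    from has_derivative_minus[OF this]
    have D: "(h has_derivative (\<lambda>v. LINT z|lborel. f2 z * dir_deriv \<tau> v z)) (at \<zeta>)"
      by (simp add: h_eq[abs_def] d')
    have ii: "integrable lborel (\<lambda>z. f2 z * dir_deriv \<tau> v z)" for v
    proof -
      obtain B where B: "\<And>x. norm (dir_deriv \<tau> v x) \<le> B"
      proof -
        have "\<tau> z = 0" if "norm z > norm \<zeta> + e" for z
          using t_out[of z] that norm_triangle_ineq2[of z \<zeta>] by (simp add: dist_norm norm_minus_commute)
        from C_1_dir_deriv_bounded[OF smoothD[OF t_smooth] this] show thesis using that by blast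
      qed
      have [measurable]: "dir_deriv \<tau> v \<in> borel_measurable borel"
        by (intro borel_measurable_continuous_onI smooth_continuous smooth_dir_deriv t_smooth)
      show ?thesis by (rule integrable_mult_bounded[OF f2i _ B]) measurable
    qed
    have "wirtinger_bar j h \<zeta> = (LINT z|lborel. f2 z * wirtinger_bar j \<tau> z)"
    proof -
      have "wirtinger_bar j h \<zeta> = (LINT z|lborel. (f2 z * dir_deriv \<tau> (axis j 1) z + \<i> * (f2 z * dir_deriv \<tau> (axis j \<i>) z)) / 2)"
        unfolding wirtinger_bar_eq[OF D] using ii by simp
      also have "\<dots> = (LINT z|lborel. f2 z * wirtinger_bar j \<tau> z)"
        by (intro Bochner_Integration.integral_cong refl) (simp add: wirtinger_bar_def field_simps)
      finally show ?thesis .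
    qed
    also have "\<dots> = pairing U f (wirtinger_bar j \<tau>)"
      by (rule f2_pair[OF smooth_wirtinger_bar[OF t_smooth] compact_cball sub wt_out, symmetric])
    also have "\<dots> = 0"
      by (rule 0, rule test_functionI[OF t_smooth compact_cball _ t_out]) (use sub e in auto)
    finally show "wirtinger_bar j h \<zeta> = 0" .
  qed
  have hm [measurable]: "h \<in> borel_measurable borel" by (intro borel_measurable_continuous_onI smooth_continuous h_smooth)
  have Lh: "Lp_loc 1 W h"
    using Lp_loc_mult_continuous[OF order_refl W(1) _ smooth_continuous[OF h_smooth], of "\<lambda>_. 1"]
  proof -
    have one: "Lp_loc 1 W (\<lambda>_. 1)"
    proof (rule Lp_locI)
      fix K :: "(complex^'n) set" assume "compact K"
      hence "K \<in> sets lborel" "emeasure lborel K < \<infinity>" using emeasure_bounded_finite[OF compact_imp_bounded, of K] by (simp_all add: borel_compact)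
      thus "if (1::ennreal) = \<infinity> then \<exists>C. AE z in lborel. z \<in> K \<longrightarrow> norm (1::complex) \<le> C
         else (NN z. ennreal (norm (1::complex) powr enn2real 1) * indicator K z) < \<infinity>" by simp
    qed simp
    show ?thesis using Lp_loc_mult_continuous[OF order_refl W(1) one smooth_continuous[OF h_smooth]] by simp
  qed
  have LfW: "Lp_loc 1 W f" using Lp_loc_subset[OF f W(3)] .
  have mh: "Lp_loc 1 W (\<lambda>z. (- 1) * h z)" using Lp_loc_mult_continuous[OF order_refl W(1) Lh continuous_on_const[of UNIV "-1"]] .
  have "AE z in lebesgue_on W. f z + (- 1) * h z = 0"
  proof (rule pairing_eq_0_imp_AE[OF W(1) Lp_loc_add[OF order_refl W(1) LfW mh]])
    fix \<phi> assume t: "test_function W \<phi>"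
    obtain K where K: "smooth \<phi>" "compact K" "K \<subseteq> W" "\<And>z. z \<notin> K \<Longrightarrow> \<phi> z = 0" using test_functionE[OF t] by blast
    obtain R B where R: "\<And>z. norm z > R \<Longrightarrow> \<phi> z = 0" and B: "\<And>z. norm (\<phi> z) \<le> B"
      using test_function_bounded_support[OF t] by metis
    have phim [measurable]: "\<phi> \<in> borel_measurable borel" by (intro borel_measurable_continuous_onI smooth_continuous K(1))
    define S where "S j z = (LINT w|lborel. \<kappa> j w * \<phi> (z - w))" for j z
    define KC where "KC = {a + b |a b. a \<in> K \<and> b \<in> C}"
    have KC: "compact KC" "KC \<subseteq> cball x (2 * e)"
    proof -
      show "compact KC" unfolding KC_def by (rule compact_sums[OF K(2) \<theta>(2)])
      show "KC \<subseteq> cball x (2 * e)"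
      proof
        fix y assume "y \<in> KC"
        then obtain a b where ab: "y = a + b" "a \<in> K" "b \<in> C" by (auto simp: KC_def)
        have "norm (a - x) < e" "norm b < e" using ab K(3) \<theta>(3) by (auto simp: W_def dist_norm norm_minus_commute)
        hence "norm ((a - x) + b) \<le> 2 * e" using norm_triangle_ineq[of "a - x" b] by linarith
        thus "y \<in> cball x (2 * e)" using ab by (simp add: dist_norm norm_minus_commute algebra_simps)
      qed
    qed
    have zero: "\<kappa> j w * \<phi> (z - w) = 0" "\<phi> (z - w) * \<omega> w = 0" if "z \<notin> KC" for j w z
    proof -
      have "w \<notin> C \<or> z - w \<notin> K"
      proof (rule ccontr)
        assume "\<not> (w \<notin> C \<or> z - w \<notin> K)"
        hence "(z - w) + w \<in> KC" unfolding KC_def by blast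
        thus False using that by simp
      qed
      thus "\<kappa> j w * \<phi> (z - w) = 0" "\<phi> (z - w) * \<omega> w = 0"
        using T_out om_out K(4) by (auto simp: \<kappa>_def)
    qed
    have S_smooth: "smooth (S j)" for j unfolding S_def[abs_def]
      by (rule smooth_translate_average[OF \<kappa>i idm K(1) R])
    have S_out: "S j z = 0" if "z \<notin> KC" for j z unfolding S_def by (simp only: zero(1)[OF that] Bochner_Integration.integral_zero)
    have S_test: "test_function U (S j)" for j
      by (rule test_functionI[OF S_smooth KC(1) _ S_out]) (use KC e in auto)
    have dout: "dir_deriv \<phi> v z = 0" if "norm z > R" for v z
      using dir_deriv_outside_support[of "cball 0 R" \<phi> z] R that by auto
    have ki: "integrable lborel (\<lambda>w. \<kappa> j w * \<psi> (z - w))" if "continuous_on UNIV \<psi>" "\<And>z. norm z > R \<Longrightarrow> \<psi> z = 0" for j \<psi> z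
    proof -
      note \<psi> = that
      obtain B where B: "\<And>x. norm (\<psi> x) \<le> B" using bounded_continuous_support[OF \<psi>] by metis
      have [measurable]: "\<psi> \<in> borel_measurable borel" by (rule borel_measurable_continuous_onI[OF \<psi>(1)])
      show ?thesis by (rule integrable_mult_bounded[OF \<kappa>i _ B]) measurable
    qed
    have wS: "wirtinger_bar j (S j) z = (LINT w|lborel. \<kappa> j w * wirtinger_bar j \<phi> (z - w))" for j z
    proof -
      have "(S j has_derivative (\<lambda>v. LINT w|lborel. \<kappa> j w * dir_deriv \<phi> v (z - w))) (at z)"
        unfolding S_def[abs_def] by (rule translate_average_has_derivative[OF \<kappa>i idm K(1) R])
      from wirtinger_bar_eq[OF this, of j]
      have "wirtinger_bar j (S j) z = (LINT w|lborel. (\<kappa> j w * dir_deriv \<phi> (axis j 1) (z - w) + \<i> * (\<kappa> j w * dir_deriv \<phi> (axis j \<i>) (z - w))) / 2)"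
        using ki[OF smooth_continuous[OF smooth_dir_deriv[OF K(1)]] dout] by simp
      also have "\<dots> = (LINT w|lborel. \<kappa> j w * wirtinger_bar j \<phi> (z - w))"
        by (intro Bochner_Integration.integral_cong refl) (simp add: wirtinger_bar_def field_simps)
      finally show ?thesis .
    qed
    define G where "G z = (LINT w|lborel. \<phi> (z - w) * \<omega> w)" for z
    have key: "(\<Sum>j\<in>UNIV. wirtinger_bar j (S j) z) = \<phi> z + G z" for z
    proof -
      define \<psi> where "\<psi> w = \<phi> (z + - w) * \<Theta> w" for w
      have p1: "smooth (\<lambda>w. \<phi> (z + - w))" by (rule smooth_comp_linear[OF K(1) neg])
      have ps: "smooth \<psi>" unfolding \<psi>_def[abs_def] by (intro smooth_mult p1 T_smooth)
      have pout: "\<psi> w = 0" if "norm w > e" for w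
      proof -
        have "w \<notin> C" using \<theta>(3) that by force
        thus ?thesis by (simp add: \<psi>_def T_out)
      qed
      have lin: "linear (frechet_derivative \<phi> (at y))" for y
        using smooth_has_derivative[OF K(1)] has_derivative_linear by blast
      have w1: "wirtinger_bar j (\<lambda>w. \<phi> (z + - w)) w = - wirtinger_bar j \<phi> (z - w)" for j w
      proof -
        have "((\<lambda>w. z + - w) has_derivative (\<lambda>v. - v)) (at w)" by (auto intro!: derivative_eq_intros)
        from wirtinger_bar_eq[OF has_derivative_compose[OF this smooth_has_derivative[OF K(1)]], of j]
        show ?thesis by (simp add: linear_neg[OF lin] wirtinger_bar_def field_simps)
      qed
      have wp: "wirtinger_bar j \<psi> w = - wirtinger_bar j \<phi> (z - w) * \<Theta> w + \<phi> (z - w) * wirtinger_bar j \<Theta> w" for j w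
        unfolding \<psi>_def wirtinger_bar_mult[OF smooth_has_derivative[OF p1] smooth_has_derivative[OF T_smooth]] w1 by simp
      have "(LINT w|lborel. (\<Sum>j\<in>UNIV. wirtinger_bar j \<psi> w * bm_kernel w j)) = - of_real c * \<phi> z"
      proof -
        have "\<psi> 0 = \<phi> z" using \<theta>(5)[of 0] e by (simp add: \<psi>_def \<Theta>_def)
        thus ?thesis using Bochner_Martinelli[OF ps pout] by (simp add: c_def)
      qed
      hence bm: "(LINT w|lborel. (\<Sum>j\<in>UNIV. wirtinger_bar j \<psi> w * bm_kernel w j) * of_real (inverse c)) = - \<phi> z"
        using c by simp
      have wout: "wirtinger_bar j \<phi> z = 0" if "norm z > R" for j z
        using dout[OF that] by (simp add: wirtinger_bar_def)
      have i1: "integrable lborel (\<lambda>w. \<Sum>j\<in>UNIV. \<kappa> j w * wirtinger_bar j \<phi> (z - w))"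
        by (intro Bochner_Integration.integrable_sum ki smooth_continuous smooth_wirtinger_bar K(1) wout)
      have i2: "integrable lborel (\<lambda>w. \<phi> (z - w) * \<omega> w)"
      proof (rule integrable_continuous_support[where R = e])
        show "continuous_on UNIV (\<lambda>w. \<phi> (z - w) * \<omega> w)"
          using smooth_continuous[OF p1] smooth_continuous[OF om_smooth] by (intro continuous_intros) auto
        show "\<phi> (z - w) * \<omega> w = 0" if "norm w > e" for w
        proof -
          have "w \<notin> C" using \<theta>(3) that by force
          thus ?thesis by (simp add: om_out)
        qed
      qed
      have "(\<Sum>j\<in>UNIV. wirtinger_bar j \<psi> w * bm_kernel w j) * of_real (inverse c)
         = \<phi> (z - w) * \<omega> w - (\<Sum>j\<in>UNIV. \<kappa> j w * wirtinger_bar j \<phi> (z - w))" for w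
        by (simp add: wp om_eq \<kappa>_def sum_distrib_left sum_distrib_right sum_subtractf[symmetric] algebra_simps)
      hence "(LINT w|lborel. \<phi> (z - w) * \<omega> w - (\<Sum>j\<in>UNIV. \<kappa> j w * wirtinger_bar j \<phi> (z - w))) = - \<phi> z"
        using bm by simp
      hence "G z - (LINT w|lborel. (\<Sum>j\<in>UNIV. \<kappa> j w * wirtinger_bar j \<phi> (z - w))) = - \<phi> z"
        using i1 i2 by (simp add: G_def)
      moreover have "(LINT w|lborel. (\<Sum>j\<in>UNIV. \<kappa> j w * wirtinger_bar j \<phi> (z - w))) = (\<Sum>j\<in>UNIV. wirtinger_bar j (S j) z)"
        unfolding wS by (intro Bochner_Integration.integral_sum ki smooth_continuous smooth_wirtinger_bar K(1) wout)
      ultimately show ?thesis by (simp add: algebra_simps)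
    qed
    have G_eq: "G z = (\<Sum>j\<in>UNIV. wirtinger_bar j (S j) z) + (- 1) * \<phi> z" for z using key[of z] by simp
    have G_smooth: "smooth G" unfolding G_eq[abs_def]
      by (intro smooth_add smooth_sum smooth_mult smooth_const smooth_wirtinger_bar S_smooth K(1))
    have G_out: "G z = 0" if "z \<notin> KC" for z unfolding G_def by (simp only: zero(2)[OF that] Bochner_Integration.integral_zero)
    have G_test: "test_function U G"
      by (rule test_functionI[OF G_smooth KC(1) _ G_out]) (use KC e in auto)
    have "0 = (\<Sum>j\<in>UNIV. pairing U f (wirtinger_bar j (S j)))" using 0[OF S_test] by simp
    also have "\<dots> = pairing U f (\<lambda>z. \<Sum>j\<in>UNIV. wirtinger_bar j (S j) z)"
      by (rule pairing_sum_right[OF U(1) f test_function_wirtinger_bar[OF S_test], symmetric])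
    also have "\<dots> = pairing U f \<phi> + pairing U f G"
      unfolding key by (rule pairing_add_right[OF U(1) f test_function_mono[OF t W(3)] G_test])
    finally have sum0: "pairing U f \<phi> + pairing U f G = 0" by simp
    have [measurable]: "\<omega> \<in> borel_measurable borel" by (intro borel_measurable_continuous_onI smooth_continuous om_smooth)
    have om_i: "integrable lborel \<omega>"
      by (rule integrable_continuous_support[OF smooth_continuous[OF om_smooth], of e]) (use om_out \<theta>(3) in force)
    have "pairing U f G = (LINT z|lborel. f2 z * G z)"
      by (rule f2_pair[OF G_smooth KC G_out])
    also have "\<dots> = (LINT z|lborel. f2 z * (LINT w|lborel. \<omega> w * \<phi> (z + - w)))" by (simp add: G_def mult.commute)
    also have "\<dots> = (LINT z|lborel. (LINT w|lborel. \<omega> w * f2 (z - - w)) * \<phi> z)"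
      by (rule translate_average_swap[OF om_i _ f2i phim B, symmetric]) measurable
    also have "\<dots> = (LINT \<zeta>|lborel. - (h \<zeta> * \<phi> \<zeta>))"
    proof (intro Bochner_Integration.integral_cong refl)
      fix \<zeta>
      have "(LINT w|lborel. \<omega> w * f2 (\<zeta> - - w)) = - h \<zeta>"
        using integral_lborel_translate[of "\<lambda>z. f2 z * \<omega> (- (\<zeta> - z))" \<zeta>] by (simp add: h_def mult.commute add.commute)
      thus "(LINT w|lborel. \<omega> w * f2 (\<zeta> - - w)) * \<phi> \<zeta> = - (h \<zeta> * \<phi> \<zeta>)" by simp
    qed
    also have "\<dots> = - pairing W h \<phi>"
    proof -
      have "pairing W h \<phi> = pairing UNIV h \<phi>" by (rule pairing_subset[symmetric]) (use W t in auto)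
      thus ?thesis by (simp add: pairing_lborel[OF hm K(1)])
    qed
    finally have "pairing U f G = - pairing W h \<phi>" .
    thus "pairing W (\<lambda>z. f z + (- 1) * h z) \<phi> = 0"
      using sum0 pairing_subset[OF U(1) W(1,3) t, of f]
      by (simp only: pairing_add[OF W(1) LfW mh t] pairing_cmult) simp
  qed
  hence "AE z in lebesgue_on W. f z = h z" by eventually_elim simp
  thus ?thesis using W holo by blast
qed

section \<open>Local exactness in weighted spaces\<close>

lemma weighted_zero: "weighted_Lp_loc p s U (\<lambda>z. 0)"
  by (simp add: weighted_Lp_loc_def Lp_loc_zero)

lemma weighted_add:
  assumes "p \<ge> 1" "open U" "weighted_Lp_loc p s U f" "weighted_Lp_loc p s U g"
  shows "weighted_Lp_loc p s U (\<lambda>z. f z + g z)"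
  using assms Lp_loc_add[OF assms(1,2), of "\<lambda>z. complex_of_real (abs_powr z (- s)) * f z" "\<lambda>z. complex_of_real (abs_powr z (- s)) * g z"]
  by (auto simp: weighted_Lp_loc_def distrib_left intro: borel_measurable_add)

lemma weighted_mult:
  assumes "p \<ge> 1" "open U" "weighted_Lp_loc p s U f" "continuous_on UNIV g"
  shows "weighted_Lp_loc p s U (\<lambda>z. g z * f z)"
proof -
  have "g \<in> lmeas U" using assms(4) by (intro borel_imp_measurable_on borel_measurable_continuous_onI)
  thus ?thesis
    using assms Lp_loc_mult_continuous[OF assms(1,2) _ assms(4), of "\<lambda>z. complex_of_real (abs_powr z (- s)) * f z"]
    by (auto simp: weighted_Lp_loc_def mult.left_commute)
qed

lemma weighted_sum:
  assumes "p \<ge> 1" "open U" "\<And>i. i \<in> A \<Longrightarrow> weighted_Lp_loc p s U (f i)"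
  shows "weighted_Lp_loc p s U (\<lambda>z. \<Sum>i\<in>A. f i z)"
  using assms(3) by (induction A rule: infinite_finite_induct) (auto intro: weighted_zero weighted_add[OF assms(1,2)])

lemma weighted_subset: "weighted_Lp_loc p s U f \<Longrightarrow> V \<subseteq> U \<Longrightarrow> weighted_Lp_loc p s V f"
  using Lp_loc_subset measurable_on_subset unfolding weighted_Lp_loc_def by metis

lemma weighted_cong_AE:
  assumes "p \<ge> 1" "open U" "weighted_Lp_loc p s U f" "AE z in lebesgue_on U. g z = f z"
  shows "weighted_Lp_loc p s U g"
  unfolding weighted_Lp_loc_def
proof
  show "g \<in> lmeas U"
    using measurable_on_cong_AE[OF open_in_lebesgue[OF assms(2)] _ assms(4)] assms(3) by (simp add: weighted_Lp_loc_def)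
  show "Lp_loc p U (\<lambda>z. complex_of_real (abs_powr z (- s)) * g z)"
  proof (rule Lp_loc_cong_AE[OF assms(1,2)])
    show "Lp_loc p U (\<lambda>z. complex_of_real (abs_powr z (- s)) * f z)" using assms(3) by (simp add: weighted_Lp_loc_def)
    show "AE z in lebesgue_on U. complex_of_real (abs_powr z (- s)) * g z = complex_of_real (abs_powr z (- s)) * f z"
      using assms(4) by eventually_elim simp
  qed
qed

lemma weighted_local:
  assumes "p \<ge> 1" and U: "open U" and loc: "\<And>x. x \<in> U \<Longrightarrow> \<exists>V. open V \<and> x \<in> V \<and> V \<subseteq> U \<and> weighted_Lp_loc p s V f"
  shows "weighted_Lp_loc p s U f"
  unfolding weighted_Lp_loc_def
proof
  show "f \<in> lmeas U"
    using measurable_on_local[OF U] loc unfolding weighted_Lp_loc_def by meson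
  show "Lp_loc p U (\<lambda>z. complex_of_real (abs_powr z (- s)) * f z)"
    using Lp_loc_local[OF assms(1) U] loc unfolding weighted_Lp_loc_def by meson
qed

lemma weighted_Lp_forms_iff:
  "f \<in> weighted_Lp_forms p s q U \<longleftrightarrow> (\<forall>J. weighted_Lp_loc p s U (f J)) \<and> (\<forall>J. card J \<noteq> q \<longrightarrow> f J = (\<lambda>z. 0))"
  by (auto simp: weighted_Lp_forms_def measurable_forms_def weighted_Lp_loc_def)

text \<open>Bounds for the exponents \<open>t\<^sub>j\<close> of the weight under which the Cauchy transform in the variable
  \<open>z\<^sub>j\<close> preserves the weighted space.\<close>

definition admissible_exponent :: "ennreal \<Rightarrow> real \<Rightarrow> bool" where
  "admissible_exponent p t \<longleftrightarrow>
     (if p = \<infinity> then - 2 < t \<and> t \<le> 0 else t * enn2real p < 2 \<and> 2 - 2 * enn2real p < t * enn2real p)"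

lemma cauchy_transform_cong_AE:
  fixes u v :: "complex^'n::finite \<Rightarrow> complex"
  assumes [measurable]: "u \<in> borel_measurable borel" "v \<in> borel_measurable borel" and eq: "AE z in lborel. u z = v z"
  shows "AE z in lborel. cauchy_transform k u z = cauchy_transform k v z"
proof -
  have "AE z in lborel. u (z - axis k (w $ 1)) = v (z - axis k (w $ 1))" for w :: "complex^1"
  proof -
    have "AE z in distr lborel borel ((+) (- axis k (w $ 1))). u z = v z"
      using eq by (simp only: lborel_distr_plus)
    hence "AE z in lborel. u (- axis k (w $ 1) + z) = v (- axis k (w $ 1) + z)"
      by (subst (asm) AE_distr_iff) auto
    thus ?thesis by simp
  qed
  hence "AE w in (lborel :: (complex^1) measure). AE z in lborel. u (z - axis k (w $ 1)) = v (z - axis k (w $ 1))" by simp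
  hence "AE z in lborel. AE w in (lborel :: (complex^1) measure). u (z - axis k (w $ 1)) = v (z - axis k (w $ 1))"
    by (subst lborel_pair.AE_commute) measurable
  thus ?thesis
  proof eventually_elim
    case (elim z)
    show ?case unfolding cauchy_transform_def
      by (rule integral_cong_AE) (measurable, use elim in \<open>auto elim!: eventually_mono\<close>)
  qed
qed

lemma weighted_cauchy_transform:
  fixes u :: "complex^'n::finite \<Rightarrow> complex"
  assumes p: "p \<ge> 1" and t: "admissible_exponent p (t $ k)"
    and u [measurable]: "u \<in> borel_measurable borel" and supp: "\<And>z. norm z > R \<Longrightarrow> u z = 0" and R: "R \<ge> 0"
    and w: "weighted_Lp_loc p t UNIV u"
  shows "weighted_Lp_loc p t UNIV (cauchy_transform k u)"
proof -
  define V where "V z = (\<Prod>j\<in>UNIV - {k}. norm (z $ j) powr (- t $ j))" for z :: "complex^'n"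
  have Vm [measurable]: "V \<in> borel_measurable borel" unfolding V_def by measurable
  have V0: "V z \<ge> 0" for z unfolding V_def by (intro prod_nonneg) auto
  have Vk: "V (z + axis k a) = V z" for z a unfolding V_def by (intro prod.cong) (auto simp: axis_def)
  have split: "abs_powr z (- t) = norm (z $ k) powr (- t $ k) * V z" for z
    unfolding abs_powr_def V_def by (subst prod.remove[of UNIV k]) auto
  have Tm: "cauchy_transform k u \<in> borel_measurable borel" by measurable
  show ?thesis unfolding weighted_Lp_loc_def
  proof
    show "cauchy_transform k u \<in> lmeas UNIV" by (rule borel_imp_measurable_on[OF Tm])
    show "Lp_loc p UNIV (\<lambda>z. complex_of_real (abs_powr z (- t)) * cauchy_transform k u z)"
    proof (rule Lp_locI)
      show "(\<lambda>z. complex_of_real (abs_powr z (- t)) * cauchy_transform k u z) \<in> lmeas UNIV"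
        using Tm by (intro borel_imp_measurable_on) measurable
      fix K :: "(complex^'n) set" assume K: "compact K"
      obtain M where M: "M > 0" "K \<subseteq> cball 0 M"
        using compact_imp_bounded[OF K] by (auto simp: bounded_pos subset_iff)
      note L = w[unfolded weighted_Lp_loc_def, THEN conjunct2, THEN Lp_locD, OF compact_cball[of 0 R] subset_UNIV]
      show "if p = \<infinity> then \<exists>C. AE z in lborel. z \<in> K \<longrightarrow> norm (complex_of_real (abs_powr z (- t)) * cauchy_transform k u z) \<le> C
         else (NN z. ennreal (norm (complex_of_real (abs_powr z (- t)) * cauchy_transform k u z) powr enn2real p) * indicator K z) < \<infinity>"
      proof (cases "p = \<infinity>")
        case False
        define q where "q = enn2real p"
        have q: "q \<ge> 1" using p False unfolding q_def by (cases p) auto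
        define e where "e = t $ k * q"
        have e: "e < 2" "2 - 2 * q < e" using t False by (auto simp: admissible_exponent_def e_def q_def)
        define b where "b = (if e \<ge> 0 then 0 else - e / (q - 1))"
        define c where "c = e + b * (q - 1)"
        have q1: "e < 0 \<Longrightarrow> q > 1" using e by linarith
        have bc: "0 \<le> b" "b < 2" "0 \<le> c" "c < 2"
        proof -
          have "b * (q - 1) = - e" if "e < 0" using q1[OF that] that by (simp add: b_def)
          moreover have "b < 2"
          proof (cases "e \<ge> 0")
            case False
            hence "- e / (q - 1) < 2" using e q1 by (subst pos_divide_less_eq) auto
            thus ?thesis using False by (simp add: b_def)
          qed (simp add: b_def)
          moreover have "0 \<le> b" using q by (auto simp: b_def divide_nonpos_nonneg)
          ultimately show "0 \<le> b" "b < 2" "0 \<le> c" "c < 2" using e by (auto simp: c_def b_def not_le split: if_splits)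
        qed
        have nw: "norm (complex_of_real (abs_powr z (- t)) * v) powr q = V z powr q * norm (z $ k) powr (- e) * norm v powr q" for z v
        proof -
          have "norm (complex_of_real (abs_powr z (- t)) * v) = (norm (z $ k) powr (- t $ k) * V z) * norm v"
            using V0[of z] by (simp add: norm_mult split abs_of_nonneg)
          thus ?thesis using V0[of z] by (simp add: powr_mult powr_powr e_def mult_ac)
        qed
        have fin: "(NN z. ennreal (V z powr q * norm (z $ k) powr (- e) * norm (u z) powr q)) < \<infinity>"
        proof -
          have "ennreal (V z powr q * norm (z $ k) powr (- e) * norm (u z) powr q)
            = ennreal (norm (complex_of_real (abs_powr z (- t)) * u z) powr enn2real p) * indicator (cball 0 R) z" for z
            unfolding q_def[symmetric] nw using supp[of z] by (cases "norm z > R") auto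
          thus ?thesis using L False by simp
        qed
        have "(NN z. ennreal (V z powr q * norm (z $ k) powr (- e) * norm (cauchy_transform k u z) powr q) * indicator (cball 0 M) z) < \<infinity>"
          by (rule cauchy_transform_weighted_Lp[OF u supp _ _ _ q bc c_def fin R M(1)]) (use Vk in auto)
        moreover have "(NN z. ennreal (norm (complex_of_real (abs_powr z (- t)) * cauchy_transform k u z) powr q) * indicator K z)
           \<le> (NN z. ennreal (V z powr q * norm (z $ k) powr (- e) * norm (cauchy_transform k u z) powr q) * indicator (cball 0 M) z)"
          unfolding nw using M(2) by (intro nn_integral_mono) (auto simp: indicator_def)
        ultimately show ?thesis using False by (simp add: q_def order_le_less_trans)
      next
        case True
        then obtain C where C: "AE z in lborel. z \<in> cball 0 R \<longrightarrow> norm (complex_of_real (abs_powr z (- t)) * u z) \<le> C" using L by auto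
        define u' where "u' z = (if (\<forall>j. z $ j \<noteq> 0) \<and> norm (complex_of_real (abs_powr z (- t)) * u z) \<le> C then u z else 0)" for z
        have u'm [measurable]: "u' \<in> borel_measurable borel" unfolding u'_def by measurable
        have "AE z in lborel. u z = u' z"
          using C AE_coords_nonzero[where 'n = 'n]
        proof eventually_elim
          case (elim z)
          thus ?case using supp[of z] by (cases "norm z > R") (auto simp: u'_def)
        qed
        hence eq: "AE z in lborel. cauchy_transform k u z = cauchy_transform k u' z" by (intro cauchy_transform_cong_AE u u'm)
        have tk: "0 \<le> - t $ k" "- t $ k < 2" using t True by (auto simp: admissible_exponent_def)
        have inv: "V z > 0" if "\<forall>j. z $ j \<noteq> 0" for z unfolding V_def using that by (intro prod_pos) auto
        have "norm (u' z) \<le> (\<bar>C\<bar> * inverse (V z)) * norm (z $ k) powr (- (- t $ k))" for z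
        proof (cases "(\<forall>j. z $ j \<noteq> 0) \<and> norm (complex_of_real (abs_powr z (- t)) * u z) \<le> C")
          case True
          hence Vp: "V z > 0" using inv by blast
          let ?r = "norm (z $ k) powr (- t $ k)"
          have rp: "?r > 0" using True by simp
          have "?r * V z * norm (u z) \<le> \<bar>C\<bar>" using True V0[of z] abs_ge_self[of C] by (auto simp: norm_mult split abs_of_nonneg)
          hence "norm (u z) \<le> \<bar>C\<bar> / (?r * V z)" using Vp rp by (simp add: pos_le_divide_eq mult_ac)
          also have "\<dots> = (\<bar>C\<bar> * inverse (V z)) * norm (z $ k) powr (- (- t $ k))"
            by (simp add: divide_inverse powr_minus mult_ac)
          finally show ?thesis using True by (simp add: u'_def)
        qed (use V0[of z] in \<open>auto simp: u'_def\<close>)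
        moreover have "u' z = 0" if "norm z > R" for z using supp[OF that] by (simp add: u'_def)
        ultimately obtain C' where C': "\<And>z. norm z \<le> M \<Longrightarrow> z $ k \<noteq> 0 \<Longrightarrow>
            norm (cauchy_transform k u' z) \<le> C' * (\<bar>C\<bar> * inverse (V z)) * norm (z $ k) powr (- (- t $ k))"
          using cauchy_transform_weighted_bounded[OF u'm, of R "\<lambda>z. \<bar>C\<bar> * inverse (V z)" k "- t $ k" M] tk R M(1) Vk V0
          by auto
        have "AE z in lborel. z \<in> K \<longrightarrow> norm (complex_of_real (abs_powr z (- t)) * cauchy_transform k u z) \<le> C' * \<bar>C\<bar>"
          using eq AE_coords_nonzero[where 'n = 'n]
        proof eventually_elim
          case (elim z)
          show ?case
          proof
            assume "z \<in> K"
            hence z: "norm z \<le> M" using M by auto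
            let ?r = "norm (z $ k) powr (- t $ k)"
            have Vp: "V z > 0" using inv elim by blast
            have rp: "?r > 0" using elim by simp
            have "norm (complex_of_real (abs_powr z (- t)) * cauchy_transform k u z) = ?r * V z * norm (cauchy_transform k u' z)"
              using elim V0[of z] by (simp add: norm_mult split abs_of_nonneg)
            also have "\<dots> \<le> ?r * V z * (C' * (\<bar>C\<bar> * inverse (V z)) * norm (z $ k) powr (- (- t $ k)))"
              using C'[OF z] elim Vp rp by (intro mult_left_mono) auto
            also have "\<dots> = (?r * norm (z $ k) powr (- (- t $ k))) * (V z * inverse (V z)) * (C' * \<bar>C\<bar>)" by (simp only: mult_ac)
            also have "\<dots> = C' * \<bar>C\<bar>"
            proof -
              have "?r * norm (z $ k) powr (- (- t $ k)) = 1" using elim by (simp flip: powr_add)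
              thus ?thesis using Vp by simp
            qed
            finally show "norm (complex_of_real (abs_powr z (- t)) * cauchy_transform k u z) \<le> C' * \<bar>C\<bar>" .
          qed
        qed
        thus ?thesis using True by auto
      qed
    qed
  qed
qed

lemma Lp_loc_integrable:
  assumes "Lp_loc 1 UNIV u" "u \<in> borel_measurable borel" "\<And>z. norm z > R \<Longrightarrow> u z = 0"
  shows "integrable lborel u"
proof (rule integrableI_bounded)
  have "(NN z. ennreal (norm (u z) powr enn2real 1) * indicator (cball 0 R) z) < \<infinity>"
    using Lp_locD[OF assms(1) compact_cball[of 0 R] subset_UNIV] by simp
  also have "(NN z. ennreal (norm (u z) powr enn2real 1) * indicator (cball 0 R) z) = (NN z. ennreal (norm (u z)))"
  proof (rule nn_integral_cong)
    fix z show "ennreal (norm (u z) powr enn2real 1) * indicator (cball 0 R) z = ennreal (norm (u z))"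
      using assms(3)[of z] by (cases "norm z > R") auto
  qed
  finally show "(NN z. ennreal (norm (u z))) < \<infinity>" .
qed (use assms in simp)

lemma cauchy_transform_zero [simp]: "cauchy_transform k (\<lambda>z. 0) = (\<lambda>z. 0)"
  by (simp add: cauchy_transform_def fun_eq_iff)

lemma Lp_loc_cauchy_transform:
  fixes u :: "complex^'n::finite \<Rightarrow> complex"
  assumes L: "Lp_loc 1 UNIV u" and u [measurable]: "u \<in> borel_measurable borel" and supp: "\<And>z. norm z > R \<Longrightarrow> u z = 0" and R: "R \<ge> 0"
  shows "Lp_loc 1 UNIV (cauchy_transform k u)"
proof (rule Lp_locI)
  show "cauchy_transform k u \<in> lmeas UNIV" by (intro borel_imp_measurable_on) measurable
  fix K :: "(complex^'n) set" assume K: "compact K"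
  obtain M where M: "M > 0" "K \<subseteq> cball 0 M"
    using compact_imp_bounded[OF K] by (auto simp: bounded_pos subset_iff)
  have "integrable lborel u" by (rule Lp_loc_integrable[OF L u supp])
  hence "(NN z. ennreal (norm (u z))) < \<infinity>" by (simp add: integrable_iff_bounded)
  moreover have "(NN z. ennreal (1 * norm (z $ k) powr (- 0) * norm (u z) powr 1)) \<le> (NN z. ennreal (norm (u z)))"
    by (intro nn_integral_mono) (auto intro!: ennreal_leI)
  ultimately have fin: "(NN z. ennreal (1 * norm (z $ k) powr (- 0) * norm (u z) powr 1)) < \<infinity>" by (rule order_le_less_trans[rotated])
  have "(NN z. ennreal (1 * norm (z $ k) powr (- 0) * norm (cauchy_transform k u z) powr 1) * indicator (cball 0 M) z) < \<infinity>"
    by (rule cauchy_transform_weighted_Lp[OF u supp _ _ _ order_refl _ _ _ _ _ fin R M(1), where b = 0 and c = 0]) auto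
  moreover have "(NN z. ennreal (norm (cauchy_transform k u z) powr enn2real 1) * indicator K z)
     \<le> (NN z. ennreal (1 * norm (z $ k) powr (- 0) * norm (cauchy_transform k u z) powr 1) * indicator (cball 0 M) z)"
  proof (rule nn_integral_mono_AE, use AE_coords_nonzero[where 'n = 'n] in eventually_elim)
    case (elim z)
    thus ?case using M(2) by (auto simp: indicator_def)
  qed
  ultimately show "if (1::ennreal) = \<infinity> then \<exists>C. AE z in lborel. z \<in> K \<longrightarrow> norm (cauchy_transform k u z) \<le> C
     else (NN z. ennreal (norm (cauchy_transform k u z) powr enn2real 1) * indicator K z) < \<infinity>"
    by (simp add: order_le_less_trans)
qed

text \<open>Contraction with \<open>\<partial> / \<partial> zbar\<^sub>k\<close> followed by the Cauchy transform in the variable \<open>z\<^sub>k\<close>.\<close>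

definition cauchy_contraction :: "'n \<Rightarrow> 'n::{finite,linorder} form \<Rightarrow> 'n form" where
  "cauchy_contraction k u J z = (if k \<in> J then 0 else form_sign k J * cauchy_transform k (u (insert k J)) z)"

lemma form_sign_remove: "form_sign k (K - {k}) = form_sign k K"
proof -
  have "{i \<in> K - {k}. i < k} = {i \<in> K. i < k}" by auto
  thus ?thesis by (simp add: form_sign_def)
qed

lemma form_sign_insert: "form_sign k (insert k K) = form_sign k K"
proof -
  have "{i \<in> insert k K. i < k} = {i \<in> K. i < k}" by auto
  thus ?thesis by (simp add: form_sign_def)
qed

text \<open>For forms with compact support the contraction is a homotopy between the identity and 0. In
  the weak formulation this is the duality of the Cauchy transform with itself, because the
  transform of a test function agrees, near the support of the form, with a test function.\<close>

theorem cauchy_homotopy: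
  fixes u v :: "'n::{finite,linorder} form"
  assumes D: "dist_dbar UNIV (Suc q) u v"
    and um: "\<And>J. u J \<in> borel_measurable borel" and vm: "\<And>J. v J \<in> borel_measurable borel"
    and us: "\<And>J z. norm z > R \<Longrightarrow> u J z = 0" and vs: "\<And>J z. norm z > R \<Longrightarrow> v J z = 0" and R: "R \<ge> 0"
  shows "dist_dbar UNIV q (cauchy_contraction k u) (\<lambda>J z. u J z - cauchy_contraction k v J z)"
proof (rule dist_dbarI[OF open_UNIV])
  note D = dist_dbarD[OF open_UNIV D]
  have ui: "integrable lborel (u J)" "integrable lborel (v J)" for J
    using Lp_loc_integrable[OF D(1) um us] Lp_loc_integrable[OF D(2) vm vs] by auto
  have LT: "Lp_loc 1 UNIV (cauchy_transform k (u J))" "Lp_loc 1 UNIV (cauchy_transform k (v J))" for J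
    using Lp_loc_cauchy_transform[OF D(1) um us R] Lp_loc_cauchy_transform[OF D(2) vm vs R] by auto
  have cc: "cauchy_contraction k w J = (if k \<in> J then (\<lambda>z. 0) else (\<lambda>z. form_sign k J * cauchy_transform k (w (insert k J)) z))" for w J
    by (auto simp: cauchy_contraction_def fun_eq_iff)
  have cmul: "Lp_loc 1 UNIV (\<lambda>z. c * f z)" if "Lp_loc 1 UNIV f" for c and f :: "(complex,'n) vec \<Rightarrow> complex"
    using Lp_loc_mult_continuous[OF order_refl open_UNIV that continuous_on_const[of UNIV c]] .
  have LC: "Lp_loc 1 UNIV (cauchy_contraction k u J)" "Lp_loc 1 UNIV (cauchy_contraction k v J)" for J
    unfolding cc using LT cmul by (auto simp: Lp_loc_zero)
  have deg: "card (insert k J) = Suc (card J)" if "k \<notin> J" for J using that by simp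
  have u0: "cauchy_contraction k u J = (\<lambda>z. 0)" if "card J \<noteq> q" for J
    unfolding cc using that D(3)[of "insert k J"] deg[of J] by auto
  have v0: "cauchy_contraction k v J = (\<lambda>z. 0)" if "card J \<noteq> Suc q" for J
    unfolding cc using that D(4)[of "insert k J"] deg[of J] by auto
  show "cauchy_contraction k u \<in> Lp_forms 1 q UNIV" using LC u0 by (simp add: Lp_forms_iff)
  have Lm: "Lp_loc 1 UNIV (\<lambda>z. (- 1) * cauchy_contraction k v J z)" for J by (rule cmul[OF LC(2)])
  have Ld: "Lp_loc 1 UNIV (\<lambda>z. u J z - cauchy_contraction k v J z)" for J
    using Lp_loc_add[OF order_refl open_UNIV D(1) Lm, of J J] by simp
  show "(\<lambda>J z. u J z - cauchy_contraction k v J z) \<in> Lp_forms 1 (Suc q) UNIV"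
    using Ld v0 D(3) by (simp add: Lp_forms_iff)
  fix K :: "'n set" and \<phi> :: "(complex,'n) vec \<Rightarrow> complex" assume K: "card K = Suc q" and t: "test_function UNIV \<phi>"
  let ?P = "pairing UNIV"
  let ?T = "cauchy_transform k"
  have ps: "smooth \<phi>" by (rule test_function_smooth[OF t])
  obtain R' B where R': "\<And>z. norm z > R' \<Longrightarrow> \<phi> z = 0" and B: "\<And>z. norm (\<phi> z) \<le> B"
    using test_function_bounded_support[OF t] by metis
  obtain \<theta> C where \<theta>: "smooth \<theta>" "compact C" "C \<subseteq> ball (0::(complex,'n) vec) (R + 2)" "\<And>x. x \<notin> C \<Longrightarrow> \<theta> x = (0::real)" "\<And>x. x \<in> cball 0 (R + 1) \<Longrightarrow> \<theta> x = 1"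
    by (rule smooth_cutoff[of "cball (0::(complex,'n) vec) (R + 1)" "ball 0 (R + 2)"]) auto
  define \<Phi> where "\<Phi> z = complex_of_real (\<theta> z) * ?T \<phi> z" for z
  note Ts = cauchy_transform_has_derivative(2)[OF ps R']
  have Pt: "test_function UNIV \<Phi>"
  proof (rule test_functionI[OF _ \<theta>(2)])
    show "smooth \<Phi>" unfolding \<Phi>_def[abs_def] by (intro smooth_mult smooth_of_real \<theta>(1) Ts)
  qed (use \<theta>(4) in \<open>auto simp: \<Phi>_def\<close>)
  have anti: "?P (?T a) \<psi> = - ?P a (?T \<psi>)"
    if a: "integrable lborel a" "a \<in> borel_measurable borel" "\<And>z. norm z > R \<Longrightarrow> a z = 0" and \<psi>: "test_function UNIV \<psi>" for a \<psi>
  proof -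
    obtain R' B where R': "\<And>z. norm z > R' \<Longrightarrow> \<psi> z = 0" and B: "\<And>z. norm (\<psi> z) \<le> B"
      using test_function_bounded_support[OF \<psi>] by metis
    have s: "smooth \<psi>" by (rule test_function_smooth[OF \<psi>])
    have m: "\<psi> \<in> borel_measurable borel" by (intro borel_measurable_continuous_onI smooth_continuous s)
    have "?P (?T a) \<psi> = (LINT z|lborel. ?T a z * \<psi> z)" by (rule pairing_lborel[OF cauchy_transform_measurable[OF a(2)] s])
    also have "\<dots> = - (LINT z|lborel. a z * ?T \<psi> z)" by (rule cauchy_transform_antisymmetric[OF a(1,3) m B R'])
    also have "(LINT z|lborel. a z * ?T \<psi> z) = ?P a (?T \<psi>)"
      by (rule pairing_lborel[OF a(2) cauchy_transform_has_derivative(2)[OF s R'], symmetric])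
    finally show ?thesis .
  qed
  have local_eq: "?P a \<psi> = ?P a \<psi>'" if "\<And>z. norm z > R \<Longrightarrow> a z = 0" "\<And>z. norm z \<le> R \<Longrightarrow> \<psi> z = \<psi>' z" for a \<psi> \<psi>'
    unfolding pairing_def
  proof (rule Bochner_Integration.integral_cong[OF refl])
    fix z show "a z * \<psi> z = a z * \<psi>' z" using that by (cases "norm z > R") auto
  qed
  have wP: "wirtinger_bar j \<Phi> z = ?T (wirtinger_bar j \<phi>) z" if "norm z \<le> R" for j z
  proof -
    have "wirtinger_bar j \<Phi> z = wirtinger_bar j (?T \<phi>) z"
      by (rule wirtinger_bar_cong_open[of "ball 0 (R + 1)", OF _ _ _ smooth_has_derivative[OF Ts]])
         (use that \<theta>(5) in \<open>auto simp: \<Phi>_def\<close>)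
    thus ?thesis by (simp add: wirtinger_bar_cauchy_transform[OF ps R'])
  qed
  have Tv: "?P (?T (v L)) \<phi> = (\<Sum>j\<in>L. form_sign j L * (if j = k then ?P (u (L - {k})) \<phi> else - ?P (?T (u (L - {j}))) (wirtinger_bar j \<phi>)))"
    if L: "card L = Suc (Suc q)" for L
  proof -
    have "?P (?T (v L)) \<phi> = - ?P (v L) (?T \<phi>)" by (rule anti[OF ui(2) vm vs t])
    also have "?P (v L) (?T \<phi>) = ?P (v L) \<Phi>"
      by (rule local_eq) (use vs \<theta>(5) in \<open>auto simp: \<Phi>_def\<close>)
    also have "- ?P (v L) \<Phi> = (\<Sum>j\<in>L. form_sign j L * ?P (u (L - {j})) (wirtinger_bar j \<Phi>))" using D(5)[OF L Pt] by simp
    also have "\<dots> = (\<Sum>j\<in>L. form_sign j L * (if j = k then ?P (u (L - {k})) \<phi> else - ?P (?T (u (L - {j}))) (wirtinger_bar j \<phi>)))"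
    proof (intro sum.cong refl arg_cong2[of _ _ _ _ "(*)"])
   fix j
   have 1: "?P (u (L - {j})) (wirtinger_bar j \<Phi>) = ?P (u (L - {j})) (?T (wirtinger_bar j \<phi>))"
    by (rule local_eq[OF us wP])
   have 2: "?P (u (L - {j})) (?T (wirtinger_bar j \<phi>)) = - ?P (?T (u (L - {j}))) (wirtinger_bar j \<phi>)"
    using anti[OF ui(1) um us test_function_wirtinger_bar[OF t]] by simp
   show "?P (u (L - {j})) (wirtinger_bar j \<Phi>) = (if j = k then ?P (u (L - {k})) \<phi> else - ?P (?T (u (L - {j}))) (wirtinger_bar j \<phi>))"
    using 1 2 cauchy_transform_wirtinger_bar[OF ps R', where k = k] by auto
  qed
  finally show ?thesis .
 qed
 have fK: "finite K" using K card_ge_0_finite by force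
 have split: "?P (%z. u K z - cauchy_contraction k v K z) \<phi> = ?P (u K) \<phi> - ?P (cauchy_contraction k v K) \<phi>"
  using pairing_add[OF open_UNIV D(1) Lm t, of K K] pairing_cmult[of UNIV "- 1" "cauchy_contraction k v K" \<phi>] by simp
 show "?P (%z. u K z - cauchy_contraction k v K z) \<phi> =
   - (\<Sum>j\<in>K. form_sign j K * ?P (cauchy_contraction k u (K - {j})) (wirtinger_bar j \<phi>))"
 proof (cases "k : K")
  case True
  have "(\<Sum>j\<in>K. form_sign j K * ?P (cauchy_contraction k u (K - {j})) (wirtinger_bar j \<phi>))
    = (\<Sum>j\<in>{k}. form_sign j K * ?P (cauchy_contraction k u (K - {j})) (wirtinger_bar j \<phi>))"
   by (rule sum.mono_neutral_right) (use fK True in "auto simp: cc")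
  also have "... = form_sign k K * (form_sign k K * ?P (?T (u K)) (wirtinger_bar k \<phi>))"
   using True by (simp add: cc pairing_cmult form_sign_remove insert_absorb)
  also have "... = ?P (?T (u K)) (wirtinger_bar k \<phi>)" by (simp flip: mult.assoc)
  also have "... = - ?P (u K) \<phi>"
   using anti[OF ui(1) um us test_function_wirtinger_bar[OF t]] cauchy_transform_wirtinger_bar[OF ps R', where k = k] by simp
  finally show ?thesis unfolding split using True by (simp add: cc)
 next
  case False
  let ?L = "insert k K"
  have cL: "card ?L = Suc (Suc q)" using K False fK by simp
  have rem: "?L - {j} = insert k (K - {j})" if "j : K" for j using that False by auto
  have "?P (cauchy_contraction k v K) \<phi> = form_sign k K * ?P (?T (v ?L)) \<phi>"
   using False by (simp add: cc pairing_cmult)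
  also have "?P (?T (v ?L)) \<phi> = form_sign k ?L * ?P (u K) \<phi> - (\<Sum>j\<in>K. form_sign j ?L * ?P (?T (u (insert k (K - {j})))) (wirtinger_bar j \<phi>))"
  proof -
   have "(\<Sum>j\<in>K. form_sign j ?L * (if j = k then ?P (u (?L - {k})) \<phi> else - ?P (?T (u (?L - {j}))) (wirtinger_bar j \<phi>)))
     = (\<Sum>j\<in>K. - (form_sign j ?L * ?P (?T (u (insert k (K - {j})))) (wirtinger_bar j \<phi>)))"
    using False rem by (intro sum.cong) auto
   thus ?thesis unfolding Tv[OF cL] using False fK by (simp add: sum_negf)
  qed
  also have "form_sign k K * (form_sign k ?L * ?P (u K) \<phi> - (\<Sum>j\<in>K. form_sign j ?L * ?P (?T (u (insert k (K - {j})))) (wirtinger_bar j \<phi>)))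
    = ?P (u K) \<phi> - (\<Sum>j\<in>K. (form_sign k K * form_sign j ?L) * ?P (?T (u (insert k (K - {j})))) (wirtinger_bar j \<phi>))"
   by (simp add: right_diff_distrib form_sign_insert sum_distrib_left flip: mult.assoc)
  also have "(\<Sum>j\<in>K. (form_sign k K * form_sign j ?L) * ?P (?T (u (insert k (K - {j})))) (wirtinger_bar j \<phi>))
    = - (\<Sum>j\<in>K. form_sign j K * ?P (cauchy_contraction k u (K - {j})) (wirtinger_bar j \<phi>))"
  proof -
   have sg: "form_sign k K * form_sign j ?L = - (form_sign j K * form_sign k (K - {j}))" if j: "j : K" for j
   proof -
    have jk: "j ~= k" using j False by auto
    have "form_sign j ?L * form_sign k (?L - {j}) = - (form_sign k ?L * form_sign j (?L - {k}))"
     by (rule form_sign_swap) (use j jk in auto)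
    moreover have "?L - {k} = K" using False by auto
    ultimately have *: "form_sign j ?L * form_sign k (K - {j}) = - (form_sign k K * form_sign j K)"
     using rem[OF j] by (simp add: form_sign_insert)
    have "form_sign k K * form_sign j ?L = form_sign k K * (form_sign j ?L * form_sign k (K - {j})) * form_sign k (K - {j})"
     by (simp add: mult.assoc)
    also have "... = - ((form_sign k K * form_sign k K) * (form_sign j K * form_sign k (K - {j})))"
     unfolding * by (simp only: mult_minus_right mult_minus_left mult_ac)
    finally show ?thesis by simp
   qed
   have "(form_sign k K * form_sign j ?L) * ?P (?T (u (insert k (K - {j})))) (wirtinger_bar j \<phi>)
     = - (form_sign j K * ?P (cauchy_contraction k u (K - {j})) (wirtinger_bar j \<phi>))" if j: "j : K" for j
    unfolding sg[OF j] using False by (simp add: cc pairing_cmult mult.assoc)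
   thus ?thesis by (simp add: sum_negf)
  qed
  finally show ?thesis unfolding split by simp
 qed
qed

lemma dist_dbar_extend:
 assumes U: "open U" and K: "compact K" "K <= U" and D: "dist_dbar U q u v"
  and out: "!!J z. z ~: K ==> u J z = 0" "!!J z. z ~: K ==> v J z = 0"
 shows "dist_dbar UNIV q u v"
proof (rule dist_dbar_local[OF open_UNIV])
 note D' = dist_dbarD[OF U D]
 show "!!J. card J ~= q ==> u J = (%z. 0)" "!!J. card J ~= Suc q ==> v J = (%z. 0)" using D'(3,4) by auto
 fix x
 have op: "open (- K)" using K(1) by (simp add: compact_imp_closed open_Compl)
 have "dist_dbar (- K) q u v"
 proof (rule dist_dbar_cong_AE[OF op dist_dbar_zero[OF op]])
  show "AE z in lebesgue_on (- K). u J z = 0" "AE z in lebesgue_on (- K). v J z = 0" for J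
   unfolding AE_on_iff[OF open_in_lebesgue[OF op]] using out by auto
 qed (use D'(3,4) in auto)
 thus "EX V. open V & x : V & V <= UNIV & dist_dbar V q u v"
  using op U D K(2) by (cases "x : K") blast+
qed

lemma weighted_extend:
 assumes p: "p >= 1" and U: "open U" and K: "compact K" "K <= U" and w: "weighted_Lp_loc p s U u"
  and out: "!!z. z ~: K ==> u z = 0"
 shows "weighted_Lp_loc p s UNIV u"
proof (rule weighted_local[OF p open_UNIV])
 fix x
 have op: "open (- K)" using K(1) by (simp add: compact_imp_closed open_Compl)
 have "weighted_Lp_loc p s (- K) u"
 proof (rule weighted_cong_AE[OF p op weighted_zero])
  show "AE z in lebesgue_on (- K). u z = 0"
   unfolding AE_on_iff[OF open_in_lebesgue[OF op]] using out by auto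
 qed
 thus "EX V. open V & x : V & V <= UNIV & weighted_Lp_loc p s V u"
  using op U w K(2) by (cases "x : K") blast+
qed

lemma dist_le_coordinates:
 fixes z x :: "complex^'n::finite" and r :: real
 assumes "!!j. norm (z $ j - x $ j) <= r"
 shows "dist x z <= CARD('n) * r"
proof -
 have "norm (z - x) <= (\<Sum>j\<in>UNIV. norm ((z - x) $ j))"
  unfolding norm_vec_def by (rule L2_set_le_sum) simp
 also have "... <= (\<Sum>j\<in>(UNIV::'n set). r)" using assms by (intro sum_mono) simp
 finally show ?thesis by (simp add: dist_norm norm_minus_commute)
qed

lemma weighted_cmult:
 assumes "p >= 1" "open U" "weighted_Lp_loc p s U f"
 shows "weighted_Lp_loc p s U (%z. c * f z)"
 by (rule weighted_mult[OF assms continuous_on_const])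

text \<open>The induction removes one differential after the other. If no \<open>dzbar\<^sub>j\<close> with \<open>j \<in> S\<close> occurs in
  the closed form \<open>F\<close>, the homotopy formula in the variable \<open>z\<^sub>k\<close>, applied to \<open>\<theta> F\<close> with a cutoff
  function \<open>\<theta>\<close>, leaves the error \<open>T\<^sub>k (dbar \<theta> \<and> F)\<close>. It contains no \<open>dzbar\<^sub>k\<close>, and near \<open>x\<close> no
  \<open>dzbar\<^sub>j\<close> with \<open>j \<in> S\<close> because \<open>\<theta>\<close>, a product of functions of one variable each, depends only on
  \<open>z\<^sub>k\<close> along the discs over which \<open>T\<^sub>k\<close> integrates.\<close>

theorem local_exactness:
 fixes t :: "real^'n::{finite,linorder}"
 assumes p: "p >= 1" and t: "!!j. admissible_exponent p (t $ j)"
  and U: "open U" "x : U" and F: "F : weighted_Lp_forms p t (Suc q) U"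
  and D: "dist_dbar U (Suc q) F (%J z. 0)"
 shows "EX W G. open W & x : W & W <= U & G : weighted_Lp_forms p t q W & dist_dbar W q G F"
proof -
 have "EX W G. open W & x : W & W <= U & G : weighted_Lp_forms p t q W & dist_dbar W q G F"
  if "card (UNIV - S) = n" "open U" "x : U" "F : weighted_Lp_forms p t (Suc q) U"
   "dist_dbar U (Suc q) F (%J z. 0)" "ALL J. J Int S ~= {} --> F J = (%z. 0)"
  for n and S :: "'n set" and U F
  using that
 proof (induction n arbitrary: S U F)
  case 0
  hence S: "S = UNIV" by auto
  have "F J = (%z. 0)" for J
  proof (cases "J = {}")
   case True
   thus ?thesis using "0.prems"(4) by (simp add: weighted_Lp_forms_iff)
  next
   case False
   thus ?thesis using "0.prems"(6) S by auto
  qed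
  hence F0: "F = (%J z. 0)" by auto
  show ?case
  proof (intro exI conjI)
   show "dist_dbar U q (%J z. 0) F" unfolding F0 by (rule dist_dbar_zero[OF "0.prems"(2)])
   show "(%J z. 0) : weighted_Lp_forms p t q U" by (simp add: weighted_Lp_forms_iff weighted_zero)
  qed (use "0.prems" in auto)
 next
  case (Suc n)
  note U = Suc.prems(2,3) and D = Suc.prems(5) and FS = Suc.prems(6)
  have F: "!!J. weighted_Lp_loc p t U (F J)" "!!J. card J ~= Suc q ==> F J = (%z. 0)"
   using Suc.prems(4) unfolding weighted_Lp_forms_iff by blast+
  obtain k where k: "k ~: S" using Suc.prems(1) by (cases "S = UNIV") auto
  have cS: "card (UNIV - insert k S) = n"
  proof -
   have "UNIV - S = insert k (UNIV - insert k S)" using k by auto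
   thus ?thesis using Suc.prems(1) by simp
  qed
  have "ALL J. EX g. g : borel_measurable borel & (AE z in lebesgue_on U. g z = F J z)"
  proof
   fix J
   have "F J : lmeas U" using F(1) by (simp add: weighted_Lp_loc_def)
   from borel_representative[OF open_in_lebesgue[OF U(1)] this]
   show "EX g. g : borel_measurable borel & (AE z in lebesgue_on U. g z = F J z)" by metis
  qed
  then obtain F0 where F0: "!!J. F0 J : borel_measurable borel" "!!J. AE z in lebesgue_on U. F0 J z = F J z" by metis
  define F1 where "F1 J z = (if J Int S ~= {} | card J ~= Suc q then 0 else F0 J z)" for J z
  have F1m [measurable]: "F1 J : borel_measurable borel" for J
   unfolding F1_def using F0(1) by (cases "J Int S ~= {} | card J ~= Suc q") auto
  have F1e: "AE z in lebesgue_on U. F1 J z = F J z" for J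
  proof (cases "J Int S ~= {} | card J ~= Suc q")
   case True
   hence "F J = (%z. 0)" using FS F(2) by blast
   thus ?thesis using True by (simp add: F1_def)
  qed (use F0(2)[of J] in "simp add: F1_def")
  have F1d: "F1 J = (%z. 0)" if "card J ~= Suc q" for J using that by (simp add: F1_def fun_eq_iff)
  have F1w: "weighted_Lp_loc p t U (F1 J)" for J by (rule weighted_cong_AE[OF p U(1) F(1) F1e])
  have D1: "dist_dbar U (Suc q) F1 (%J z. 0)"
   by (rule dist_dbar_cong_AE[OF U(1) D F1e F1d]) auto
  obtain e where e: "e > 0" "cball x e <= U" using U open_contains_cball by blast
  define r where "r = e / (2 * CARD('n))"
  have r: "r > 0" "CARD('n) * (2 * r) = e" using e by (auto simp: r_def)
  have "ALL a::complex. EX \<beta>::complex => real. smooth \<beta> & (ALL w. norm (w - a) >= 2 * r --> \<beta> w = 0) & (ALL w. norm (w - a) <= r --> \<beta> w = 1)"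
  proof
   fix a :: complex
   have sub: "cball a r <= ball a (2 * r)" using r by auto
   obtain \<beta> C where \<beta>: "smooth \<beta>" "C <= ball a (2 * r)" "!!w. w ~: C ==> \<beta> w = (0::real)" "!!w. w : cball a r ==> \<beta> w = 1"
    by (rule smooth_cutoff[OF compact_cball open_ball sub]) blast
   have "\<beta> w = 0" if "norm (w - a) >= 2 * r" for w
   proof (rule \<beta>(3))
    show "w ~: C" using \<beta>(2) that by (auto simp: dist_norm norm_minus_commute)
   qed
   thus "EX \<beta>::complex => real. smooth \<beta> & (ALL w. norm (w - a) >= 2 * r --> \<beta> w = 0) & (ALL w. norm (w - a) <= r --> \<beta> w = 1)"
    using \<beta>(1,4) by (intro exI[of _ \<beta>]) (auto simp: dist_norm norm_minus_commute)
  qed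
  then obtain \<beta> :: "complex => complex => real" where \<beta>: "!!a. smooth (\<beta> a)" "!!a w. norm (w - a) >= 2 * r ==> \<beta> a w = 0"
    "!!a w. norm (w - a) <= r ==> \<beta> a w = 1" by metis
  define \<theta> where "\<theta> z = (\<Prod>j\<in>UNIV. complex_of_real (\<beta> (x $ j) (z $ j)))" for z
  have bs: "smooth (%z::(complex,'n) vec. complex_of_real (\<beta> (x $ j) (z $ j)))" for j
   using smooth_comp_linear[OF smooth_of_real[OF \<beta>(1)[of "x $ j"]] bounded_linear_vec_nth, of 0 j] by simp
  have \<theta>s: "smooth \<theta>" unfolding \<theta>_def[abs_def] by (intro smooth_prod bs)
  have \<theta>out: "\<theta> z = 0" if z: "z ~: cball x e" for z
  proof -
   obtain j where "norm (z $ j - x $ j) >= 2 * r"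
    using dist_le_coordinates[of z x "2 * r"] z r(2) by (auto simp: not_le) (meson less_imp_le not_le)
   thus ?thesis unfolding \<theta>_def using \<beta>(2) by (auto simp: prod_zero_iff)
  qed
  have wout: "wirtinger_bar j \<theta> z = 0" if "z ~: cball x e" for j z
   by (rule wirtinger_bar_outside_support[OF \<theta>out closed_cball that])
  define u where "u J z = \<theta> z * F1 J z" for J z
  define v where "v = dbar_wedge \<theta> F1"
  have uout: "u J z = 0" if "z ~: cball x e" for J z using \<theta>out[OF that] by (simp add: u_def)
  have vout: "v J z = 0" if "z ~: cball x e" for J z using wout[OF that] by (simp add: v_def dbar_wedge_def)
  have cont: "continuous_on UNIV \<theta>" "continuous_on UNIV (wirtinger_bar j \<theta>)" for j
   by (intro smooth_continuous \<theta>s smooth_wirtinger_bar)+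
  have [measurable]: "\<theta> : borel_measurable borel" "wirtinger_bar j \<theta> : borel_measurable borel" for j
   using cont by (auto intro: borel_measurable_continuous_onI)
  have um: "u J : borel_measurable borel" for J unfolding u_def by measurable
  have vm: "v J : borel_measurable borel" for J unfolding v_def dbar_wedge_def by measurable
  have uw: "weighted_Lp_loc p t UNIV (u J)" for J
   by (rule weighted_extend[OF p U(1) compact_cball e(2) _ uout])
     (unfold u_def, rule weighted_mult[OF p U(1) F1w cont(1)])
  have vw: "weighted_Lp_loc p t UNIV (v J)" for J
  proof (rule weighted_extend[OF p U(1) compact_cball e(2) _ vout])
   have "weighted_Lp_loc p t U (%z. \<Sum>j\<in>J. form_sign j J * (wirtinger_bar j \<theta> z * F1 (J - {j}) z))"
    by (intro weighted_sum[OF p U(1)] weighted_cmult[OF p U(1)] weighted_mult[OF p U(1) F1w] cont(2))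
   thus "weighted_Lp_loc p t U (v J)" by (simp add: v_def dbar_wedge_def[abs_def] mult.assoc)
  qed
  have "dist_dbar U (Suc q) u v"
   using dist_dbar_mult[OF U(1) D1 \<theta>s] by (simp add: u_def[abs_def] v_def)
  from dist_dbar_extend[OF U(1) compact_cball e(2) this uout vout]
  have DU: "dist_dbar UNIV (Suc q) u v" .
  define R where "R = norm x + e"
  have R: "R >= 0" using e by (simp add: R_def)
  have Rout: "z ~: cball x e" if "norm z > R" for z
   using that norm_triangle_ineq2[of z x] by (simp add: R_def dist_norm norm_minus_commute)
  note us = uout[OF Rout] and vs = vout[OF Rout]
  define Cu where "Cu = cauchy_contraction k u"
  define Cv where "Cv = cauchy_contraction k v"
  define g where "g J z = u J z - Cv J z" for J z
  have H: "dist_dbar UNIV q Cu g"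
   using cauchy_homotopy[OF DU um vm us vs R] by (simp add: Cu_def Cv_def g_def[abs_def])
  have Cuw: "weighted_Lp_loc p t UNIV (Cu J)" for J
  proof (cases "k : J")
   case False
   hence "Cu J = (%z. form_sign k J * cauchy_transform k (u (insert k J)) z)"
    by (simp add: Cu_def cauchy_contraction_def fun_eq_iff)
   thus ?thesis
    using weighted_cmult[OF p open_UNIV weighted_cauchy_transform[OF p t um us R uw]] by simp
  qed (simp add: Cu_def cauchy_contraction_def[abs_def] weighted_zero)
  have Cvw: "weighted_Lp_loc p t UNIV (Cv J)" for J
  proof (cases "k : J")
   case False
   hence "Cv J = (%z. form_sign k J * cauchy_transform k (v (insert k J)) z)"
    by (simp add: Cv_def cauchy_contraction_def fun_eq_iff)
   thus ?thesis
    using weighted_cmult[OF p open_UNIV weighted_cauchy_transform[OF p t vm vs R vw]] by simp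
  qed (simp add: Cv_def cauchy_contraction_def[abs_def] weighted_zero)
  have Cvd: "Cv J = (%z. 0)" if "card J ~= Suc q" for J
  proof (cases "k : J")
   case False
   hence *: "v (insert k J) = (%z. 0)" using dist_dbarD(4)[OF open_UNIV DU, of "insert k J"] that by simp
   show ?thesis by (rule ext) (simp add: Cv_def cauchy_contraction_def *)
  qed (simp add: Cv_def cauchy_contraction_def fun_eq_iff)
  define W0 where "W0 = {z. ALL j. norm (z $ j - x $ j) < r}"
  have W0o: "open W0" 
  proof -
   have "W0 = (\<Inter>j. {z. norm (z $ j - x $ j) < r})" by (auto simp: W0_def)
   thus ?thesis by (simp only:) (intro open_INT finite ballI open_Collect_less continuous_intros)
  qed
  have W0: "x : W0" "W0 <= U"
  proof -
   show "x : W0" using r by (simp add: W0_def)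
   have "z : cball x e" if "z : W0" for z
   proof -
    have "norm (z $ j - x $ j) <= 2 * r" for j
    proof -
     have "norm (z $ j - x $ j) < r" using that by (simp add: W0_def)
     thus ?thesis using r(1) by linarith
    qed
    from dist_le_coordinates[OF this] show ?thesis using r(2) by simp
   qed
   thus "W0 <= U" using e(2) by blast
  qed
  have \<theta>1: "\<theta> z = 1" if "z : W0" for z
   unfolding \<theta>_def using \<beta>(3) that by (intro prod.neutral) (auto simp: W0_def less_imp_le)
  define f' where "f' J z = indicator W0 z * Cv J z" for J z
  have f'0: "f' J = (%z. 0)" if J: "J Int insert k S ~= {}" for J
  proof (cases "k : J")
   case False
   have "cauchy_transform k (v (insert k J)) z = 0" if z: "z : W0" for z
   proof -
    have "v (insert k J) (z - axis k (w $ 1)) = 0" for w :: "complex^1"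
     unfolding v_def dbar_wedge_def
    proof (rule sum.neutral, intro ballI)
     fix j assume j: "j : insert k J"
     define y where "y = z - axis k (w $ 1)"
     have "wirtinger_bar j \<theta> y * F1 (insert k J - {j}) y = 0"
     proof (cases "j = k")
      case True
      hence "insert k J - {j} = J" using False by auto
      thus ?thesis using J False by (auto simp: F1_def)
     next
      case jk: False
      define N where "N = {y. ALL i:UNIV - {k}. norm (y $ i - x $ i) < r}"
      have No: "open N" 
      proof -
       have "N = (\<Inter>i\<in>UNIV - {k}. {y. norm (y $ i - x $ i) < r})" by (auto simp: N_def)
       thus ?thesis by (simp only:) (intro open_INT finite ballI open_Collect_less continuous_intros)
      qed
      have yN: "y : N" using z by (auto simp: N_def y_def W0_def axis_def)
      have \<theta>N: "\<theta> y = complex_of_real (\<beta> (x $ k) (y $ k))" if "y : N" for y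
      proof -
       have "(\<Prod>i\<in>UNIV - {k}. complex_of_real (\<beta> (x $ i) (y $ i))) = 1"
        using \<beta>(3) that by (intro prod.neutral) (auto simp: N_def less_imp_le)
       thus ?thesis unfolding \<theta>_def by (subst prod.remove[of UNIV k]) auto
      qed
      have d: "((%y. complex_of_real (\<beta> (x $ k) (y $ k))) has_derivative
        (%a. dir_deriv (%c. complex_of_real (\<beta> (x $ k) c)) (a $ k) (y $ k))) (at y)"
       by (rule has_derivative_compose[OF bounded_linear_imp_has_derivative[OF bounded_linear_vec_nth] smooth_has_derivative[OF smooth_of_real[OF \<beta>(1)]]])
      have lin: "linear (frechet_derivative (%c. complex_of_real (\<beta> (x $ k) c)) (at (y $ k)))"
       by (rule has_derivative_linear[OF smooth_has_derivative[OF smooth_of_real[OF \<beta>(1)]]])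
      have "wirtinger_bar j \<theta> y = wirtinger_bar j (%y. complex_of_real (\<beta> (x $ k) (y $ k))) y"
       by (rule wirtinger_bar_cong_open[OF No yN _ d]) (rule \<theta>N)
      also have "... = 0" using wirtinger_bar_eq[OF d, of j] jk linear_0[OF lin] by (simp add: axis_def)
      finally show ?thesis by simp
     qed
     thus "form_sign j (insert k J) * wirtinger_bar j \<theta> (z - axis k (w $ 1)) * F1 (insert k J - {j}) (z - axis k (w $ 1)) = 0"
      by (simp add: y_def)
    qed
    thus ?thesis by (simp add: cauchy_transform_def)
   qed
   thus ?thesis using False by (auto simp: f'_def Cv_def cauchy_contraction_def fun_eq_iff indicator_def)
  qed (simp add: f'_def Cv_def cauchy_contraction_def fun_eq_iff)
  have f'd: "f' J = (%z. 0)" if "card J ~= Suc q" for J using Cvd[OF that] by (simp add: f'_def fun_eq_iff)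
  have f'e: "AE z in lebesgue_on W0. f' J z = Cv J z" for J
   unfolding AE_on_iff[OF open_in_lebesgue[OF W0o]] by (auto simp: f'_def)
  have f'w: "f' : weighted_Lp_forms p t (Suc q) W0"
   using weighted_cong_AE[OF p W0o weighted_subset[OF Cvw subset_UNIV] f'e] f'd by (simp add: weighted_Lp_forms_iff)
  have gF: "AE z in lebesgue_on W0. F J z = g J z + f' J z" for J
  proof -
   have "AE z in lebesgue_on W0. z : W0" unfolding AE_on_iff[OF open_in_lebesgue[OF W0o]] by auto
   with f'e[of J] AE_on_subset[OF F1e[of J] W0(2) open_in_lebesgue[OF U(1)] open_in_lebesgue[OF W0o]]
   show ?thesis by eventually_elim (simp add: g_def u_def \<theta>1)
  qed
  have H0: "dist_dbar W0 q Cu g" by (rule dist_dbar_subset[OF open_UNIV W0o subset_UNIV H])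
  have "dist_dbar W0 (Suc q) (%J z. F J z + (- 1) * g J z) (%J z. 0 + (- 1) * 0)"
   by (intro dist_dbar_add dist_dbar_cmult W0o dist_dbar_dbar[OF W0o H0] dist_dbar_subset[OF U(1) W0o W0(2) D])
  hence Df': "dist_dbar W0 (Suc q) f' (%J z. 0)"
  proof (rule dist_dbar_cong_AE[OF W0o _ _ f'd])
   show "AE z in lebesgue_on W0. f' J z = F J z + (- 1) * g J z" for J using gF[of J] by eventually_elim simp
  qed auto
  obtain W G2 where G2: "open W" "x : W" "W <= W0" "G2 : weighted_Lp_forms p t q W" "dist_dbar W q G2 f'"
   using Suc.IH[OF cS W0o W0(1) f'w Df'] f'0 by blast
  define G where "G J z = Cu J z + G2 J z" for J z
  have G2': "weighted_Lp_loc p t W (G2 J)" "card J ~= q ==> G2 J = (%z. 0)" for J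
   using G2(4) unfolding weighted_Lp_forms_iff by blast+
  show ?case
  proof (intro exI conjI)
   show "open W" "x : W" "W <= U" using G2 W0 by auto
   show "G : weighted_Lp_forms p t q W"
    using weighted_add[OF p G2(1) weighted_subset[OF Cuw subset_UNIV] G2'(1)] G2'(2) dist_dbarD(3)[OF open_UNIV H]
    by (simp add: weighted_Lp_forms_iff G_def[abs_def])
   have *: "dist_dbar W q G (%J z. g J z + f' J z)" unfolding G_def[abs_def]
    by (rule dist_dbar_add[OF G2(1) dist_dbar_subset[OF W0o G2(1,3) H0] G2(5)])
   show "dist_dbar W q G F"
   proof (rule dist_dbar_cong_AE[OF G2(1) * _ _ _ F(2)])
    show "AE z in lebesgue_on W. F J z = g J z + f' J z" for J
     by (rule AE_on_subset[OF gF G2(3) open_in_lebesgue[OF W0o] open_in_lebesgue[OF G2(1)]])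
   qed (use dist_dbarD(3)[OF G2(1) *] in auto)
  qed
 qed
 from this[OF refl U F D, of "{}"] show ?thesis by simp
qed

section \<open>The weight and its defining minimum\<close>

text \<open>Averaging over translations in the direction of \<open>z\<^sub>k\<close> removes the factor \<open>|z\<^sub>k|\<^bsup>-c\<^sub>k\<^esup>\<close>, since its
  averages over discs are bounded.\<close>

lemma nn_integral_prod_powr_finite:
 fixes c :: "'n::finite => real"
 assumes "!!j. c j < 2"
 shows "(NN (z::complex^'n). ennreal (\<Prod>j\<in>A. norm (z $ j) powr (- c j)) * indicator (cball 0 R) z) < \<infinity>"
 using finite[of A]
proof (induction A arbitrary: R rule: finite_induct)
 case empty
 show ?case using emeasure_lborel_cball_finite[of "0::complex^'n" R] by simp
next
 case (insert k A)
 define h where "h z = (\<Prod>j\<in>A. norm (z $ j) powr (- c j))" for z :: "complex^'n"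
 define f where "f z = ennreal (\<Prod>j\<in>insert k A. norm (z $ j) powr (- c j)) * indicator (cball 0 R) z" for z :: "complex^'n"
 have h0: "h z >= 0" for z unfolding h_def by (intro prod_nonneg) auto
 have [measurable]: "h : borel_measurable borel" unfolding h_def by measurable
 have [measurable]: "f : borel_measurable borel" unfolding f_def by measurable
 have hk: "h (z + axis k a) = h z" for z a
  unfolding h_def using insert.hyps by (intro prod.cong) (auto simp: axis_def)
 obtain M where M: "!!a::complex^1. norm a <= R + 1 ==>
   (NN w. ennreal (norm (a + w) powr (- c k)) * indicator (cball 0 1) w) <= ennreal M"
  using nn_integral_translated_norm_powr[of "c k" "R + 1" 1, OF assms] by blast
 let ?v = "emeasure lborel (cball 0 1 :: (complex^1) set)"
 have pos: "0 < ?v" by (simp add: emeasure_cball)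
 have b: "f (z + axis k (w $ 1)) * indicator (cball 0 1) w
   <= (ennreal (h z) * indicator (cball 0 (R + 1)) z) * (ennreal (norm (vec (z $ k) + w) powr (- c k)) * indicator (cball 0 1) w)"
  for z and w :: "complex^1"
 proof (cases "w : cball 0 1 & z + axis k (w $ 1) : cball 0 R")
  case True
  hence "norm z <= R + 1"
   using norm_triangle_ineq4[of "z + axis k (w $ 1)" "axis k (w $ 1)"] by (simp add: norm_axis_complex norm_vector_1)
  moreover have "norm (vec (z $ k) + w) = norm (z $ k + w $ 1)" by (simp add: norm_vector_1)
  moreover have "(\<Prod>j\<in>insert k A. norm ((z + axis k (w $ 1)) $ j) powr (- c j)) = norm (z $ k + w $ 1) powr (- c k) * h z"
   using hk[of z "w $ 1"] insert.hyps by (simp add: h_def)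
  ultimately show ?thesis using True h0[of z]
   by (simp only: f_def) (simp add: ennreal_mult' mult.commute)
 qed (auto simp: f_def indicator_def)
 have "?v * (NN z. f z) = (NN (w::complex^1). (NN z. f z) * indicator (cball 0 1) w)"
  by (subst nn_integral_cmult_indicator) (auto simp: mult.commute)
 also have "... = (NN (w::complex^1). (NN z. f (z + axis k (w $ 1)) * indicator (cball 0 1) w))"
  by (intro nn_integral_cong) (simp add: nn_integral_multc nn_integral_lborel_translate)
 also have "... = (NN z. (NN (w::complex^1). f (z + axis k (w $ 1)) * indicator (cball 0 1) w))"
  by (rule lborel_pair.Fubini') measurable
 also have "... <= (NN z. (NN (w::complex^1). (ennreal (h z) * indicator (cball 0 (R + 1)) z) * (ennreal (norm (vec (z $ k) + w) powr (- c k)) * indicator (cball 0 1) w)))"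
  by (intro nn_integral_mono b)
 also have "... = (NN z. (ennreal (h z) * indicator (cball 0 (R + 1)) z) * (NN (w::complex^1). ennreal (norm (vec (z $ k) + w) powr (- c k)) * indicator (cball 0 1) w))"
  by (intro nn_integral_cong nn_integral_cmult) measurable
 also have "... <= (NN z. (ennreal (h z) * indicator (cball 0 (R + 1)) z) * ennreal M)"
 proof (intro nn_integral_mono)
  fix z :: "complex^'n"
  show "(ennreal (h z) * indicator (cball 0 (R + 1)) z) * (NN (w::complex^1). ennreal (norm (vec (z $ k) + w) powr (- c k)) * indicator (cball 0 1) w)
   <= (ennreal (h z) * indicator (cball 0 (R + 1)) z) * ennreal M"
  proof (cases "norm z <= R + 1")
   case True
   hence "norm (vec (z $ k) :: complex^1) <= R + 1" using Finite_Cartesian_Product.norm_nth_le[of z k] by (simp add: norm_vector_1)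
   thus ?thesis using M by (intro mult_left_mono) auto
  qed simp
 qed
 also have "... = (NN z. ennreal (h z) * indicator (cball 0 (R + 1)) z) * ennreal M"
  by (rule nn_integral_multc) measurable
 also have "... < \<infinity>" using insert.IH[of "R + 1"] by (simp add: h_def ennreal_mult_less_top)
 finally have "?v * (NN z. f z) < \<infinity>" .
 hence "(NN z. f z) < \<infinity>" using pos by (auto simp: ennreal_mult_less_top)
 thus ?case by (simp only: f_def)
qed

text \<open>Condition for \<open>|z|\<^bsup>-t\<^esup>\<close> to be locally in \<open>L\<^sup>p\<close> in one variable.\<close>

definition integrable_exponent :: "ennreal => real => bool" where
 "integrable_exponent p t \<longleftrightarrow> (if p = \<infinity> then t <= 0 else t * enn2real p < 2)"

lemma Lp_loc_abs_powr:
 fixes t :: "real^'n::finite"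
 assumes t: "!!j. integrable_exponent p (t $ j)"
 shows "Lp_loc p UNIV (%z. complex_of_real (abs_powr z (- t)))"
proof (rule Lp_locI)
 show "(%z. complex_of_real (abs_powr z (- t))) : lmeas UNIV"
  by (intro borel_imp_measurable_on) measurable
 fix K :: "(complex^'n) set" assume K: "compact K"
 obtain M where M: "K <= cball 0 M" using compact_imp_bounded[OF K] by (auto simp: bounded_pos subset_iff)
 have a0: "abs_powr z (- t) >= 0" for z unfolding abs_powr_def by (intro prod_nonneg) auto
 show "if p = \<infinity> then EX C. AE z in lborel. z : K --> norm (complex_of_real (abs_powr z (- t))) <= C
   else (NN z. ennreal (norm (complex_of_real (abs_powr z (- t))) powr enn2real p) * indicator K z) < \<infinity>"
 proof (cases "p = \<infinity>")
  case True
  have "norm (complex_of_real (abs_powr z (- t))) <= (\<Prod>j\<in>UNIV. M powr (- t $ j))" if z: "z : K" for z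
  proof -
   have "norm (z $ j) <= M" for j using M z Finite_Cartesian_Product.norm_nth_le[of z j] by fastforce
   hence "abs_powr z (- t) <= (\<Prod>j\<in>UNIV. M powr (- t $ j))"
    unfolding abs_powr_def using t True by (intro prod_mono) (auto simp: integrable_exponent_def intro!: powr_mono2)
   thus ?thesis using a0[of z] by simp
  qed
  thus ?thesis using True by auto
 next
  case False
  let ?q = "enn2real p"
  have "norm (complex_of_real (abs_powr z (- t))) powr ?q = (\<Prod>j\<in>UNIV. norm (z $ j) powr (- (t $ j * ?q)))" for z :: "complex^'n"
  proof -
   have "abs_powr z (- t) powr ?q = (\<Prod>j\<in>UNIV. norm (z $ j) powr (- (t $ j * ?q)))"
    by (simp add: abs_powr_def powr_powr prod_powr_distrib)
   thus ?thesis using a0[of z] by simp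
  qed
  hence "(NN z. ennreal (norm (complex_of_real (abs_powr z (- t))) powr ?q) * indicator K z)
    <= (NN (z::complex^'n). ennreal (\<Prod>j\<in>UNIV. norm (z $ j) powr (- (t $ j * ?q))) * indicator (cball 0 M) z)"
   using M by (intro nn_integral_mono) (auto simp: indicator_def)
  also have "... < \<infinity>"
   by (rule nn_integral_prod_powr_finite) (use t False in "simp add: integrable_exponent_def")
  finally show ?thesis using False by simp
 qed
qed

lemma weighted_continuous:
 fixes t :: "real^'n::finite"
 assumes p: "p >= 1" and U: "open U" and t: "!!j. integrable_exponent p (t $ j)" and h: "continuous_on U h"
 shows "weighted_Lp_loc p t U h"
 unfolding weighted_Lp_loc_def
proof
 show hm: "h : lmeas U"
  by (rule continuous_imp_measurable_on_sets_lebesgue[OF h open_in_lebesgue[OF U]])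
 have "Lp_loc p U (%z. h z * complex_of_real (abs_powr z (- t)))"
 proof (rule Lp_loc_mult[OF p U Lp_loc_subset[OF Lp_loc_abs_powr[OF t] subset_UNIV] hm])
  fix K assume K: "compact K" "K <= U"
  have "bounded (h ` K)" by (intro compact_imp_bounded compact_continuous_image continuous_on_subset[OF h] K)
  thus "EX C. ALL z:K. norm (h z) <= C" by (auto simp: bounded_iff)
 qed
 thus "Lp_loc p U (%z. complex_of_real (abs_powr z (- t)) * h z)" by (simp add: mult.commute)
qed

lemma monom_powi_inverse:
 assumes "ALL j. z $ j ~= 0"
 shows "monom_powi z m * monom_powi z (- m) = 1"
 unfolding monom_powi_def prod.distrib[symmetric] using assms by (intro prod.neutral) (simp add: power_int_minus)

lemma norm_monom_powi:
 assumes "ALL j. z $ j ~= 0"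
 shows "norm (monom_powi z m) = abs_powr z (\<chi> j. of_int (m $ j))"
 unfolding monom_powi_def abs_powr_def prod_norm[symmetric]
 using assms by (intro prod.cong) (simp_all add: norm_power_int powr_real_of_int')

abbreviation shifted_weight :: "real^'n => int^'n => real^'n::finite" where
 "shifted_weight s m \<equiv> (\<chi> j. s $ j - of_int (m $ j))"

lemma abs_powr_shift:
 assumes z: "ALL j. z $ j ~= 0"
 shows "norm (complex_of_real (abs_powr z (- shifted_weight s m)) * (monom_powi z (- m) * w))
  = norm (complex_of_real (abs_powr z (- s)) * w)"
proof -
 have "abs_powr z (- shifted_weight s m) * abs_powr z (\<chi> j. of_int ((- m) $ j)) = abs_powr z (- s)"
  unfolding abs_powr_def prod.distrib[symmetric] using z
  by (intro prod.cong) (auto simp flip: powr_add)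
 moreover have "abs_powr z r >= 0" for r unfolding abs_powr_def by (intro prod_nonneg) auto
 ultimately show ?thesis by (simp add: norm_mult norm_monom_powi[OF z] abs_of_nonneg flip: mult.assoc)
qed

lemma measurable_monom_mult:
 assumes "f : lmeas U"
 shows "(%z. monom_powi z m * f z) : lmeas U"
 by (intro borel_measurable_times assms borel_imp_measurable_on borel_measurable_monom_powi)

lemma weighted_shift:
 assumes p: "p >= 1" and U: "open U" and f: "f : lmeas U"
 shows "weighted_Lp_loc p (shifted_weight s m) U (%z. monom_powi z (- m) * f z) \<longleftrightarrow> weighted_Lp_loc p s U f"
proof -
 let ?a = "%z. complex_of_real (abs_powr z (- shifted_weight s m)) * (monom_powi z (- m) * f z)"
 let ?b = "%z. complex_of_real (abs_powr z (- s)) * f z"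
 have eq: "AE z in lborel. norm (?a z) = norm (?b z)"
  using AE_coords_nonzero by eventually_elim (rule abs_powr_shift)
 have bd: "EX C. AE z in lborel. z : K --> norm (?a z) <= C * (norm (?b z) + norm (?b z))"
  "EX C. AE z in lborel. z : K --> norm (?b z) <= C * (norm (?a z) + norm (?a z))" for K
  by (rule exI[of _ 1], use eq in eventually_elim, simp)+
 have m: "?a : lmeas U" "?b : lmeas U"
  by (intro borel_measurable_times f measurable_monom_mult borel_imp_measurable_on; measurable)+
 have "Lp_loc p U ?a \<longleftrightarrow> Lp_loc p U ?b"
  using Lp_loc_bound[OF p U m(1) _ _ bd(1)] Lp_loc_bound[OF p U m(2) _ _ bd(2)] by blast
 thus ?thesis using f measurable_monom_mult[OF f] by (simp add: weighted_Lp_loc_def)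
qed

lemma ideal_section_eq:
 assumes "ALL z:U. (ALL j. z $ j ~= 0) --> monom_powi z (- m) * f z = h z" "open U"
 shows "AE z in lebesgue_on U. monom_powi z (- m) * f z = h z" "AE z in lebesgue_on U. f z = monom_powi z m * h z"
proof -
 have "AE z in lebesgue_on U. z : U & (ALL j. z $ j ~= 0)"
  unfolding AE_on_iff[OF open_in_lebesgue[OF assms(2)]] using AE_coords_nonzero by eventually_elim simp
 thus *: "AE z in lebesgue_on U. monom_powi z (- m) * f z = h z"
  by eventually_elim (use assms(1) in blast)
 have "AE z in lebesgue_on U. ALL j. z $ j ~= 0"
  unfolding AE_on_iff[OF open_in_lebesgue[OF assms(2)]] using AE_coords_nonzero by eventually_elim simp
 with * show "AE z in lebesgue_on U. f z = monom_powi z m * h z"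
 proof eventually_elim
  case (elim z)
  thus ?case using monom_powi_inverse[of z m] by (simp flip: elim(1) mult.assoc)
 qed
qed

lemma ideal_section_weighted:
 assumes p: "p >= 1" and U: "open U" and t: "!!j. integrable_exponent p (s $ j - of_int (m $ j))"
  and f: "f : ideal_sections m U"
 shows "weighted_Lp_loc p s U f"
proof -
 obtain h where h: "holomorphic_n U h" "ALL z:U. (ALL j. z $ j ~= 0) --> monom_powi z (- m) * f z = h z"
  using f by (auto simp: ideal_sections_def)
 note eq = ideal_section_eq[OF h(2) U]
 have wh: "weighted_Lp_loc p (shifted_weight s m) U h"
  by (rule weighted_continuous[OF p U _ holomorphic_n_continuous[OF h(1)]]) (simp add: t)
 have "(%z. monom_powi z m * h z) : lmeas U"
  using wh by (intro measurable_monom_mult) (simp add: weighted_Lp_loc_def)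
 from measurable_on_cong_AE[OF open_in_lebesgue[OF U] this eq(2)]
 have fm: "f : lmeas U" .
 show ?thesis using weighted_cong_AE[OF p U wh eq(1)] weighted_shift[OF p U fm] by blast
qed

lemma powi_weighted_imp:
 assumes p: "p >= 1"
  and w: "weighted_Lp_loc p (\<chi> j. \<sigma>) UNIV (%z::complex^1. if z $ 1 = 0 then 0 else (z $ 1) powi m)"
 shows "integrable_exponent p (\<sigma> - of_int m)"
proof (rule ccontr)
 assume neg: "~ ?thesis"
 let ?F = "%z::complex^1. complex_of_real (abs_powr z (- (\<chi> j. \<sigma>))) * (if z $ 1 = 0 then 0 else (z $ 1) powi m)"
 define a where "a = \<sigma> - of_int m"
 have U1: "(UNIV::1 set) = {1}" by auto
 have nF: "norm (?F z) = norm z powr (- a)" if "ALL j. z $ j ~= 0" for z :: "complex^1"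
 proof -
  have z: "z $ 1 ~= 0" using that by simp
  have "norm (?F z) = norm (z $ 1) powr (- \<sigma>) * norm (z $ 1) powr of_int m"
   using z by (simp add: abs_powr_def U1 norm_mult norm_power_int powr_real_of_int')
  thus ?thesis by (simp add: norm_vector_1 a_def flip: powr_add)
 qed
 note L = w[unfolded weighted_Lp_loc_def, THEN conjunct2, THEN Lp_locD, OF compact_cball[of 0 1] subset_UNIV]
 show False
 proof (cases "p = \<infinity>")
  case False
  let ?q = "enn2real p"
  have "(NN z. ennreal (norm (?F z) powr ?q) * indicator (cball 0 1) z)
   = (NN (z::complex^1). ennreal (norm z powr (- (a * ?q))) * indicator (cball 0 1) z)"
  proof (rule nn_integral_cong_AE, use AE_coords_nonzero in eventually_elim)
   case (elim z) thus ?case unfolding nF[OF elim] powr_powr by simp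
  qed
  also have "... = \<infinity>"
   by (rule nn_integral_norm_powr_infinite) (use neg False in "simp_all add: integrable_exponent_def a_def")
  finally show False using L False by simp
 next
  case True
  hence a: "a > 0" using neg by (simp add: integrable_exponent_def a_def)
  obtain C where C: "AE z in lborel. z : cball 0 1 --> norm (?F z) <= C" using L True by auto
  define N where "N = 2 / a"
  have N: "N > 0" "a * N = 2" using a by (auto simp: N_def)
  have "(NN (z::complex^1). ennreal (norm z powr (- (a * N))) * indicator (cball 0 1) z)
   <= (NN (z::complex^1). ennreal (\<bar>C\<bar> powr N) * indicator (cball 0 1) z)"
  proof (rule nn_integral_mono_AE, use C AE_coords_nonzero[where 'n = 1] in eventually_elim)
   case (elim z)
   show ?case
   proof (cases "z : cball 0 1")
    case True
    hence "norm z powr (- a) <= \<bar>C\<bar>" using elim nF[of z] by auto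
    hence "(norm z powr (- a)) powr N <= \<bar>C\<bar> powr N" using N by (intro powr_mono2) auto
    thus ?thesis using True by (simp add: powr_powr ennreal_leI)
   qed simp
  qed
  also have "... < \<infinity>" using emeasure_lborel_cball_finite[of "0::complex^1" 1]
   by (simp add: nn_integral_cmult_indicator ennreal_mult_less_top)
  finally show False
   using nn_integral_norm_powr_infinite[where 'a = "complex^1" and c = "a * N" and R = 1] N by simp
 qed
qed

text \<open>The minimum is characterised by the exponents for which \<open>z\<^sup>m\<close> itself is in the weighted space.\<close>

lemma dbar_weight1_eq:
 assumes p: "p >= 1"
 shows "dbar_weight1 p \<sigma> = (LEAST m. integrable_exponent p (\<sigma> - of_int m))"
proof -
 have "(ALL U::(complex^1) set. open U --> (ALL f:ideal_sections (\<chi> j. m) U. weighted_Lp_loc p (\<chi> j. \<sigma>) U f))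
   \<longleftrightarrow> integrable_exponent p (\<sigma> - of_int m)" (is "?A \<longleftrightarrow> ?B") for m
 proof
  assume ?B
  thus ?A using ideal_section_weighted[OF p, where 'a = 1 and s = "\<chi> j. \<sigma>" and m = "\<chi> j. m"] by simp
 next
  assume A: ?A
  let ?f = "%z::complex^1. if z $ 1 = 0 then 0 else (z $ 1) powi m"
  have U1: "(UNIV::1 set) = {1}" by auto
  have "holomorphic_n UNIV (%z::complex^1. 1)"
   unfolding holomorphic_n_def by (auto intro!: exI[of _ "%_. 0"])
  moreover have "ALL z:UNIV. (ALL j. z $ j ~= 0) --> monom_powi z (- (\<chi> j. m)) * ?f z = 1"
   by (simp add: monom_powi_def U1 power_int_minus)
  ultimately have "?f : ideal_sections (\<chi> j. m) UNIV"
   unfolding ideal_sections_def by (auto intro!: exI[of _ "%_. 1"])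
  thus ?B using powi_weighted_imp[OF p] A by blast
 qed
 thus ?thesis unfolding dbar_weight1_def by simp
qed

lemma dbar_weight1_bounds:
 fixes \<sigma> :: real
 assumes p: "p >= 1"
 defines "t \<equiv> \<sigma> - of_int (dbar_weight1 p \<sigma>)"
 shows "integrable_exponent p t" "admissible_exponent p t"
proof -
 have "integrable_exponent p t & admissible_exponent p t"
 proof (cases "p = \<infinity>")
  case True
  have "dbar_weight1 p \<sigma> = \<lceil>\<sigma>\<rceil>" unfolding dbar_weight1_eq[OF p] integrable_exponent_def
   by (rule Least_equality) (use True in "auto simp: le_of_int_ceiling ceiling_le")
  thus ?thesis using True ceiling_correct[of \<sigma>]
   by (auto simp: t_def integrable_exponent_def admissible_exponent_def)
 next
  case False
  define q where "q = enn2real p"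
  have q: "q >= 1" using p False unfolding q_def by (cases p) auto
  have iff: "integrable_exponent p (\<sigma> - of_int m) \<longleftrightarrow> \<sigma> - 2 / q < of_int m" for m
   using False q by (simp add: integrable_exponent_def q_def[symmetric] field_simps)
  have m: "dbar_weight1 p \<sigma> = \<lfloor>\<sigma> - 2 / q\<rfloor> + 1" unfolding dbar_weight1_eq[OF p] iff
  proof (rule Least_equality)
   show "\<sigma> - 2 / q < of_int (\<lfloor>\<sigma> - 2 / q\<rfloor> + 1)" using floor_correct[of "\<sigma> - 2 / q"] by simp
   show "\<lfloor>\<sigma> - 2 / q\<rfloor> + 1 <= m" if "\<sigma> - 2 / q < of_int m" for m using that by linarith
  qed
  have "integrable_exponent p t" unfolding t_def iff m using floor_correct[of "\<sigma> - 2 / q"] by simp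
  moreover have "2 / q <= t + 1" using of_int_floor_le[of "\<sigma> - 2 / q"] unfolding t_def m of_int_add of_int_1 by linarith
  hence "2 <= (t + 1) * q" using q by (simp add: divide_le_eq)
  hence "2 - 2 * q < t * q" using q by (simp add: distrib_right)
  ultimately show ?thesis using False by (simp add: integrable_exponent_def admissible_exponent_def q_def)
 qed
 thus "integrable_exponent p t" "admissible_exponent p t" by auto
qed

section \<open>The operator \<open>dbar\<^sub>m\<close>\<close>

definition twist :: "int^'n => 'n::finite form => 'n form" where
 "twist m f J z = monom_powi z m * f J z"

lemma twist_inverse:
 assumes "open U"
 shows "AE z in lebesgue_on U. twist m (twist (- m) f) J z = f J z" "AE z in lebesgue_on U. twist (- m) (twist m f) J z = f J z"
proof -
 have "AE z in lebesgue_on U. ALL j. z $ j ~= 0"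
  unfolding AE_on_iff[OF open_in_lebesgue[OF assms]] using AE_coords_nonzero by eventually_elim simp
 thus "AE z in lebesgue_on U. twist m (twist (- m) f) J z = f J z" "AE z in lebesgue_on U. twist (- m) (twist m f) J z = f J z"
  by (eventually_elim, use monom_powi_inverse[of _ m] in \<open>simp add: twist_def mult.commute[of "monom_powi _ (- m)"] flip: mult.assoc\<close>)+
qed

lemma twist_cong_AE:
 "AE z in lebesgue_on U. f J z = g J z ==> AE z in lebesgue_on U. twist m f J z = twist m g J z"
 by (auto simp: twist_def elim: eventually_mono)

lemma twist_degree: "f J = (%z. 0) ==> twist m f J = (%z. 0)"
 by (simp add: twist_def fun_eq_iff)

lemma measurable_formsD:
 assumes "f : measurable_forms q U"
 shows "f J : lmeas U" "card J ~= q ==> f J = (%z. 0)"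
 using assms by (auto simp: measurable_forms_def)

lemma has_dbar_m_iff:
 assumes U: "open U"
 shows "has_dbar_m m U q f h \<longleftrightarrow> f : measurable_forms q U & h : measurable_forms (Suc q) U &
  dist_dbar U q (twist (- m) f) (twist (- m) h)"
proof -
 have tw: "(%J z. monom_powi z m * f J z) = twist m f" for m f by (simp add: twist_def fun_eq_iff)
 show ?thesis
 proof
  assume "has_dbar_m m U q f h"
  then obtain g where fh: "f : measurable_forms q U" "h : measurable_forms (Suc q) U"
   and D: "dist_dbar U q (twist (- m) f) g" and g: "!!K. AE z in lebesgue_on U. h K z = twist m g K z"
   unfolding has_dbar_m_def tw by (auto simp: twist_def)
  have "dist_dbar U q (twist (- m) f) (twist (- m) h)"
  proof (rule dist_dbar_cong_AE[OF U D])
   show "AE z in lebesgue_on U. twist (- m) h J z = g J z" for J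
    using twist_cong_AE[where f = h and g = "twist m g" and J = J and m = "- m", OF g[of J]] twist_inverse(2)[OF U, of m g J] by eventually_elim simp
   show "twist (- m) h J = (%z. 0)" if "card J ~= Suc q" for J by (rule twist_degree[where f = h and J = J, OF measurable_formsD(2)[OF fh(2) that]])
  qed (use dist_dbarD(3)[OF U D] in auto)
  thus "f : measurable_forms q U & h : measurable_forms (Suc q) U & dist_dbar U q (twist (- m) f) (twist (- m) h)"
   using fh by blast
 next
  assume *: "f : measurable_forms q U & h : measurable_forms (Suc q) U & dist_dbar U q (twist (- m) f) (twist (- m) h)"
  have "AE z in lebesgue_on U. h K z = monom_powi z m * twist (- m) h K z" for K
   using twist_inverse(1)[OF U, of m h K] by eventually_elim (simp add: twist_def)
  thus "has_dbar_m m U q f h" unfolding has_dbar_m_def tw using * by blast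
 qed
qed

lemma measurable_forms_add:
 assumes "f : measurable_forms q U" "g : measurable_forms q U"
 shows "(%J z. f J z + g J z) : measurable_forms q U"
 using measurable_formsD[OF assms(1)] measurable_formsD[OF assms(2)]
 by (auto simp: measurable_forms_def intro: borel_measurable_add)

lemma measurable_forms_cmult:
 assumes "f : measurable_forms q U"
 shows "(%J z. c * f J z) : measurable_forms q U"
 using measurable_formsD[OF assms] by (auto simp: measurable_forms_def intro: borel_measurable_times)

lemma measurable_forms_zero [simp]: "(%J z. 0) : measurable_forms q U"
 by (simp add: measurable_forms_def)

lemma measurable_forms_subset: "f : measurable_forms q U ==> V <= U ==> f : measurable_forms q V"
 by (auto simp: measurable_forms_def intro: measurable_on_subset)

lemma measurable_forms_cong_AE:
 assumes U: "open U" and f: "f : measurable_forms q U" and eq: "!!J. AE z in lebesgue_on U. g J z = f J z"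
  and g: "!!J. card J ~= q ==> g J = (%z. 0)"
 shows "g : measurable_forms q U"
 using measurable_on_cong_AE[OF open_in_lebesgue[OF U] measurable_formsD(1)[OF f] eq] g by (simp add: measurable_forms_def)

lemma measurable_forms_local:
 assumes U: "open U" and loc: "!!x. x : U ==> EX V. open V & x : V & V <= U & f : measurable_forms q V"
  and f: "!!J. card J ~= q ==> f J = (%z. 0)"
 shows "f : measurable_forms q U"
 unfolding measurable_forms_def
proof (intro CollectI conjI allI impI)
 fix J show "f J : lmeas U"
  by (rule measurable_on_local[OF U]) (use loc measurable_formsD(1) in meson)
qed (use f in auto)

lemma has_dbar_m_subset:
 assumes "open U" "open V" "V <= U" "has_dbar_m m U q f h"
 shows "has_dbar_m m V q f h"
 using assms dist_dbar_subset measurable_forms_subset by (metis has_dbar_m_iff)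

lemma has_dbar_m_cong_AE:
 assumes U: "open U" and D: "has_dbar_m m U q f h"
  and f': "!!J. AE z in lebesgue_on U. f' J z = f J z" "f' : measurable_forms q U"
  and h': "!!J. AE z in lebesgue_on U. h' J z = h J z" "h' : measurable_forms (Suc q) U"
 shows "has_dbar_m m U q f' h'"
proof -
 have "dist_dbar U q (twist (- m) f) (twist (- m) h)" using D by (simp add: has_dbar_m_iff[OF U])
 hence "dist_dbar U q (twist (- m) f') (twist (- m) h')"
  by (rule dist_dbar_cong_AE[OF U])
    (intro twist_cong_AE f' h' twist_degree measurable_formsD(2)[OF f'(2)] measurable_formsD(2)[OF h'(2)]; assumption)+
 thus ?thesis using f' h' by (simp add: has_dbar_m_iff[OF U])
qed

lemma has_dbar_m_add:
 assumes U: "open U" and "has_dbar_m m U q f h" "has_dbar_m m U q f' h'"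
 shows "has_dbar_m m U q (%J z. f J z + f' J z) (%J z. h J z + h' J z)"
proof -
 have tw: "twist n (%J z. f J z + f' J z) = (%J z. twist n f J z + twist n f' J z)" for n and f f' :: "'a form"
  by (simp add: twist_def fun_eq_iff distrib_left)
 show ?thesis using assms(2,3) dist_dbar_add[OF U] measurable_forms_add unfolding has_dbar_m_iff[OF U] tw by blast
qed

lemma has_dbar_m_cmult:
 assumes U: "open U" and "has_dbar_m m U q f h"
 shows "has_dbar_m m U q (%J z. c * f J z) (%J z. c * h J z)"
proof -
 have tw: "twist n (%J z. c * f J z) = (%J z. c * twist n f J z)" for n and f :: "'a form"
  by (simp add: twist_def fun_eq_iff mult.left_commute)
 show ?thesis using assms(2) dist_dbar_cmult[OF U] measurable_forms_cmult unfolding has_dbar_m_iff[OF U] tw by blast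
qed

lemma twist_zero [simp]: "twist m (%J z. 0) = (%J z. 0)"
 by (simp add: twist_def fun_eq_iff)

lemma has_dbar_m_zero: "open U ==> has_dbar_m m U q (%J z. 0) (%J z. 0)"
 by (simp add: has_dbar_m_iff dist_dbar_zero)

lemma has_dbar_m_dbar:
 assumes U: "open U" and "has_dbar_m m U q f h"
 shows "has_dbar_m m U (Suc q) h (%J z. 0)"
 using assms(2) dist_dbar_dbar[OF U] by (auto simp: has_dbar_m_iff[OF U])

lemma has_dbar_m_unique:
 assumes U: "open U" and "has_dbar_m m U q f h" "has_dbar_m m U q f h'"
 shows "AE z in lebesgue_on U. h' J z = h J z"
proof -
 have "AE z in lebesgue_on U. twist (- m) h' J z = twist (- m) h J z"
  by (rule dist_dbar_unique[OF U]) (use assms has_dbar_m_iff[OF U] in blast)+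
 from twist_cong_AE[where f = "twist (- m) h'" and g = "twist (- m) h" and J = J and m = m, OF this] twist_inverse(1)[OF U, of m h' J] twist_inverse(1)[OF U, of m h J]
 show ?thesis by eventually_elim simp
qed

lemma has_dbar_m_mult:
 assumes U: "open U" and D: "has_dbar_m m U q f h" and \<theta>: "smooth \<theta>"
 shows "has_dbar_m m U q (%J z. \<theta> z * f J z) (%J z. \<theta> z * h J z + dbar_wedge \<theta> f J z)"
proof -
 note * = D[unfolded has_dbar_m_iff[OF U]]
 have tw: "(%J z. \<theta> z * twist (- m) f J z) = twist (- m) (%J z. \<theta> z * f J z)"
  "(%J z. \<theta> z * twist (- m) h J z + dbar_wedge \<theta> (twist (- m) f) J z) = twist (- m) (%J z. \<theta> z * h J z + dbar_wedge \<theta> f J z)"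
  by (simp_all add: twist_def dbar_wedge_def fun_eq_iff distrib_left sum_distrib_left mult_ac)
 have D': "dist_dbar U q (twist (- m) (%J z. \<theta> z * f J z)) (twist (- m) (%J z. \<theta> z * h J z + dbar_wedge \<theta> f J z))"
  using dist_dbar_mult[OF U _ \<theta>, of q "twist (- m) f" "twist (- m) h"] * unfolding tw by blast
 have m: "\<theta> : lmeas U" "wirtinger_bar j \<theta> : lmeas U" for j
  by (intro borel_imp_measurable_on borel_measurable_continuous_onI smooth_continuous smooth_wirtinger_bar \<theta>)+
 have f0: "f (K - {j}) = (%z. 0)" if "card K ~= Suc q" "j : K" for K j
 proof (rule measurable_formsD(2))
  show "card (K - {j}) ~= q" using that card_Suc_Diff1[of K j] by auto
 qed (use * in blast)
 have "(%J z. \<theta> z * f J z) : measurable_forms q U"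
 proof -
  have fm: "f : measurable_forms q U" using * by blast
  show ?thesis unfolding measurable_forms_def
  proof (intro CollectI conjI allI impI)
   show "(%z. \<theta> z * f J z) : lmeas U" for J
    by (rule borel_measurable_times[OF m(1) measurable_formsD(1)[OF fm]])
   show "(%z. \<theta> z * f J z) = (%z. 0)" if "card J ~= q" for J
    unfolding measurable_formsD(2)[OF fm that] by simp
  qed
 qed
 moreover have "(%J z. \<theta> z * h J z + dbar_wedge \<theta> f J z) : measurable_forms (Suc q) U"
  unfolding measurable_forms_def
 proof (intro CollectI conjI allI impI)
  fix J
  show "(%z. \<theta> z * h J z + dbar_wedge \<theta> f J z) : lmeas U"
   unfolding dbar_wedge_def using measurable_formsD(1)[of f q U] measurable_formsD(1)[of h "Suc q" U] *
   by (intro borel_measurable_add borel_measurable_times borel_measurable_sum m) auto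
  assume J: "card J ~= Suc q"
  have "h J = (%z. 0)" using measurable_formsD(2)[of h "Suc q" U] * J by blast
  moreover have "dbar_wedge \<theta> f J z = 0" for z unfolding dbar_wedge_def by (rule sum.neutral) (simp add: f0[OF J])
  ultimately show "(%z. \<theta> z * h J z + dbar_wedge \<theta> f J z) = (%z. 0)" by simp
 qed
 ultimately show ?thesis using D' by (simp add: has_dbar_m_iff[OF U])
qed

lemma has_dbar_m_local:
 assumes U: "open U" and loc: "!!x. x : U ==> EX V. open V & x : V & V <= U & has_dbar_m m V q f h"
  and fh: "!!J. card J ~= q ==> f J = (%z. 0)" "!!J. card J ~= Suc q ==> h J = (%z. 0)"
 shows "has_dbar_m m U q f h"
 unfolding has_dbar_m_iff[OF U]
proof (intro conjI)
 show "f : measurable_forms q U" by (rule measurable_forms_local[OF U _ fh(1)]) (use loc has_dbar_m_iff in meson)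
 show "h : measurable_forms (Suc q) U" by (rule measurable_forms_local[OF U _ fh(2)]) (use loc has_dbar_m_iff in meson)
 show "dist_dbar U q (twist (- m) f) (twist (- m) h)"
  by (rule dist_dbar_local[OF U _ twist_degree[OF fh(1)] twist_degree[OF fh(2)]]) (use loc has_dbar_m_iff in meson)
qed

section \<open>Germs and exactness\<close>

lemma is_presheafD:
 assumes "is_presheaf F"
 shows "open U ==> comm_group (secs F U)"
  "open U ==> open V ==> V <= U ==> res F U V : hom (secs F U) (secs F V)"
  "open U ==> s : carrier (secs F U) ==> res F U U s = s"
  "open U ==> open V ==> open W ==> W <= V ==> V <= U ==> s : carrier (secs F U) ==> res F V W (res F U V s) = res F U W s"
 using assms by (simp_all add: is_presheaf_def)

lemma res_closed:
 assumes "is_presheaf F" "open U" "open V" "V <= U" "s : carrier (secs F U)"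
 shows "res F U V s : carrier (secs F V)"
 using is_presheafD(2)[OF assms(1-4)] assms(5) by (auto simp: hom_def)

lemma hom_comm_group_one:
 assumes "h : hom G H" "comm_group G" "comm_group H"
 shows "h \<one>\<^bsub>G\<^esub> = \<one>\<^bsub>H\<^esub>"
 using hom_one[OF assms(1)] assms(2,3) by (simp add: comm_group_def)

lemma germ_eqI:
 assumes F: "is_presheaf F" and U: "open U" "s : carrier (secs F U)" and V: "open V" "t : carrier (secs F V)"
  and W: "open W" "x : W" "W <= U Int V" "res F U W s = res F V W t"
 shows "germ F x U s = germ F x V t"
proof -
 have *: "germ F x U s <= germ F x V t"
  if U: "open U" "s : carrier (secs F U)" and V: "open V" "t : carrier (secs F V)"
   and W: "W <= U Int V" "res F U W s = res F V W t" for U s V t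
 proof
  fix y assume "y : germ F x U s"
  then obtain Y r W' where y: "y = (Y, r)" "open Y" "x : Y" "r : carrier (secs F Y)"
   "open W'" "x : W'" "W' <= U Int Y" "res F U W' s = res F Y W' r" unfolding germ_def by auto
  have o: "open (W Int W')" using \<open>open W\<close> y by auto
  have "res F V (W Int W') t = res F W (W Int W') (res F V W t)"
   using is_presheafD(4)[OF F V(1) \<open>open W\<close> o _ _ V(2)] W by simp
  also have "... = res F U (W Int W') s"
   using is_presheafD(4)[OF F U(1) \<open>open W\<close> o _ _ U(2)] W by simp
  also have "... = res F W' (W Int W') (res F U W' s)"
   using is_presheafD(4)[OF F U(1) y(5) o _ _ U(2)] y(7) by simp
  also have "... = res F Y (W Int W') r"
   using is_presheafD(4)[OF F y(2,5) o _ _ y(4)] y(7,8) by simp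
  finally show "y : germ F x V t"
   unfolding germ_def y(1) using o W y(2-7) \<open>x : W\<close> by blast
 qed
 show ?thesis using *[OF U V W(3,4)] *[OF V U _ W(4)[symmetric]] W(3) by blast
qed

lemma germ_eqD:
 assumes F: "is_presheaf F" and U: "open U" "x : U" "s : carrier (secs F U)"
  and eq: "germ F x U s = germ F x V t"
 shows "EX W. open W & x : W & W <= U Int V & res F U W s = res F V W t"
proof -
 have "(U, s) : germ F x U s" unfolding germ_def using U by auto
 hence "(U, s) : germ F x V t" using eq by simp
 thus ?thesis unfolding germ_def by auto
qed

lemma stalk_map_germ:
 assumes F: "is_presheaf F" and G: "is_presheaf G" and \<phi>: "sheaf_hom F G \<phi>"
  and U: "open U" "x : U" "s : carrier (secs F U)"
 shows "stalk_map G \<phi> x (germ F x U s) = germ G x U (\<phi> U s)"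
proof -
 have cl: "\<phi> V t : carrier (secs G V)" if "open V" "t : carrier (secs F V)" for V t
  using \<phi> that unfolding sheaf_hom_def hom_def by auto
 have "germ G x V (\<phi> V t) = germ G x U (\<phi> U s)" if mem: "(V, t) : germ F x U s" for V t
 proof -
  obtain W where V: "open V" "t : carrier (secs F V)" and W: "open W" "x : W" "W <= U Int V" "res F U W s = res F V W t"
   using mem unfolding germ_def by auto
  have "res G V W (\<phi> V t) = res G U W (\<phi> U s)"
   using \<phi> V U W unfolding sheaf_hom_def by (metis le_inf_iff)
  thus ?thesis using W(3) by (intro germ_eqI[OF G V(1) cl[OF V] U(1) cl[OF U(1,3)] W(1,2)]) auto
 qed
 hence eq: "(\<Union>(V, t)\<in>germ F x U s. germ G x V (\<phi> V t)) = (\<Union>y\<in>germ F x U s. germ G x U (\<phi> U s))"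
  by (intro SUP_cong refl) (simp add: case_prod_unfold)
 have "(U, s) : germ F x U s" unfolding germ_def using U by auto
 thus ?thesis unfolding stalk_map_def eq UN_constant by (metis empty_iff)
qed

lemma zero_germ_eq:
 assumes F: "is_presheaf F" and U: "open U" "x : U"
 shows "zero_germ F x = germ F x U \<one>\<^bsub>secs F U\<^esub>"
proof -
 have 1: "\<one>\<^bsub>secs F V\<^esub> : carrier (secs F V)" if "open V" for V
  using is_presheafD(1)[OF F that] by (simp add: comm_group_def group.is_monoid monoid.one_closed)
 have "res F V U \<one>\<^bsub>secs F V\<^esub> = \<one>\<^bsub>secs F U\<^esub>" if "open V" "U <= V" for V
  by (rule hom_comm_group_one[OF is_presheafD(2)[OF F that(1) U(1) that(2)]]) (intro is_presheafD(1)[OF F] that U)+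
 thus ?thesis unfolding zero_germ_def
  by (intro germ_eqI[OF F open_UNIV 1[OF open_UNIV] U(1) 1[OF U(1)] U]) (use U in auto)
qed

lemma exact_atI:
 assumes F: "is_presheaf F" and G: "is_presheaf G" and H: "is_presheaf H"
  and \<phi>: "sheaf_hom F G \<phi>" and \<psi>: "sheaf_hom G H \<psi>"
  and comp: "!!U s. open U ==> s : carrier (secs F U) ==> \<psi> U (\<phi> U s) = \<one>\<^bsub>secs H U\<^esub>"
  and lift: "!!x U g. open U ==> x : U ==> g : carrier (secs G U) ==> \<psi> U g = \<one>\<^bsub>secs H U\<^esub> ==>
   EX V f. open V & x : V & V <= U & f : carrier (secs F V) & \<phi> V f = res G U V g"
 shows "exact_at F \<phi> G \<psi> H"
 unfolding exact_at_def
proof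
 fix x
 have cl: "\<phi> V t : carrier (secs G V)" if "open V" "t : carrier (secs F V)" for V t
  using \<phi> that unfolding sheaf_hom_def hom_def by auto
 have cl2: "\<psi> V t : carrier (secs H V)" if "open V" "t : carrier (secs G V)" for V t
  using \<psi> that unfolding sheaf_hom_def hom_def by auto
 show "stalk_map G \<phi> x ` stalk F x = {g : stalk G x. stalk_map H \<psi> x g = zero_germ H x}"
 proof (intro equalityI subsetI)
  fix g assume "g : stalk_map G \<phi> x ` stalk F x"
  then obtain U s where U: "open U" "x : U" "s : carrier (secs F U)" and g: "g = germ G x U (\<phi> U s)"
   unfolding stalk_def using stalk_map_germ[OF F G \<phi>] by auto
  hence "g : stalk G x" unfolding stalk_def using cl by blast
  moreover have "stalk_map H \<psi> x g = zero_germ H x"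
   unfolding g using U cl by (simp add: stalk_map_germ[OF G H \<psi>] comp zero_germ_eq[OF H U(1,2)])
  ultimately show "g : {g : stalk G x. stalk_map H \<psi> x g = zero_germ H x}" by blast
 next
 fix g assume "g : {g : stalk G x. stalk_map H \<psi> x g = zero_germ H x}"
 then obtain U t where U: "open U" "x : U" "t : carrier (secs G U)" and g: "g = germ G x U t"
  and z: "stalk_map H \<psi> x g = zero_germ H x" unfolding stalk_def by blast
 have "germ H x U (\<psi> U t) = germ H x U \<one>\<^bsub>secs H U\<^esub>"
  using z unfolding g stalk_map_germ[OF G H \<psi> U] zero_germ_eq[OF H U(1,2)] .
 from germ_eqD[OF H U(1,2) cl2[OF U(1,3)] this]
 obtain W where W: "open W" "x : W" "W <= U" "res H U W (\<psi> U t) = res H U W \<one>\<^bsub>secs H U\<^esub>" by auto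
 have rt: "res G U W t : carrier (secs G W)" by (rule res_closed[OF G U(1) W(1,3) U(3)])
 have "\<psi> W (res G U W t) = res H U W (\<psi> U t)" using \<psi> U W unfolding sheaf_hom_def by blast
 also have "... = \<one>\<^bsub>secs H W\<^esub>"
  unfolding W(4) by (rule hom_comm_group_one[OF is_presheafD(2)[OF H U(1) W(1,3)]]) (intro is_presheafD(1)[OF H] U W)+
 finally obtain V f where V: "open V" "x : V" "V <= W" "f : carrier (secs F V)" "\<phi> V f = res G W V (res G U W t)"
  using lift[OF W(1,2) rt] by blast
 hence "\<phi> V f = res G U V t" using is_presheafD(4)[OF G U(1) W(1) V(1,3) W(3) U(3)] by simp
 hence "germ G x V (\<phi> V f) = germ G x U t"
  using is_presheafD(3)[OF G V(1) cl[OF V(1,4)]] V W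
  by (intro germ_eqI[OF G V(1) cl[OF V(1,4)] U(1,3) V(1,2)]) auto
 hence "g = stalk_map G \<phi> x (germ F x V f)" unfolding g stalk_map_germ[OF F G \<phi> V(1,2,4)] by simp
 thus "g : stalk_map G \<phi> x ` stalk F x" unfolding stalk_def using V by blast
 qed
qed

lemma zero_sheaf_presheaf: "is_presheaf zero_sheaf"
proof -
 have "comm_group \<lparr>carrier = {undefined}, mult = (%_ _. undefined), one = undefined\<rparr>"
  by (rule comm_groupI) auto
 thus ?thesis by (auto simp: is_presheaf_def zero_sheaf_def hom_def)
qed

lemma zero_hom_sheaf_hom:
 assumes F: "is_presheaf F" and G: "is_presheaf G"
 shows "sheaf_hom F G (zero_hom G)"
proof -
 have 1: "\<one>\<^bsub>secs G V\<^esub> : carrier (secs G V)" "\<one>\<^bsub>secs G V\<^esub> \<otimes>\<^bsub>secs G V\<^esub> \<one>\<^bsub>secs G V\<^esub> = \<one>\<^bsub>secs G V\<^esub>" if "open V" for V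
  using is_presheafD(1)[OF G that] by (simp_all add: comm_group_def group.is_monoid monoid.one_closed monoid.l_one)
 have "res G U V \<one>\<^bsub>secs G U\<^esub> = \<one>\<^bsub>secs G V\<^esub>" if "open U" "open V" "V <= U" for U V
  by (rule hom_comm_group_one[OF is_presheafD(2)[OF G that]]) (intro is_presheafD(1)[OF G] that)+
 thus ?thesis using 1 unfolding sheaf_hom_def zero_hom_def hom_def by auto
qed

section \<open>Almost-everywhere classes of forms\<close>

definition ae_class :: "nat => (complex^'n) set => 'n::finite form => 'n form set" where
 "ae_class q U f = {g : measurable_forms q U. ALL J. AE z in lebesgue_on U. g J z = f J z}"

lemma ae_class_self: "f : measurable_forms q U ==> f : ae_class q U f"
 by (simp add: ae_class_def)

lemma ae_class_eqI:
 assumes "!!J. AE z in lebesgue_on U. f J z = g J z"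
 shows "ae_class q U f = ae_class q U g"
proof -
 have "(AE z in lebesgue_on U. h J z = f J z) \<longleftrightarrow> (AE z in lebesgue_on U. h J z = g J z)" for h J
 proof
  show "AE z in lebesgue_on U. h J z = g J z" if "AE z in lebesgue_on U. h J z = f J z"
   using that assms[of J] by eventually_elim simp
  show "AE z in lebesgue_on U. h J z = f J z" if "AE z in lebesgue_on U. h J z = g J z"
   using that assms[of J] by eventually_elim simp
 qed
 thus ?thesis by (simp add: ae_class_def)
qed

lemma ae_class_eqD:
 assumes "ae_class q U f = ae_class q U g" "f : measurable_forms q U"
 shows "AE z in lebesgue_on U. f J z = g J z"
 using ae_class_self[OF assms(2)] unfolding assms(1) by (simp add: ae_class_def)

lemma ae_class_sum:
 assumes f: "f : measurable_forms q V" and A: "A <= measurable_forms q V"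
  and m: "!!a b. a : A ==> b : B ==> b : measurable_forms q V & (ALL J. AE z in lebesgue_on V. a J z + b J z = f J z)"
  and b: "EX b:B. ALL h:ae_class q V f. (%J z. h J z - b J z) : A"
 shows "{a. EX x:A. EX y:B. a = (%J z. x J z + y J z)} = ae_class q V f"
proof (intro equalityI subsetI)
 fix h assume "h : {a. EX x:A. EX y:B. a = (%J z. x J z + y J z)}"
 then obtain a b where ab: "a : A" "b : B" and h: "h = (%J z. a J z + b J z)" by blast
 show "h : ae_class q V f"
  using m[OF ab] measurable_forms_add[of a q V b] subsetD[OF A ab(1)] unfolding h ae_class_def by blast
next
 fix h assume "h : ae_class q V f"
 moreover obtain b where "b : B" "ALL h:ae_class q V f. (%J z. h J z - b J z) : A" using b by blast
 ultimately show "h : {a. EX x:A. EX y:B. a = (%J z. x J z + y J z)}"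
  by (intro CollectI bexI[of _ "%J z. h J z - b J z"] bexI[of _ b]) simp_all
qed

lemma measurable_forms_diff:
 assumes "f : measurable_forms q U" "g : measurable_forms q U"
 shows "(%J z. f J z - g J z) : measurable_forms q U"
 using measurable_forms_add[OF assms(1) measurable_forms_cmult[OF assms(2), of "- 1"]] by simp

lemma null_forms_eq: "null_forms q U = ae_class q U (%J z. 0)"
 by (simp add: null_forms_def ae_class_def)

lemma ae_class_coset:
 assumes "f : measurable_forms q U"
 shows "null_forms q U #>\<^bsub>dbar_Lp_group p s q U\<^esub> f = ae_class q U f"
proof -
 have "null_forms q U #>\<^bsub>dbar_Lp_group p s q U\<^esub> f = {a. EX x:null_forms q U. EX y:{f}. a = (%J z. x J z + y J z)}"
  by (auto simp: r_coset_def dbar_Lp_group_def)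
 also have "... = ae_class q U f"
  by (rule ae_class_sum[OF assms])
    (use assms in "auto simp: null_forms_def ae_class_def intro: measurable_forms_diff")
 finally show ?thesis .
qed

lemma ae_class_set_mult:
 assumes f: "f : measurable_forms q U" and g: "g : measurable_forms q U"
 shows "ae_class q U f <#>\<^bsub>dbar_Lp_group p s q U\<^esub> ae_class q U g = ae_class q U (%J z. f J z + g J z)"
proof -
 have "ae_class q U f <#>\<^bsub>dbar_Lp_group p s q U\<^esub> ae_class q U g
   = {a. EX x:ae_class q U f. EX y:ae_class q U g. a = (%J z. x J z + y J z)}"
  by (auto simp: set_mult_def dbar_Lp_group_def)
 also have "... = ae_class q U (%J z. f J z + g J z)"
 proof (rule ae_class_sum[OF measurable_forms_add[OF f g]])
  fix a b assume a: "a : ae_class q U f" and b: "b : ae_class q U g"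
  have "AE z in lebesgue_on U. a J z + b J z = f J z + g J z" for J
  proof -
   have "AE z in lebesgue_on U. a J z = f J z" "AE z in lebesgue_on U. b J z = g J z"
    using a b by (auto simp: ae_class_def)
   thus ?thesis by eventually_elim simp
  qed
  thus "b : measurable_forms q U & (ALL J. AE z in lebesgue_on U. a J z + b J z = f J z + g J z)"
   using b by (simp add: ae_class_def)
 next
  have "(%J z. h J z - g J z) : ae_class q U f" if h: "h : ae_class q U (%J z. f J z + g J z)" for h
  proof -
   have "AE z in lebesgue_on U. h J z - g J z = f J z" for J
   proof -
    have "AE z in lebesgue_on U. h J z = f J z + g J z" using h by (auto simp: ae_class_def)
    thus ?thesis by eventually_elim simp
   qed
   thus ?thesis using h measurable_forms_diff[OF _ g] by (auto simp: ae_class_def)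
  qed
  thus "EX b:ae_class q U g. ALL h:ae_class q U (%J z. f J z + g J z). (%J z. h J z - b J z) : ae_class q U f"
   using ae_class_self[OF g] by blast
 qed (auto simp: ae_class_def)
 finally show ?thesis .
qed

lemma ae_class_restrict:
 assumes U: "open U" and V: "open V" "V <= U" and f: "f : measurable_forms q U"
 shows "null_forms q V <#>\<^bsub>dbar_Lp_group p s q V\<^esub> ae_class q U f = ae_class q V f"
proof -
 have fV: "f : measurable_forms q V" by (rule measurable_forms_subset[OF f V(2)])
 have "null_forms q V <#>\<^bsub>dbar_Lp_group p s q V\<^esub> ae_class q U f
   = {a. EX x:null_forms q V. EX y:ae_class q U f. a = (%J z. x J z + y J z)}"
  by (auto simp: set_mult_def dbar_Lp_group_def)
 also have "... = ae_class q V f"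
 proof (rule ae_class_sum[OF fV])
  fix a b assume a: "a : null_forms q V" and b: "b : ae_class q U f"
  have "AE z in lebesgue_on V. a J z + b J z = f J z" for J
  proof -
   have "AE z in lebesgue_on V. a J z = 0" using a by (auto simp: null_forms_def)
   moreover have "AE z in lebesgue_on V. b J z = f J z"
    by (rule AE_on_subset[OF _ V(2) open_in_lebesgue[OF U] open_in_lebesgue[OF V(1)]]) (use b in "simp add: ae_class_def")
   ultimately show ?thesis by eventually_elim simp
  qed
  thus "b : measurable_forms q V & (ALL J. AE z in lebesgue_on V. a J z + b J z = f J z)"
   using b measurable_forms_subset[OF _ V(2)] by (auto simp: ae_class_def)
 next
  have "(%J z. h J z - f J z) : null_forms q V" if "h : ae_class q V f" for h
   using that measurable_forms_diff[OF _ fV] by (auto simp: ae_class_def null_forms_def)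
  thus "EX b:ae_class q U f. ALL h:ae_class q V f. (%J z. h J z - b J z) : null_forms q V"
   using ae_class_self[OF f] by blast
 qed (auto simp: null_forms_def)
 finally show ?thesis .
qed

section \<open>The sheaves of weighted forms\<close>

lemma weighted_Lp_forms_add:
 assumes "p >= 1" "open U" "f : weighted_Lp_forms p s q U" "g : weighted_Lp_forms p s q U"
 shows "(%J z. f J z + g J z) : weighted_Lp_forms p s q U"
 using assms(3,4) weighted_add[OF assms(1,2)] by (simp add: weighted_Lp_forms_iff)

lemma weighted_Lp_forms_cmult:
 assumes "p >= 1" "open U" "f : weighted_Lp_forms p s q U"
 shows "(%J z. c * f J z) : weighted_Lp_forms p s q U"
 using assms(3) weighted_cmult[OF assms(1,2)] by (simp add: weighted_Lp_forms_iff)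

lemma weighted_Lp_forms_zero [simp]: "(%J z. 0) : weighted_Lp_forms p s q U"
 by (simp add: weighted_Lp_forms_iff weighted_zero)

lemma weighted_Lp_forms_subset: "f : weighted_Lp_forms p s q U ==> V <= U ==> f : weighted_Lp_forms p s q V"
 using weighted_subset by (metis weighted_Lp_forms_iff)

lemma weighted_Lp_forms_cong_AE:
 assumes "p >= 1" "open U" "f : weighted_Lp_forms p s q U" "!!J. AE z in lebesgue_on U. g J z = f J z" "g : measurable_forms q U"
 shows "g : weighted_Lp_forms p s q U"
 unfolding weighted_Lp_forms_iff
proof (intro conjI allI impI)
 show "weighted_Lp_loc p s U (g J)" for J
  by (rule weighted_cong_AE[OF assms(1,2) _ assms(4)]) (use assms(3) weighted_Lp_forms_iff in blast)
qed (rule measurable_formsD(2)[OF assms(5)])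

lemma weighted_Lp_forms_measurable: "f : weighted_Lp_forms p s q U ==> f : measurable_forms q U"
 by (simp add: weighted_Lp_forms_def)

lemma dbar_Lp_formsI:
 assumes "f : weighted_Lp_forms p s q U" "h : weighted_Lp_forms p s (Suc q) U" "has_dbar_m (dbar_weight p s) U q f h"
 shows "f : dbar_Lp_forms p s q U"
 using assms by (auto simp: dbar_Lp_forms_def)

lemma dbar_Lp_formsE:
 assumes "f : dbar_Lp_forms p s q U"
 obtains h where "f : weighted_Lp_forms p s q U" "h : weighted_Lp_forms p s (Suc q) U" "has_dbar_m (dbar_weight p s) U q f h"
 using assms by (auto simp: dbar_Lp_forms_def)

lemma dbar_Lp_forms_measurable: "f : dbar_Lp_forms p s q U ==> f : measurable_forms q U"
 by (auto simp: dbar_Lp_forms_def weighted_Lp_forms_def)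

lemma dbar_Lp_forms_zero: "open U ==> (%J z. 0) : dbar_Lp_forms p s q U"
 by (rule dbar_Lp_formsI[OF _ weighted_Lp_forms_zero has_dbar_m_zero]) simp

lemma dbar_Lp_forms_add:
 assumes "p >= 1" "open U" "f : dbar_Lp_forms p s q U" "g : dbar_Lp_forms p s q U"
 shows "(%J z. f J z + g J z) : dbar_Lp_forms p s q U"
proof -
 obtain h where h: "f : weighted_Lp_forms p s q U" "h : weighted_Lp_forms p s (Suc q) U" "has_dbar_m (dbar_weight p s) U q f h"
  using assms(3) by (rule dbar_Lp_formsE)
 obtain k where k: "g : weighted_Lp_forms p s q U" "k : weighted_Lp_forms p s (Suc q) U" "has_dbar_m (dbar_weight p s) U q g k"
  using assms(4) by (rule dbar_Lp_formsE)
 show ?thesis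
  by (rule dbar_Lp_formsI[OF weighted_Lp_forms_add[OF assms(1,2) h(1) k(1)] weighted_Lp_forms_add[OF assms(1,2) h(2) k(2)]
    has_dbar_m_add[OF assms(2) h(3) k(3)]])
qed

lemma dbar_Lp_forms_cmult:
 assumes "p >= 1" "open U" "f : dbar_Lp_forms p s q U"
 shows "(%J z. c * f J z) : dbar_Lp_forms p s q U"
proof -
 obtain h where h: "f : weighted_Lp_forms p s q U" "h : weighted_Lp_forms p s (Suc q) U" "has_dbar_m (dbar_weight p s) U q f h"
  using assms(3) by (rule dbar_Lp_formsE)
 show ?thesis
  by (rule dbar_Lp_formsI[OF weighted_Lp_forms_cmult[OF assms(1,2) h(1)] weighted_Lp_forms_cmult[OF assms(1,2) h(2)]
    has_dbar_m_cmult[OF assms(2) h(3)]])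
qed

lemma dbar_Lp_forms_subset:
 assumes "open U" "open V" "V <= U" "f : dbar_Lp_forms p s q U"
 shows "f : dbar_Lp_forms p s q V"
 using assms(4) weighted_Lp_forms_subset[OF _ assms(3)] has_dbar_m_subset[OF assms(1-3)]
 by (elim dbar_Lp_formsE) (rule dbar_Lp_formsI)

lemma dbar_Lp_forms_cong_AE:
 assumes "p >= 1" and U: "open U" and f: "f : dbar_Lp_forms p s q U"
  and g: "!!J. AE z in lebesgue_on U. g J z = f J z" "g : measurable_forms q U"
 shows "g : dbar_Lp_forms p s q U"
proof -
 obtain h where h: "f : weighted_Lp_forms p s q U" "h : weighted_Lp_forms p s (Suc q) U" "has_dbar_m (dbar_weight p s) U q f h"
  using f by (rule dbar_Lp_formsE)
 show ?thesis
  by (rule dbar_Lp_formsI[OF weighted_Lp_forms_cong_AE[OF assms(1,2) h(1) g] h(2)])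
    (rule has_dbar_m_cong_AE[OF U h(3) g], simp, rule weighted_Lp_forms_measurable[OF h(2)])
qed

lemma dbar_Lp_forms_mult:
 assumes p: "p >= 1" and U: "open U" and f: "f : dbar_Lp_forms p s q U" and \<theta>: "smooth \<theta>"
 shows "(%J z. \<theta> z * f J z) : dbar_Lp_forms p s q U"
proof -
 obtain h where h: "f : weighted_Lp_forms p s q U" "h : weighted_Lp_forms p s (Suc q) U" "has_dbar_m (dbar_weight p s) U q f h"
  using f by (rule dbar_Lp_formsE)
 note D = has_dbar_m_mult[OF U h(3) \<theta>]
 note M = D[unfolded has_dbar_m_iff[OF U]]
 have w: "weighted_Lp_loc p s U (f J)" "weighted_Lp_loc p s U (h J)" for J
  using h(1,2) unfolding weighted_Lp_forms_iff by blast+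
 have "weighted_Lp_loc p s U (%z. \<Sum>j\<in>J. form_sign j J * (wirtinger_bar j \<theta> z * f (J - {j}) z))" for J
  by (intro weighted_sum[OF p U] weighted_cmult[OF p U] weighted_mult[OF p U w(1)] smooth_continuous smooth_wirtinger_bar \<theta>)
 hence ww: "weighted_Lp_loc p s U (dbar_wedge \<theta> f J)" for J by (simp add: dbar_wedge_def[abs_def] mult.assoc)
 have mw: "weighted_Lp_loc p s U (%z. \<theta> z * f J z)" "weighted_Lp_loc p s U (%z. \<theta> z * h J z)" for J
  by (intro weighted_mult[OF p U] w smooth_continuous \<theta>)+
 show ?thesis
 proof (rule dbar_Lp_formsI[OF _ _ D])
  show "(%J z. \<theta> z * f J z) : weighted_Lp_forms p s q U"
   using mw(1) M by (simp add: weighted_Lp_forms_def)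
  show "(%J z. \<theta> z * h J z + dbar_wedge \<theta> f J z) : weighted_Lp_forms p s (Suc q) U"
   using weighted_add[OF p U mw(2) ww] M by (simp add: weighted_Lp_forms_def)
 qed
qed

lemma dbar_Lp_group_comm:
 assumes "p >= 1" "open U"
 shows "comm_group (dbar_Lp_group p s q U)"
proof (rule comm_groupI)
 fix f assume "f : carrier (dbar_Lp_group p s q U)"
 hence "(%J z. - 1 * f J z) : dbar_Lp_forms p s q U"
  by (intro dbar_Lp_forms_cmult[OF assms]) (simp add: dbar_Lp_group_def)
 thus "EX g:carrier (dbar_Lp_group p s q U). g \<otimes>\<^bsub>dbar_Lp_group p s q U\<^esub> f = \<one>\<^bsub>dbar_Lp_group p s q U\<^esub>"
  by (intro bexI[of _ "%J z. - 1 * f J z"]) (simp_all add: dbar_Lp_group_def)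
qed (auto simp: dbar_Lp_group_def dbar_Lp_forms_zero dbar_Lp_forms_add assms add_ac)

lemma null_forms_subgroup:
 assumes p: "p >= 1" and U: "open U"
 shows "subgroup (null_forms q U) (dbar_Lp_group p s q U)"
proof -
 interpret G: comm_group "dbar_Lp_group p s q U" by (rule dbar_Lp_group_comm[OF assms])
 have sub: "null_forms q U <= dbar_Lp_forms p s q U"
 proof
  fix f :: "'a form" assume f: "f : null_forms q U"
  show "f : dbar_Lp_forms p s q U"
   by (rule dbar_Lp_forms_cong_AE[OF p U dbar_Lp_forms_zero[OF U]]) (use f in "auto simp: null_forms_def")
 qed
 have add: "(%J z. f J z + c * g J z) : null_forms q U" if fg: "f : null_forms q U" "g : null_forms q U" for f g :: "'a form" and c
 proof -
  have "AE z in lebesgue_on U. f J z + c * g J z = 0" for J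
  proof -
   have "AE z in lebesgue_on U. f J z = 0" "AE z in lebesgue_on U. g J z = 0" using fg by (auto simp: null_forms_def)
   thus ?thesis by eventually_elim simp
  qed
  thus ?thesis using fg by (auto simp: null_forms_def intro: measurable_forms_add measurable_forms_cmult)
 qed
 have zero: "(%J z. 0) : null_forms q U" by (simp add: null_forms_def)
 show ?thesis
 proof (rule G.subgroupI)
  show "null_forms q U <= carrier (dbar_Lp_group p s q U)" using sub by (simp add: dbar_Lp_group_def)
  show "null_forms q U ~= {}" using zero by blast
 next
  fix f :: "'a form" assume f: "f : null_forms q U"
  hence n: "(%J z. - 1 * f J z) : null_forms q U" using add[OF zero f, of "- 1"] by simp
  have "inv\<^bsub>dbar_Lp_group p s q U\<^esub> f = (%J z. - 1 * f J z)"
   by (rule G.inv_equality) (use sub f n in "auto simp: dbar_Lp_group_def")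
  thus "inv\<^bsub>dbar_Lp_group p s q U\<^esub> f : null_forms q U" using n by simp
 next
  fix f g :: "'a form" assume "f : null_forms q U" "g : null_forms q U"
  thus "f \<otimes>\<^bsub>dbar_Lp_group p s q U\<^esub> g : null_forms q U" using add[of f g 1] by (simp add: dbar_Lp_group_def)
 qed
qed

lemma Lp_sheaf_secs:
 assumes p: "p >= 1" and U: "open U"
 shows "comm_group (secs (Lp_sheaf p s q) U)"
  and "carrier (secs (Lp_sheaf p s q) U) = ae_class q U ` dbar_Lp_forms p s q U"
  and "\<one>\<^bsub>secs (Lp_sheaf p s q) U\<^esub> = ae_class q U (%J z. 0)"
  and "f : dbar_Lp_forms p s q U ==> g : dbar_Lp_forms p s q U ==>
   ae_class q U f \<otimes>\<^bsub>secs (Lp_sheaf p s q) U\<^esub> ae_class q U g = ae_class q U (%J z. f J z + g J z)"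
proof -
 interpret G: comm_group "dbar_Lp_group p s q U" by (rule dbar_Lp_group_comm[OF assms])
 show "comm_group (secs (Lp_sheaf p s q) U)"
  using G.abelian_FactGroup[OF null_forms_subgroup[OF assms]] by (simp add: Lp_sheaf_def)
 show "carrier (secs (Lp_sheaf p s q) U) = ae_class q U ` dbar_Lp_forms p s q U"
  using ae_class_coset[OF dbar_Lp_forms_measurable, where p = p and s = s]
  by (auto simp: Lp_sheaf_def FactGroup_def RCOSETS_def dbar_Lp_group_def[THEN arg_cong[where f = carrier]] image_iff)
 show "\<one>\<^bsub>secs (Lp_sheaf p s q) U\<^esub> = ae_class q U (%J z. 0)"
  by (simp add: Lp_sheaf_def FactGroup_def null_forms_eq)
 show "ae_class q U f \<otimes>\<^bsub>secs (Lp_sheaf p s q) U\<^esub> ae_class q U g = ae_class q U (%J z. f J z + g J z)"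
  if "f : dbar_Lp_forms p s q U" "g : dbar_Lp_forms p s q U"
  using ae_class_set_mult[OF that[THEN dbar_Lp_forms_measurable]] by (simp add: Lp_sheaf_def FactGroup_def)
qed

lemma Lp_sheaf_res:
 assumes "open U" "open V" "V <= U" "f : dbar_Lp_forms p s q U"
 shows "res (Lp_sheaf p s q) U V (ae_class q U f) = ae_class q V f"
 using ae_class_restrict[OF assms(1-3) dbar_Lp_forms_measurable[OF assms(4)]] by (simp add: Lp_sheaf_def)

lemma Lp_sheaf_presheaf:
 assumes p: "p >= 1"
 shows "is_presheaf (Lp_sheaf p s q)"
 unfolding is_presheaf_def
proof (intro conjI allI impI ballI)
 fix U V W :: "(complex,'a) vec set" assume U: "open U"
 show "comm_group (secs (Lp_sheaf p s q) U)" by (rule Lp_sheaf_secs(1)[OF p U])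
 show "res (Lp_sheaf p s q) U U A = A" if "A : carrier (secs (Lp_sheaf p s q) U)" for A
  using that Lp_sheaf_res[OF U U order_refl] unfolding Lp_sheaf_secs(2)[OF p U] by auto
 assume V: "open V"
 show "res (Lp_sheaf p s q) U V : hom (secs (Lp_sheaf p s q) U) (secs (Lp_sheaf p s q) V)" if "V <= U"
 proof (rule homI)
  fix A assume "A : carrier (secs (Lp_sheaf p s q) U)"
  then obtain f where f: "A = ae_class q U f" "f : dbar_Lp_forms p s q U" unfolding Lp_sheaf_secs(2)[OF p U] by blast
  show "res (Lp_sheaf p s q) U V A : carrier (secs (Lp_sheaf p s q) V)"
   unfolding f(1) Lp_sheaf_res[OF U V that f(2)] Lp_sheaf_secs(2)[OF p V]
   using dbar_Lp_forms_subset[OF U V that f(2)] by blast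
  fix B assume "B : carrier (secs (Lp_sheaf p s q) U)"
  then obtain g where g: "B = ae_class q U g" "g : dbar_Lp_forms p s q U" unfolding Lp_sheaf_secs(2)[OF p U] by blast
  show "res (Lp_sheaf p s q) U V (A \<otimes>\<^bsub>secs (Lp_sheaf p s q) U\<^esub> B)
    = res (Lp_sheaf p s q) U V A \<otimes>\<^bsub>secs (Lp_sheaf p s q) V\<^esub> res (Lp_sheaf p s q) U V B"
   unfolding f(1) g(1) Lp_sheaf_res[OF U V that f(2)] Lp_sheaf_res[OF U V that g(2)]
    Lp_sheaf_secs(4)[OF p U f(2) g(2)] Lp_sheaf_res[OF U V that dbar_Lp_forms_add[OF p U f(2) g(2)]]
    Lp_sheaf_secs(4)[OF p V dbar_Lp_forms_subset[OF U V that f(2)] dbar_Lp_forms_subset[OF U V that g(2)]] ..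
 qed
 fix A assume W: "open W" "W <= V" "V <= U" "A : carrier (secs (Lp_sheaf p s q) U)"
 then obtain f where f: "A = ae_class q U f" "f : dbar_Lp_forms p s q U" unfolding Lp_sheaf_secs(2)[OF p U] by blast
 show "res (Lp_sheaf p s q) V W (res (Lp_sheaf p s q) U V A) = res (Lp_sheaf p s q) U W A"
  unfolding f(1) Lp_sheaf_res[OF U V W(3) f(2)] Lp_sheaf_res[OF V W(1,2) dbar_Lp_forms_subset[OF U V W(3) f(2)]]
  using Lp_sheaf_res[OF U W(1) order_trans[OF W(2,3)] f(2)] by simp
qed

text \<open>A countable subcover suffices to choose at each point the form whose value is taken, so that
  the exceptional null sets add up to a null set.\<close>

lemma forms_glue_AE:
 fixes f :: "(complex^'n::finite) set => 'n form"
 assumes *: "ALL V:\<V>. open V" "ALL V:\<V>. ALL W:\<V>. ALL J. AE z in lebesgue_on (V Int W). f V J z = f W J z"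
 shows "EX g. (ALL V:\<V>. ALL J. AE z in lebesgue_on V. g J z = f V J z) & (ALL J. (ALL V:\<V>. f V J = (%z. 0)) --> g J = (%z. 0))"
proof -
 note op = *(1)[rule_format] and eq = *(2)[rule_format]
 obtain \<W> where W: "\<W> <= \<V>" "countable \<W>" "\<Union>\<W> = \<Union>\<V>" using Lindelof[of \<V>] op by metis
 define c where "c z = (SOME V. V : \<W> & z : V)" for z
 have c: "c z : \<W>" "z : c z" if "z : \<Union>\<V>" for z
  using someI_ex[of "%V. V : \<W> & z : V"] that W(3) unfolding c_def by auto
 define g where "g J z = (if z : \<Union>\<V> then f (c z) J z else 0)" for J z
 have "AE z in lebesgue_on V. g J z = f V J z" if V: "V : \<V>" for V J
 proof -
  have "AE z in lborel. z : V Int W' --> f V J z = f W' J z" if "W' : \<W>" for W'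
  proof -
   have W': "W' : \<V>" using that W(1) by blast
   have o: "open (V Int W')" by (intro open_Int op V W')
   show ?thesis using eq[OF V W', of J] unfolding AE_on_iff[OF open_in_lebesgue[OF o]] .
  qed
  hence "AE z in lborel. ALL W':\<W>. z : V Int W' --> f V J z = f W' J z"
   using W(2) by (simp add: AE_ball_countable)
  thus ?thesis
   unfolding AE_on_iff[OF open_in_lebesgue[OF op[OF V]]]
  proof eventually_elim
   case (elim z)
   show ?case
   proof
    assume z: "z : V"
    hence "z : \<Union>\<V>" using V by blast
    thus "g J z = f V J z" using c[of z] elim z by (simp add: g_def)
   qed
  qed
 qed
 moreover have "g J = (%z. 0)" if "ALL V:\<V>. f V J = (%z. 0)" for J
 proof
  fix z show "g J z = 0"
  proof (cases "z : \<Union>\<V>")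
   case True
   hence "f (c z) J = (%z. 0)" using c(1) W(1) that by blast
   thus ?thesis by (simp add: g_def)
  qed (simp add: g_def)
 qed
 ultimately show ?thesis by blast
qed

lemma Lp_sheaf_is_sheaf:
 assumes p: "p >= 1"
 shows "is_sheaf (Lp_sheaf p s q)"
 unfolding is_sheaf_def
proof (intro conjI allI impI ballI Lp_sheaf_presheaf[OF p])
 fix \<V> :: "(complex,'a) vec set set" assume op: "ALL V:\<V>. open V"
 hence U: "open (\<Union>\<V>)" by blast
 let ?F = "Lp_sheaf p s q" and ?m = "dbar_weight p s"
 show "A = B" if AB: "A : carrier (secs ?F (\<Union>\<V>))" "B : carrier (secs ?F (\<Union>\<V>))"
  and eq: "ALL V:\<V>. res ?F (\<Union>\<V>) V A = res ?F (\<Union>\<V>) V B" for A B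
 proof -
  obtain f g where f: "A = ae_class q (\<Union>\<V>) f" "f : dbar_Lp_forms p s q (\<Union>\<V>)"
   and g: "B = ae_class q (\<Union>\<V>) g" "g : dbar_Lp_forms p s q (\<Union>\<V>)"
   using AB unfolding Lp_sheaf_secs(2)[OF p U] by blast
  have "AE z in lebesgue_on V. f J z = g J z" if V: "V : \<V>" for V J
  proof (rule ae_class_eqD)
   have V': "open V" "V <= \<Union>\<V>" using V op by auto
   show "ae_class q V f = ae_class q V g"
    using eq[rule_format, OF V] unfolding f(1) g(1) Lp_sheaf_res[OF U V' f(2)] Lp_sheaf_res[OF U V' g(2)] .
   show "f : measurable_forms q V" by (rule measurable_forms_subset[OF dbar_Lp_forms_measurable[OF f(2)] V'(2)])
  qed
  hence "AE z in lebesgue_on (\<Union>\<V>). f J z = g J z" for J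
   by (intro AE_on_cover[OF U]) (use op in blast)
  thus ?thesis unfolding f(1) g(1) by (rule ae_class_eqI)
 qed
 fix \<sigma> assume \<sigma>: "ALL V:\<V>. \<sigma> V : carrier (secs ?F V)"
  and comp: "ALL V:\<V>. ALL W:\<V>. res ?F V (V Int W) (\<sigma> V) = res ?F W (V Int W) (\<sigma> W)"
 have "ALL V:\<V>. EX f h. \<sigma> V = ae_class q V f & f : weighted_Lp_forms p s q V & h : weighted_Lp_forms p s (Suc q) V & has_dbar_m ?m V q f h"
  using \<sigma> op by (auto simp: Lp_sheaf_secs(2)[OF p] dbar_Lp_forms_def) blast
 then obtain f h where f: "!!V. V : \<V> ==> \<sigma> V = ae_class q V (f V)" "!!V. V : \<V> ==> f V : weighted_Lp_forms p s q V"
  and h: "!!V. V : \<V> ==> h V : weighted_Lp_forms p s (Suc q) V" "!!V. V : \<V> ==> has_dbar_m ?m V q (f V) (h V)" by metis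
 have fD: "f V : dbar_Lp_forms p s q V" if "V : \<V>" for V using dbar_Lp_formsI f(2) h that by blast
 have feq: "AE z in lebesgue_on (V Int W). f V J z = f W J z" if VW: "V : \<V>" "W : \<V>" for V W J
 proof (rule ae_class_eqD)
  have o: "open V" "open W" "open (V Int W)" using VW op by auto
  show "ae_class q (V Int W) (f V) = ae_class q (V Int W) (f W)"
   using comp[rule_format, OF VW] unfolding f(1)[OF VW(1)] f(1)[OF VW(2)]
    Lp_sheaf_res[OF o(1,3) inf_le1 fD[OF VW(1)]] Lp_sheaf_res[OF o(2,3) inf_le2 fD[OF VW(2)]] .
  show "f V : measurable_forms q (V Int W)"
   by (rule measurable_forms_subset[OF dbar_Lp_forms_measurable[OF fD[OF VW(1)]]]) simp
 qed
 have heq: "AE z in lebesgue_on (V Int W). h V J z = h W J z" if VW: "V : \<V>" "W : \<V>" for V W J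
 proof -
  have o: "open V" "open W" "open (V Int W)" using VW op by auto
  have "has_dbar_m ?m (V Int W) q (f V) (h V)" "has_dbar_m ?m (V Int W) q (f W) (h W)"
   using has_dbar_m_subset o h(2) VW by (metis inf_le1, metis inf_le2)
  moreover from this(1) have "has_dbar_m ?m (V Int W) q (f W) (h V)"
  proof (rule has_dbar_m_cong_AE[OF o(3)])
   show "AE z in lebesgue_on (V Int W). f W J z = f V J z" for J
    using feq[OF VW, of J] by eventually_elim simp
   show "f W : measurable_forms q (V Int W)" "h V : measurable_forms (Suc q) (V Int W)"
    using calculation by (simp_all add: has_dbar_m_iff[OF o(3)])
  qed simp
  ultimately show ?thesis using has_dbar_m_unique[OF o(3)] by blast
 qed
 have "ALL V:\<V>. ALL W:\<V>. ALL J. AE z in lebesgue_on (V Int W). f V J z = f W J z" using feq by blast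
 from forms_glue_AE[OF op this] obtain f' where f'1: "ALL V:\<V>. ALL J. AE z in lebesgue_on V. f' J z = f V J z"
  and f'2: "ALL J. (ALL V:\<V>. f V J = (%z. 0)) --> f' J = (%z. 0)" by (elim exE conjE)
 have "ALL V:\<V>. ALL W:\<V>. ALL J. AE z in lebesgue_on (V Int W). h V J z = h W J z" using heq by blast
 from forms_glue_AE[OF op this] obtain h' where h'1: "ALL V:\<V>. ALL J. AE z in lebesgue_on V. h' J z = h V J z"
  and h'2: "ALL J. (ALL V:\<V>. h V J = (%z. 0)) --> h' J = (%z. 0)" by (elim exE conjE)
 note f' = f'1[rule_format] and h' = h'1[rule_format]
 have f'0: "f' J = (%z. 0)" if "card J ~= q" for J
  by (rule f'2[rule_format]) (use f(2) that in "simp add: weighted_Lp_forms_iff")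
 have h'0: "h' J = (%z. 0)" if "card J ~= Suc q" for J
  by (rule h'2[rule_format]) (use h(1) that in "simp add: weighted_Lp_forms_iff")
 have fm: "f' : measurable_forms q V" if "V : \<V>" for V
  by (rule measurable_forms_cong_AE[OF _ weighted_Lp_forms_measurable[OF f(2)[OF that]] f'[OF that] f'0]) (use op that in auto)
 have hm: "h' : measurable_forms (Suc q) V" if "V : \<V>" for V
  by (rule measurable_forms_cong_AE[OF _ weighted_Lp_forms_measurable[OF h(1)[OF that]] h'[OF that] h'0]) (use op that in auto)
 have D: "has_dbar_m ?m V q f' h'" if "V : \<V>" for V
  by (rule has_dbar_m_cong_AE[OF _ h(2)[OF that] f'[OF that] fm[OF that] h'[OF that] hm[OF that]]) (use op that in auto)
 have wf: "f' : weighted_Lp_forms p s q V" if "V : \<V>" for V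
  by (rule weighted_Lp_forms_cong_AE[OF p _ f(2)[OF that] f'[OF that] fm[OF that]]) (use op that in auto)
 have wh: "h' : weighted_Lp_forms p s (Suc q) V" if "V : \<V>" for V
  by (rule weighted_Lp_forms_cong_AE[OF p _ h(1)[OF that] h'[OF that] hm[OF that]]) (use op that in auto)
 have loc: "EX V. open V & x : V & V <= \<Union>\<V> & P V" if P: "!!V. V : \<V> ==> P V" and x: "x : \<Union>\<V>" for P x
 proof -
  obtain V where "V : \<V>" "x : V" using x by blast
  thus ?thesis using op P by (intro exI[of _ V]) auto
 qed
 have f'D: "f' : dbar_Lp_forms p s q (\<Union>\<V>)"
 proof (rule dbar_Lp_formsI)
  have "weighted_Lp_loc p s V (f' J)" if "V : \<V>" for V J using wf[OF that] by (simp add: weighted_Lp_forms_iff)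
  hence "weighted_Lp_loc p s (\<Union>\<V>) (f' J)" for J by (intro weighted_local[OF p U] loc)
  thus "f' : weighted_Lp_forms p s q (\<Union>\<V>)" using f'0 by (simp add: weighted_Lp_forms_iff)
  have "weighted_Lp_loc p s V (h' J)" if "V : \<V>" for V J using wh[OF that] by (simp add: weighted_Lp_forms_iff)
  hence "weighted_Lp_loc p s (\<Union>\<V>) (h' J)" for J by (intro weighted_local[OF p U] loc)
  thus "h' : weighted_Lp_forms p s (Suc q) (\<Union>\<V>)" using h'0 by (simp add: weighted_Lp_forms_iff)
  show "has_dbar_m ?m (\<Union>\<V>) q f' h'"
   by (rule has_dbar_m_local[OF U _ f'0 h'0]) (rule loc[OF D])
 qed
 show "EX t:carrier (secs ?F (\<Union>\<V>)). ALL V:\<V>. res ?F (\<Union>\<V>) V t = \<sigma> V"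
 proof (intro bexI ballI)
  show "ae_class q (\<Union>\<V>) f' : carrier (secs ?F (\<Union>\<V>))" unfolding Lp_sheaf_secs(2)[OF p U] using f'D by blast
  fix V assume V: "V : \<V>"
  have "res ?F (\<Union>\<V>) V (ae_class q (\<Union>\<V>) f') = ae_class q V f'"
   by (rule Lp_sheaf_res[OF U _ _ f'D]) (use V op in auto)
  also have "... = \<sigma> V" unfolding f(1)[OF V] by (rule ae_class_eqI[OF f'[OF V]])
  finally show "res ?F (\<Union>\<V>) V (ae_class q (\<Union>\<V>) f') = \<sigma> V" .
 qed
qed

text \<open>A relation between forms that is additive and compatible with restriction induces a
  homomorphism of the sheaves of classes.\<close>

lemma Lp_sheaf_homI:
 assumes p: "p >= 1"
  and ex: "!!U f. open U ==> f : dbar_Lp_forms p s q U ==> EX h:dbar_Lp_forms p s q' U. R U f h"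
  and eq: "!!U f h. open U ==> f : dbar_Lp_forms p s q U ==> R U f h ==> \<phi> U (ae_class q U f) = ae_class q' U h"
  and add: "!!U f h f' h'. open U ==> R U f h ==> R U f' h' ==> R U (%J z. f J z + f' J z) (%J z. h J z + h' J z)"
  and sub: "!!U V f h. open U ==> open V ==> V <= U ==> R U f h ==> R V f h"
 shows "sheaf_hom (Lp_sheaf p s q) (Lp_sheaf p s q') \<phi>"
 unfolding sheaf_hom_def
proof (intro conjI allI impI ballI)
 fix U V :: "(complex,'a) vec set" assume U: "open U"
 show "\<phi> U : hom (secs (Lp_sheaf p s q) U) (secs (Lp_sheaf p s q') U)"
 proof (rule homI)
  fix A assume "A : carrier (secs (Lp_sheaf p s q) U)"
  then obtain f where f: "A = ae_class q U f" "f : dbar_Lp_forms p s q U" unfolding Lp_sheaf_secs(2)[OF p U] by blast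
  obtain h where h: "h : dbar_Lp_forms p s q' U" "R U f h" using ex[OF U f(2)] by blast
  show "\<phi> U A : carrier (secs (Lp_sheaf p s q') U)"
   unfolding f(1) eq[OF U f(2) h(2)] Lp_sheaf_secs(2)[OF p U] using h(1) by blast
  fix B assume "B : carrier (secs (Lp_sheaf p s q) U)"
  then obtain f' where f': "B = ae_class q U f'" "f' : dbar_Lp_forms p s q U" unfolding Lp_sheaf_secs(2)[OF p U] by blast
  obtain h' where h': "h' : dbar_Lp_forms p s q' U" "R U f' h'" using ex[OF U f'(2)] by blast
  show "\<phi> U (A \<otimes>\<^bsub>secs (Lp_sheaf p s q) U\<^esub> B) = \<phi> U A \<otimes>\<^bsub>secs (Lp_sheaf p s q') U\<^esub> \<phi> U B"
   unfolding f(1) f'(1) Lp_sheaf_secs(4)[OF p U f(2) f'(2)] eq[OF U dbar_Lp_forms_add[OF p U f(2) f'(2)] add[OF U h(2) h'(2)]]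
    eq[OF U f(2) h(2)] eq[OF U f'(2) h'(2)] Lp_sheaf_secs(4)[OF p U h(1) h'(1)] ..
 qed
 fix A assume V: "open V" "V <= U" and "A : carrier (secs (Lp_sheaf p s q) U)"
 then obtain f where f: "A = ae_class q U f" "f : dbar_Lp_forms p s q U" unfolding Lp_sheaf_secs(2)[OF p U] by blast
 obtain h where h: "h : dbar_Lp_forms p s q' U" "R U f h" using ex[OF U f(2)] by blast
 show "\<phi> V (res (Lp_sheaf p s q) U V A) = res (Lp_sheaf p s q') U V (\<phi> U A)"
  unfolding f(1) Lp_sheaf_res[OF U V f(2)] eq[OF U f(2) h(2)] Lp_sheaf_res[OF U V h(1)]
  by (rule eq[OF V(1) dbar_Lp_forms_subset[OF U V f(2)] sub[OF U V h(2)]])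
qed

lemma dbar_map_class:
 assumes U: "open U" and D: "has_dbar_m m U q f h"
 shows "dbar_map m q U (ae_class q U f) = ae_class (Suc q) U h"
proof (intro equalityI subsetI)
 have m: "f : measurable_forms q U" using D by (simp add: has_dbar_m_iff[OF U])
 fix h' assume "h' : dbar_map m q U (ae_class q U f)"
 then obtain f' where f': "f' : ae_class q U f" "has_dbar_m m U q f' h'" by (auto simp: dbar_map_def)
 have hm': "h' : measurable_forms (Suc q) U" using f'(2) by (simp add: has_dbar_m_iff[OF U])
 have "AE z in lebesgue_on U. f J z = f' J z" for J
 proof -
  have "AE z in lebesgue_on U. f' J z = f J z" using f'(1) by (simp add: ae_class_def)
  thus ?thesis by eventually_elim simp
 qed
 hence "has_dbar_m m U q f h'" by (rule has_dbar_m_cong_AE[OF U f'(2) _ m]) (simp_all add: hm')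
 thus "h' : ae_class (Suc q) U h" using has_dbar_m_unique[OF U D] hm' by (simp add: ae_class_def)
next
 have m: "f : measurable_forms q U" using D by (simp add: has_dbar_m_iff[OF U])
 fix h' assume "h' : ae_class (Suc q) U h"
 hence "has_dbar_m m U q f h'" by (intro has_dbar_m_cong_AE[OF U D _ m]) (auto simp: ae_class_def)
 thus "h' : dbar_map m q U (ae_class q U f)" unfolding dbar_map_def using ae_class_self[OF m] by blast
qed

lemma dbar_map_sheaf_hom:
 assumes p: "p >= 1"
 shows "sheaf_hom (Lp_sheaf p s q) (Lp_sheaf p s (Suc q)) (dbar_map (dbar_weight p s) q)"
proof (rule Lp_sheaf_homI[OF p, where R = "%U. has_dbar_m (dbar_weight p s) U q"])
 fix U :: "(complex,'a) vec set" and f assume U: "open U" and f: "f : dbar_Lp_forms p s q U"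
 show "EX h:dbar_Lp_forms p s (Suc q) U. has_dbar_m (dbar_weight p s) U q f h"
  using f dbar_Lp_formsI[OF _ weighted_Lp_forms_zero has_dbar_m_dbar[OF U]] by (elim dbar_Lp_formsE) blast
qed (rule dbar_map_class has_dbar_m_add has_dbar_m_subset, assumption+)+

text \<open>Multiplication by smooth functions gives the endomorphisms that make the sheaves fine.\<close>

definition mult_map :: "(complex^'n => complex) => nat => (complex^'n) set => 'n::finite form set => 'n form set" where
 "mult_map \<theta> q U A = {h : measurable_forms q U. EX f:A. ALL J. AE z in lebesgue_on U. h J z = \<theta> z * f J z}"

lemma mult_map_class:
 assumes f: "f : measurable_forms q U"
 shows "mult_map \<theta> q U (ae_class q U f) = ae_class q U (%J z. \<theta> z * f J z)"
proof (intro equalityI subsetI)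
 fix h assume "h : mult_map \<theta> q U (ae_class q U f)"
 then obtain f' where f': "f' : ae_class q U f" "h : measurable_forms q U" "!!J. AE z in lebesgue_on U. h J z = \<theta> z * f' J z"
  by (auto simp: mult_map_def)
 have "AE z in lebesgue_on U. h J z = \<theta> z * f J z" for J
 proof -
  have "AE z in lebesgue_on U. f' J z = f J z" using f'(1) by (simp add: ae_class_def)
  with f'(3)[of J] show ?thesis by eventually_elim simp
 qed
 thus "h : ae_class q U (%J z. \<theta> z * f J z)" using f'(2) by (simp add: ae_class_def)
qed (use ae_class_self[OF f] in "auto simp: mult_map_def ae_class_def")

lemma mult_map_sheaf_hom:
 assumes p: "p >= 1" and \<theta>: "smooth \<theta>"
 shows "sheaf_hom (Lp_sheaf p s q) (Lp_sheaf p s q) (mult_map \<theta> q)"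
 by (rule Lp_sheaf_homI[OF p, where R = "%U f h. h = (%J z. \<theta> z * f J z)"])
   (auto simp: mult_map_class dbar_Lp_forms_measurable distrib_left intro: dbar_Lp_forms_mult[OF p _ _ \<theta>])

lemma mult_map_support:
 assumes p: "p >= 1" and \<theta>: "smooth \<theta>"
 shows "hom_support (Lp_sheaf p s q) (mult_map \<theta> q) <= closure {z. \<theta> z ~= 0}"
 unfolding hom_support_def
proof (intro closure_minimal closed_closure subsetI, rule ccontr)
 let ?F = "Lp_sheaf p s q" and ?C = "closure {z. \<theta> z ~= 0}"
 note F = Lp_sheaf_presheaf[OF p, of s q]
 fix x assume "x : {x. EX g:stalk ?F x. stalk_map ?F (mult_map \<theta> q) x g ~= zero_germ ?F x}" and x: "x ~: ?C"
 then obtain U A where U: "open U" "x : U" "A : carrier (secs ?F U)"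
  and ne: "stalk_map ?F (mult_map \<theta> q) x (germ ?F x U A) ~= zero_germ ?F x"
  unfolding stalk_def by blast
 obtain f where f: "A = ae_class q U f" "f : dbar_Lp_forms p s q U" using U(3) unfolding Lp_sheaf_secs(2)[OF p U(1)] by blast
 have \<theta>f: "(%J z. \<theta> z * f J z) : dbar_Lp_forms p s q U" by (rule dbar_Lp_forms_mult[OF p U(1) f(2) \<theta>])
 have W: "open (U - ?C)" "U - ?C <= U" using U(1) by (auto intro: open_Diff)
 have "ae_class q (U - ?C) (%J z. \<theta> z * f J z) = ae_class q (U - ?C) (%J z. 0)"
 proof (rule ae_class_eqI)
  show "AE z in lebesgue_on (U - ?C). \<theta> z * f J z = 0" for J
   unfolding AE_on_iff[OF open_in_lebesgue[OF W(1)]] using closure_subset[of "{z. \<theta> z ~= 0}"] by auto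
 qed
 hence r: "res ?F U (U - ?C) (ae_class q U (%J z. \<theta> z * f J z)) = res ?F U (U - ?C) (ae_class q U (%J z. 0))"
  by (simp add: Lp_sheaf_res[OF U(1) W \<theta>f] Lp_sheaf_res[OF U(1) W dbar_Lp_forms_zero[OF U(1)]])
 have "germ ?F x U (ae_class q U (%J z. \<theta> z * f J z)) = germ ?F x U (ae_class q U (%J z. 0))"
  by (rule germ_eqI[OF F U(1) _ U(1) _ W(1) _ _ r])
    (use U x \<theta>f dbar_Lp_forms_zero[OF U(1)] in "auto simp: Lp_sheaf_secs(2)[OF p U(1)]")
 thus False
  using ne stalk_map_germ[OF F F mult_map_sheaf_hom[OF p \<theta>] U]
  by (simp add: f(1) mult_map_class dbar_Lp_forms_measurable[OF f(2)] zero_germ_eq[OF F U(1,2)] Lp_sheaf_secs(3)[OF p U(1)])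
qed

theorem Lp_sheaf_fine:
 assumes p: "p >= 1"
 shows "fine_sheaf (Lp_sheaf p s q)"
 unfolding fine_sheaf_def
proof (intro conjI allI impI Lp_sheaf_is_sheaf[OF p])
 let ?F = "Lp_sheaf p s q"
 fix \<U> :: "(complex,'a) vec set set" assume op: "ALL U:\<U>. open U" and cov: "\<Union>\<U> = UNIV"
 obtain \<theta> where \<theta>: "!!U. U : \<U> ==> smooth (\<theta> U)"
  "!!U. U : \<U> ==> closure {x. \<theta> U x ~= 0} <= U"
  "!!F x. finite F ==> F <= \<U> ==> (!!U. U : \<U> ==> \<theta> U x ~= 0 ==> U : F) ==> (\<Sum>U\<in>F. \<theta> U x) = (1::real)"
  by (rule smooth_partition_of_unity[OF op cov]) blast
 define \<eta> where "\<eta> U = mult_map (%z. complex_of_real (\<theta> U z)) q" for U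
 have \<theta>c: "smooth (%z. complex_of_real (\<theta> U z))" if "U : \<U>" for U by (rule smooth_of_real[OF \<theta>(1)[OF that]])
 show "EX \<eta>. (ALL U:\<U>. sheaf_hom ?F ?F (\<eta> U) & hom_support ?F (\<eta> U) <= U) &
   (ALL V. open V --> finite {U:\<U>. U Int V ~= {}} -->
    (ALL s:carrier (secs ?F V). finprod (secs ?F V) (%U. \<eta> U V s) {U:\<U>. U Int V ~= {}} = s))"
 proof (intro exI[of _ \<eta>] conjI ballI allI impI)
  fix U assume U: "U : \<U>"
  show "sheaf_hom ?F ?F (\<eta> U)" unfolding \<eta>_def by (rule mult_map_sheaf_hom[OF p \<theta>c[OF U]])
  have "hom_support ?F (\<eta> U) <= closure {z. complex_of_real (\<theta> U z) ~= 0}"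
   unfolding \<eta>_def by (rule mult_map_support[OF p \<theta>c[OF U]])
  thus "hom_support ?F (\<eta> U) <= U" using \<theta>(2)[OF U] by simp
 next
  fix V A assume V: "open V" and fin: "finite {U:\<U>. U Int V ~= {}}" and "A : carrier (secs ?F V)"
  then obtain f where f: "A = ae_class q V f" "f : dbar_Lp_forms p s q V" unfolding Lp_sheaf_secs(2)[OF p V] by blast
  interpret G: comm_group "secs ?F V" by (rule Lp_sheaf_secs(1)[OF p V])
  have \<eta>A: "\<eta> U V A = ae_class q V (%J z. complex_of_real (\<theta> U z) * f J z)" for U
   unfolding f(1) \<eta>_def by (rule mult_map_class[OF dbar_Lp_forms_measurable[OF f(2)]])
  have D: "(%J z. complex_of_real (\<theta> U z) * f J z) : dbar_Lp_forms p s q V" if "U : \<U>" for U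
   by (rule dbar_Lp_forms_mult[OF p V f(2) \<theta>c[OF that]])
  have "(%J z. \<Sum>U\<in>S. complex_of_real (\<theta> U z) * f J z) : dbar_Lp_forms p s q V &
   finprod (secs ?F V) (%U. \<eta> U V A) S = ae_class q V (%J z. \<Sum>U\<in>S. complex_of_real (\<theta> U z) * f J z)"
   if "finite S" "S <= \<U>" for S
   using that
  proof (induction S rule: finite_induct)
   case empty
   show ?case using dbar_Lp_forms_zero[OF V] by (simp add: Lp_sheaf_secs(3)[OF p V])
  next
   case (insert U S)
   have cl: "\<eta> U V A : carrier (secs ?F V)" if "U : \<U>" for U
    unfolding \<eta>A Lp_sheaf_secs(2)[OF p V] using D[OF that] by blast
   have IH: "(%J z. \<Sum>U\<in>S. complex_of_real (\<theta> U z) * f J z) : dbar_Lp_forms p s q V"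
    "finprod (secs ?F V) (%U. \<eta> U V A) S = ae_class q V (%J z. \<Sum>U\<in>S. complex_of_real (\<theta> U z) * f J z)"
    using insert by auto
   have "finprod (secs ?F V) (%U. \<eta> U V A) (insert U S) = \<eta> U V A \<otimes>\<^bsub>secs ?F V\<^esub> finprod (secs ?F V) (%U. \<eta> U V A) S"
    using insert cl by (intro G.finprod_insert) auto
   also have "... = ae_class q V (%J z. complex_of_real (\<theta> U z) * f J z + (\<Sum>U\<in>S. complex_of_real (\<theta> U z) * f J z))"
    unfolding IH(2) unfolding \<eta>A by (rule Lp_sheaf_secs(4)[OF p V D IH(1)]) (use insert in auto)
   finally show ?case using dbar_Lp_forms_add[OF p V D IH(1), of U] insert by simp
  qed
  from this[OF fin] have "finprod (secs ?F V) (%U. \<eta> U V A) {U:\<U>. U Int V ~= {}}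
    = ae_class q V (%J z. \<Sum>U | U : \<U> & U Int V ~= {}. complex_of_real (\<theta> U z) * f J z)" by auto
  also have "... = ae_class q V f"
  proof (rule ae_class_eqI)
   fix J
   have "(\<Sum>U | U : \<U> & U Int V ~= {}. complex_of_real (\<theta> U z) * f J z) = f J z" if z: "z : V" for z
   proof -
    have "(\<Sum>U | U : \<U> & U Int V ~= {}. \<theta> U z) = 1"
    proof (rule \<theta>(3)[OF fin])
     show "U : {U : \<U>. U Int V ~= {}}" if U: "U : \<U>" "\<theta> U z ~= 0" for U
      using \<theta>(2)[OF U(1)] closure_subset[of "{x. \<theta> U x ~= 0}"] U z by blast
    qed auto
    hence "(\<Sum>U | U : \<U> & U Int V ~= {}. complex_of_real (\<theta> U z)) = 1" by (simp flip: of_real_sum)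
    thus ?thesis by (simp flip: sum_distrib_right)
   qed
   thus "AE z in lebesgue_on V. (\<Sum>U | U : \<U> & U Int V ~= {}. complex_of_real (\<theta> U z) * f J z) = f J z"
    unfolding AE_on_iff[OF open_in_lebesgue[OF V]] by simp
  qed
  finally show "finprod (secs ?F V) (%U. \<eta> U V A) {U:\<U>. U Int V ~= {}} = A" unfolding f(1) .
 qed
qed

section \<open>The sheaf of meromorphic functions\<close>

lemma holomorphic_n_add:
 assumes "holomorphic_n U f" "holomorphic_n U g"
 shows "holomorphic_n U (%z. f z + g z)"
 unfolding holomorphic_n_def
proof
 fix z assume "z : U"
 then obtain L M where "(f has_derivative L) (at z)" "ALL c v. L (c *s v) = c * L v"
  "(g has_derivative M) (at z)" "ALL c v. M (c *s v) = c * M v" using assms unfolding holomorphic_n_def by metis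
 thus "EX L. ((%z. f z + g z) has_derivative L) (at z) & (ALL c v. L (c *s v) = c * L v)"
  by (intro exI[of _ "%v. L v + M v"] conjI has_derivative_add) (simp_all add: distrib_left)
qed

lemma holomorphic_n_cmult:
 assumes "holomorphic_n U f"
 shows "holomorphic_n U (%z. c * f z)"
 unfolding holomorphic_n_def
proof
 fix z assume "z : U"
 then obtain L where "(f has_derivative L) (at z)" "ALL c v. L (c *s v) = c * L v" using assms unfolding holomorphic_n_def by metis
 thus "EX L. ((%z. c * f z) has_derivative L) (at z) & (ALL c v. L (c *s v) = c * L v)"
  by (intro exI[of _ "%v. c * L v"] conjI has_derivative_mult_right) simp_all
qed

lemma holomorphic_n_zero: "holomorphic_n U (%z. 0)"
 unfolding holomorphic_n_def by (intro ballI exI[of _ "%_. 0"]) simp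

lemma holomorphic_n_cong_local:
 assumes loc: "!!z. z : U ==> EX V g. open V & z : V & holomorphic_n V g & (ALL y:V. f y = g y)"
 shows "holomorphic_n U f"
 unfolding holomorphic_n_def
proof
 fix z assume "z : U"
 then obtain V g where V: "open V" "z : V" "holomorphic_n V g" "ALL y:V. f y = g y" using loc by blast
 then obtain L where L: "(g has_derivative L) (at z)" "ALL c v. L (c *s v) = c * L v" unfolding holomorphic_n_def by blast
 have "(f has_derivative L) (at z)" by (rule has_derivative_transform_within_open[OF L(1) V(1,2)]) (use V(4) in auto)
 thus "EX L. (f has_derivative L) (at z) & (ALL c v. L (c *s v) = c * L v)" using L(2) by blast
qed

lemma continuous_AE_eq:
 fixes h h' :: "'a::euclidean_space => complex"
 assumes W: "open W" and h: "continuous_on W h" "continuous_on W h'" and eq: "AE z in lebesgue_on W. h z = h' z" and z: "z : W"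
 shows "h z = h' z"
proof (rule ccontr)
 assume ne: "h z ~= h' z"
 define S where "S = W Int (%z. h z - h' z) -` (- {0})"
 have S: "open S" unfolding S_def by (intro continuous_open_preimage continuous_intros h W)
 have "AE z in lborel. z ~: S"
  using eq unfolding AE_on_iff[OF open_in_lebesgue[OF W]] by eventually_elim (auto simp: S_def)
 hence "S : null_sets lborel" using S AE_iff_null_sets[of S lborel] by simp
 hence "negligible S" using null_sets_completionI negligible_iff_null_sets by blast
 moreover have "z : S" using ne z by (simp add: S_def)
 ultimately show False using open_not_negligible[OF S] by blast
qed

lemma ideal_sectionsE:
 assumes "f : ideal_sections m U"
 obtains h where "holomorphic_n U h" "ALL z:U. (ALL j. z $ j ~= 0) --> monom_powi z (- m) * f z = h z"
  "ALL z. z ~: U | (EX j. z $ j = 0) --> f z = 0"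
 using assms by (auto simp: ideal_sections_def)

lemma ideal_sectionsI:
 assumes "holomorphic_n U h" "!!z. z : U ==> ALL j. z $ j ~= 0 ==> monom_powi z (- m) * f z = h z"
  "!!z. z ~: U | (EX j. z $ j = 0) ==> f z = 0"
 shows "f : ideal_sections m U"
 using assms by (auto simp: ideal_sections_def)

lemma ideal_sections_add:
 assumes "f : ideal_sections m U" "g : ideal_sections m U"
 shows "(%z. f z + g z) : ideal_sections m U"
proof -
 obtain h where h: "holomorphic_n U h" "ALL z:U. (ALL j. z $ j ~= 0) --> monom_powi z (- m) * f z = h z"
  "ALL z. z ~: U | (EX j. z $ j = 0) --> f z = 0" using assms(1) by (rule ideal_sectionsE)
 obtain k where k: "holomorphic_n U k" "ALL z:U. (ALL j. z $ j ~= 0) --> monom_powi z (- m) * g z = k z"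
  "ALL z. z ~: U | (EX j. z $ j = 0) --> g z = 0" using assms(2) by (rule ideal_sectionsE)
 show ?thesis
 proof (rule ideal_sectionsI[OF holomorphic_n_add[OF h(1) k(1)]])
  show "monom_powi z (- m) * (f z + g z) = h z + k z" if "z : U" "ALL j. z $ j ~= 0" for z
   unfolding distrib_left using h(2) k(2) that by metis
  show "f z + g z = 0" if "z ~: U | (EX j. z $ j = 0)" for z using h(3)[rule_format, OF that] k(3)[rule_format, OF that] by simp
 qed
qed

lemma ideal_sections_cmult:
 assumes "f : ideal_sections m U"
 shows "(%z. c * f z) : ideal_sections m U"
proof -
 obtain h where h: "holomorphic_n U h" "ALL z:U. (ALL j. z $ j ~= 0) --> monom_powi z (- m) * f z = h z"
  "ALL z. z ~: U | (EX j. z $ j = 0) --> f z = 0" using assms(1) by (rule ideal_sectionsE)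
 show ?thesis
 proof (rule ideal_sectionsI[OF holomorphic_n_cmult[OF h(1)]])
  show "monom_powi z (- m) * (c * f z) = c * h z" if "z : U" "ALL j. z $ j ~= 0" for z
   unfolding mult.left_commute[of _ c] using h(2) that by metis
  show "c * f z = 0" if "z ~: U | (EX j. z $ j = 0)" for z using h(3)[rule_format, OF that] by simp
 qed
qed

lemma ideal_sections_restrict:
 assumes "f : ideal_sections m U" "V <= U"
 shows "(%z. if z : V then f z else 0) : ideal_sections m V"
proof -
 obtain h where h: "holomorphic_n U h" "ALL z:U. (ALL j. z $ j ~= 0) --> monom_powi z (- m) * f z = h z"
  "ALL z. z ~: U | (EX j. z $ j = 0) --> f z = 0" using assms(1) by (rule ideal_sectionsE)
 show ?thesis
  by (rule ideal_sectionsI[OF holomorphic_n_subset[OF h(1) assms(2)]]) (use h(2,3) assms(2) in auto)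
qed

lemma ideal_sheaf_presheaf: "is_presheaf (ideal_sheaf m)"
proof -
 have "comm_group (secs (ideal_sheaf m) U)" for U
 proof (rule comm_groupI)
  fix f assume "f : carrier (secs (ideal_sheaf m) U)"
  hence "(%z. - 1 * f z) : ideal_sections m U" by (intro ideal_sections_cmult) (simp add: ideal_sheaf_def)
  thus "EX g:carrier (secs (ideal_sheaf m) U). g \<otimes>\<^bsub>secs (ideal_sheaf m) U\<^esub> f = \<one>\<^bsub>secs (ideal_sheaf m) U\<^esub>"
   by (intro bexI[of _ "%z. - 1 * f z"]) (simp_all add: ideal_sheaf_def)
 qed (auto simp: ideal_sheaf_def add_ac ideal_sections_add intro: ideal_sectionsI[OF holomorphic_n_zero])
 moreover have "(%z. if z : U then f z else 0) = f" if "f : ideal_sections m U" for f U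
  using that by (auto simp: ideal_sections_def fun_eq_iff)
 moreover have "(%z. if z : W then if z : V then f z else 0 else 0) = (%z. if z : W then f z else 0)"
  if "W <= V" for f :: "(complex,'a) vec => complex" and V W using that by (auto simp: fun_eq_iff)
 ultimately show ?thesis
  by (auto simp: is_presheaf_def ideal_sheaf_def hom_def ideal_sections_restrict)
qed

text \<open>The holomorphic functions belonging to local sections agree on overlaps, because the complement
  of the coordinate hyperplanes is dense.\<close>

lemma ideal_sheaf_is_sheaf: "is_sheaf (ideal_sheaf m)"
 unfolding is_sheaf_def
proof (intro conjI allI impI ballI ideal_sheaf_presheaf)
 fix \<V> :: "(complex,'a) vec set set" assume op: "ALL V:\<V>. open V"
 show "f = g" if f: "f : carrier (secs (ideal_sheaf m) (\<Union>\<V>))" and g: "g : carrier (secs (ideal_sheaf m) (\<Union>\<V>))"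
  and eq: "ALL V:\<V>. res (ideal_sheaf m) (\<Union>\<V>) V f = res (ideal_sheaf m) (\<Union>\<V>) V g" for f g
 proof
  fix z
  show "f z = g z"
  proof (cases "z : \<Union>\<V>")
   case True
   then obtain V where V: "V : \<V>" "z : V" by blast
   have "res (ideal_sheaf m) (\<Union>\<V>) V f z = res (ideal_sheaf m) (\<Union>\<V>) V g z" using eq V by simp
   thus ?thesis using V by (simp add: ideal_sheaf_def)
  qed (use f g in "auto simp: ideal_sheaf_def ideal_sections_def")
 qed
 fix \<sigma> assume "ALL V:\<V>. \<sigma> V : carrier (secs (ideal_sheaf m) V)"
  and comp: "ALL V:\<V>. ALL W:\<V>. res (ideal_sheaf m) V (V Int W) (\<sigma> V) = res (ideal_sheaf m) W (V Int W) (\<sigma> W)"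
 hence \<sigma>: "!!V. V : \<V> ==> \<sigma> V : ideal_sections m V" by (simp add: ideal_sheaf_def)
 hence "ALL V:\<V>. EX h. holomorphic_n V h & (ALL z:V. (ALL j. z $ j ~= 0) --> monom_powi z (- m) * \<sigma> V z = h z)"
  by (auto simp: ideal_sections_def)
 then obtain h where h: "!!V. V : \<V> ==> holomorphic_n V (h V)"
  "!!V z. V : \<V> ==> z : V ==> ALL j. z $ j ~= 0 ==> monom_powi z (- m) * \<sigma> V z = h V z" by metis
 have s_eq: "\<sigma> V z = \<sigma> W z" if VW: "V : \<V>" "W : \<V>" "z : V" "z : W" for V W z
 proof -
  have "res (ideal_sheaf m) V (V Int W) (\<sigma> V) z = res (ideal_sheaf m) W (V Int W) (\<sigma> W) z"
   by (rule fun_cong[OF comp[rule_format, OF VW(1,2)]])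
  thus ?thesis using VW by (simp add: ideal_sheaf_def)
 qed
 have h_eq: "h V z = h W z" if VW: "V : \<V>" "W : \<V>" "z : V" "z : W" for V W z
 proof (rule continuous_AE_eq[of "V Int W"])
  show o: "open (V Int W)" using VW op by auto
  show "continuous_on (V Int W) (h V)" "continuous_on (V Int W) (h W)"
   using holomorphic_n_continuous[OF h(1)] VW continuous_on_subset by (metis inf_le1, metis inf_le2)
  show "AE z in lebesgue_on (V Int W). h V z = h W z"
   unfolding AE_on_iff[OF open_in_lebesgue[OF o]] using AE_coords_nonzero
  proof eventually_elim
   case (elim z)
   show ?case
   proof
    assume "z : V Int W"
    hence z: "z : V" "z : W" by auto
    show "h V z = h W z" using h(2)[OF VW(1) z(1) elim] h(2)[OF VW(2) z(2) elim] s_eq[OF VW(1,2) z] by simp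
   qed
  qed
 qed (use VW in auto)
 define c where "c z = (SOME V. V : \<V> & z : V)" for z
 have c: "c z : \<V>" "z : c z" if "V : \<V>" "z : V" for z V
  using someI_ex[of "%V. V : \<V> & z : V"] that unfolding c_def by auto
 define f where "f z = (if z : \<Union>\<V> then \<sigma> (c z) z else 0)" for z
 have f: "f z = \<sigma> V z" if "V : \<V>" "z : V" for V z
  using s_eq[OF that(1) c(1)[OF that] that(2) c(2)[OF that]] that by (auto simp: f_def)
 have hc: "h (c z) z = h V z" if "V : \<V>" "z : V" for V z
  using h_eq[OF c(1)[OF that] that(1) c(2)[OF that] that(2)] .
 have "f : ideal_sections m (\<Union>\<V>)"
 proof (rule ideal_sectionsI[where h = "%z. h (c z) z"])
  show "holomorphic_n (\<Union>\<V>) (%z. h (c z) z)"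
   by (rule holomorphic_n_cong_local) (use op h(1) hc in blast)
  show "monom_powi z (- m) * f z = h (c z) z" if z: "z : \<Union>\<V>" "ALL j. z $ j ~= 0" for z
  proof -
   obtain V where V: "V : \<V>" "z : V" using z by blast
   thus ?thesis using h(2)[OF V z(2)] by (simp add: f[OF V] hc[OF V])
  qed
  show "f z = 0" if z: "z ~: \<Union>\<V> | (EX j. z $ j = 0)" for z
  proof (cases "z : \<Union>\<V>")
   case True
   then obtain V where V: "V : \<V>" "z : V" by blast
   thus ?thesis using \<sigma>[OF V(1)] z True by (auto simp: f[OF V] ideal_sections_def)
  qed (simp add: f_def)
 qed
 moreover have "res (ideal_sheaf m) (\<Union>\<V>) V f = \<sigma> V" if V: "V : \<V>" for V
 proof
  fix z show "res (ideal_sheaf m) (\<Union>\<V>) V f z = \<sigma> V z"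
   using \<sigma>[OF V] f[OF V, of z] by (auto simp: ideal_sheaf_def ideal_sections_def)
 qed
 ultimately show "EX t:carrier (secs (ideal_sheaf m) (\<Union>\<V>)). ALL V:\<V>. res (ideal_sheaf m) (\<Union>\<V>) V t = \<sigma> V"
  by (auto simp: ideal_sheaf_def)
qed

text \<open>Functions as forms of degree 0.\<close>

definition form0 :: "(complex^'n => complex) => 'n::finite form" where
 "form0 f J z = (if J = {} then f z else 0)"

lemma form0_eq: "form0 f J = (if J = {} then f else (%z. 0))"
 by (simp add: form0_def fun_eq_iff)

lemma ideal_incl_class: "ideal_incl U f = ae_class 0 U (form0 f)"
proof -
 have "(ALL J. AE z in lebesgue_on U. h J z = form0 f J z) \<longleftrightarrow> (AE z in lebesgue_on U. h {} z = f z)"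
  if "h : measurable_forms 0 U" for h
 proof
  show "AE z in lebesgue_on U. h {} z = f z" if "ALL J. AE z in lebesgue_on U. h J z = form0 f J z"
   using that[THEN spec, of "{}"] by (simp add: form0_def)
  assume a: "AE z in lebesgue_on U. h {} z = f z"
  show "ALL J. AE z in lebesgue_on U. h J z = form0 f J z"
  proof
   fix J show "AE z in lebesgue_on U. h J z = form0 f J z"
    using a measurable_formsD(2)[OF that, of J] by (cases "J = {}") (simp_all add: form0_def)
  qed
 qed
 thus ?thesis unfolding ideal_incl_def ae_class_def by (intro Collect_cong conj_cong refl) (rule sym)
qed

lemma Lp_loc_1_continuous:
 assumes U: "open U" and h: "continuous_on U h"
 shows "Lp_loc 1 U h"
proof -
 have "weighted_Lp_loc 1 0 U h"
  by (rule weighted_continuous[OF order_refl U _ h]) (simp add: integrable_exponent_def)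
 hence "Lp_loc 1 U (%z. complex_of_real (abs_powr z (- 0)) * h z)" by (simp add: weighted_Lp_loc_def)
 thus ?thesis
 proof (rule Lp_loc_cong_AE[OF order_refl U])
  show "AE z in lebesgue_on U. h z = complex_of_real (abs_powr z (- 0)) * h z"
   unfolding AE_on_iff[OF open_in_lebesgue[OF U]] using AE_coords_nonzero
   by eventually_elim (simp add: abs_powr_def)
 qed
qed

lemma ideal_section_dbar:
 fixes p :: ennreal and s :: "real^'n::{finite,linorder}"
 assumes p: "p >= 1" and U: "open U" and f: "f : ideal_sections (dbar_weight p s) U"
 shows "form0 f : weighted_Lp_forms p s 0 U" "has_dbar_m (dbar_weight p s) U 0 (form0 f) (%J z. 0)" "form0 f : dbar_Lp_forms p s 0 U"
proof -
 let ?m = "dbar_weight p s"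
 obtain h where h: "holomorphic_n U h" "ALL z:U. (ALL j. z $ j ~= 0) --> monom_powi z (- ?m) * f z = h z"
  using f by (rule ideal_sectionsE)
 have wf: "weighted_Lp_loc p s U f"
  by (rule ideal_section_weighted[OF p U _ f]) (simp add: dbar_weight_def dbar_weight1_bounds[OF p])
 thus w: "form0 f : weighted_Lp_forms p s 0 U"
  by (auto simp: weighted_Lp_forms_iff form0_eq weighted_zero)
 have Lh: "Lp_loc 1 U h" by (rule Lp_loc_1_continuous[OF U holomorphic_n_continuous[OF h(1)]])
 have Dh: "dist_dbar U 0 (form0 h) (%J z. 0)"
 proof (rule dist_dbarI[OF U])
  show "form0 h : Lp_forms 1 0 U" using Lh by (auto simp: Lp_forms_iff form0_eq Lp_loc_zero)
  show "(%J z. 0) : Lp_forms 1 (Suc 0) U" by (simp add: Lp_forms_iff Lp_loc_zero)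
  fix K :: "'n set" and \<phi> assume "card K = Suc 0" and t: "test_function U \<phi>"
  have "pairing U (form0 h J) (wirtinger_bar j \<phi>) = 0" for J j
   using holomorphic_n_pairing[OF h(1) U t] by (cases "J = {}") (simp_all add: form0_eq)
  thus "pairing U (%z. 0) \<phi> = - (\<Sum>j\<in>K. form_sign j K * pairing U (form0 h (K - {j})) (wirtinger_bar j \<phi>))" by simp
 qed
 have "dist_dbar U 0 (twist (- ?m) (form0 f)) (%J z. 0)"
 proof (rule dist_dbar_cong_AE[OF U Dh])
  show "AE z in lebesgue_on U. twist (- ?m) (form0 f) J z = form0 h J z" for J
   using ideal_section_eq(1)[OF h(2) U] by (cases "J = {}") (simp_all add: twist_def form0_def)
 qed (auto simp: twist_def form0_def fun_eq_iff)
 thus D: "has_dbar_m ?m U 0 (form0 f) (%J z. 0)"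
  using weighted_Lp_forms_measurable[OF w] by (simp add: has_dbar_m_iff[OF U])
 show "form0 f : dbar_Lp_forms p s 0 U" by (rule dbar_Lp_formsI[OF w weighted_Lp_forms_zero D])
qed

lemma ideal_incl_sheaf_hom:
 fixes s :: "real^'n::{finite,linorder}"
 assumes p: "p >= 1"
 shows "sheaf_hom (ideal_sheaf (dbar_weight p s)) (Lp_sheaf p s 0) ideal_incl"
 unfolding sheaf_hom_def
proof (intro conjI allI impI ballI)
 let ?m = "dbar_weight p s"
 fix U V :: "(complex^'n::{finite,linorder}) set" assume U: "open U"
 have cs: "carrier (secs (ideal_sheaf ?m) U) = ideal_sections ?m U" by (simp add: ideal_sheaf_def)
 show "ideal_incl U : hom (secs (ideal_sheaf ?m) U) (secs (Lp_sheaf p s 0) U)"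
 proof (rule homI, unfold cs)
  fix f assume f: "f : ideal_sections ?m U"
  show "ideal_incl U f : carrier (secs (Lp_sheaf p s 0) U)"
   unfolding ideal_incl_class Lp_sheaf_secs(2)[OF p U] using ideal_section_dbar(3)[OF p U f] by blast
  fix g assume g: "g : ideal_sections ?m U"
  have "form0 (%z. f z + g z) = (%J z. form0 f J z + form0 g J z)" by (simp add: form0_def fun_eq_iff)
  thus "ideal_incl U (f \<otimes>\<^bsub>secs (ideal_sheaf ?m) U\<^esub> g) = ideal_incl U f \<otimes>\<^bsub>secs (Lp_sheaf p s 0) U\<^esub> ideal_incl U g"
   unfolding ideal_incl_class Lp_sheaf_secs(4)[OF p U ideal_section_dbar(3)[OF p U f] ideal_section_dbar(3)[OF p U g]]
   by (simp add: ideal_sheaf_def)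
 qed
 fix f assume V: "open V" "V <= U" and "f : carrier (secs (ideal_sheaf ?m) U)"
 hence f: "f : ideal_sections ?m U" by (simp only: cs)
 have "ae_class 0 V (form0 (%z. if z : V then f z else 0)) = ae_class 0 V (form0 f)"
  by (rule ae_class_eqI) (simp add: AE_on_iff[OF open_in_lebesgue[OF V(1)]] form0_def)
 thus "ideal_incl V (res (ideal_sheaf ?m) U V f) = res (Lp_sheaf p s 0) U V (ideal_incl U f)"
  unfolding ideal_incl_class Lp_sheaf_res[OF U V ideal_section_dbar(3)[OF p U f]] by (simp add: ideal_sheaf_def)
qed

section \<open>Exactness\<close>

lemma dbar_map_eq_one:
 assumes p: "p >= 1" and U: "open U" and A: "A : carrier (secs (Lp_sheaf p s q) U)"
  and 1: "dbar_map (dbar_weight p s) q U A = \<one>\<^bsub>secs (Lp_sheaf p s (Suc q)) U\<^esub>"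
 shows "EX f. A = ae_class q U f & f : dbar_Lp_forms p s q U & has_dbar_m (dbar_weight p s) U q f (%J z. 0)"
proof -
 obtain f where f: "A = ae_class q U f" "f : dbar_Lp_forms p s q U" using A unfolding Lp_sheaf_secs(2)[OF p U] by blast
 obtain h where h: "has_dbar_m (dbar_weight p s) U q f h" using f(2) by (rule dbar_Lp_formsE)
 have "h : measurable_forms (Suc q) U" using h by (simp add: has_dbar_m_iff[OF U])
 moreover have "ae_class (Suc q) U h = ae_class (Suc q) U (%J z. 0)"
  using 1 unfolding f(1) dbar_map_class[OF U h] Lp_sheaf_secs(3)[OF p U] .
 ultimately have h0: "AE z in lebesgue_on U. h J z = 0" for J using ae_class_eqD by blast
 have "has_dbar_m (dbar_weight p s) U q f (%J z. 0)"
 proof (rule has_dbar_m_cong_AE[OF U h])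
  show "AE z in lebesgue_on U. 0 = h J z" for J using h0[of J] by eventually_elim simp
 qed (use f(2) dbar_Lp_forms_measurable in auto)
 thus ?thesis using f by blast
qed

lemma dbar_closed_degree_0:
 fixes s :: "real^'n::{finite,linorder}"
 assumes p: "p >= 1" and U: "open U" "x : U" and D: "has_dbar_m (dbar_weight p s) U 0 f (%J z. 0)"
 shows "EX V g. open V & x : V & V <= U & g : ideal_sections (dbar_weight p s) V & ae_class 0 V (form0 g) = ae_class 0 V f"
proof -
 let ?m = "dbar_weight p s"
 let ?F = "twist (- ?m) f"
 have fm: "f : measurable_forms 0 U" and DF: "dist_dbar U 0 ?F (%J z. 0)" using D by (simp_all add: has_dbar_m_iff[OF U(1)])
 note DF = dist_dbarD[OF U(1) DF]
 have "pairing U (?F {}) (wirtinger_bar j \<phi>) = 0" if t: "test_function U \<phi>" for j \<phi>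
  using DF(5)[OF _ t, of "{j}"] by (simp add: form_sign_def)
 from dbar_closed_imp_holomorphic[OF U DF(1) this]
 obtain W h where W: "open W" "x : W" "W <= U" "holomorphic_n W h" and eq: "AE z in lebesgue_on W. ?F {} z = h z" by blast
 define g where "g z = (if z : W & (ALL j. z $ j ~= 0) then monom_powi z ?m * h z else 0)" for z
 have gI: "g : ideal_sections ?m W"
 proof (rule ideal_sectionsI[OF W(4)])
  show "monom_powi z (- ?m) * g z = h z" if "z : W" "ALL j. z $ j ~= 0" for z
   using monom_powi_inverse[OF that(2), of ?m] that by (simp add: g_def mult.commute[of "monom_powi z (- ?m)"] mult.assoc mult.left_commute) 
 qed (auto simp: g_def)
 have "ae_class 0 W (form0 g) = ae_class 0 W f"
 proof (rule ae_class_eqI)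
  fix J
  show "AE z in lebesgue_on W. form0 g J z = f J z"
  proof (cases "J = {}")
   case True
   have "AE z in lebesgue_on W. z : W & (ALL j. z $ j ~= 0)"
    unfolding AE_on_iff[OF open_in_lebesgue[OF W(1)]] using AE_coords_nonzero by eventually_elim simp
   with eq show ?thesis
   proof eventually_elim
    case (elim z)
    hence "g z = (monom_powi z ?m * monom_powi z (- ?m)) * f {} z" by (simp add: g_def twist_def flip: elim(1))
    thus ?case using True monom_powi_inverse[of z ?m] elim by (simp add: form0_def)
   qed
  qed (use measurable_formsD(2)[OF fm, of J] in "simp add: form0_def")
 qed
 thus ?thesis using W gI by blast
qed

lemma dbar_closed_locally_exact:
 fixes s :: "real^'n::{finite,linorder}"
 assumes p: "p >= 1" and U: "open U" "x : U" and f: "f : dbar_Lp_forms p s (Suc q) U"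
  and D: "has_dbar_m (dbar_weight p s) U (Suc q) f (%J z. 0)"
 shows "EX V g. open V & x : V & V <= U & g : dbar_Lp_forms p s q V & has_dbar_m (dbar_weight p s) V q g f"
proof -
 let ?m = "dbar_weight p s"
 let ?t = "shifted_weight s ?m"
 have fm: "f : measurable_forms (Suc q) U" and DF: "dist_dbar U (Suc q) (twist (- ?m) f) (%J z. 0)"
  using D by (simp_all add: has_dbar_m_iff[OF U(1)])
 have fw: "weighted_Lp_loc p s U (f J)" for J
  using f by (elim dbar_Lp_formsE) (simp add: weighted_Lp_forms_iff)
 have "weighted_Lp_loc p ?t U (twist (- ?m) f J)" for J
  using weighted_shift[OF p U(1) measurable_formsD(1)[OF fm], of s ?m J] fw by (simp add: twist_def[abs_def])
 hence tw: "twist (- ?m) f : weighted_Lp_forms p ?t (Suc q) U"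
  using dist_dbarD(3)[OF U(1) DF] by (simp add: weighted_Lp_forms_iff)
 have adm: "admissible_exponent p (?t $ j)" for j
  by (simp add: dbar_weight_def dbar_weight1_bounds[OF p])
 from local_exactness[OF p adm U tw DF]
 obtain W G where W: "open W" "x : W" "W <= U" and G: "G : weighted_Lp_forms p ?t q W" "dist_dbar W q G (twist (- ?m) f)" by blast
 have Gm: "G : measurable_forms q W" by (rule weighted_Lp_forms_measurable[OF G(1)])
 have gm: "twist ?m G : measurable_forms q W"
  unfolding measurable_forms_def
 proof (intro CollectI conjI allI impI)
  show "twist ?m G J : lmeas W" for J
   using measurable_monom_mult[OF measurable_formsD(1)[OF Gm]] by (simp add: twist_def[abs_def])
  show "twist ?m G J = (%z. 0)" if "card J ~= q" for J
   by (rule twist_degree[where f = G and J = J, OF measurable_formsD(2)[OF Gm that]])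
 qed
 note inv = twist_inverse(2)[OF W(1), of ?m G]
 have "dist_dbar W q (twist (- ?m) (twist ?m G)) (twist (- ?m) f)"
 proof (rule dist_dbar_cong_AE[OF W(1) G(2) inv])
  show "twist (- ?m) (twist ?m G) J = (%z. 0)" if "card J ~= q" for J
   by (rule twist_degree[where f = "twist ?m G" and J = J, OF measurable_formsD(2)[OF gm that]])
 qed (use dist_dbarD(4)[OF W(1) G(2)] in auto)
 hence Dg: "has_dbar_m ?m W q (twist ?m G) f"
  using gm measurable_forms_subset[OF fm W(3)] by (simp add: has_dbar_m_iff[OF W(1)])
 have "weighted_Lp_loc p s W (twist ?m G J)" for J
 proof -
  have "weighted_Lp_loc p ?t W (twist (- ?m) (twist ?m G) J)"
   by (rule weighted_cong_AE[OF p W(1) _ inv]) (use G(1) weighted_Lp_forms_iff in blast)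
  thus ?thesis
   using weighted_shift[OF p W(1) measurable_formsD(1)[OF gm], of s ?m J] by (simp add: twist_def[abs_def])
 qed
 hence "twist ?m G : weighted_Lp_forms p s q W" using gm by (simp add: weighted_Lp_forms_def)
 moreover have "f : weighted_Lp_forms p s (Suc q) W"
  using f weighted_Lp_forms_subset[OF _ W(3)] by (elim dbar_Lp_formsE) blast
 ultimately have "twist ?m G : dbar_Lp_forms p s q W" using Dg by (rule dbar_Lp_formsI)
 thus ?thesis using W Dg by blast
qed

lemma ideal_incl_injective:
 assumes p: "p >= 1" and U: "open U" and f: "f : ideal_sections (dbar_weight p s) U"
  and 1: "ideal_incl U f = \<one>\<^bsub>secs (Lp_sheaf p s 0) U\<^esub>"
 shows "f = (%z. 0)"
proof -
 let ?m = "dbar_weight p s"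
 obtain h where h: "holomorphic_n U h" "ALL z:U. (ALL j. z $ j ~= 0) --> monom_powi z (- ?m) * f z = h z"
  "ALL z. z ~: U | (EX j. z $ j = 0) --> f z = 0" using f by (rule ideal_sectionsE)
 have "ae_class 0 U (form0 f) = ae_class 0 U (%J z. 0)"
  using 1 unfolding ideal_incl_class Lp_sheaf_secs(3)[OF p U] .
 from ae_class_eqD[OF this dbar_Lp_forms_measurable[OF ideal_section_dbar(3)[OF p U f]], of "{}"]
 have "AE z in lebesgue_on U. f z = 0" by (simp add: form0_def)
 with ideal_section_eq(1)[OF h(2) U] have "AE z in lebesgue_on U. h z = 0" by eventually_elim simp
 from continuous_AE_eq[OF U holomorphic_n_continuous[OF h(1)] continuous_on_const this]
 have h0: "h z = 0" if "z : U" for z using that .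
 show ?thesis
 proof
  fix z show "f z = 0"
  proof (cases "z : U & (ALL j. z $ j ~= 0)")
   case True
   hence "monom_powi z (- ?m) * f z = 0" using h(2) h0 by simp
   thus ?thesis using monom_powi_inverse[of z ?m] True by auto
  qed (use h(3) in blast)
 qed
qed

theorem theorem5p1:
  fixes p :: ennreal and s :: "real^'n::{finite,linorder}"
  assumes "1 \<le> p"
  shows "exact_resolution CARD('n) (ideal_sheaf (dbar_weight p s)) ideal_incl
           (Lp_sheaf p s) (dbar_map (dbar_weight p s))
       \<and> (\<forall>q\<le>CARD('n). fine_sheaf (Lp_sheaf p s q))"
proof -
 let ?N = "CARD('n)" and ?m = "dbar_weight p s" and ?A = "ideal_sheaf (dbar_weight p s)" and ?F = "Lp_sheaf p s"
  and ?d = "dbar_map (dbar_weight p s)" and ?Z = "zero_sheaf :: (complex^'n::{finite,linorder}, 'n form set) presheaf"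
 note p = assms
 note F = Lp_sheaf_presheaf[OF p, of s] and A = ideal_sheaf_presheaf[of ?m] and Z = zero_sheaf_presheaf
 note d = dbar_map_sheaf_hom[OF p, of s] and \<iota> = ideal_incl_sheaf_hom[OF p, of s]
 have N: "?N ~= 0" by simp
 have one: "?d q U (ae_class q U f) = \<one>\<^bsub>secs (?F (Suc q)) U\<^esub>" if "open U" "has_dbar_m ?m U q f (%J z. 0)" for q U f
  unfolding dbar_map_class[OF that] Lp_sheaf_secs(3)[OF p that(1)] ..
 have secsA: "carrier (secs ?A U) = ideal_sections ?m U" "\<one>\<^bsub>secs ?A U\<^esub> = (%z. 0)" for U by (simp_all add: ideal_sheaf_def)
 have secsZ: "carrier (secs zero_sheaf U) = {undefined}" "\<one>\<^bsub>secs zero_sheaf U\<^esub> = undefined" for U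
  by (simp_all add: zero_sheaf_def)
 have e1: "exact_at (zero_sheaf :: (complex^'n::{finite,linorder}, unit) presheaf) (zero_hom ?A) ?A ideal_incl (?F 0)"
 proof (rule exact_atI[OF Z A F zero_hom_sheaf_hom[OF Z A] \<iota>])
  fix U :: "(complex^'n::{finite,linorder}) set" assume U: "open U"
  show "ideal_incl U (zero_hom ?A U x) = \<one>\<^bsub>secs (?F 0) U\<^esub>" for x :: unit
   unfolding zero_hom_def
  proof (rule hom_comm_group_one[OF _ is_presheafD(1)[OF A U] is_presheafD(1)[OF F U]])
   show "ideal_incl U : hom (secs ?A U) (secs (?F 0) U)" using \<iota> U unfolding sheaf_hom_def by (elim conjE allE[of _ U]) blast
  qed
  fix x f assume x: "x : U" and f: "f : carrier (secs ?A U)" and 1: "ideal_incl U f = \<one>\<^bsub>secs (?F 0) U\<^esub>"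
  have "f = \<one>\<^bsub>secs ?A U\<^esub>" using ideal_incl_injective[OF p U _ 1] f by (simp add: secsA)
  thus "EX V t. open V & x : V & V <= U & t : carrier (secs (zero_sheaf :: (complex^'n::{finite,linorder}, unit) presheaf) V)
    & zero_hom ?A V t = res ?A U V f"
   using U x is_presheafD(3)[OF A U f] by (intro exI[of _ U] exI[of _ undefined]) (simp add: zero_hom_def secsZ)
 qed
 have e2: "exact_at ?A ideal_incl (?F 0) (?d 0) (?F 1)"
  unfolding One_nat_def
 proof (rule exact_atI[OF A F F \<iota> d])
  fix U :: "(complex^'n::{finite,linorder}) set" assume U: "open U"
  show "?d 0 U (ideal_incl U f) = \<one>\<^bsub>secs (?F (Suc 0)) U\<^esub>" if "f : carrier (secs ?A U)" for f
   unfolding ideal_incl_class using that by (intro one[OF U] ideal_section_dbar(2)[OF p U]) (simp add: secsA)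
  fix x B assume x: "x : U" and B: "B : carrier (secs (?F 0) U)" "?d 0 U B = \<one>\<^bsub>secs (?F (Suc 0)) U\<^esub>"
  obtain f where f: "B = ae_class 0 U f" "f : dbar_Lp_forms p s 0 U" "has_dbar_m ?m U 0 f (%J z. 0)"
   using dbar_map_eq_one[OF p U B] by blast
  obtain V g where V: "open V" "x : V" "V <= U" "g : ideal_sections ?m V" "ae_class 0 V (form0 g) = ae_class 0 V f"
   using dbar_closed_degree_0[OF p U x f(3)] by blast
  thus "EX V g. open V & x : V & V <= U & g : carrier (secs ?A V) & ideal_incl V g = res (?F 0) U V B"
   unfolding secsA ideal_incl_class f(1) using Lp_sheaf_res[OF U V(1,3) f(2)] by metis
 qed
 have lift: "EX V B. open V & x : V & V <= U & B : carrier (secs (?F q) V) & ?d q V B = res (?F (Suc q)) U V (ae_class (Suc q) U f)"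
  if U: "open U" "x : U" and f: "f : dbar_Lp_forms p s (Suc q) U" "has_dbar_m ?m U (Suc q) f (%J z. 0)" for x U q f
 proof -
  obtain V g where V: "open V" "x : V" "V <= U" "g : dbar_Lp_forms p s q V" "has_dbar_m ?m V q g f"
   using dbar_closed_locally_exact[OF p U f] by blast
  have "?d q V (ae_class q V g) = res (?F (Suc q)) U V (ae_class (Suc q) U f)"
   unfolding dbar_map_class[OF V(1,5)] Lp_sheaf_res[OF U(1) V(1,3) f(1)] ..
  moreover have "ae_class q V g : carrier (secs (?F q) V)"
   unfolding Lp_sheaf_secs(2)[OF p V(1)] using V(4) by (rule imageI)
  ultimately show ?thesis using V(1-3) by (intro exI[of _ V] exI[of _ "ae_class q V g"] conjI)
 qed
 have e3: "exact_at (?F q) (?d q) (?F (Suc q)) (?d (Suc q)) (?F (Suc (Suc q)))" for q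
 proof (rule exact_atI[OF F F F d d])
  fix U :: "(complex^'n::{finite,linorder}) set" assume U: "open U"
  show "?d (Suc q) U (?d q U B) = \<one>\<^bsub>secs (?F (Suc (Suc q))) U\<^esub>" if B: "B : carrier (secs (?F q) U)" for B
  proof -
   obtain f where f: "B = ae_class q U f" "f : dbar_Lp_forms p s q U" using B unfolding Lp_sheaf_secs(2)[OF p U] by blast
   obtain h where h: "has_dbar_m ?m U q f h" using f(2) by (rule dbar_Lp_formsE)
   show ?thesis unfolding f(1) dbar_map_class[OF U h] by (rule one[OF U has_dbar_m_dbar[OF U h]])
  qed
  fix x B assume x: "x : U" and B: "B : carrier (secs (?F (Suc q)) U)" "?d (Suc q) U B = \<one>\<^bsub>secs (?F (Suc (Suc q))) U\<^esub>"
  show "EX V B'. open V & x : V & V <= U & B' : carrier (secs (?F q) V) & ?d q V B' = res (?F (Suc q)) U V B"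
  proof -
   obtain f where f: "B = ae_class (Suc q) U f" "f : dbar_Lp_forms p s (Suc q) U" "has_dbar_m ?m U (Suc q) f (%J z. 0)"
    using dbar_map_eq_one[OF p U B] by (elim exE conjE)
   show ?thesis unfolding f(1) by (rule lift[OF U x f(2,3)])
  qed
 qed
 (* There are no forms of degree n + 1, so every form of degree n is closed. *)
 have e4: "exact_at (?F q) (?d q) (?F (Suc q)) (zero_hom ?Z) ?Z" if q: "Suc q = ?N" for q
 proof (rule exact_atI[OF F F Z d zero_hom_sheaf_hom[OF F Z]])
  fix U :: "(complex^'n::{finite,linorder}) set" assume U: "open U"
  show "zero_hom ?Z U (?d q U B) = \<one>\<^bsub>secs ?Z U\<^esub>" for B by (simp add: zero_hom_def)
  fix x B assume x: "x : U" and B: "B : carrier (secs (?F (Suc q)) U)"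
  obtain f where f: "B = ae_class (Suc q) U f" "f : dbar_Lp_forms p s (Suc q) U" using B unfolding Lp_sheaf_secs(2)[OF p U] by blast
  obtain h where h: "h : weighted_Lp_forms p s (Suc (Suc q)) U" "has_dbar_m ?m U (Suc q) f h" using f(2) by (rule dbar_Lp_formsE)
  have "card J ~= Suc (Suc q)" for J :: "'n set" using card_mono[of "UNIV :: 'n set" J] q by auto
  hence "h = (%J z. 0)" using h(1) by (auto simp: weighted_Lp_forms_iff)
  hence D: "has_dbar_m ?m U (Suc q) f (%J z. 0)" using h(2) by (simp only:)
  show "EX V B'. open V & x : V & V <= U & B' : carrier (secs (?F q) V) & ?d q V B' = res (?F (Suc q)) U V B"
   unfolding f(1) by (rule lift[OF U x f(2) D])
 qed
 let ?F' = "%q. if q <= ?N then ?F q else ?Z"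
 let ?d' = "%q. if q < ?N then ?d q else zero_hom (?F' (Suc q))"
 have x3: "exact_at (?F' q) (?d' q) (?F' (q + 1)) (?d' (q + 1)) (?F' (q + 2))" if "q < ?N" for q
 proof (cases "Suc q = ?N")
  case True
  thus ?thesis using e4[OF True] by simp
 next
  case False
  hence "Suc q < ?N" using that by simp
  thus ?thesis using e3[of q] by simp
 qed
 have x2: "exact_at ?A ideal_incl (?F' 0) (?d' 0) (?F' 1)" using e2 N by simp
 have x1: "exact_at (zero_sheaf :: (complex^'n::{finite,linorder}, unit) presheaf) (zero_hom ?A) ?A ideal_incl (?F' 0)"
  using e1 by simp
 have "exact_resolution ?N ?A ideal_incl ?F ?d"
  unfolding exact_resolution_def Let_def
  by (intro conjI allI impI ideal_sheaf_is_sheaf Lp_sheaf_is_sheaf[OF p] \<iota> d x1 x2 x3)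
 thus ?thesis using Lp_sheaf_fine[OF p] by (intro conjI allI impI)
qed

end
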